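(* Assume $\xi_1$ follows a centred, normal law with positive definite covariance matrix $\Sigma$. Then there exist $\delta_0,\sigma_0>0$ such that, if the sets $B_i$ have a diameter bounded by $\delta_0$ and $0<\sigma<\sigma_0$, then the uniform positivity assumption (POS) is satisfied for $n_0(\sigma)$ of order $\log(\sigma^{-1})$.
   Context: Let $\Pi:\mathbb R^d\to\mathbb R^d$ be of class $C^2$, and let $X_{n+1}=\Pi(X_n)+\sigma\xi_{n+1}$, where $\sigma>0$ and the $\xi_n$ are i.i.d. random variables with values in $\mathbb R^d$. $\mathbb P_x$ denotes the law of $(X_n)_{n\ge0}$ with $X_0=x$. Assumptions on $\Pi$: there are $R_0,\varepsilon_0>0$ such that $\mathcal X=\{x:\|x\|<R_0\}$ satisfies $\Pi(\mathcal X)\subset\mathcal X$, and $\|\Pi(x)\|^2\le\|x\|^2-\varepsilon_0$ whenever $\|x\|\ge R_0$; $\Pi$ has finitely many limit sets in $\mathcal X$ (sets of accumulation points of forward or backward orbits), each being either a linearly asymptotically stable fixed point (spectral radius of the Jacobian $<1$), denoted $x_1^\star,\dots,x_N^\star$, or a linearly unstable fixed point (spectral radius $>1$). Sets $B_j$: for each $j=1,\dots,N$, $B_j$ is a closed set containing $x_j^\star$ in its interior and such that $\Pi(B_j)\subset B_j$. The diameters of all $B_j$ are bounded by a constant $\delta>0$, taken small but independent of $\sigma$. Set $\mathcal M=\bigcup_jB_j$ and $\tau^+_{\mathcal M}=\inf\{n\ge1:X_n\in\mathcal M\}$. The trace process on $\mathcal M$ is the Markov chain on $\mathcal M$ with kernel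 $\mathbb P_x\{X_{\tau_{\mathcal M}^+}\in\cdot\}$. Let $\mathring K^{B_i}$ be the kernel of this trace process killed when it hits $\mathcal M\setminus B_i$ (i.e. when it leaves $B_i$), and let $(\mathring k^{B_i})^n$ be the density on $B_i$ of its $n$-th power. (POS) There exist a constant $L\in(1,2)$, independent of $\sigma$, and an integer $n_0(\sigma)$ such that for each $1\le i\le N$ and all $y\in B_i$, $$\sup_{x\in B_i}(\mathring k^{B_i})^{n_0(\sigma)}(x,y)\le L\inf_{x\in B_i}(\mathring k^{B_i})^{n_0(\sigma)}(x,y).$$ Furthermore, for any $\eta>0$ there exists $\sigma_0(\eta)>0$ such that $n_0(\sigma)\le e^{\eta/\sigma^2}$ for all $\sigma\in(0,\sigma_0(\eta)]$. *)

theory Defs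
  imports "HOL-Probability.Probability" "HOL-Library.Landau_Symbols"
begin

section \<open>The deterministic map\<close>

text \<open>Class \<open>C\<^sup>2\<close> on the whole space: the derivative, viewed as a map into the bounded linear
  maps, is itself continuously differentiable.\<close>

definition C2_map :: "('a::euclidean_space \<Rightarrow> 'a) \<Rightarrow> bool" where
  "C2_map \<Phi> \<longleftrightarrow>
    (\<exists>(D :: 'a \<Rightarrow> ('a \<Rightarrow>\<^sub>L 'a)) (D2 :: 'a \<Rightarrow> ('a \<Rightarrow>\<^sub>L ('a \<Rightarrow>\<^sub>L 'a))).
       (\<forall>x. (\<Phi> has_derivative blinfun_apply (D x)) (at x)) \<and>
       (\<forall>x. (D has_derivative blinfun_apply (D2 x)) (at x)) \<and>
       continuous_on UNIV D2)"

text \<open>Eigenvalues of a real matrix are taken over the complex numbers.\<close>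

definition complex_spectrum :: "real^'n^'n \<Rightarrow> complex set" where
  "complex_spectrum A =
    {\<mu>. \<exists>v :: complex^'n. v \<noteq> 0 \<and> map_matrix complex_of_real A *v v = \<mu> *s v}"

definition spectral_radius :: "real^'n^'n \<Rightarrow> real" where
  "spectral_radius A = Max (norm ` complex_spectrum A)"

definition accumulation_points :: "(nat \<Rightarrow> 'a::topological_space) \<Rightarrow> 'a set" where
  "accumulation_points u = {z. \<exists>r :: nat \<Rightarrow> nat. strict_mono r \<and> (u \<circ> r) \<longlonglongrightarrow> z}"

text \<open>The map need not be invertible, so a backward orbit in \<open>S\<close> is any sequence in \<open>S\<close>
  along which each term is the image of the next one.\<close>

definition limit_sets :: "('a::topological_space \<Rightarrow> 'a) \<Rightarrow> 'a set \<Rightarrow> 'a set set" where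
  "limit_sets \<Phi> S =
    {accumulation_points (\<lambda>n. (\<Phi> ^^ n) x) | x. x \<in> S} \<union>
    {accumulation_points u | u. range u \<subseteq> S \<and> (\<forall>n. \<Phi> (u (Suc n)) = u n)}"

definition lin_stable_fixed_point :: "(real^'n \<Rightarrow> real^'n) \<Rightarrow> real^'n \<Rightarrow> bool" where
  "lin_stable_fixed_point \<Phi> z \<longleftrightarrow> \<Phi> z = z \<and> spectral_radius (jacobian \<Phi> (at z)) < 1"

definition lin_unstable_fixed_point :: "(real^'n \<Rightarrow> real^'n) \<Rightarrow> real^'n \<Rightarrow> bool" where
  "lin_unstable_fixed_point \<Phi> z \<longleftrightarrow> \<Phi> z = z \<and> spectral_radius (jacobian \<Phi> (at z)) > 1"

text \<open>The standing assumptions on the map, with \<open>xs 1, \<dots>, xs N\<close> an enumeration of the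
  linearly stable limit points.\<close>

definition map_assumptions ::
    "(real^'n \<Rightarrow> real^'n) \<Rightarrow> real \<Rightarrow> real \<Rightarrow> nat \<Rightarrow> (nat \<Rightarrow> real^'n) \<Rightarrow> bool" where
  "map_assumptions \<Phi> R\<^sub>0 \<epsilon>\<^sub>0 N xs \<longleftrightarrow>
     C2_map \<Phi> \<and> R\<^sub>0 > 0 \<and> \<epsilon>\<^sub>0 > 0 \<and>
     \<Phi> ` ball 0 R\<^sub>0 \<subseteq> ball 0 R\<^sub>0 \<and>
     (\<forall>x. norm x \<ge> R\<^sub>0 \<longrightarrow> (norm (\<Phi> x))\<^sup>2 \<le> (norm x)\<^sup>2 - \<epsilon>\<^sub>0) \<and>
     finite (limit_sets \<Phi> (ball 0 R\<^sub>0)) \<and>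
     (\<forall>S \<in> limit_sets \<Phi> (ball 0 R\<^sub>0). \<exists>z. S = {z} \<and>
        (lin_stable_fixed_point \<Phi> z \<or> lin_unstable_fixed_point \<Phi> z)) \<and>
     inj_on xs {1..N} \<and>
     xs ` {1..N} = {z. {z} \<in> limit_sets \<Phi> (ball 0 R\<^sub>0) \<and> lin_stable_fixed_point \<Phi> z}"

definition trapping_neighbourhood :: "('a::metric_space \<Rightarrow> 'a) \<Rightarrow> 'a \<Rightarrow> real \<Rightarrow> 'a set \<Rightarrow> bool" where
  "trapping_neighbourhood \<Phi> z \<delta> B \<longleftrightarrow>
     closed B \<and> z \<in> interior B \<and> \<Phi> ` B \<subseteq> B \<and> bounded B \<and> diameter B \<le> \<delta>"


section \<open>The Gaussian noise\<close>

definition pos_def_symmetric :: "real^'n^'n \<Rightarrow> bool" where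
  "pos_def_symmetric \<Sigma> \<longleftrightarrow> transpose \<Sigma> = \<Sigma> \<and> (\<forall>v. v \<noteq> 0 \<longrightarrow> v \<bullet> (\<Sigma> *v v) > 0)"

text \<open>Lebesgue density of the centred normal law with covariance matrix \<open>\<Sigma>\<close>.\<close>

definition centred_normal_density :: "real^'n^'n \<Rightarrow> real^'n \<Rightarrow> real" where
  "centred_normal_density \<Sigma> x =
     exp (- (x \<bullet> (matrix_inv \<Sigma> *v x)) / 2) / sqrt ((2 * pi) ^ CARD('n) * det \<Sigma>)"

definition iid_sequence :: "'w measure \<Rightarrow> (nat \<Rightarrow> 'w \<Rightarrow> 'a::topological_space) \<Rightarrow> bool" where
  "iid_sequence P \<xi> \<longleftrightarrow>
     prob_space.indep_vars P (\<lambda>_. borel) \<xi> {1..} \<and>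
     (\<forall>n\<ge>1. distr P borel (\<xi> n) = distr P borel (\<xi> 1))"


section \<open>The perturbed chain and its trace\<close>

primrec chain ::
    "('a::real_vector \<Rightarrow> 'a) \<Rightarrow> real \<Rightarrow> (nat \<Rightarrow> 'w \<Rightarrow> 'a) \<Rightarrow> 'a \<Rightarrow> nat \<Rightarrow> 'w \<Rightarrow> 'a" where
  "chain \<Phi> \<sigma> \<xi> x 0 \<omega> = x"
| "chain \<Phi> \<sigma> \<xi> x (Suc n) \<omega> = \<Phi> (chain \<Phi> \<sigma> \<xi> x n \<omega>) + \<sigma> *\<^sub>R \<xi> (Suc n) \<omega>"

text \<open>First return time to \<open>A\<close>; it is \<open>\<infinity>\<close> if the path never returns.\<close>

definition return_time :: "'a set \<Rightarrow> (nat \<Rightarrow> 'a) \<Rightarrow> enat" where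
  "return_time A u = Inf {enat n | n. n \<ge> 1 \<and> u n \<in> A}"

text \<open>The kernel of the trace on \<open>A\<close> is the law of the chain at its first return to \<open>A\<close>,
  on the event that there is one.  Kernels are maps into measures on the ambient space.\<close>

definition trace_kernel ::
    "'w measure \<Rightarrow> (real^'n \<Rightarrow> nat \<Rightarrow> 'w \<Rightarrow> real^'n) \<Rightarrow> (real^'n) set \<Rightarrow> real^'n \<Rightarrow> (real^'n) measure"
  where
  "trace_kernel P X A x =
     (let \<tau> = (\<lambda>\<omega>. return_time A (\<lambda>n. X x n \<omega>))
      in distr (restrict_space P {\<omega> \<in> space P. \<tau> \<omega> < \<infinity>}) borel (\<lambda>\<omega>. X x (the_enat (\<tau> \<omega>)) \<omega>))"

definition killed_kernel ::
    "('a::topological_space \<Rightarrow> 'a measure) \<Rightarrow> 'a set \<Rightarrow> 'a \<Rightarrow> 'a measure" where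
  "killed_kernel K B x = density (K x) (indicator B)"

primrec kernel_power ::
    "('a::topological_space \<Rightarrow> 'a measure) \<Rightarrow> nat \<Rightarrow> 'a \<Rightarrow> 'a measure" where
  "kernel_power K 0 x = return borel x"
| "kernel_power K (Suc n) x = bind (K x) (kernel_power K n)"

text \<open>A pointwise comparison of densities needs a choice of version.  We ask for a version that is
  jointly continuous on \<open>B \<times> B\<close>; its values \<open>k x y\<close> for \<open>y\<close> in the closure of the interior of
  \<open>B\<close> are then determined by the kernel.\<close>

definition continuous_density_on ::
    "'a::euclidean_space set \<Rightarrow> ('a \<Rightarrow> 'a measure) \<Rightarrow> ('a \<Rightarrow> 'a \<Rightarrow> real) \<Rightarrow> bool" where
  "continuous_density_on B K k \<longleftrightarrow>
     continuous_on (B \<times> B) (\<lambda>(x, y). k x y) \<and>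
     (\<forall>x\<in>B. \<forall>y\<in>B. k x y \<ge> 0) \<and>
     (\<forall>x\<in>B. K x = density lborel (\<lambda>y. ennreal (indicator B y * k x y)))"

text \<open>The uniform positivity assumption for noise intensities in \<open>(0, \<sigma>\<^sub>0)\<close>.  For \<open>B i\<close> compact,
  the supremum and infimum of the continuous density are those of a bounded set of reals.\<close>

definition uniform_positivity ::
    "'w measure \<Rightarrow> (nat \<Rightarrow> 'w \<Rightarrow> real^'n) \<Rightarrow> (real^'n \<Rightarrow> real^'n) \<Rightarrow> nat \<Rightarrow>
     (nat \<Rightarrow> (real^'n) set) \<Rightarrow> real \<Rightarrow> (real \<Rightarrow> nat) \<Rightarrow> bool" where
  "uniform_positivity P \<xi> \<Phi> N B \<sigma>\<^sub>0 n\<^sub>0 \<longleftrightarrow>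
     (\<exists>L. 1 < L \<and> L < 2 \<and>
        (\<forall>\<sigma>. 0 < \<sigma> \<and> \<sigma> < \<sigma>\<^sub>0 \<longrightarrow>
          (\<forall>i\<in>{1..N}. \<exists>k.
             continuous_density_on (B i)
               (kernel_power
                 (killed_kernel (trace_kernel P (chain \<Phi> \<sigma> \<xi>) (\<Union>j\<in>{1..N}. B j)) (B i))
                 (n\<^sub>0 \<sigma>)) k \<and>
             (\<forall>y\<in>B i. (SUP x\<in>B i. k x y) \<le> L * (INF x\<in>B i. k x y))))) \<and>
     (\<forall>\<eta>>0. \<exists>\<sigma>\<^sub>1>0. \<forall>\<sigma>. 0 < \<sigma> \<and> \<sigma> \<le> \<sigma>\<^sub>1 \<longrightarrow> real (n\<^sub>0 \<sigma>) \<le> exp (\<eta> / \<sigma>\<^sup>2))"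

end

theory Submission
  imports Defs "HOL-Computational_Algebra.Fundamental_Theorem_Algebra"
begin

text \<open>Near a stable fixed point \<open>\<Phi>\<close> contracts an adapted norm at rate \<open>\<kappa> < 1\<close>, so two copies of
  the chain driven by the same noise show that the modulus of log-continuity of a function iterated
  under the chain contracts at rate \<open>\<kappa>\<close> too.  To use this for the killed trace on \<open>B\<close>, one
  compares the trace density with the one-step kernel by explicit supersolutions of the first-step
  equation on nested neighbourhoods of the fixed point.

  For every noise intensity below a threshold that does not depend on \<open>B\<close>, Birkhoff's contraction
  makes the densities approximate eigenfunctions of the killed trace.  These are nearly constant by
  a dichotomy: if the volume of \<open>B\<close> is not exponentially small, then \<open>B\<close> is hit before the
  neighbourhood is left and the eigenvalue is close to 1; otherwise the killing has little effect.
  For a fixed \<open>B\<close> and \<open>\<sigma> \<rightarrow> 0\<close>, the trace moves like the chain itself on a ball inside \<open>B\<close>,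
  and \<open>C ln (1 / \<sigma>)\<close> steps reduce the initial log-oscillation, a power of \<open>1 / \<sigma>\<close>, to a small one.\<close>

section \<open>The density of the trace kernel\<close>

text \<open>The noise threshold must be fixed before \<open>B\<close>, whose volume may be small
  even on the scale \<open>exp (- 1 / \<sigma>\<^sup>2)\<close>, and one step of the trace is an
  excursion of unbounded length, so two copies cannot be coupled step by step along the trace. The
  way out is to extend a function \<open>h\<close> on \<open>B\<close> by \<open>K h\<close> off
  \<open>M\<close>: then \<open>K h x\<close> is the mean of \<open>ext h\<close> after one step of
  the chain, and coupling acts on chain steps alone. The constants come from comparing exponents.
  Leaving \<open>V \<rho>\<close> has probability at most of order
  \<open>exp (- c0 / \<sigma>\<^sup>2)\<close>, while the transition density inside a core of radius
  \<delta> is at least of order \<open>exp (- 2 * b * \<delta>\<^sup>2 / \<sigma>\<^sup>2)\<close>.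
  A small diameter makes the second exponent at most half the first, so escape is exponentially
  rarer than a hit of a set of given volume. This is the origin of the bound on the diameters. The
  constant \<open>L\<close> is 7/4: coupling bounds a value by 5/4 of any other value plus 1/8 of
  the supremum, which leaves a ratio of 10/7 or 5/3.\<close>

locale noisy_map =
  fixes \<Phi> :: "'a::euclidean_space \<Rightarrow> 'a" and g :: "'a \<Rightarrow> real"
  assumes cont_map: "continuous_on UNIV \<Phi>"
    and cont_noise: "continuous_on UNIV g"
    and noise_pos: "\<And>v. 0 < g v"
    and noise_mass: "(\<integral>\<^sup>+v. ennreal (g v) \<partial>lborel) = 1"
begin

definition p :: "'a \<Rightarrow> 'a \<Rightarrow> ennreal" where
  "p x z = ennreal (g (z - \<Phi> x))"

lemma map_borel [measurable]: "\<Phi> \<in> borel_measurable borel"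
  using cont_map by (rule borel_measurable_continuous_onI)

lemma noise_borel [measurable]: "g \<in> borel_measurable borel"
  using cont_noise by (rule borel_measurable_continuous_onI)

lemma p_borel [measurable]: "(\<lambda>w. p (fst w) (snd w)) \<in> borel_measurable (borel \<Otimes>\<^sub>M borel)"
  unfolding p_def by measurable

lemma p_borel' [measurable (raw)]:
  assumes [measurable]: "f \<in> borel_measurable N" "h \<in> borel_measurable N"
  shows "(\<lambda>w. p (f w) (h w)) \<in> borel_measurable N"
  unfolding p_def by measurable

lemma p_mass: "(\<integral>\<^sup>+z. p x z \<partial>lborel) = 1"
proof -
  have "(\<integral>\<^sup>+z. p x z \<partial>lborel) = (\<integral>\<^sup>+z. ennreal (g (z - \<Phi> x)) \<partial>distr lborel borel ((+) (\<Phi> x)))"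
    unfolding p_def by (simp add: lborel_distr_plus)
  also have "\<dots> = 1"
    using noise_mass by (subst nn_integral_distr) auto
  finally show ?thesis .
qed

definition step :: "'a \<Rightarrow> 'a measure" where
  "step x = density lborel (p x)"

lemma sets_step [measurable_cong, simp]: "sets (step x) = sets borel"
  and space_step [simp]: "space (step x) = UNIV"
  by (simp_all add: step_def)

lemma prob_step: "prob_space (step x)"
proof
  show "emeasure (step x) (space (step x)) = 1"
    using p_mass[of x] by (simp add: step_def emeasure_density)
qed

lemma nn_step: "f \<in> borel_measurable borel \<Longrightarrow> (\<integral>\<^sup>+z. f z \<partial>step x) = (\<integral>\<^sup>+z. p x z * f z \<partial>lborel)"
  unfolding step_def by (rule nn_integral_density) (auto)

end

locale trace_chain = noisy_map +
  fixes M :: "'a set"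
  assumes M_borel [measurable]: "M \<in> sets borel"
begin

text \<open>Density at \<open>y\<close> of the state at time \<open>n + 1\<close> on the event that
  the times \<open>1, ..., n\<close> are spent outside \<open>M\<close>. The starting point itself
  may lie in \<open>M\<close>, which is why only intermediate points carry the indicator.\<close>

primrec q :: "nat \<Rightarrow> 'a \<Rightarrow> 'a \<Rightarrow> ennreal" where
  "q 0 x y = p x y"
| "q (Suc n) x y = (\<integral>\<^sup>+z. p x z * (indicator (- M) z * q n z y) \<partial>lborel)"

lemma q_borel: "(\<lambda>w. q n (fst w) (snd w)) \<in> borel_measurable (borel \<Otimes>\<^sub>M borel)"
proof (induction n)
  case (Suc n)
  note [measurable] = Suc
  have "(\<lambda>u. q n (snd u) (snd (fst u))) \<in> borel_measurable ((borel \<Otimes>\<^sub>M borel) \<Otimes>\<^sub>M lborel)"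
    by (rule measurable_compose[OF _ Suc, where f="\<lambda>u. (snd u, snd (fst u))", simplified]) measurable
  note [measurable] = this
  show ?case
    by simp measurable
qed simp

lemma q_borel' [measurable (raw)]:
  assumes [measurable]: "f \<in> borel_measurable N" "h \<in> borel_measurable N"
  shows "(\<lambda>w. q n (f w) (h w)) \<in> borel_measurable N"
  using measurable_compose[OF _ q_borel, where f="\<lambda>u. (f u, h u)"] by simp

text \<open>Splitting off the last step instead of the first. This form matches the forward
  construction of the chain, and it leads to \<open>k_last\<close>, where the endpoint occurs only
  in the explicit kernel \<open>p\<close>.\<close>

lemma q_Suc_last: "q (Suc n) x y = (\<integral>\<^sup>+z. q n x z * (indicator (- M) z * p z y) \<partial>lborel)"
proof (induction n arbitrary: x)
  case (Suc n)
  have "q (Suc (Suc n)) x y =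
    (\<integral>\<^sup>+w. p x w * (indicator (- M) w * (\<integral>\<^sup>+z. q n w z * (indicator (- M) z * p z y) \<partial>lborel)) \<partial>lborel)"
    by (subst q.simps(2)) (simp only: Suc)
  also have "\<dots> = (\<integral>\<^sup>+w. \<integral>\<^sup>+z. p x w * (indicator (- M) w * (q n w z * (indicator (- M) z * p z y))) \<partial>lborel \<partial>lborel)"
    by (intro nn_integral_cong) (simp add: nn_integral_cmult)
  also have "\<dots> = (\<integral>\<^sup>+z. \<integral>\<^sup>+w. p x w * (indicator (- M) w * (q n w z * (indicator (- M) z * p z y))) \<partial>lborel \<partial>lborel)"
    by (rule lborel_pair.Fubini') measurable
  also have "\<dots> = (\<integral>\<^sup>+z. \<integral>\<^sup>+w. (p x w * (indicator (- M) w * q n w z)) * (indicator (- M) z * p z y) \<partial>lborel \<partial>lborel)"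
    by (simp add: mult.assoc)
  also have "\<dots> = (\<integral>\<^sup>+z. q (Suc n) x z * (indicator (- M) z * p z y) \<partial>lborel)"
    by (intro nn_integral_cong) (simp add: nn_integral_multc)
  finally show ?case .
qed simp

text \<open>For \<open>y\<close> in \<open>M\<close> this is the density of the trace kernel. For
  \<open>y\<close> outside \<open>M\<close> it is the Green density of the chain stopped at its
  first return to \<open>M\<close>, and may be infinite; both readings are used.\<close>

definition k :: "'a \<Rightarrow> 'a \<Rightarrow> ennreal" where
  "k x y = (\<Sum>n. q n x y)"

lemma k_borel' [measurable (raw)]:
  assumes [measurable]: "f \<in> borel_measurable N" "h \<in> borel_measurable N"
  shows "(\<lambda>w. k (f w) (h w)) \<in> borel_measurable N"
  unfolding k_def by measurable

lemma k_first: "k x y = p x y + (\<integral>\<^sup>+z. p x z * (indicator (- M) z * k z y) \<partial>lborel)"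
proof -
  have "k x y = q 0 x y + (\<Sum>n. q (Suc n) x y)"
    unfolding k_def using suminf_offset[of "\<lambda>n. q n x y" 1] by (simp add: summableI)
  also have "(\<Sum>n. q (Suc n) x y) = (\<integral>\<^sup>+z. (\<Sum>n. p x z * (indicator (- M) z * q n z y)) \<partial>lborel)"
    unfolding q.simps by (rule nn_integral_suminf[symmetric]) measurable
  also have "\<dots> = (\<integral>\<^sup>+z. p x z * (indicator (- M) z * k z y) \<partial>lborel)"
    by (simp only: k_def ennreal_suminf_cmult)
  finally show ?thesis by simp
qed

lemma k_last: "k x y = p x y + (\<integral>\<^sup>+z. k x z * (indicator (- M) z * p z y) \<partial>lborel)"
proof -
  have "k x y = q 0 x y + (\<Sum>n. q (Suc n) x y)"
    unfolding k_def using suminf_offset[of "\<lambda>n. q n x y" 1] by (simp add: summableI)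
  also have "(\<Sum>n. q (Suc n) x y) = (\<integral>\<^sup>+z. (\<Sum>n. q n x z * (indicator (- M) z * p z y)) \<partial>lborel)"
    unfolding q_Suc_last by (rule nn_integral_suminf[symmetric]) measurable
  also have "\<dots> = (\<integral>\<^sup>+z. k x z * (indicator (- M) z * p z y) \<partial>lborel)"
    by (simp only: k_def ennreal_suminf_multc)
  finally show ?thesis by simp
qed

text \<open>The series is the least nonnegative solution of the first-step equation, so by induction
  every supersolution dominates its partial sums. Values in \<open>ennreal\<close> allow this
  without knowing beforehand that anything is finite.\<close>

lemma k_minimal:
  assumes [measurable]: "f \<in> borel_measurable borel" "W \<in> borel_measurable borel"
    and W: "\<And>x. (\<integral>\<^sup>+z. p x z * (f z + indicator (- M) z * W z) \<partial>lborel) \<le> W x"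
  shows "(\<integral>\<^sup>+y. k x y * f y \<partial>lborel) \<le> W x"
proof -
  define S where "S n x = (\<Sum>i<n. \<integral>\<^sup>+y. q i x y * f y \<partial>lborel)" for n x
  have [measurable]: "S n \<in> borel_measurable borel" for n
    unfolding S_def by measurable
  have S_Suc: "S (Suc n) x = (\<integral>\<^sup>+z. p x z * (f z + indicator (- M) z * S n z) \<partial>lborel)" for n x
  proof -
    have "S (Suc n) x = (\<integral>\<^sup>+y. p x y * f y \<partial>lborel) + (\<Sum>i<n. \<integral>\<^sup>+y. q (Suc i) x y * f y \<partial>lborel)"
      unfolding S_def sum.lessThan_Suc_shift by simp
    also have "(\<Sum>i<n. \<integral>\<^sup>+y. q (Suc i) x y * f y \<partial>lborel) =
       (\<Sum>i<n. \<integral>\<^sup>+z. p x z * (indicator (- M) z * (\<integral>\<^sup>+y. q i z y * f y \<partial>lborel)) \<partial>lborel)"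
    proof (intro sum.cong refl)
      fix i
      have "(\<integral>\<^sup>+y. q (Suc i) x y * f y \<partial>lborel) =
        (\<integral>\<^sup>+y. \<integral>\<^sup>+z. p x z * (indicator (- M) z * q i z y) * f y \<partial>lborel \<partial>lborel)"
        by (simp add: nn_integral_multc)
      also have "\<dots> = (\<integral>\<^sup>+z. \<integral>\<^sup>+y. p x z * (indicator (- M) z * q i z y) * f y \<partial>lborel \<partial>lborel)"
        by (rule lborel_pair.Fubini') measurable
      also have "\<dots> = (\<integral>\<^sup>+z. p x z * (indicator (- M) z * (\<integral>\<^sup>+y. q i z y * f y \<partial>lborel)) \<partial>lborel)"
        by (intro nn_integral_cong) (simp add: nn_integral_cmult mult.assoc)
      finally show "(\<integral>\<^sup>+y. q (Suc i) x y * f y \<partial>lborel) = \<dots>" .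
    qed
    also have "\<dots> = (\<integral>\<^sup>+z. p x z * (indicator (- M) z * S n z) \<partial>lborel)"
      unfolding S_def sum_distrib_left by (rule nn_integral_sum[symmetric]) measurable
    finally show ?thesis
      by (simp add: distrib_left nn_integral_add)
  qed
  have S_le: "S n x \<le> W x" for n x
  proof (induction n arbitrary: x)
    case (Suc n)
    have "S (Suc n) x \<le> (\<integral>\<^sup>+z. p x z * (f z + indicator (- M) z * W z) \<partial>lborel)"
      unfolding S_Suc by (intro nn_integral_mono mult_left_mono add_left_mono Suc) auto
    then show ?case using W[of x] by simp
  qed (simp add: S_def)
  have "(\<integral>\<^sup>+y. k x y * f y \<partial>lborel) = (\<Sum>i. \<integral>\<^sup>+y. q i x y * f y \<partial>lborel)"
    unfolding k_def by (simp add: nn_integral_suminf[symmetric])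
  also have "\<dots> \<le> W x"
    using S_le unfolding S_def by (intro suminf_le_const) (auto simp: summableI)
  finally show ?thesis .
qed

lemma k_first_integral:
  assumes [measurable]: "f \<in> borel_measurable borel"
  shows "(\<integral>\<^sup>+y. k x y * f y \<partial>lborel) =
    (\<integral>\<^sup>+z. p x z * (f z + indicator (- M) z * (\<integral>\<^sup>+y. k z y * f y \<partial>lborel)) \<partial>lborel)"
proof -
  have "(\<integral>\<^sup>+y. k x y * f y \<partial>lborel) =
    (\<integral>\<^sup>+y. p x y * f y + (\<integral>\<^sup>+z. p x z * (indicator (- M) z * k z y) * f y \<partial>lborel) \<partial>lborel)"
    by (subst k_first) (simp add: distrib_right nn_integral_multc)
  also have "\<dots> = (\<integral>\<^sup>+y. p x y * f y \<partial>lborel) +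
     (\<integral>\<^sup>+y. \<integral>\<^sup>+z. p x z * (indicator (- M) z * k z y) * f y \<partial>lborel \<partial>lborel)"
    by (rule nn_integral_add) measurable
  also have "(\<integral>\<^sup>+y. \<integral>\<^sup>+z. p x z * (indicator (- M) z * k z y) * f y \<partial>lborel \<partial>lborel) =
     (\<integral>\<^sup>+z. \<integral>\<^sup>+y. p x z * (indicator (- M) z * k z y) * f y \<partial>lborel \<partial>lborel)"
    by (rule lborel_pair.Fubini') measurable
  also have "\<dots> = (\<integral>\<^sup>+z. p x z * (indicator (- M) z * (\<integral>\<^sup>+y. k z y * f y \<partial>lborel)) \<partial>lborel)"
    by (intro nn_integral_cong) (simp add: nn_integral_cmult mult.assoc)
  finally show ?thesis
    by (simp add: distrib_left nn_integral_add)
qed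

text \<open>The same comparison with the source concentrated at a single endpoint. It bounds the
  density pointwise rather than its integrals.\<close>

lemma k_minimal_point:
  assumes [measurable]: "W \<in> borel_measurable borel"
    and W: "\<And>x. p x y + (\<integral>\<^sup>+z. p x z * (indicator (- M) z * W z) \<partial>lborel) \<le> W x"
  shows "k x y \<le> W x"
proof -
  have S_Suc: "(\<Sum>i<Suc n. q i x y) = p x y + (\<integral>\<^sup>+z. p x z * (indicator (- M) z * (\<Sum>i<n. q i z y)) \<partial>lborel)" for n x
    unfolding sum.lessThan_Suc_shift sum_distrib_left q.simps
    by (subst nn_integral_sum) auto
  have S_le: "(\<Sum>i<n. q i x y) \<le> W x" for n x
  proof (induction n arbitrary: x)
    case (Suc n)
    have "(\<Sum>i<Suc n. q i x y) \<le> p x y + (\<integral>\<^sup>+z. p x z * (indicator (- M) z * W z) \<partial>lborel)"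
      unfolding S_Suc by (intro add_left_mono nn_integral_mono mult_left_mono Suc) auto
    then show ?case using W[of x] by (rule order_trans)
  qed simp
  show ?thesis
    unfolding k_def by (intro suminf_le_const S_le) (auto simp: summableI)
qed

lemma k_submarkov: "(\<integral>\<^sup>+y. k x y * indicator M y \<partial>lborel) \<le> 1"
proof (rule k_minimal)
  fix x
  have "(\<integral>\<^sup>+z. p x z * (indicator M z + indicator (- M) z * 1) \<partial>lborel) = (\<integral>\<^sup>+z. p x z \<partial>lborel)"
    by (intro nn_integral_cong) (auto split: split_indicator)
  then show "(\<integral>\<^sup>+z. p x z * (indicator M z + indicator (- M) z * 1) \<partial>lborel) \<le> 1"
    by (simp add: p_mass)
qed auto

end

section \<open>Return times of paths and the law of the trace\<close>

lemma return_time_eq_iff: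
  "return_time A u = enat (Suc n) \<longleftrightarrow> u (Suc n) \<in> A \<and> (\<forall>m\<in>{1..n}. u m \<notin> A)"
proof
  assume eq: "return_time A u = enat (Suc n)"
  let ?S = "{enat n | n. n \<ge> 1 \<and> u n \<in> A}"
  have ne: "?S \<noteq> {}"
  proof
    assume "?S = {}"
    then have "return_time A u = \<infinity>" unfolding return_time_def by (simp only: Inf_enat_def) simp
    then show False using eq by simp
  qed
  have "Inf ?S \<in> ?S" using ne by (simp only: Inf_enat_def if_False) (meson LeastI ex_in_conv)
  then have 1: "u (Suc n) \<in> A" using eq unfolding return_time_def by auto
  have "u m \<notin> A" if "m \<in> {1..n}" for m
  proof
    assume "u m \<in> A"
    then have "Inf ?S \<le> enat m" using that by (intro Inf_lower) auto
    then show False using eq that unfolding return_time_def by simp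
  qed
  then show "u (Suc n) \<in> A \<and> (\<forall>m\<in>{1..n}. u m \<notin> A)" using 1 by blast
next
  assume *: "u (Suc n) \<in> A \<and> (\<forall>m\<in>{1..n}. u m \<notin> A)"
  show "return_time A u = enat (Suc n)"
    unfolding return_time_def
  proof (rule antisym)
    show "Inf {enat n | n. n \<ge> 1 \<and> u n \<in> A} \<le> enat (Suc n)"
      using * by (intro Inf_lower) auto
    show "enat (Suc n) \<le> Inf {enat n | n. n \<ge> 1 \<and> u n \<in> A}"
    proof (rule Inf_greatest)
      fix e assume "e \<in> {enat n | n. n \<ge> 1 \<and> u n \<in> A}"
      then obtain m where "e = enat m" "m \<ge> 1" "u m \<in> A" by blast
      then have "\<not> m \<le> n" using * by auto
      then show "enat (Suc n) \<le> e" using \<open>e = enat m\<close> by simp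
    qed
  qed
qed

lemma return_time_finite_iff:
  "return_time A u < \<infinity> \<longleftrightarrow> (\<exists>n. return_time A u = enat (Suc n))"
proof
  assume fin: "return_time A u < \<infinity>"
  let ?S = "{enat n | n. n \<ge> 1 \<and> u n \<in> A}"
  have ne: "?S \<noteq> {}"
  proof
    assume "?S = {}"
    then have "return_time A u = \<infinity>" unfolding return_time_def by (simp only: Inf_enat_def) simp
    then show False using fin by simp
  qed
  have "Inf ?S \<in> ?S" using ne by (simp only: Inf_enat_def if_False) (meson LeastI ex_in_conv)
  then obtain m where "return_time A u = enat m" "m \<ge> 1" unfolding return_time_def by auto
  then show "\<exists>n. return_time A u = enat (Suc n)" by (cases m) auto
qed auto

text \<open>Running the chain on the coordinate maps \<open>\<lambda>k w. w k\<close> exhibits the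
  state at time \<open>n\<close> as a function of the vector of the first noises, a form to which
  independence of blocks of noises can be applied.\<close>

lemma chain_restrict:
  "n \<le> m \<Longrightarrow> chain \<Phi> \<sigma> (\<lambda>k w. w k) x n (restrict (\<lambda>k. \<xi> k \<omega>) {1..m}) = chain \<Phi> \<sigma> \<xi> x n \<omega>"
  by (induction n) auto

context trace_chain
begin

lemma chain_noise_measurable:
  "n \<le> m \<Longrightarrow> (\<lambda>w. chain \<Phi> \<sigma> (\<lambda>k w. w k) x n w) \<in> borel_measurable (PiM {1..m} (\<lambda>_. borel))"
proof (induction n)
  case (Suc n)
  then have [measurable]: "(\<lambda>w. chain \<Phi> \<sigma> (\<lambda>k w. w k) x n w) \<in> borel_measurable (PiM {1..m} (\<lambda>_. borel))"
    by simp
  have [measurable]: "(\<lambda>w. w (Suc n)) \<in> borel_measurable (PiM {1..m} (\<lambda>_. borel :: 'a measure))"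
    using Suc.prems by (intro measurable_component_singleton) auto
  show ?case unfolding chain.simps by measurable
next
  case 0
  have "chain \<Phi> \<sigma> (\<lambda>k w. w k) x 0 = (\<lambda>_. x)" by auto
  then show ?case by simp
qed

context
  fixes P :: "'w measure" and \<xi> :: "nat \<Rightarrow> 'w \<Rightarrow> 'a" and \<sigma> :: real
  assumes P: "prob_space P"
    and indep: "prob_space.indep_vars P (\<lambda>_. borel) \<xi> {1..}"
    and law: "\<And>n. n \<ge> 1 \<Longrightarrow> distr P borel (\<lambda>\<omega>. \<sigma> *\<^sub>R \<xi> n \<omega>) = density lborel (\<lambda>v. ennreal (g v))"
begin

interpretation P: prob_space P by (rule P)

lemma noise_rv: "n \<ge> 1 \<Longrightarrow> \<xi> n \<in> borel_measurable P"
  using P.indep_vars_def2[of "\<lambda>_. borel" \<xi> "{1..}"] indep by auto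

lemma chain_rv [measurable]: "chain \<Phi> \<sigma> \<xi> x n \<in> borel_measurable P"
proof (induction n)
  case (Suc n)
  note [measurable] = Suc noise_rv[of "Suc n", simplified]
  have "(\<lambda>\<omega>. \<Phi> (chain \<Phi> \<sigma> \<xi> x n \<omega>) + \<sigma> *\<^sub>R \<xi> (Suc n) \<omega>) \<in> borel_measurable P" by measurable
  then show ?case by (simp add: fun_eq_iff[symmetric] cong: measurable_cong)
next
  case 0
  have "chain \<Phi> \<sigma> \<xi> x 0 = (\<lambda>_. x)" by auto
  then show ?case by simp
qed

text \<open>The Markov property, weighted by an arbitrary functional \<open>H\<close> of the past.
  The next noise is independent of the past noises, so their joint law is a product and the next
  step can be integrated out with the past frozen.\<close>

lemma nn_integral_chain_Suc:
  assumes H [measurable]: "H \<in> borel_measurable (PiM {1..n} (\<lambda>_. borel))"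
    and f [measurable]: "f \<in> borel_measurable borel"
  shows "(\<integral>\<^sup>+\<omega>. H (restrict (\<lambda>k. \<xi> k \<omega>) {1..n}) * f (chain \<Phi> \<sigma> \<xi> x (Suc n) \<omega>) \<partial>P) =
    (\<integral>\<^sup>+\<omega>. H (restrict (\<lambda>k. \<xi> k \<omega>) {1..n}) *
        (\<integral>\<^sup>+z. p (chain \<Phi> \<sigma> \<xi> x n \<omega>) z * f z \<partial>lborel) \<partial>P)"
proof -
  let ?S = "PiM {1..n} (\<lambda>_. borel :: 'a measure)"
  let ?R = "\<lambda>\<omega>. restrict (\<lambda>k. \<xi> k \<omega>) {1..n}"
  let ?Z = "\<lambda>\<omega>. \<sigma> *\<^sub>R \<xi> (Suc n) \<omega>"
  let ?c = "\<lambda>w. chain \<Phi> \<sigma> (\<lambda>k w. w k) x n w"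
  have [measurable]: "?c \<in> borel_measurable ?S" by (rule chain_noise_measurable) simp
  \<comment> \<open>Independence is available for blocks of indices, so the next noise enters as a
    vector over the singleton \<open>{Suc n}\<close>.\<close>
  have ind: "P.indep_var ?S ?R (PiM {Suc n} (\<lambda>_. borel)) (\<lambda>\<omega>. restrict (\<lambda>k. \<xi> k \<omega>) {Suc n})"
    by (rule P.indep_var_restrict[OF indep]) auto
  let ?T = "PiM {Suc n} (\<lambda>_. borel :: 'a measure)"
  let ?Y = "\<lambda>\<omega>. restrict (\<lambda>k. \<xi> k \<omega>) {Suc n}"
  have R [measurable]: "?R \<in> measurable P ?S" and Y [measurable]: "?Y \<in> measurable P ?T"
    and pair: "distr P ?S ?R \<Otimes>\<^sub>M distr P ?T ?Y = distr P (?S \<Otimes>\<^sub>M ?T) (\<lambda>\<omega>. (?R \<omega>, ?Y \<omega>))"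
    using ind unfolding P.indep_var_distribution_eq by auto
  have [measurable]: "(\<lambda>w. w (Suc n)) \<in> borel_measurable ?T"
    by (rule measurable_component_singleton) simp
  interpret Z: prob_space "distr P ?T ?Y" by (rule P.prob_space_distr) measurable
  have inner: "(\<integral>\<^sup>+w. f (\<Phi> y + \<sigma> *\<^sub>R w (Suc n)) \<partial>distr P ?T ?Y) = (\<integral>\<^sup>+z. p y z * f z \<partial>lborel)" for y
  proof -
    have [measurable]: "\<xi> (Suc n) \<in> borel_measurable P" by (rule noise_rv) simp
    have "(\<integral>\<^sup>+w. f (\<Phi> y + \<sigma> *\<^sub>R w (Suc n)) \<partial>distr P ?T ?Y) = (\<integral>\<^sup>+v. f (\<Phi> y + v) \<partial>distr P borel ?Z)"
      by (subst (1 2) nn_integral_distr) auto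
    also have "\<dots> = (\<integral>\<^sup>+v. ennreal (g v) * f (\<Phi> y + v) \<partial>lborel)"
      by (simp add: law nn_integral_density)
    also have "\<dots> = (\<integral>\<^sup>+z. p y z * f z \<partial>distr lborel borel ((+) (\<Phi> y)))"
      by (subst nn_integral_distr) (auto simp: p_def)
    finally show ?thesis by (simp add: lborel_distr_plus)
  qed
  define \<Psi> where "\<Psi> u = H (fst u) * f (\<Phi> (?c (fst u)) + \<sigma> *\<^sub>R snd u (Suc n))" for u
  have [measurable]: "(\<lambda>u. snd u (Suc n)) \<in> borel_measurable (?S \<Otimes>\<^sub>M ?T)"
    by (rule measurable_compose[OF measurable_snd]) measurable
  have [measurable]: "\<Psi> \<in> borel_measurable (?S \<Otimes>\<^sub>M ?T)"
    unfolding \<Psi>_def by measurable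
  have "(\<integral>\<^sup>+\<omega>. H (?R \<omega>) * f (chain \<Phi> \<sigma> \<xi> x (Suc n) \<omega>) \<partial>P) = (\<integral>\<^sup>+\<omega>. \<Psi> (?R \<omega>, ?Y \<omega>) \<partial>P)"
    by (simp add: \<Psi>_def chain_restrict[where m=n, simplified])
  also have "\<dots> = (\<integral>\<^sup>+u. \<Psi> u \<partial>distr P (?S \<Otimes>\<^sub>M ?T) (\<lambda>\<omega>. (?R \<omega>, ?Y \<omega>)))"
    by (rule nn_integral_distr[symmetric], measurable)
  also have "\<dots> = (\<integral>\<^sup>+w. \<integral>\<^sup>+v. \<Psi> (w, v) \<partial>distr P ?T ?Y \<partial>distr P ?S ?R)"
    unfolding pair[symmetric] by (rule Z.nn_integral_fst[symmetric], measurable)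
  also have "\<dots> = (\<integral>\<^sup>+w. \<integral>\<^sup>+v. H w * f (\<Phi> (?c w) + \<sigma> *\<^sub>R v (Suc n)) \<partial>distr P ?T ?Y \<partial>distr P ?S ?R)"
    by (simp add: \<Psi>_def)
  also have "\<dots> = (\<integral>\<^sup>+w. H w * (\<integral>\<^sup>+z. p (?c w) z * f z \<partial>lborel) \<partial>distr P ?S ?R)"
    by (intro nn_integral_cong) (simp add: nn_integral_cmult inner)
  also have "\<dots> = (\<integral>\<^sup>+\<omega>. H (?R \<omega>) * (\<integral>\<^sup>+z. p (?c (?R \<omega>)) z * f z \<partial>lborel) \<partial>P)"
    by (rule nn_integral_distr, measurable)
  finally show ?thesis by (simp add: chain_restrict[where m=n, simplified])
qed

lemma nn_integral_excursion:
  assumes [measurable]: "f \<in> borel_measurable borel"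
  shows "(\<integral>\<^sup>+\<omega>. (\<Prod>m\<in>{1..n}. indicator (- M) (chain \<Phi> \<sigma> \<xi> x m \<omega>)) * f (chain \<Phi> \<sigma> \<xi> x (Suc n) \<omega>) \<partial>P)
    = (\<integral>\<^sup>+y. q n x y * f y \<partial>lborel)"
  using assms
proof (induction n arbitrary: f)
  case 0
  then show ?case using nn_integral_chain_Suc[of "\<lambda>_. 1" 0 f x] by (simp add: P.emeasure_space_1)
next
  case (Suc n)
  note [measurable] = Suc.prems
  let ?X = "chain \<Phi> \<sigma> \<xi> x"
  let ?H = "\<lambda>w. (\<Prod>m\<in>{1..Suc n}. indicator (- M) (chain \<Phi> \<sigma> (\<lambda>k w. w k) x m w)) :: ennreal"
  have Hm: "?H \<in> borel_measurable (PiM {1..Suc n} (\<lambda>_. borel))"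
  proof (rule borel_measurable_prod_ennreal)
    fix m assume "m \<in> {1..Suc n}"
    then have [measurable]: "(\<lambda>w. chain \<Phi> \<sigma> (\<lambda>k w. w k) x m w) \<in> borel_measurable (PiM {1..Suc n} (\<lambda>_. borel))"
      by (intro chain_noise_measurable) auto
    show "(\<lambda>w. indicator (- M) (chain \<Phi> \<sigma> (\<lambda>k w. w k) x m w) :: ennreal) \<in> borel_measurable (PiM {1..Suc n} (\<lambda>_. borel))"
      by measurable
  qed
  have HR: "?H (restrict (\<lambda>k. \<xi> k \<omega>) {1..Suc n}) = (\<Prod>m\<in>{1..Suc n}. indicator (- M) (?X m \<omega>))" for \<omega>
    by (intro prod.cong refl) (simp add: chain_restrict[where m="Suc n", simplified])
  let ?h = "\<lambda>y. indicator (- M) y * (\<integral>\<^sup>+z. p y z * f z \<partial>lborel)"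
  have "(\<integral>\<^sup>+\<omega>. (\<Prod>m\<in>{1..Suc n}. indicator (- M) (?X m \<omega>)) * f (?X (Suc (Suc n)) \<omega>) \<partial>P)
     = (\<integral>\<^sup>+\<omega>. (\<Prod>m\<in>{1..Suc n}. indicator (- M) (?X m \<omega>)) * (\<integral>\<^sup>+z. p (?X (Suc n) \<omega>) z * f z \<partial>lborel) \<partial>P)"
    using nn_integral_chain_Suc[OF Hm Suc.prems, of x] unfolding HR .
  also have "\<dots> = (\<integral>\<^sup>+\<omega>. (\<Prod>m\<in>{1..n}. indicator (- M) (?X m \<omega>)) * ?h (?X (Suc n) \<omega>) \<partial>P)"
    by (simp add: prod.nat_ivl_Suc' mult_ac)
  also have "\<dots> = (\<integral>\<^sup>+y. q n x y * ?h y \<partial>lborel)"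
    by (rule Suc.IH) measurable
  also have "\<dots> = (\<integral>\<^sup>+y. \<integral>\<^sup>+z. q n x y * (indicator (- M) y * p y z) * f z \<partial>lborel \<partial>lborel)"
    by (intro nn_integral_cong) (simp add: nn_integral_cmult[symmetric] mult.assoc)
  also have "\<dots> = (\<integral>\<^sup>+z. \<integral>\<^sup>+y. q n x y * (indicator (- M) y * p y z) * f z \<partial>lborel \<partial>lborel)"
    by (rule lborel_pair.Fubini') measurable
  also have "\<dots> = (\<integral>\<^sup>+z. q (Suc n) x z * f z \<partial>lborel)"
    unfolding q_Suc_last by (intro nn_integral_cong) (simp add: nn_integral_multc)
  finally show ?case .
qed

lemma trace_kernel_density:
  fixes x
  defines "X \<equiv> chain \<Phi> \<sigma> \<xi> x"
  defines "\<tau> \<equiv> (\<lambda>\<omega>. return_time M (\<lambda>n. X n \<omega>))"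
  shows "distr (restrict_space P {\<omega> \<in> space P. \<tau> \<omega> < \<infinity>}) borel (\<lambda>\<omega>. X (the_enat (\<tau> \<omega>)) \<omega>)
    = density lborel (\<lambda>y. k x y * indicator M y)"
proof (rule measure_eqI)
  have X [measurable]: "X n \<in> borel_measurable P" for n
    unfolding X_def by (rule chain_rv)
  \<comment> \<open>The event that the first return happens at time \<open>n + 1\<close> and lands
    in \<open>A\<close>. These events are disjoint in \<open>n\<close> and their union is the
    preimage of \<open>A\<close>; this yields both measurability of the stopped state and the series
    defining \<open>k\<close>.\<close>
  define E where "E n A = {\<omega> \<in> space P. X (Suc n) \<omega> \<in> M \<inter> A \<and> (\<forall>m\<in>{1..n}. X m \<omega> \<notin> M)}" for n A
  have E_meas [measurable]: "E n A \<in> sets P" if [measurable]: "A \<in> sets borel" for n A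
    unfolding E_def by measurable
  have \<tau>: "\<tau> \<omega> = enat (Suc n) \<longleftrightarrow> \<omega> \<in> E n UNIV" if "\<omega> \<in> space P" for n \<omega>
    using that unfolding \<tau>_def E_def return_time_eq_iff by auto
  let ?F = "{\<omega> \<in> space P. \<tau> \<omega> < \<infinity>}"
  have pre: "{\<omega> \<in> space P. \<tau> \<omega> < \<infinity> \<and> X (the_enat (\<tau> \<omega>)) \<omega> \<in> A} = (\<Union>n. E n A)" for A
  proof (intro set_eqI iffI)
    fix \<omega> assume *: "\<omega> \<in> {\<omega> \<in> space P. \<tau> \<omega> < \<infinity> \<and> X (the_enat (\<tau> \<omega>)) \<omega> \<in> A}"
    then obtain n where n: "\<tau> \<omega> = enat (Suc n)" unfolding \<tau>_def return_time_finite_iff by blast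
    then have "\<omega> \<in> E n UNIV" using \<tau> * by blast
    then have "\<omega> \<in> E n A" using * n unfolding E_def by auto
    then show "\<omega> \<in> (\<Union>n. E n A)" by blast
  next
    fix \<omega> assume "\<omega> \<in> (\<Union>n. E n A)"
    then obtain n where n: "\<omega> \<in> E n A" by blast
    then have "\<tau> \<omega> = enat (Suc n)" using \<tau> unfolding E_def by auto
    then show "\<omega> \<in> {\<omega> \<in> space P. \<tau> \<omega> < \<infinity> \<and> X (the_enat (\<tau> \<omega>)) \<omega> \<in> A}" using n unfolding E_def by auto
  qed
  have F: "?F \<in> sets P"
    using pre[of UNIV] by (simp add: sets.countable_UN)
  have spF: "space (restrict_space P ?F) = ?F" by (auto simp: space_restrict_space)
  have vim: "(\<lambda>\<omega>. X (the_enat (\<tau> \<omega>)) \<omega>) -` A \<inter> ?F = (\<Union>n. E n A)" for A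
    unfolding pre[symmetric] by auto
  have meas: "(\<lambda>\<omega>. X (the_enat (\<tau> \<omega>)) \<omega>) \<in> borel_measurable (restrict_space P ?F)"
  proof (rule measurableI)
    fix A :: "'a set" assume A: "A \<in> sets borel"
    have "(\<Union>n. E n A) \<in> sets P" using A by (intro sets.countable_UN) auto
    moreover have "(\<Union>n. E n A) \<subseteq> ?F" unfolding pre[symmetric] by auto
    ultimately show "(\<lambda>\<omega>. X (the_enat (\<tau> \<omega>)) \<omega>) -` A \<inter> space (restrict_space P ?F) \<in> sets (restrict_space P ?F)"
      unfolding spF vim using F by (subst sets_restrict_space_iff) auto
  qed simp
  fix A assume "A \<in> sets (distr (restrict_space P ?F) borel (\<lambda>\<omega>. X (the_enat (\<tau> \<omega>)) \<omega>))"
  then have A [measurable]: "A \<in> sets borel" by simp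
  have "emeasure (distr (restrict_space P ?F) borel (\<lambda>\<omega>. X (the_enat (\<tau> \<omega>)) \<omega>)) A = emeasure P (\<Union>n. E n A)"
    unfolding emeasure_distr[OF meas A] spF vim using F
    by (subst emeasure_restrict_space) (auto simp add: pre[symmetric])
  also have "\<dots> = (\<Sum>n. emeasure P (E n A))"
  proof (rule suminf_emeasure[symmetric])
    show "range (\<lambda>n. E n A) \<subseteq> sets P" by auto
    show "disjoint_family (\<lambda>n. E n A)"
    proof (unfold disjoint_family_on_def, intro ballI impI)
      fix m n :: nat assume "m \<noteq> n"
      show "E m A \<inter> E n A = {}"
      proof (rule equals0I)
        fix \<omega> assume "\<omega> \<in> E m A \<inter> E n A"
        then have "\<omega> \<in> space P" "\<omega> \<in> E m UNIV" "\<omega> \<in> E n UNIV" unfolding E_def by auto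
        then show False using \<tau>[of \<omega> m] \<tau>[of \<omega> n] \<open>m \<noteq> n\<close> by simp
      qed
    qed
  qed
  also have "\<dots> = (\<Sum>n. \<integral>\<^sup>+y. q n x y * indicator (M \<inter> A) y \<partial>lborel)"
  proof (intro suminf_cong)
    fix n
    have "emeasure P (E n A) = (\<integral>\<^sup>+\<omega>. indicator (E n A) \<omega> \<partial>P)" by simp
    also have "\<dots> = (\<integral>\<^sup>+\<omega>. (\<Prod>m\<in>{1..n}. indicator (- M) (X m \<omega>)) * indicator (M \<inter> A) (X (Suc n) \<omega>) \<partial>P)"
    proof (rule nn_integral_cong)
      fix \<omega> assume "\<omega> \<in> space P"
      have "(\<Prod>m\<in>{1..n}. indicator (- M) (X m \<omega>)) = (if \<forall>m\<in>{1..n}. X m \<omega> \<notin> M then 1 else 0 :: ennreal)"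
        by (auto simp: prod_zero_iff indicator_def intro!: prod.neutral)
      then show "indicator (E n A) \<omega> = (\<Prod>m\<in>{1..n}. indicator (- M) (X m \<omega>)) * (indicator (M \<inter> A) (X (Suc n) \<omega>) :: ennreal)"
        using \<open>\<omega> \<in> space P\<close> unfolding E_def by (auto simp: indicator_def)
    qed
    also have "\<dots> = (\<integral>\<^sup>+y. q n x y * indicator (M \<inter> A) y \<partial>lborel)"
      unfolding X_def by (rule nn_integral_excursion) measurable
    finally show "emeasure P (E n A) = \<dots>" .
  qed
  also have "\<dots> = (\<integral>\<^sup>+y. k x y * indicator (M \<inter> A) y \<partial>lborel)"
    unfolding k_def ennreal_suminf_multc[symmetric] by (rule nn_integral_suminf[symmetric]) measurable
  also have "\<dots> = emeasure (density lborel (\<lambda>y. k x y * indicator M y)) A"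
    by (subst emeasure_density) (auto intro!: nn_integral_cong split: split_indicator)
  finally show "emeasure (distr (restrict_space P ?F) borel (\<lambda>\<omega>. X (the_enat (\<tau> \<omega>)) \<omega>)) A = \<dots>" .
qed simp

end

section \<open>Powers of the killed kernel\<close>

text \<open>An off-by-one to keep in mind: \<open>kp B n\<close> belongs to the power
  \<open>n + 1\<close>, since the power 0 is a point mass without density. The restriction of the
  endpoint to \<open>B\<close> is left out here and is applied where the density is used.\<close>

primrec kp :: "'a set \<Rightarrow> nat \<Rightarrow> 'a \<Rightarrow> 'a \<Rightarrow> ennreal" where
  "kp B 0 x y = k x y"
| "kp B (Suc n) x y = (\<integral>\<^sup>+z. k x z * (indicator B z * kp B n z y) \<partial>lborel)"

lemma kp_borel:
  assumes [measurable]: "B \<in> sets borel"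
  shows "(\<lambda>w. kp B n (fst w) (snd w)) \<in> borel_measurable (borel \<Otimes>\<^sub>M borel)"
proof (induction n)
  case (Suc n)
  have "(\<lambda>u. kp B n (snd u) (snd (fst u))) \<in> borel_measurable ((borel \<Otimes>\<^sub>M borel) \<Otimes>\<^sub>M lborel)"
    by (rule measurable_compose[OF _ Suc, where f="\<lambda>u. (snd u, snd (fst u))", simplified]) measurable
  note [measurable] = this
  show ?case by simp measurable
qed simp

lemma kp_borel':
  assumes [measurable]: "B \<in> sets borel" "f \<in> borel_measurable N" "h \<in> borel_measurable N"
  shows "(\<lambda>w. kp B n (f w) (h w)) \<in> borel_measurable N"
  using measurable_compose[OF _ kp_borel[OF assms(1)], where f="\<lambda>u. (f u, h u)"] by simp

text \<open>This is what makes the densities subprobability kernels, as the monadic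
  \<open>bind\<close> in the definition of the powers demands.\<close>

lemma kp_submarkov:
  assumes B [measurable]: "B \<in> sets borel" and "B \<subseteq> M"
  shows "(\<integral>\<^sup>+y. indicator B y * kp B n x y \<partial>lborel) \<le> 1"
proof -
  have k: "(\<integral>\<^sup>+y. indicator B y * k x y \<partial>lborel) \<le> 1" for x
  proof -
    have "(\<integral>\<^sup>+y. indicator B y * k x y \<partial>lborel) \<le> (\<integral>\<^sup>+y. k x y * indicator M y \<partial>lborel)"
      using \<open>B \<subseteq> M\<close> by (intro nn_integral_mono) (auto split: split_indicator)
    also have "\<dots> \<le> 1" by (rule k_submarkov)
    finally show ?thesis .
  qed
  note [measurable] = kp_borel'[OF B]
  show ?thesis
  proof (induction n arbitrary: x)
    case (Suc n)
    have "(\<integral>\<^sup>+y. indicator B y * kp B (Suc n) x y \<partial>lborel) =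
       (\<integral>\<^sup>+y. \<integral>\<^sup>+z. k x z * (indicator B z * (indicator B y * kp B n z y)) \<partial>lborel \<partial>lborel)"
      unfolding kp.simps by (subst nn_integral_cmult[symmetric]) (auto simp: mult_ac)
    also have "\<dots> = (\<integral>\<^sup>+z. \<integral>\<^sup>+y. k x z * (indicator B z * (indicator B y * kp B n z y)) \<partial>lborel \<partial>lborel)"
      by (rule lborel_pair.Fubini') measurable
    also have "\<dots> = (\<integral>\<^sup>+z. indicator B z * k x z * (\<integral>\<^sup>+y. indicator B y * kp B n z y \<partial>lborel) \<partial>lborel)"
      by (intro nn_integral_cong, subst nn_integral_cmult[symmetric]) (auto simp: mult_ac)
    also have "\<dots> \<le> (\<integral>\<^sup>+z. indicator B z * k x z * 1 \<partial>lborel)"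
      by (intro nn_integral_mono mult_left_mono Suc) auto
    also have "\<dots> \<le> 1" using k by simp
    finally show ?case .
  qed (use k in simp)
qed

lemma kernel_power_density:
  assumes B [measurable]: "B \<in> sets borel" and "B \<subseteq> M"
    and K: "\<And>x. K x = density lborel (\<lambda>y. k x y * indicator M y)"
  shows "kernel_power (killed_kernel K B) (Suc n) x = density lborel (\<lambda>y. indicator B y * kp B n x y)"
proof -
  note [measurable] = kp_borel'[OF B]
  have K': "killed_kernel K B x = density lborel (\<lambda>y. k x y * indicator B y)" for x
    unfolding killed_kernel_def K using \<open>B \<subseteq> M\<close>
    by (subst density_density_eq) (auto intro!: arg_cong[where f="density lborel"] ext split: split_indicator)
  show ?thesis
  proof (induction n arbitrary: x)
    case 0
    have "kernel_power (killed_kernel K B) (Suc 0) x = killed_kernel K B x \<bind> return borel"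
      by (simp add: kernel_power.simps(1)[abs_def])
    also have "\<dots> = killed_kernel K B x" by (rule bind_return'') (simp add: K')
    finally show ?case unfolding K' by (simp add: mult.commute)
  next
    case (Suc n)
    let ?D = "\<lambda>x. density lborel (\<lambda>y. indicator B y * kp B n x y)"
    have eq: "kernel_power (killed_kernel K B) (Suc n) = ?D"
      using Suc by blast
    have D: "?D \<in> measurable borel (subprob_algebra borel)"
    proof (rule measurable_subprob_algebra)
      fix x :: 'a
      show "subprob_space (?D x)"
        using kp_submarkov[OF B \<open>B \<subseteq> M\<close>, of n x] by (intro subprob_spaceI) (simp_all add: emeasure_density)
    next
      fix A :: "'a set" assume [measurable]: "A \<in> sets borel"
      show "(\<lambda>x. emeasure (?D x) A) \<in> borel_measurable borel"
        by (subst emeasure_density) measurable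
    qed simp
    have D': "?D \<in> measurable (killed_kernel K B x) (subprob_algebra borel)"
      using D by (simp add: K' cong: measurable_cong_sets)
    have "kernel_power (killed_kernel K B) (Suc (Suc n)) x = killed_kernel K B x \<bind> ?D"
      using eq by simp
    also have "\<dots> = density lborel (\<lambda>y. indicator B y * kp B (Suc n) x y)"
    proof (rule measure_eqI)
      show "sets (killed_kernel K B x \<bind> ?D) = sets (density lborel (\<lambda>y. indicator B y * kp B (Suc n) x y))"
        by (subst sets_bind[where N=borel]) (simp_all add: K')
      fix A assume "A \<in> sets (killed_kernel K B x \<bind> ?D)"
      also have "sets (killed_kernel K B x \<bind> ?D) = sets borel"
        by (subst sets_bind[where N=borel]) (simp_all add: K')
      finally have [measurable]: "A \<in> sets borel" .
      have "emeasure (killed_kernel K B x \<bind> ?D) A = (\<integral>\<^sup>+z. emeasure (?D z) A \<partial>killed_kernel K B x)"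
        by (rule emeasure_bind[OF _ D']) (simp_all add: K')
      also have "\<dots> = (\<integral>\<^sup>+z. k x z * indicator B z * (\<integral>\<^sup>+y. indicator B y * kp B n z y * indicator A y \<partial>lborel) \<partial>lborel)"
        by (simp add: K' emeasure_density nn_integral_density)
      also have "\<dots> = (\<integral>\<^sup>+z. \<integral>\<^sup>+y. k x z * indicator B z * (indicator B y * kp B n z y * indicator A y) \<partial>lborel \<partial>lborel)"
        by (intro nn_integral_cong) (simp add: nn_integral_cmult)
      also have "\<dots> = (\<integral>\<^sup>+y. \<integral>\<^sup>+z. k x z * indicator B z * (indicator B y * kp B n z y * indicator A y) \<partial>lborel \<partial>lborel)"
        by (rule lborel_pair.Fubini') measurable
      also have "\<dots> = (\<integral>\<^sup>+y. \<integral>\<^sup>+z. k x z * (indicator B z * kp B n z y) * (indicator B y * indicator A y) \<partial>lborel \<partial>lborel)"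
        by (simp add: mult_ac)
      also have "\<dots> = (\<integral>\<^sup>+y. kp B (Suc n) x y * (indicator B y * indicator A y) \<partial>lborel)"
        by (intro nn_integral_cong) (simp add: nn_integral_multc)
      also have "\<dots> = emeasure (density lborel (\<lambda>y. indicator B y * kp B (Suc n) x y)) A"
        by (subst emeasure_density) (auto simp: mult_ac simp del: kp.simps)
      finally show "emeasure (killed_kernel K B x \<bind> ?D) A = \<dots>" .
    qed
    finally show ?case .
  qed
qed

end

section \<open>The potential of a contracting neighbourhood\<close>

text \<open>\<open>N\<close> is an adapted norm, of which only subadditivity, symmetry and
  domination of the Euclidean norm are recorded. The equation for \<open>B\<close> says that no
  other piece of \<open>M\<close> meets the neighbourhood: a point of \<open>V \<rho>\<close>
  outside \<open>B\<close> is outside \<open>M\<close>. The integrable envelope of the shifted noise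
  densities serves dominated convergence in the starting point.\<close>

locale contracting_well = trace_chain \<Phi> g M
  for \<Phi> :: "'a::euclidean_space \<Rightarrow> 'a" and g M +
  fixes N :: "'a \<Rightarrow> real" and c :: 'a and \<kappa> \<rho> :: real and B :: "'a set"
  assumes noise_dominated: "\<And>r. \<exists>G\<in>borel_measurable borel. (\<integral>\<^sup>+z. G z \<partial>lborel) < \<infinity> \<and>
      (\<forall>u z. norm u \<le> r \<longrightarrow> ennreal (g (z - u)) \<le> G z)"
    and N_triangle: "N (v + w) \<le> N v + N w"
    and N_0: "N 0 = 0"
    and N_minus: "N (- v) = N v"
    and norm_le_N: "norm v \<le> N v"
    and N_cont: "continuous_on UNIV N"
    and \<kappa>: "0 < \<kappa>" "\<kappa> < 1"
    and \<rho>: "0 < \<rho>"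
    and fixed: "\<Phi> c = c"
    and contraction: "N (x - c) \<le> \<rho> \<Longrightarrow> N (x' - c) \<le> \<rho> \<Longrightarrow> N (\<Phi> x - \<Phi> x') \<le> \<kappa> * N (x - x')"
    and B_eq: "B = {z \<in> M. N (z - c) \<le> \<rho>}"
    and B_closed: "closed B"
begin

definition V :: "real \<Rightarrow> 'a set" where
  "V r = {z. N (z - c) \<le> r}"

definition tail :: "real \<Rightarrow> real" where
  "tail t = measure (density lborel (\<lambda>v. ennreal (g v))) {v. N v > t}"

lemma N_diff_triangle: "N (x - z) \<le> N (x - y) + N (y - z)"
  using N_triangle[of "x - y" "y - z"] by simp

lemma N_borel [measurable]: "N \<in> borel_measurable borel"
  using N_cont by (rule borel_measurable_continuous_onI)

lemma V_borel [measurable]: "V r \<in> sets borel"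
  unfolding V_def by measurable

lemma B_borel [measurable]: "B \<in> sets borel"
  using B_closed by (rule borel_closed)

lemma B_sub: "B \<subseteq> M" and B_sub_V: "B \<subseteq> V \<rho>" and M_V: "r \<le> \<rho> \<Longrightarrow> M \<inter> V r \<subseteq> B"
  unfolding B_eq V_def by auto

lemma V_bounded: "bounded (V r)"
proof -
  have "dist c z \<le> r" if "z \<in> V r" for z
    using that norm_le_N[of "z - c"] unfolding V_def by (simp add: dist_norm norm_minus_commute)
  then show ?thesis unfolding bounded_def by blast
qed

lemma B_bounded: "bounded B"
  using V_bounded B_sub_V bounded_subset by blast

lemma B_compact: "compact B"
  using B_closed B_bounded compact_eq_bounded_closed by blast

lemma prob_noise: "prob_space (density lborel (\<lambda>v. ennreal (g v)))"
  using noise_mass by (intro prob_spaceI) (simp add: emeasure_density)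

lemma step_distr: "step x = distr (density lborel (\<lambda>v. ennreal (g v))) borel (\<lambda>v. \<Phi> x + v)"
proof (rule measure_eqI)
  fix A assume "A \<in> sets (step x)"
  then have [measurable]: "A \<in> sets borel" by simp
  have "emeasure (step x) A = (\<integral>\<^sup>+z. p x z * indicator A z \<partial>distr lborel borel ((+) (\<Phi> x)))"
    by (simp add: step_def emeasure_density lborel_distr_plus)
  also have "\<dots> = (\<integral>\<^sup>+v. ennreal (g v) * indicator A (\<Phi> x + v) \<partial>lborel)"
    by (subst nn_integral_distr) (auto simp: p_def)
  also have "\<dots> = emeasure (distr (density lborel (\<lambda>v. ennreal (g v))) borel (\<lambda>v. \<Phi> x + v)) A"
    by (simp add: emeasure_distr emeasure_density vimage_def indicator_def)
  finally show "emeasure (step x) A = \<dots>" .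
qed simp

lemma integral_step: 
  fixes f :: "'a \<Rightarrow> real"
  assumes [measurable]: "f \<in> borel_measurable borel"
  shows "(\<integral>z. f z \<partial>step x) = (\<integral>v. f (\<Phi> x + v) \<partial>density lborel (\<lambda>v. ennreal (g v)))"
  unfolding step_distr by (rule integral_distr) auto

lemma integrable_step:
  fixes f :: "'a \<Rightarrow> real"
  assumes [measurable]: "f \<in> borel_measurable borel" and "\<And>z. 0 \<le> f z" "\<And>z. f z \<le> b"
  shows "integrable (step x) f"
proof -
  interpret prob_space "step x" by (rule prob_step)
  show ?thesis
    by (rule integrable_const_bound[where B=b]) (use assms in auto)
qed

lemma prob_le_1: "measure (step x) A \<le> 1"
  by (rule prob_space.prob_le_1[OF prob_step])

text \<open>The map sends \<open>V r\<close> into \<open>V (\<kappa> * r)\<close>, so a noise of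
  \<open>N\<close>-size at most \<open>t\<close> cannot carry the chain out of
  \<open>V r'\<close>.\<close>

lemma stay:
  assumes "x \<in> V r" "r \<le> \<rho>" "\<kappa> * r + t \<le> r'"
  shows "measure (step x) (V r') \<ge> 1 - tail t"
proof -
  let ?\<nu> = "density lborel (\<lambda>v. ennreal (g v))"
  interpret \<nu>: prob_space ?\<nu> by (rule prob_noise)
  have "1 - tail t = measure ?\<nu> (space ?\<nu> - {v. N v > t})"
    unfolding tail_def by (subst \<nu>.prob_compl) auto
  also have "\<dots> \<le> measure ?\<nu> ((\<lambda>v. \<Phi> x + v) -` V r' \<inter> space ?\<nu>)"
  proof (rule \<nu>.finite_measure_mono)
    have "N (\<Phi> x - c) \<le> \<kappa> * r"
    proof -
      have "N (\<Phi> x - c) \<le> \<kappa> * N (x - c)"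
        using contraction[of x c] assms \<rho> fixed N_0 by (simp add: V_def)
      also have "\<dots> \<le> \<kappa> * r" using assms \<kappa> by (simp add: V_def)
      finally show ?thesis .
    qed
    then have "N (\<Phi> x + v - c) \<le> r'" if "N v \<le> t" for v
      using N_triangle[of "\<Phi> x - c" v] that assms by (simp add: algebra_simps)
    then show "space ?\<nu> - {v. N v > t} \<subseteq> (\<lambda>v. \<Phi> x + v) -` V r' \<inter> space ?\<nu>"
      by (auto simp: V_def not_less)
  qed measurable
  also have "\<dots> = measure (step x) (V r')"
    unfolding step_distr by (subst measure_distr) auto
  finally show ?thesis .
qed

lemma ennreal_expectation:
  fixes f :: "'a \<Rightarrow> real"
  assumes [measurable]: "f \<in> borel_measurable borel" and "\<And>z. 0 \<le> f z" "\<And>z. f z \<le> b"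
  shows "(\<integral>\<^sup>+z. p x z * ennreal (f z) \<partial>lborel) = ennreal (\<integral>z. f z \<partial>step x)"
proof -
  have "(\<integral>\<^sup>+z. p x z * ennreal (f z) \<partial>lborel) = (\<integral>\<^sup>+z. ennreal (f z) \<partial>step x)"
    by (rule nn_step[symmetric]) measurable
  also have "\<dots> = ennreal (\<integral>z. f z \<partial>step x)"
    by (rule nn_integral_eq_integral[OF integrable_step[OF assms]]) (use assms in auto)
  finally show ?thesis .
qed

lemma sum_powers_4: "(\<Sum>i\<le>l. 4 ^ i * (2 * c1)) = 2 / 3 * (4 ^ Suc l - 1) * (c1 :: real)"
  by (induction l) (auto simp: field_simps)

text \<open>The reason for weights growing by the factor 4. The next layer is reached with
  probability 1/2, so its weight \<open>4 ^ Suc l * 2 * c1\<close> yields a gain of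
  \<open>4 ^ Suc l * c1\<close>; this must pay for all the outer weights, a geometric sum below 2/3
  of it, and for the source \<open>c1\<close>.\<close>

lemma layer_gain:
  assumes "0 < (c1 :: real)"
  shows "c1 + 2 / 3 * (4 ^ Suc l - 1) * c1 \<le> 4 ^ Suc l * c1"
proof -
  have "1 + 2 / 3 * (4 * X - 1) \<le> 4 * X" if "1 \<le> X" for X :: real using that by (simp add: field_simps)
  from this[of "4 ^ l"] have "1 + 2 / 3 * (4 ^ Suc l - 1) \<le> (4 :: real) ^ Suc l" by simp
  from mult_right_mono[OF this, of c1] assms show ?thesis by (simp add: distrib_right)
qed

text \<open>The potential of the neighbourhood \<open>V \<rho>\<close> for the chain killed in \<open>M\<close>.  The supersolution
  loses a geometrically growing amount in each of the layers \<open>V (s l)\<close> that a path crosses on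
  its way to the core \<open>V (s J)\<close>, where it is killed with probability at least \<open>\<beta>\<close>.\<close>

lemma supersolution:
  fixes s :: "nat \<Rightarrow> real"
  assumes s0: "s 0 = \<rho>" and s_step: "\<And>l. l < J \<Longrightarrow> \<kappa> * s l + t \<le> s (Suc l)"
    and s_dec: "decseq s" and t: "0 \<le> t" "tail t \<le> 1/2"
    and c1: "0 < c1" and \<beta>: "0 < \<beta>" "\<And>x. x \<in> V (s J) \<Longrightarrow> measure (step x) M \<ge> \<beta>"
  obtains W where "W \<in> borel_measurable borel" "\<And>x. 0 \<le> W x" "\<And>x. W x \<le> 4 ^ Suc J * c1 / \<beta>"
    "\<And>x. c1 * measure (step x) (V \<rho>) + (\<integral>z. indicator (- M) z * W z \<partial>step x) \<le> W x"
proof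
  define D where "D z = (\<Sum>l\<le>J. 4 ^ l * (2 * c1) * indicator (V (s l)) z)" for z
  \<comment> \<open>With this value, being killed with probability \<beta> lowers the mean of the
    constant \<open>A\<close> by exactly \<open>4 ^ Suc J * c1\<close>.\<close>
  define A where "A = 4 ^ Suc J * c1 / \<beta>"
  let ?W = "\<lambda>z. A - D z"
  have [measurable]: "D \<in> borel_measurable borel" unfolding D_def by measurable
  then show "?W \<in> borel_measurable borel" by measurable
  have D0: "0 \<le> D z" for z unfolding D_def using c1 by (intro sum_nonneg) auto
  have Dmax: "D z \<le> 2 / 3 * (4 ^ Suc J - 1) * c1" for z
    unfolding D_def sum_powers_4[symmetric] using c1
    by (intro sum_mono) (auto split: split_indicator)
  have "s l \<ge> 0" if "l \<le> J" for l
  proof (cases l)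
    case 0 then show ?thesis using s0 \<rho> by simp
  next
    case (Suc i)
    have "s j \<ge> 0" if "j \<le> J" for j using that
    proof (induction j)
      case 0 then show ?case using s0 \<rho> by simp
    next
      case (Suc j)
      then have "0 \<le> \<kappa> * s j + t" using \<kappa> t by simp
      then show ?case using s_step[of j] Suc by simp
    qed
    then show ?thesis using that by blast
  qed
  then have "c \<in> V (s J)" unfolding V_def using N_0 by simp
  then have "\<beta> \<le> 1" using order_trans[OF \<beta>(2) prob_le_1] by blast
  then have A_ge: "4 ^ Suc J * c1 \<le> A"
    unfolding A_def using \<beta>(1) c1 by (simp add: pos_le_divide_eq mult_left_le)
  have W0: "0 \<le> ?W z" for z
  proof -
    have "2 / 3 * (4 ^ Suc J - 1) * c1 \<le> 4 ^ Suc J * c1"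
      proof (rule mult_right_mono)
      have "2 / 3 * (4 * X - 1) \<le> 4 * X" if "0 \<le> X" for X :: real using that by simp
      from this[of "4 ^ J"] show "2 / 3 * (4 ^ Suc J - 1) \<le> (4 :: real) ^ Suc J" by simp
    qed (use c1 in simp)
    then show ?thesis using Dmax[of z] A_ge by simp
  qed
  then show "\<And>x. 0 \<le> ?W x" .
  show "\<And>x. ?W x \<le> 4 ^ Suc J * c1 / \<beta>" using D0 A_def by simp
  fix x
  interpret S: prob_space "step x" by (rule prob_step)
  have WA: "?W z \<le> A" for z using D0[of z] by simp
  have intW: "integrable (step x) ?W" by (rule integrable_step[OF _ W0 WA]) measurable
  have "0 < 4 ^ Suc J * c1" using c1 by simp
  then have A0: "0 \<le> A" using A_ge by linarith
  have intMW: "integrable (step x) (\<lambda>z. indicator (- M) z * ?W z)"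
    by (rule integrable_step[where b=A]) (use W0 WA A0 in \<open>auto split: split_indicator\<close>)
  have "(\<integral>z. indicator (- M) z * ?W z \<partial>step x) \<le> (\<integral>z. ?W z \<partial>step x)"
    by (rule integral_mono[OF intMW intW]) (use W0 in \<open>auto split: split_indicator\<close>)
  also have "\<dots> = A - (\<Sum>l\<le>J. 4 ^ l * (2 * c1) * measure (step x) (V (s l)))"
  proof -
    have "(\<integral>z. D z \<partial>step x) = (\<Sum>l\<le>J. 4 ^ l * (2 * c1) * measure (step x) (V (s l)))"
      unfolding D_def by (subst Bochner_Integration.integral_sum) (simp_all add: S.emeasure_eq_measure)
    moreover have "integrable (step x) D"
      unfolding D_def by (rule Bochner_Integration.integrable_sum) (simp add: S.emeasure_eq_measure)
    ultimately show ?thesis by (simp add: S.prob_space[simplified])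
  qed
  finally have le1: "(\<integral>z. indicator (- M) z * ?W z \<partial>step x) \<le> A - (\<Sum>l\<le>J. 4 ^ l * (2 * c1) * measure (step x) (V (s l)))" .
  have single: "4 ^ l * (2 * c1) * measure (step x) (V (s l)) \<le> (\<Sum>l\<le>J. 4 ^ l * (2 * c1) * measure (step x) (V (s l)))"
    if "l \<le> J" for l
    using that c1 by (intro member_le_sum) auto
  \<comment> \<open>Outside \<open>V \<rho>\<close> no weight is present at \<open>x\<close>, and
    the outermost weight \<open>2 * c1\<close> pays for the source
    \<open>c1 * measure (step x) (V \<rho>)\<close>. In the core the killing pays, as
    \<open>A\<close> is calibrated for it. Between two layers the next weight is reached with
    probability at least 1/2 and \<open>layer_gain\<close> applies.\<close>
  consider "x \<notin> V (s 0)" | "x \<in> V (s J)" | l where "l < J" "x \<in> V (s l)" "x \<notin> V (s (Suc l))"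
  proof -
    have "\<exists>l<J. x \<in> V (s l) \<and> x \<notin> V (s (Suc l))" if "x \<in> V (s 0)" "x \<notin> V (s J)"
    proof (rule ccontr)
      assume *: "\<not> ?thesis"
      have "x \<in> V (s l)" if "l \<le> J" for l
        using that by (induction l) (use \<open>x \<in> V (s 0)\<close> * in auto)
      then show False using that by auto
    qed
    then show ?thesis using that by blast
  qed
  then show "c1 * measure (step x) (V \<rho>) + (\<integral>z. indicator (- M) z * ?W z \<partial>step x) \<le> ?W x"
  proof cases
    case 1
    have "s l \<le> s 0" for l using s_dec by (simp add: decseqD)
    then have "x \<notin> V (s l)" for l using 1 order_trans[of "N (x - c)" "s l" "s 0"] unfolding V_def by blast
    then have "D x = 0" unfolding D_def by simp
    moreover have "2 * (c1 * measure (step x) (V \<rho>)) \<le> (\<Sum>l\<le>J. 4 ^ l * (2 * c1) * measure (step x) (V (s l)))"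
      using single[of 0] s0 by simp
    moreover have "0 \<le> c1 * measure (step x) (V \<rho>)" using c1 by simp
    ultimately show ?thesis using le1 by linarith
  next
    case 2
    have "(\<integral>z. indicator (- M) z * ?W z \<partial>step x) \<le> (\<integral>z. A * indicator (- M) z \<partial>step x)"
      by (rule integral_mono[OF intMW]) (use D0 in \<open>auto simp: S.emeasure_eq_measure split: split_indicator\<close>)
    also have "\<dots> = A * (1 - measure (step x) M)"
      using S.prob_compl[of M] by (simp add: Compl_eq_Diff_UNIV)
    also have "\<dots> \<le> A * (1 - \<beta>)"
      using \<beta>(2)[OF 2] A0 by (intro mult_left_mono) auto
    also have "\<dots> = A - 4 ^ Suc J * c1" unfolding A_def using \<beta>(1) by (simp add: field_simps)
    finally have "(\<integral>z. indicator (- M) z * ?W z \<partial>step x) \<le> A - 4 ^ Suc J * c1" .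
    moreover have "c1 * measure (step x) (V \<rho>) \<le> c1" using c1 prob_le_1 by (simp add: mult_left_le)
    moreover have "c1 + D x \<le> 4 ^ Suc J * c1"
      using Dmax[of x] layer_gain[OF c1, of J] by linarith
    ultimately show ?thesis by linarith
  next
    case 3
    have "D x \<le> (\<Sum>i\<le>l. 4 ^ i * (2 * c1))"
    proof -
      have "D x = (\<Sum>i\<in>{..l} \<union> {Suc l..J}. 4 ^ i * (2 * c1) * indicator (V (s i)) x)"
        unfolding D_def using 3 by (intro sum.cong) auto
      also have "\<dots> = (\<Sum>i\<le>l. 4 ^ i * (2 * c1) * indicator (V (s i)) x) + (\<Sum>i=Suc l..J. 4 ^ i * (2 * c1) * indicator (V (s i)) x)"
        by (rule sum.union_disjoint) auto
      also have "(\<Sum>i=Suc l..J. 4 ^ i * (2 * c1) * indicator (V (s i)) x) = 0"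
      proof (rule sum.neutral, safe)
        fix i assume "i \<in> {Suc l..J}"
        then have "s i \<le> s (Suc l)" using s_dec by (simp add: decseqD)
        then show "4 ^ i * (2 * c1) * indicator (V (s i)) x = 0" using 3 by (auto simp: V_def split: split_indicator)
      qed
      also have "(\<Sum>i\<le>l. 4 ^ i * (2 * c1) * indicator (V (s i)) x) \<le> (\<Sum>i\<le>l. 4 ^ i * (2 * c1))"
        using c1 by (intro sum_mono) (auto split: split_indicator)
      finally show ?thesis by simp
    qed
    then have D: "D x \<le> 2 / 3 * (4 ^ Suc l - 1) * c1" unfolding sum_powers_4 .
    have "s l \<le> \<rho>" using s0 s_dec decseqD[of s 0 l] by simp
    then have "1 / 2 \<le> measure (step x) (V (s (Suc l)))"
      using stay[OF 3(2) _ s_step[OF 3(1)]] t by linarith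
    then have "4 ^ Suc l * (2 * c1) * (1 / 2) \<le> 4 ^ Suc l * (2 * c1) * measure (step x) (V (s (Suc l)))"
      using c1 by (intro mult_left_mono) auto
    then have "(\<integral>z. indicator (- M) z * ?W z \<partial>step x) \<le> A - 4 ^ Suc l * c1"
      using le1 single[of "Suc l"] 3(1) by (simp add: algebra_simps)
    moreover have "c1 * measure (step x) (V \<rho>) \<le> c1" using c1 prob_le_1 by (simp add: mult_left_le)
    moreover have "c1 + 2 / 3 * (4 ^ Suc l - 1) * c1 \<le> 4 ^ Suc l * c1"
      by (rule layer_gain[OF c1])
    ultimately show ?thesis using D by linarith
  qed
qed

text \<open>Standing hypotheses for the density of the trace at points of \<open>B\<close>: \<open>c1\<close> bounds the noise
  density and compares it with the probability of a step into \<open>V \<rho>\<close>; \<open>W\<close> is a supersolution.\<close>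

context
  fixes c1 A :: real and W :: "'a \<Rightarrow> real"
  assumes c1: "\<And>x y. y \<in> B \<Longrightarrow> g (y - \<Phi> x) \<le> c1 * measure (step x) (V \<rho>)"
    and W: "W \<in> borel_measurable borel" "\<And>x. 0 \<le> W x" "\<And>x. W x \<le> A"
      "\<And>x. c1 * measure (step x) (V \<rho>) + (\<integral>z. indicator (- M) z * W z \<partial>step x) \<le> W x"
begin

lemma A_nonneg: "0 \<le> A"
  using W(2,3) order_trans by metis

lemma c1_pos: "B \<noteq> {} \<Longrightarrow> 0 < c1"
proof -
  assume "B \<noteq> {}"
  then obtain y where "y \<in> B" by blast
  then have "0 < c1 * measure (step c) (V \<rho>)" using c1[of y c] noise_pos[of "y - \<Phi> c"] by simp
  then show "0 < c1" by (metis measure_nonneg zero_less_mult_pos2 mult_zero_right order_le_less)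
qed

lemma nn_W: "(\<integral>\<^sup>+z. p x z * (indicator (- M) z * ennreal (W z)) \<partial>lborel) = ennreal (\<integral>z. indicator (- M) z * W z \<partial>step x)"
proof -
  have [measurable]: "W \<in> borel_measurable borel" by (rule W)
  have "(\<integral>\<^sup>+z. p x z * (indicator (- M) z * ennreal (W z)) \<partial>lborel) = (\<integral>\<^sup>+z. p x z * ennreal (indicator (- M) z * W z) \<partial>lborel)"
    by (intro nn_integral_cong) (auto split: split_indicator)
  also have "\<dots> = ennreal (\<integral>z. indicator (- M) z * W z \<partial>step x)"
    by (rule ennreal_expectation[where b=A]) (use W A_nonneg in \<open>auto split: split_indicator\<close>)
  finally show ?thesis .
qed

lemma int_W_nonneg: "0 \<le> (\<integral>z. indicator (- M) z * W z \<partial>step x)"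
  by (rule integral_nonneg_AE) (use W in \<open>auto split: split_indicator\<close>)

lemma k_le: "y \<in> B \<Longrightarrow> k x y \<le> ennreal A"
proof -
  assume y: "y \<in> B"
  have [measurable]: "W \<in> borel_measurable borel" by (rule W)
  have "k x y \<le> ennreal (W x)"
  proof (rule k_minimal_point)
    fix x
    have "p x y + (\<integral>\<^sup>+z. p x z * (indicator (- M) z * ennreal (W z)) \<partial>lborel) \<le>
       ennreal (c1 * measure (step x) (V \<rho>)) + ennreal (\<integral>z. indicator (- M) z * W z \<partial>step x)"
      unfolding nn_W using c1[OF y, of x] by (intro add_mono order_refl) (simp add: p_def ennreal_leI)
    also have "\<dots> \<le> ennreal (W x)"
    proof -
      have "0 \<le> c1 * measure (step x) (V \<rho>)" using c1[OF y, of x] noise_pos[of "y - \<Phi> x"] by linarith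
      then show ?thesis using W(4)[of x] int_W_nonneg[of x]
        by (subst ennreal_plus[symmetric]) (auto intro!: ennreal_leI simp del: ennreal_plus)
    qed
    finally show "p x y + (\<integral>\<^sup>+z. p x z * (indicator (- M) z * ennreal (W z)) \<partial>lborel) \<le> ennreal (W x)" .
  qed measurable
  also have "\<dots> \<le> ennreal A" using W(3) by (rule ennreal_leI)
  finally show ?thesis .
qed

text \<open>Weighting the Green density by the probability of stepping into \<open>V \<rho>\<close>
  counts visits to \<open>V \<rho>\<close>, by \<open>k_last\<close>, and the supersolution bounds
  their expected number. The resulting finite measure is the envelope for continuity of the density
  in its endpoint.\<close>

lemma potential_finite:
  assumes "0 \<le> c1"
  shows "(\<integral>\<^sup>+w. k x w * (indicator (- M) w * ennreal (c1 * measure (step w) (V \<rho>))) \<partial>lborel) < \<infinity>"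
proof -
  have [measurable]: "W \<in> borel_measurable borel" by (rule W)
  have Pc: "ennreal (c1 * measure (step x) (V \<rho>)) = (\<integral>\<^sup>+v. p x v * (ennreal c1 * indicator (V \<rho>) v) \<partial>lborel)" for x
  proof -
    interpret prob_space "step x" by (rule prob_step)
    have "ennreal (c1 * measure (step x) (V \<rho>)) = ennreal c1 * emeasure (step x) (V \<rho>)"
      using \<open>0 \<le> c1\<close> by (simp add: emeasure_eq_measure ennreal_mult)
    also have "\<dots> = (\<integral>\<^sup>+v. ennreal c1 * indicator (V \<rho>) v \<partial>step x)"
      by (subst nn_integral_cmult) auto
    finally show ?thesis by (simp add: nn_step)
  qed
  have "(\<integral>\<^sup>+w. k x w * (indicator (- M) w * ennreal (c1 * measure (step w) (V \<rho>))) \<partial>lborel)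
    = (\<integral>\<^sup>+w. \<integral>\<^sup>+v. k x w * (indicator (- M) w * p w v) * (ennreal c1 * indicator (V \<rho>) v) \<partial>lborel \<partial>lborel)"
    unfolding Pc by (intro nn_integral_cong) (simp add: nn_integral_cmult[symmetric] mult.assoc)
  also have "\<dots> = (\<integral>\<^sup>+v. \<integral>\<^sup>+w. k x w * (indicator (- M) w * p w v) * (ennreal c1 * indicator (V \<rho>) v) \<partial>lborel \<partial>lborel)"
    by (rule lborel_pair.Fubini') measurable
  also have "\<dots> \<le> (\<integral>\<^sup>+v. k x v * (ennreal c1 * indicator (V \<rho>) v) \<partial>lborel)"
    by (intro nn_integral_mono) (simp add: nn_integral_multc, subst (2) k_last, intro mult_right_mono, auto)
  also have "\<dots> \<le> ennreal (W x)"
  proof (rule k_minimal)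
    fix x
    have "(\<integral>\<^sup>+z. p x z * (ennreal c1 * indicator (V \<rho>) z + indicator (- M) z * ennreal (W z)) \<partial>lborel)
      = ennreal (c1 * measure (step x) (V \<rho>)) + ennreal (\<integral>z. indicator (- M) z * W z \<partial>step x)"
      unfolding nn_W[symmetric] Pc by (subst nn_integral_add[symmetric]) (auto simp: distrib_left)
    also have "\<dots> \<le> ennreal (W x)"
      using W(4)[of x] int_W_nonneg[of x] \<open>0 \<le> c1\<close>
      by (subst ennreal_plus[symmetric]) (auto intro!: ennreal_leI simp del: ennreal_plus)
    finally show "(\<integral>\<^sup>+z. p x z * (ennreal c1 * indicator (V \<rho>) z + indicator (- M) z * ennreal (W z)) \<partial>lborel) \<le> ennreal (W x)" .
  qed measurable
  also have "\<dots> < \<infinity>" by simp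
  finally show ?thesis .
qed

lemma p_tendsto:
  "u \<longlonglongrightarrow> x \<Longrightarrow> v \<longlonglongrightarrow> y \<Longrightarrow> (\<lambda>i. p (u i) (v i)) \<longlonglongrightarrow> p x y"
  unfolding p_def
  by (intro tendsto_ennrealI continuous_on_tendsto_compose[OF cont_noise] tendsto_diff
      continuous_on_tendsto_compose[OF cont_map]) auto

text \<open>Continuity is obtained in two stages. In \<open>k_last\<close> the endpoint occurs only
  in \<open>p\<close>, so it may move while \<open>x\<close> is fixed; afterwards
  \<open>k_first\<close> lets the starting point move as well, the integrand then being bounded by
  \<open>A\<close> times an envelope of the noise.\<close>

lemma k_tendsto_snd:
  assumes v: "v \<longlonglongrightarrow> y" "\<And>i. v i \<in> B" and y: "y \<in> B"
  shows "(\<lambda>i. k x (v i)) \<longlonglongrightarrow> k x y"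
proof -
  have c1': "0 \<le> c1" using c1_pos y by fastforce
  have "(\<lambda>i. \<integral>\<^sup>+w. k x w * (indicator (- M) w * p w (v i)) \<partial>lborel) \<longlonglongrightarrow> (\<integral>\<^sup>+w. k x w * (indicator (- M) w * p w y) \<partial>lborel)"
  proof (rule nn_integral_dominated_convergence[OF _ _ _ _ potential_finite[OF c1']])
    let ?b = "\<lambda>w. k x w * (indicator (- M) w * ennreal (c1 * measure (step w) (V \<rho>)))"
    have [measurable]: "(\<lambda>w. measure (step w) (V \<rho>)) \<in> borel_measurable borel"
      unfolding measure_def step_def by (subst emeasure_density) measurable
    show "?b \<in> borel_measurable lborel" by measurable
    show "AE w in lborel. k x w * (indicator (- M) w * p w (v i)) \<le> ?b w" for i
      using c1[OF v(2)] unfolding p_def by (intro AE_I2 mult_left_mono ennreal_leI) auto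
    have fin: "AE w in lborel. ?b w \<noteq> \<infinity>"
      by (rule nn_integral_PInf_AE) (use potential_finite[OF c1', of x] in auto)
    show "AE w in lborel. (\<lambda>i. k x w * (indicator (- M) w * p w (v i))) \<longlonglongrightarrow> k x w * (indicator (- M) w * p w y)"
      using fin
    proof eventually_elim
      case (elim w)
      show ?case
      proof (cases "w \<in> M")
        case False
        \<comment> \<open>Multiplication in \<open>ennreal\<close> is not continuous at infinity.
          Since the weight is strictly positive, finiteness almost everywhere of the weighted Green
          density forces \<open>k x w\<close> itself to be finite.\<close>
        have "c1 * measure (step w) (V \<rho>) > 0" using c1[OF y, of w] noise_pos[of "y - \<Phi> w"] by linarith
        then have "ennreal (c1 * measure (step w) (V \<rho>)) \<noteq> 0" unfolding ennreal_eq_0_iff by linarith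
        then have "k x w \<noteq> \<infinity>" using elim False by (auto simp: ennreal_top_mult simp del: ennreal_eq_0_iff)
        then show ?thesis using False by (intro tendsto_mult_ennreal tendsto_const p_tendsto v) (auto simp: p_def)
      qed simp
    qed
  qed measurable
  then have "(\<lambda>i. p x (v i) + (\<integral>\<^sup>+w. k x w * (indicator (- M) w * p w (v i)) \<partial>lborel)) \<longlonglongrightarrow>
     p x y + (\<integral>\<^sup>+w. k x w * (indicator (- M) w * p w y) \<partial>lborel)"
    by (intro tendsto_add p_tendsto v tendsto_const)
  then show ?thesis unfolding k_last[symmetric] .
qed

lemma k_tendsto:
  assumes u: "u \<longlonglongrightarrow> x" and v: "v \<longlonglongrightarrow> y" "\<And>i. v i \<in> B" and y: "y \<in> B"
  shows "(\<lambda>i. k (u i) (v i)) \<longlonglongrightarrow> k x y"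
proof -
  have "bounded (range (\<lambda>i. \<Phi> (u i)))"
    by (rule convergent_imp_bounded) (rule continuous_on_tendsto_compose[OF cont_map u], auto)
  then obtain r where r: "\<And>i. norm (\<Phi> (u i)) \<le> r" unfolding bounded_iff by blast
  obtain G where [measurable]: "G \<in> borel_measurable borel" and G: "(\<integral>\<^sup>+z. G z \<partial>lborel) < \<infinity>"
    "\<And>w z. norm w \<le> r \<Longrightarrow> ennreal (g (z - w)) \<le> G z"
    using noise_dominated[of r] by blast
  have "(\<lambda>i. \<integral>\<^sup>+z. p (u i) z * (indicator (- M) z * k z (v i)) \<partial>lborel) \<longlonglongrightarrow> (\<integral>\<^sup>+z. p x z * (indicator (- M) z * k z y) \<partial>lborel)"
  proof (rule nn_integral_dominated_convergence)
    show "AE z in lborel. p (u i) z * (indicator (- M) z * k z (v i)) \<le> G z * ennreal A" for i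
    proof (rule AE_I2, rule mult_mono)
      fix z
      show "p (u i) z \<le> G z" unfolding p_def by (rule G) (rule r)
      show "indicator (- M) z * k z (v i) \<le> ennreal A" using k_le[OF v(2)] by (auto split: split_indicator)
    qed auto
    show "(\<integral>\<^sup>+z. G z * ennreal A \<partial>lborel) < \<infinity>" using G(1) by (simp add: nn_integral_multc ennreal_mult_less_top)
    show "AE z in lborel. (\<lambda>i. p (u i) z * (indicator (- M) z * k z (v i))) \<longlonglongrightarrow> p x z * (indicator (- M) z * k z y)"
    proof (rule AE_I2)
      fix z
      have "k z y \<noteq> \<infinity>" using k_le[OF y, of z] by (auto simp: top_unique)
      moreover have "p x z \<noteq> \<infinity>" unfolding p_def by simp
      ultimately show "(\<lambda>i. p (u i) z * (indicator (- M) z * k z (v i))) \<longlonglongrightarrow> p x z * (indicator (- M) z * k z y)"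
        by (intro tendsto_mult_ennreal p_tendsto u tendsto_const k_tendsto_snd v y) (auto split: split_indicator)
    qed
  qed measurable
  then have "(\<lambda>i. p (u i) (v i) + (\<integral>\<^sup>+z. p (u i) z * (indicator (- M) z * k z (v i)) \<partial>lborel)) \<longlonglongrightarrow>
     p x y + (\<integral>\<^sup>+z. p x z * (indicator (- M) z * k z y) \<partial>lborel)"
    by (intro tendsto_add p_tendsto u v)
  then show ?thesis unfolding k_first[symmetric] .
qed

lemma kB_mass: "(\<integral>\<^sup>+z. k x z * indicator B z \<partial>lborel) \<le> 1"
proof -
  have "(\<integral>\<^sup>+z. k x z * indicator B z \<partial>lborel) \<le> (\<integral>\<^sup>+z. k x z * indicator M z \<partial>lborel)"
    using B_sub by (intro nn_integral_mono) (auto split: split_indicator)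
  also have "\<dots> \<le> 1" by (rule k_submarkov)
  finally show ?thesis .
qed

lemma kp_le: "y \<in> B \<Longrightarrow> kp B n x y \<le> ennreal A"
proof (induction n arbitrary: x)
  case (Suc n)
  have "kp B (Suc n) x y \<le> (\<integral>\<^sup>+z. k x z * indicator B z * ennreal A \<partial>lborel)"
    unfolding kp.simps mult.assoc[symmetric] by (intro nn_integral_mono mult_left_mono Suc) auto
  also have "\<dots> \<le> 1 * ennreal A"
    by (subst nn_integral_multc) (simp_all add: mult_right_mono[OF kB_mass, of "ennreal A", simplified])
  finally show ?case by simp
qed (simp add: k_le)

text \<open>Intermediate points range over the compact set \<open>B\<close>, where both factors are
  at most \<open>A\<close>, so a constant on \<open>B\<close> is an integrable envelope.\<close>

lemma kp_tendsto:
  assumes "u \<longlonglongrightarrow> x" and v: "v \<longlonglongrightarrow> y" "\<And>i. v i \<in> B" and y: "y \<in> B"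
  shows "(\<lambda>i. kp B n (u i) (v i)) \<longlonglongrightarrow> kp B n x y"
  using assms(1)
proof (induction n arbitrary: u x)
  case 0
  then show ?case using k_tendsto[OF _ v y] by simp
next
  case (Suc n)
  note [measurable] = kp_borel'[OF B_borel]
  show ?case unfolding kp.simps
  proof (rule nn_integral_dominated_convergence)
    show "AE z in lborel. k (u i) z * (indicator B z * kp B n z (v i)) \<le> ennreal A * (ennreal A * indicator B z)" for i
      using k_le kp_le[OF v(2)] by (intro AE_I2) (auto split: split_indicator intro!: mult_mono)
    have "emeasure lborel B < \<infinity>" using B_compact by (rule emeasure_compact_finite)
    then show "(\<integral>\<^sup>+z. ennreal A * (ennreal A * indicator B z) \<partial>lborel) < \<infinity>"
      by (simp add: nn_integral_cmult ennreal_mult_less_top)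
    show "AE z in lborel. (\<lambda>i. k (u i) z * (indicator B z * kp B n z (v i))) \<longlonglongrightarrow> k x z * (indicator B z * kp B n z y)"
    proof (rule AE_I2)
      fix z
      show "(\<lambda>i. k (u i) z * (indicator B z * kp B n z (v i))) \<longlonglongrightarrow> k x z * (indicator B z * kp B n z y)"
      proof (cases "z \<in> B")
        case True
        have "kp B n z y \<noteq> \<infinity>" "k x z \<noteq> \<infinity>" using kp_le[OF y, of n z] k_le[OF True, of x] by (auto simp: top_unique)
        then show ?thesis using True
          by (intro tendsto_mult_ennreal tendsto_const Suc.IH k_tendsto Suc.prems) auto
      qed simp
    qed
  qed measurable
qed

lemma kp_real_continuous: "continuous_on (UNIV \<times> B) (\<lambda>(x, y). enn2real (kp B n x y))"
proof (unfold continuous_on_sequentially, intro allI ballI impI)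
  fix w :: "nat \<Rightarrow> 'a \<times> 'a" and a assume a: "a \<in> UNIV \<times> B" and w: "(\<forall>i. w i \<in> UNIV \<times> B) \<and> w \<longlonglongrightarrow> a"
  have "(\<lambda>i. kp B n (fst (w i)) (snd (w i))) \<longlonglongrightarrow> kp B n (fst a) (snd a)"
    using w a by (intro kp_tendsto tendsto_fst tendsto_snd) (auto simp: mem_Times_iff)
  moreover have "kp B n (fst a) (snd a) < top" using kp_le[of "snd a" n "fst a"] a
    by (auto simp: mem_Times_iff intro: le_less_trans[OF _ ennreal_less_top])
  ultimately have "(\<lambda>i. enn2real (kp B n (fst (w i)) (snd (w i)))) \<longlonglongrightarrow> enn2real (kp B n (fst a) (snd a))"
    by (intro tendsto_enn2real) auto
  then show "((\<lambda>(x, y). enn2real (kp B n x y)) \<circ> w) \<longlonglongrightarrow> (case a of (x, y) \<Rightarrow> enn2real (kp B n x y))"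
    by (simp add: comp_def case_prod_beta)
qed

end

section \<open>The killed trace as an operator\<close>

definition K :: "('a \<Rightarrow> real) \<Rightarrow> 'a \<Rightarrow> real" where
  "K h x = enn2real (\<integral>\<^sup>+y. k x y * (indicator B y * ennreal (h y)) \<partial>lborel)"

text \<open>The worth of landing at \<open>z\<close>: the payoff \<open>h\<close> on
  \<open>B\<close>, nothing on the rest of \<open>M\<close> where the process is killed, and the
  continuation value \<open>K h\<close> while the excursion goes on.\<close>

definition ext :: "('a \<Rightarrow> real) \<Rightarrow> 'a \<Rightarrow> real" where
  "ext h z = (if z \<in> B then h z else if z \<in> M then 0 else K h z)"

definition adm :: "real \<Rightarrow> ('a \<Rightarrow> real) \<Rightarrow> bool" where
  "adm H h \<longleftrightarrow> h \<in> borel_measurable borel \<and> 0 \<le> H \<and> (\<forall>y\<in>B. 0 \<le> h y \<and> h y \<le> H)"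

lemma K_nonneg: "0 \<le> K h x"
  unfolding K_def by simp

lemma nn_K_le:
  assumes "adm H h"
  shows "(\<integral>\<^sup>+y. k x y * (indicator B y * ennreal (h y)) \<partial>lborel) \<le> ennreal H"
proof -
  have "(\<integral>\<^sup>+y. k x y * (indicator B y * ennreal (h y)) \<partial>lborel) \<le> (\<integral>\<^sup>+y. k x y * indicator M y * ennreal H \<partial>lborel)"
    using assms B_sub unfolding adm_def
    by (intro nn_integral_mono) (auto split: split_indicator intro!: mult_left_mono ennreal_leI)
  also have "\<dots> \<le> 1 * ennreal H"
    by (subst nn_integral_multc) (simp_all add: mult_right_mono[OF k_submarkov, of "ennreal H", simplified])
  finally show ?thesis by simp
qed

lemma ennreal_K:
  assumes "adm H h"
  shows "ennreal (K h x) = (\<integral>\<^sup>+y. k x y * (indicator B y * ennreal (h y)) \<partial>lborel)"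
  unfolding K_def using nn_K_le[OF assms, of x] by (intro ennreal_enn2real le_less_trans[OF _ ennreal_less_top])

lemma K_le: "adm H h \<Longrightarrow> K h x \<le> H"
  using nn_K_le[of H h x] ennreal_le_iff[of H "K h x"] ennreal_K[of H h x] by (simp add: adm_def)

lemma K_borel:
  assumes "adm H h"
  shows "K h \<in> borel_measurable borel"
proof -
  have [measurable]: "h \<in> borel_measurable borel" using assms by (simp add: adm_def)
  show ?thesis unfolding K_def by measurable
qed

lemma ext_borel:
  assumes "adm H h"
  shows "ext h \<in> borel_measurable borel"
proof -
  have [measurable]: "h \<in> borel_measurable borel" "K h \<in> borel_measurable borel"
    using assms K_borel by (auto simp: adm_def)
  show ?thesis unfolding ext_def by measurable
qed

lemma ext_bounds: "adm H h \<Longrightarrow> 0 \<le> ext h z" "adm H h \<Longrightarrow> ext h z \<le> H"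
  using K_nonneg K_le unfolding ext_def adm_def by auto

text \<open>The first-step equation read as an expectation over one step of the chain. It transfers
  estimates on single steps to the trace, whose own steps are excursions.\<close>

lemma K_step:
  assumes "adm H h"
  shows "K h x = (\<integral>z. ext h z \<partial>step x)"
proof -
  have [measurable]: "h \<in> borel_measurable borel" "K h \<in> borel_measurable borel"
    using assms K_borel by (auto simp: adm_def)
  have "ennreal (K h x) = (\<integral>\<^sup>+z. p x z * (indicator B z * ennreal (h z) + indicator (- M) z * ennreal (K h z)) \<partial>lborel)"
    unfolding ennreal_K[OF assms] by (rule k_first_integral) measurable
  also have "\<dots> = (\<integral>\<^sup>+z. p x z * ennreal (ext h z) \<partial>lborel)"
    using B_sub by (intro nn_integral_cong) (auto simp: ext_def split: split_indicator)
  also have "\<dots> = ennreal (\<integral>z. ext h z \<partial>step x)"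
    using ext_borel[OF assms] ext_bounds[OF assms] by (rule ennreal_expectation)
  finally show ?thesis
    using K_nonneg[of h x] ext_bounds(1)[OF assms] by (simp add: integral_nonneg_AE)
qed

lemma K_mono:
  assumes "adm H h" "adm H' h'" and "\<And>y. y \<in> B \<Longrightarrow> h y \<le> h' y"
  shows "K h x \<le> K h' x"
proof -
  have "ennreal (K h x) \<le> ennreal (K h' x)"
    unfolding ennreal_K[OF assms(1)] ennreal_K[OF assms(2)] 
    by (intro nn_integral_mono) (auto split: split_indicator intro!: mult_left_mono ennreal_leI assms(3))
  then show ?thesis using K_nonneg by simp
qed

lemma K_cmult:
  assumes "adm H h" "0 \<le> a"
  shows "K (\<lambda>y. a * h y) x = a * K h x"
proof -
  have [measurable]: "h \<in> borel_measurable borel" using assms by (simp add: adm_def)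
  have "adm (a * H) (\<lambda>y. a * h y)" using assms by (auto simp: adm_def intro!: mult_left_mono)
  then have "ennreal (K (\<lambda>y. a * h y) x) = (\<integral>\<^sup>+y. k x y * (indicator B y * ennreal (a * h y)) \<partial>lborel)"
    by (rule ennreal_K)
  also have "\<dots> = (\<integral>\<^sup>+y. ennreal a * (k x y * (indicator B y * ennreal (h y))) \<partial>lborel)"
    using assms by (intro nn_integral_cong) (auto simp: adm_def ennreal_mult mult_ac split: split_indicator)
  also have "\<dots> = ennreal a * ennreal (K h x)"
    unfolding ennreal_K[OF assms(1)] by (rule nn_integral_cmult) measurable
  finally have "ennreal (K (\<lambda>y. a * h y) x) = ennreal (a * K h x)"
    using assms K_nonneg by (simp add: ennreal_mult)
  then show ?thesis using assms K_nonneg by simp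
qed

lemma integral_B_step:
  assumes "adm H h"
  shows "integrable (step x) (\<lambda>z. indicator B z * h z)" "0 \<le> (\<integral>z. indicator B z * h z \<partial>step x)"
  using assms
  by (auto simp: adm_def split: split_indicator intro!: integrable_step[where b=H] integral_nonneg_AE)

lemma mass_B:
  assumes "adm H h"
  shows "integrable lborel (\<lambda>y. indicator B y * h y)" "0 \<le> (\<integral>y. indicator B y * h y \<partial>lborel)"
proof -
  have [measurable]: "h \<in> borel_measurable borel" using assms by (simp add: adm_def)
  have "integrable lborel (\<lambda>y. indicator B y * H)"
    using B_compact emeasure_compact_finite by (intro integrable_mult_left integrable_real_indicator) auto
  then show "integrable lborel (\<lambda>y. indicator B y * h y)"
    by (rule Bochner_Integration.integrable_bound) (use assms in \<open>auto simp: adm_def split: split_indicator\<close>)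
  show "0 \<le> (\<integral>y. indicator B y * h y \<partial>lborel)"
    by (rule integral_nonneg_AE) (use assms in \<open>auto simp: adm_def split: split_indicator\<close>)
qed

lemma integral_B_step_eq:
  assumes "adm H h"
  shows "(\<integral>z. indicator B z * h z \<partial>step x) = (\<integral>y. g (y - \<Phi> x) * (indicator B y * h y) \<partial>lborel)"
proof -
  have [measurable]: "h \<in> borel_measurable borel" using assms by (simp add: adm_def)
  show ?thesis unfolding step_def p_def
    using noise_pos by (subst integral_density) (auto intro: less_imp_le)
qed

lemma integral_B_step_integrable:
  assumes "adm H h"
  shows "integrable lborel (\<lambda>y. g (y - \<Phi> x) * (indicator B y * h y))"
proof -
  have [measurable]: "h \<in> borel_measurable borel" using assms by (simp add: adm_def)
  have "integrable (density lborel (\<lambda>z. ennreal (g (z - \<Phi> x)))) (\<lambda>z. indicator B z * h z)"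
    using integral_B_step(1)[OF assms, of x] unfolding step_def p_def .
  then show ?thesis
    using noise_pos by (subst (asm) integrable_density) (auto intro: less_imp_le)
qed

lemma integral_B_step_le:
  assumes "adm H h" and b: "\<And>y. y \<in> B \<Longrightarrow> g (y - \<Phi> x) \<le> b"
  shows "(\<integral>z. indicator B z * h z \<partial>step x) \<le> b * (\<integral>y. indicator B y * h y \<partial>lborel)"
proof -
  have "(\<integral>y. g (y - \<Phi> x) * (indicator B y * h y) \<partial>lborel) \<le> (\<integral>y. b * (indicator B y * h y) \<partial>lborel)"
    using integral_B_step_integrable[OF assms(1)] mass_B[OF assms(1)] assms
    by (intro integral_mono) (auto simp: adm_def split: split_indicator intro!: mult_right_mono)
  then show ?thesis unfolding integral_B_step_eq[OF assms(1)] by simp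
qed

lemma integral_B_step_ge:
  assumes "adm H h" and b: "\<And>y. y \<in> B \<Longrightarrow> b \<le> g (y - \<Phi> x)"
  shows "b * (\<integral>y. indicator B y * h y \<partial>lborel) \<le> (\<integral>z. indicator B z * h z \<partial>step x)"
proof -
  have "(\<integral>y. b * (indicator B y * h y) \<partial>lborel) \<le> (\<integral>y. g (y - \<Phi> x) * (indicator B y * h y) \<partial>lborel)"
    using integral_B_step_integrable[OF assms(1)] mass_B[OF assms(1)] assms
    by (intro integral_mono) (auto simp: adm_def split: split_indicator intro!: mult_right_mono)
  then show ?thesis unfolding integral_B_step_eq[OF assms(1)] by simp
qed

text \<open>A maximum principle that carries a bound from \<open>V \<rho>\<close> to the whole
  space. A direct jump into \<open>B\<close> earns at most \<open>c1 * S\<close> times the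
  probability of entering \<open>V \<rho>\<close>, which is the share of the surplus
  \<open>c1 * S\<close> given up by entering \<open>V \<rho>\<close>.\<close>

lemma K_le_sup_V:
  assumes h: "adm H h" and c1: "\<And>x y. y \<in> B \<Longrightarrow> g (y - \<Phi> x) \<le> c1 * measure (step x) (V \<rho>)"
    and m: "\<And>x. x \<in> V \<rho> \<Longrightarrow> K h x \<le> m" "0 \<le> m" and "0 \<le> c1"
  shows "K h x \<le> m + c1 * (\<integral>y. indicator B y * h y \<partial>lborel)"
proof -
  define S where "S = (\<integral>y. indicator B y * h y \<partial>lborel)"
  have S0: "0 \<le> S" unfolding S_def using mass_B(2)[OF h] .
  \<comment> \<open>The truncation by \<open>K h\<close>, itself a solution, makes \<open>W\<close>
    at most \<open>m\<close> on \<open>V \<rho>\<close>, while off it \<open>W\<close> is at most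
    \<open>m + c1 * S\<close>.\<close>
  define W where "W x = min (K h x) (m + c1 * S)" for x
  have [measurable]: "h \<in> borel_measurable borel" "K h \<in> borel_measurable borel"
    using h K_borel by (auto simp: adm_def)
  have [measurable]: "W \<in> borel_measurable borel" unfolding W_def by measurable
  have W0: "0 \<le> W x" for x unfolding W_def using K_nonneg m(2) S0 \<open>0 \<le> c1\<close> by simp
  have "ennreal (K h x) \<le> ennreal (W x)" for x
    unfolding ennreal_K[OF h]
  proof (rule k_minimal)
    fix x
    interpret S: prob_space "step x" by (rule prob_step)
    let ?e = "\<lambda>z. indicator B z * h z + indicator (- M) z * W z"
    have e0: "0 \<le> ?e z" for z using h W0[of z] by (auto simp: adm_def split: split_indicator)
    have e_ext: "?e z \<le> ext h z" for z
      using B_sub K_nonneg[of h z] by (auto simp: ext_def W_def split: split_indicator)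
    have e_borel [measurable]: "?e \<in> borel_measurable borel" by measurable
    have ie: "integrable (step x) ?e"
      by (rule integrable_step[where b=H, OF e_borel e0]) (use e_ext ext_bounds(2)[OF h] order_trans in blast)
    have iext: "integrable (step x) (ext h)"
      using ext_borel[OF h] ext_bounds[OF h] by (rule integrable_step)
    have 1: "(\<integral>z. ?e z \<partial>step x) \<le> K h x"
      unfolding K_step[OF h] by (rule integral_mono[OF ie iext e_ext])
    have "(\<integral>z. ?e z \<partial>step x) \<le> (\<integral>z. indicator B z * h z + (m + c1 * S * (1 - indicator (V \<rho>) z)) \<partial>step x)"
    proof (rule integral_mono[OF ie])
      show "integrable (step x) (\<lambda>z. indicator B z * h z + (m + c1 * S * (1 - indicator (V \<rho>) z)))"
        by (intro Bochner_Integration.integrable_add integral_B_step[OF h] integrable_mult_right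
          Bochner_Integration.integrable_diff integrable_real_indicator) (auto simp: S.emeasure_eq_measure)
      fix z
      have "0 \<le> c1 * S" using S0 \<open>0 \<le> c1\<close> by simp
      then show "?e z \<le> indicator B z * h z + (m + c1 * S * (1 - indicator (V \<rho>) z))"
        using m(1)[of z] m(2) by (auto simp: W_def min.coboundedI1 split: split_indicator)
    qed
    also have "\<dots> = (\<integral>z. indicator B z * h z \<partial>step x) + (m + c1 * S * (1 - measure (step x) (V \<rho>)))"
      using integral_B_step(1)[OF h, of x]
      by (subst Bochner_Integration.integral_add) (auto simp: S.prob_space[simplified] S.emeasure_eq_measure)
    also have "\<dots> \<le> c1 * measure (step x) (V \<rho>) * S + (m + c1 * S * (1 - measure (step x) (V \<rho>)))"
      unfolding S_def using integral_B_step_le[OF h c1] by simp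
    also have "\<dots> = m + c1 * S" by (simp add: algebra_simps)
    finally have 2: "(\<integral>z. ?e z \<partial>step x) \<le> m + c1 * S" .
    have "(\<integral>\<^sup>+z. p x z * (indicator B z * ennreal (h z) + indicator (- M) z * ennreal (W z)) \<partial>lborel) =
       (\<integral>\<^sup>+z. p x z * ennreal (?e z) \<partial>lborel)"
      using B_sub by (intro nn_integral_cong) (auto split: split_indicator)
    also have "\<dots> = ennreal (\<integral>z. ?e z \<partial>step x)"
      by (rule ennreal_expectation[where b=H, OF e_borel e0]) (use e_ext ext_bounds(2)[OF h] order_trans in blast)
    also have "\<dots> \<le> ennreal (W x)"
      using 1 2 W_def[of x] by (intro ennreal_leI) simp
    finally show "(\<integral>\<^sup>+z. p x z * (indicator B z * ennreal (h z) + indicator (- M) z * ennreal (W z)) \<partial>lborel) \<le> ennreal (W x)" .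
  qed measurable
  then have "K h x \<le> W x" using W0 by simp
  then show ?thesis unfolding W_def S_def by simp
qed

section \<open>Approximate eigenfunctions\<close>

lemma tail_nonneg: "0 \<le> tail t" and tail_le_1: "tail t \<le> 1"
  using prob_space.prob_le_1[OF prob_noise] unfolding tail_def by auto

lemma tail_antimono: "s \<le> t \<Longrightarrow> tail t \<le> tail s"
proof -
  assume "s \<le> t"
  interpret \<nu>: prob_space "density lborel (\<lambda>v. ennreal (g v))" by (rule prob_noise)
  show ?thesis unfolding tail_def
    using \<open>s \<le> t\<close> by (intro \<nu>.finite_measure_mono) auto
qed

lemma stay_same:
  assumes "x \<in> V r" "r \<le> \<rho>"
  shows "measure (step x) (V r) \<ge> 1 - tail ((1 - \<kappa>) * r)"
  by (rule stay[OF assms]) (simp add: algebra_simps)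

lemma leave:
  assumes "x \<in> V r" "r \<le> \<rho>"
  shows "measure (step x) (- V r) \<le> tail ((1 - \<kappa>) * r)"
proof -
  interpret prob_space "step x" by (rule prob_step)
  have "measure (step x) (- V r) = 1 - measure (step x) (V r)"
    using prob_compl[of "V r"] by (simp add: Compl_eq_Diff_UNIV)
  then show ?thesis using stay_same[OF assms] by linarith
qed

lemma integral_indicator_step_le:
  assumes [measurable]: "f \<in> borel_measurable borel" "A \<in> sets borel"
    and f: "\<And>z. 0 \<le> f z" "\<And>z. f z \<le> b" and m: "\<And>z. z \<in> A \<Longrightarrow> f z \<le> m"
  shows "(\<integral>z. indicator A z * f z \<partial>step x) \<le> m * measure (step x) A"
proof -
  interpret prob_space "step x" by (rule prob_step)
  have "0 \<le> b" using f[of undefined] by linarith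
  have "(\<integral>z. indicator A z * f z \<partial>step x) \<le> (\<integral>z. m * indicator A z \<partial>step x)"
  proof (rule integral_mono)
    show "integrable (step x) (\<lambda>z. indicator A z * f z)"
      by (rule integrable_step[where b=b]) (use f \<open>0 \<le> b\<close> in \<open>auto split: split_indicator\<close>)
  qed (use m in \<open>auto simp: emeasure_eq_measure split: split_indicator\<close>)
  then show ?thesis by simp
qed

text \<open>Two copies of the chain driven by the same noise approach each other at rate \<open>\<kappa>\<close> as long
  as they stay in \<open>V R\<close>, so the modulus of log-continuity of \<open>F\<close> contracts at that rate.\<close>

lemma coupling:
  fixes F :: "nat \<Rightarrow> 'a \<Rightarrow> real"
  assumes R: "R \<le> \<rho>"
    and F_borel [measurable]: "\<And>k. F k \<in> borel_measurable borel"
    and F: "\<And>k x. 0 \<le> F k x" "\<And>k x. F k x \<le> b" and m: "\<And>k x. x \<in> V R \<Longrightarrow> F k x \<le> m"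
    and upper: "\<And>k x. x \<in> V R \<Longrightarrow> F (Suc k) x \<le> (\<integral>z. indicator (V R) z * F k z \<partial>step x) + E"
    and lower: "\<And>k x. x \<in> V R \<Longrightarrow> (\<integral>z. indicator (V R) z * F k z \<partial>step x) \<le> (1 + \<epsilon>) * F (Suc k) x"
    and \<epsilon>: "0 \<le> \<epsilon>" and E: "0 \<le> E" and e0: "tail ((1 - \<kappa>) * R) \<le> e0" and "0 \<le> m"
    and \<Lambda>: "\<And>x x' z. x \<in> V R \<Longrightarrow> x' \<in> V R \<Longrightarrow> z \<in> V R \<Longrightarrow> g (z - \<Phi> x) \<le> exp (\<Lambda> * N (x - x')) * g (z - \<Phi> x')"
    and "0 \<le> \<Lambda>" and x: "x \<in> V R" "x' \<in> V R"
  shows "F (Suc n) x \<le> (1 + \<epsilon>) ^ Suc n * exp (\<Lambda> * \<kappa> ^ n * N (x - x')) * F (Suc n) x' + real (Suc n) * (E + e0 * m)"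
  using x
proof (induction n arbitrary: x x')
  let ?\<nu> = "density lborel (\<lambda>v. ennreal (g v))"
  interpret \<nu>: prob_space ?\<nu> by (rule prob_noise)
  have e00: "0 \<le> e0" using tail_nonneg e0 order_trans by blast
  have b0: "0 \<le> b" using F[of 0 c] by linarith
  {
    case 0
    \<comment> \<open>A single step regularises: whatever \<open>F 0\<close> is, its mean inherits
      the log-Lipschitz constant \<Lambda> of the noise density. The later steps only contract the
      distance.\<close>
    have lip: "(\<integral>z. indicator (V R) z * F 0 z \<partial>step x) \<le> exp (\<Lambda> * N (x - x')) * (\<integral>z. indicator (V R) z * F 0 z \<partial>step x')"
    proof -
      have eq: "(\<integral>z. indicator (V R) z * F 0 z \<partial>step x) = (\<integral>z. g (z - \<Phi> x) * (indicator (V R) z * F 0 z) \<partial>lborel)" for x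
        unfolding step_def p_def using noise_pos by (subst integral_density) (auto intro: less_imp_le)
      have int: "integrable lborel (\<lambda>z. g (z - \<Phi> x) * (indicator (V R) z * F 0 z))" for x
      proof -
        have "integrable (step x) (\<lambda>z. indicator (V R) z * F 0 z)"
          by (rule integrable_step[where b=b]) (use F b0 in \<open>auto split: split_indicator\<close>)
        then show ?thesis unfolding step_def p_def
          using noise_pos by (subst (asm) integrable_density) (auto intro: less_imp_le)
      qed
      have "(\<integral>z. g (z - \<Phi> x) * (indicator (V R) z * F 0 z) \<partial>lborel) \<le>
         (\<integral>z. exp (\<Lambda> * N (x - x')) * (g (z - \<Phi> x') * (indicator (V R) z * F 0 z)) \<partial>lborel)"
      proof (rule integral_mono[OF int integrable_mult_right[OF int]])
        fix z
        show "g (z - \<Phi> x) * (indicator (V R) z * F 0 z) \<le> exp (\<Lambda> * N (x - x')) * (g (z - \<Phi> x') * (indicator (V R) z * F 0 z))"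
          using mult_right_mono[OF \<Lambda>[OF 0, of z] F(1)[of 0 z]]
          by (auto simp: mult.assoc split: split_indicator)
      qed
      then show ?thesis unfolding eq by simp
    qed
    have "F (Suc 0) x \<le> exp (\<Lambda> * N (x - x')) * (\<integral>z. indicator (V R) z * F 0 z \<partial>step x') + E"
      using upper[OF 0(1), of 0] lip by linarith
    also have "\<dots> \<le> exp (\<Lambda> * N (x - x')) * ((1 + \<epsilon>) * F (Suc 0) x') + E"
      using lower[OF 0(2), of 0] by simp
    also have "\<dots> \<le> exp (\<Lambda> * N (x - x')) * ((1 + \<epsilon>) * F (Suc 0) x') + (E + e0 * m)"
      using e00 \<open>0 \<le> m\<close> by simp
    finally show ?case by (simp add: mult_ac)
  next
    case (Suc n)
    \<comment> \<open>The noises that keep both copies in \<open>V R\<close>, because the map sends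
      \<open>V R\<close> into \<open>V (\<kappa> * R)\<close>. Larger noises cost
      \<open>e0 * m\<close> per step.\<close>
    let ?G = "{v. N v \<le> (1 - \<kappa>) * R}"
    let ?C = "(1 + \<epsilon>) ^ Suc n * exp (\<Lambda> * \<kappa> ^ Suc n * N (x - x'))"
    let ?F = "F (Suc n)"
    have C0: "0 \<le> ?C" using \<epsilon> by simp
    have good: "\<Phi> y + v \<in> V R" if "y \<in> V R" "v \<in> ?G" for y v
    proof -
      have "N (\<Phi> y - c) \<le> \<kappa> * N (y - c)"
        using contraction[of y c] fixed that R N_0 \<rho> by (simp add: V_def)
      also have "\<dots> \<le> \<kappa> * R" using that \<kappa> by (simp add: V_def)
      finally show ?thesis using N_triangle[of "\<Phi> y - c" v] that
        by (simp add: V_def algebra_simps)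
    qed
    have "indicator (V R) \<in> borel_measurable borel" by measurable
    note [measurable] = this
    have int: "integrable ?\<nu> (\<lambda>v. indicator ?G v * ?F (\<Phi> y + v))" for y
      by (rule \<nu>.integrable_const_bound[where B=b]) (use F b0 in \<open>auto split: split_indicator\<close>)
    have intV: "integrable ?\<nu> (\<lambda>v. indicator (V R) (\<Phi> y + v) * ?F (\<Phi> y + v))" for y
      by (rule \<nu>.integrable_const_bound[where B=b]) (use F b0 in \<open>auto split: split_indicator\<close>)
    have intG: "integrable ?\<nu> (\<lambda>v. indicator (- ?G) v * m)"
      using \<open>0 \<le> m\<close> by (intro \<nu>.integrable_const_bound[where B=m]) (auto split: split_indicator)
    have step_eq: "(\<integral>z. indicator (V R) z * ?F z \<partial>step y) = (\<integral>v. indicator (V R) (\<Phi> y + v) * ?F (\<Phi> y + v) \<partial>?\<nu>)" for y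
      by (rule integral_step) measurable
    have "(\<integral>z. indicator (V R) z * ?F z \<partial>step x) \<le> (\<integral>v. indicator ?G v * ?F (\<Phi> x + v) + indicator (- ?G) v * m \<partial>?\<nu>)"
      unfolding step_eq
      by (rule integral_mono[OF intV Bochner_Integration.integrable_add[OF int intG]])
        (use m F \<open>0 \<le> m\<close> good[OF Suc.prems(1)] in \<open>auto split: split_indicator\<close>)
    also have "\<dots> = (\<integral>v. indicator ?G v * ?F (\<Phi> x + v) \<partial>?\<nu>) + measure ?\<nu> (- ?G) * m"
      by (subst Bochner_Integration.integral_add[OF int intG]) simp
    also have "- ?G = {v. N v > (1 - \<kappa>) * R}" by auto
    also have "measure ?\<nu> \<dots> \<le> e0" using e0 unfolding tail_def .
    finally have 1: "(\<integral>z. indicator (V R) z * ?F z \<partial>step x) \<le> (\<integral>v. indicator ?G v * ?F (\<Phi> x + v) \<partial>?\<nu>) + e0 * m"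
      using \<open>0 \<le> m\<close> by (simp add: mult_right_mono)
    have N': "N (\<Phi> x + v - (\<Phi> x' + v)) \<le> \<kappa> * N (x - x')" for v
      using contraction[of x x'] Suc.prems R by (simp add: V_def)
    have "(\<integral>v. indicator ?G v * ?F (\<Phi> x + v) \<partial>?\<nu>) \<le>
       (\<integral>v. ?C * (indicator (V R) (\<Phi> x' + v) * ?F (\<Phi> x' + v)) + real (Suc n) * (E + e0 * m) \<partial>?\<nu>)"
    proof (rule integral_mono[OF int])
      show "integrable ?\<nu> (\<lambda>v. ?C * (indicator (V R) (\<Phi> x' + v) * ?F (\<Phi> x' + v)) + real (Suc n) * (E + e0 * m))"
        by (intro Bochner_Integration.integrable_add integrable_mult_right intV \<nu>.integrable_const)
      fix v
      show "indicator ?G v * ?F (\<Phi> x + v) \<le> ?C * (indicator (V R) (\<Phi> x' + v) * ?F (\<Phi> x' + v)) + real (Suc n) * (E + e0 * m)"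
      proof (cases "v \<in> ?G")
        case True
        have "?F (\<Phi> x + v) \<le> (1 + \<epsilon>) ^ Suc n * exp (\<Lambda> * \<kappa> ^ n * N (\<Phi> x + v - (\<Phi> x' + v))) * ?F (\<Phi> x' + v) + real (Suc n) * (E + e0 * m)"
          by (rule Suc.IH) (use good True Suc.prems in auto)
        also have "(1 + \<epsilon>) ^ Suc n * exp (\<Lambda> * \<kappa> ^ n * N (\<Phi> x + v - (\<Phi> x' + v))) * ?F (\<Phi> x' + v) \<le> ?C * ?F (\<Phi> x' + v)"
        proof (intro mult_right_mono mult_left_mono)
          have "\<Lambda> * \<kappa> ^ n * N (\<Phi> x + v - (\<Phi> x' + v)) \<le> \<Lambda> * \<kappa> ^ n * (\<kappa> * N (x - x'))"
            using \<open>0 \<le> \<Lambda>\<close> \<kappa> by (intro mult_left_mono N') auto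
          then show "exp (\<Lambda> * \<kappa> ^ n * N (\<Phi> x + v - (\<Phi> x' + v))) \<le> exp (\<Lambda> * \<kappa> ^ Suc n * N (x - x'))"
            by (simp add: mult_ac)
        qed (use F \<epsilon> in auto)
        finally show ?thesis using True good[OF Suc.prems(2) True] by simp
      next
        case False
        have "0 \<le> ?C * (indicator (V R) (\<Phi> x' + v) * ?F (\<Phi> x' + v))"
          by (intro mult_nonneg_nonneg C0 F) auto
        moreover have "0 \<le> real (Suc n) * (E + e0 * m)" using E e00 \<open>0 \<le> m\<close> by simp
        ultimately show ?thesis using False by simp
      qed
    qed
    also have "\<dots> = ?C * (\<integral>z. indicator (V R) z * ?F z \<partial>step x') + real (Suc n) * (E + e0 * m)"
      unfolding step_eq using intV by (subst Bochner_Integration.integral_add) (simp_all add: \<nu>.prob_space[simplified])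
    also have "\<dots> \<le> ?C * ((1 + \<epsilon>) * F (Suc (Suc n)) x') + real (Suc n) * (E + e0 * m)"
      using lower[OF Suc.prems(2), of "Suc n"] C0 by (intro add_right_mono mult_left_mono)
    finally have 2: "(\<integral>v. indicator ?G v * ?F (\<Phi> x + v) \<partial>?\<nu>) \<le> ?C * ((1 + \<epsilon>) * F (Suc (Suc n)) x') + real (Suc n) * (E + e0 * m)" .
    have "F (Suc (Suc n)) x \<le> ?C * ((1 + \<epsilon>) * F (Suc (Suc n)) x') + real (Suc n) * (E + e0 * m) + e0 * m + E"
      using upper[OF Suc.prems(1), of "Suc n"] 1 2 by linarith
    then show ?case by (simp add: algebra_simps)
  }
qed

text \<open>Lower bound for \<open>F = P u\<close>: \<open>m = inf F\<close> on \<open>V \<rho>\<close> cannot be much below the average of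
  \<open>u\<close> on \<open>B\<close>, because leaving \<open>V \<rho>\<close> (probability \<open>e0\<close>) is rarer than hitting \<open>B\<close>.\<close>

lemma inf_bound:
  fixes s :: "nat \<Rightarrow> real" and u :: "'a \<Rightarrow> real"
  assumes s0: "s 0 = \<rho>" and s_step: "\<And>l. l < J \<Longrightarrow> \<kappa> * s l + t \<le> s (Suc l)"
    and s_dec: "decseq s" and t: "tail t \<le> 1/2"
    and e0: "tail ((1 - \<kappa>) * \<rho>) \<le> e0" "e0 \<le> 1 / 2"
    and b0: "0 < b0" "\<And>x y. x \<in> V (s J) \<Longrightarrow> y \<in> B \<Longrightarrow> b0 \<le> g (y - \<Phi> x)"
    and [measurable]: "u \<in> borel_measurable borel" and u: "\<And>z. 0 \<le> u z" "\<And>z. u z \<le> H"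
    and uF: "\<And>x. x \<in> V \<rho> \<Longrightarrow> (1 - e0) * (\<integral>z. u z \<partial>step x) \<le> u x"
    and m: "\<And>x. x \<in> V \<rho> \<Longrightarrow> m \<le> (\<integral>z. u z \<partial>step x)" "0 \<le> m"
    and m_inf: "\<And>m'. (\<And>x. x \<in> V \<rho> \<Longrightarrow> m' \<le> (\<integral>z. u z \<partial>step x)) \<Longrightarrow> m' \<le> m"
  shows "b0 * ((\<integral>y. indicator B y * u y \<partial>lborel) - m * measure lborel B) \<le> 8 * 4 ^ J * e0 * m"
proof -
  define F where "F x = (\<integral>z. u z \<partial>step x)" for x
  define S where "S = (\<integral>y. indicator B y * u y \<partial>lborel)"
  \<comment> \<open>The gain over \<open>m\<close> after a step from the core: it hits
    \<open>B\<close> with density at least \<open>b0\<close> and finds there the excess of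
    \<open>u\<close> over \<open>m\<close>. The subtracted \<open>2 * e0 * m\<close> accounts for
    two factors \<open>1 - e0\<close>.\<close>
  define g0 where "g0 = b0 * (S - m * measure lborel B) - 2 * e0 * m"
  have e00: "0 \<le> e0" using tail_nonneg e0 order_trans by blast
  have H0: "0 \<le> H" using u[of c] by linarith
  have s_le: "s l \<le> \<rho>" for l using s0 decseqD[OF s_dec, of 0 l] by simp
  have u_ge: "(1 - e0) * m \<le> u x" if "x \<in> V \<rho>" for x
    using uF[OF that] mult_left_mono[OF m(1)[OF that], of "1 - e0"] e0 by linarith
  have iu: "integrable (step x) u" for x by (rule integrable_step[where b=H]) (use u in auto)
  have stayV: "1 - e0 \<le> measure (step x) (V \<rho>)" if "x \<in> V (s l)" for x l
  proof -
    have "x \<in> V \<rho>" using that s_le[of l] by (auto simp: V_def)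
    then show ?thesis using stay_same[of x \<rho>] e0 by linarith
  qed
  have core: "m + g0 \<le> F w" if w: "w \<in> V (s J)" for w
  proof -
    interpret S: prob_space "step w" by (rule prob_step)
    let ?d = "\<lambda>y. u y - (1 - e0) * m"
    have adm: "adm H (\<lambda>y. max 0 (?d y))"
    proof -
      have "?d y \<le> H" for y
        using u(2)[of y] mult_nonneg_nonneg[of "1 - e0" m] e0(2) m(2) by linarith
      then show ?thesis unfolding adm_def using H0 by auto
    qed
    have dB: "indicator B y * max 0 (?d y) = indicator B y * ?d y" for y
      using u_ge[of y] B_sub_V by (auto split: split_indicator)
    have "integrable lborel (\<lambda>y. indicator B y * ((1 - e0) * m))"
      using B_compact emeasure_compact_finite by (intro integrable_mult_left integrable_real_indicator) auto
    moreover have "integrable lborel (\<lambda>y. indicator B y * u y)"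
      by (rule mass_B[of H]) (use u H0 in \<open>auto simp: adm_def\<close>)
    ultimately have "(\<integral>y. indicator B y * ?d y \<partial>lborel) = S - (1 - e0) * m * measure lborel B"
      unfolding S_def by (simp add: right_diff_distrib)
    then have "b0 * (S - (1 - e0) * m * measure lborel B) = b0 * (\<integral>y. indicator B y * max 0 (?d y) \<partial>lborel)"
      unfolding dB by simp
    also have "\<dots> \<le> (\<integral>z. indicator B z * max 0 (?d z) \<partial>step w)"
      by (rule integral_B_step_ge[OF adm b0(2)[OF w]])
    finally have 1: "b0 * (S - (1 - e0) * m * measure lborel B) \<le> (\<integral>z. indicator B z * ?d z \<partial>step w)"
      unfolding dB .
    have iB: "integrable (step w) (\<lambda>z. indicator B z * ?d z)"
      using integral_B_step(1)[OF adm, of w] unfolding dB .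
    have "(1 - e0) * m * measure (step w) (V \<rho>) + (\<integral>z. indicator B z * ?d z \<partial>step w)
       = (\<integral>z. (1 - e0) * m * indicator (V \<rho>) z + indicator B z * ?d z \<partial>step w)"
      using iB by (subst Bochner_Integration.integral_add) (simp_all add: S.emeasure_eq_measure)
    also have "\<dots> \<le> F w"
      unfolding F_def
    proof (rule integral_mono[OF _ iu])
      show "integrable (step w) (\<lambda>z. (1 - e0) * m * indicator (V \<rho>) z + indicator B z * ?d z)"
        using iB by (intro Bochner_Integration.integrable_add) (simp_all add: S.emeasure_eq_measure)
      show "(1 - e0) * m * indicator (V \<rho>) z + indicator B z * ?d z \<le> u z" for z
        using u_ge[of z] u(1)[of z] B_sub_V by (auto split: split_indicator)
    qed
    finally have 2: "(1 - e0) * m * measure (step w) (V \<rho>) + (\<integral>z. indicator B z * ?d z \<partial>step w) \<le> F w" .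
    have "(1 - e0) * m * (1 - e0) \<le> (1 - e0) * m * measure (step w) (V \<rho>)"
      using stayV[OF w] e0 m(2) by (intro mult_left_mono) auto
    moreover have "m - 2 * e0 * m \<le> (1 - e0) * m * (1 - e0)"
      using m(2) e00 by (simp add: algebra_simps)
    moreover have "b0 * (S - m * measure lborel B) \<le> b0 * (S - (1 - e0) * m * measure lborel B)"
      using b0(1) e00 m(2) by (intro mult_left_mono diff_left_mono mult_right_mono) (auto simp: algebra_simps)
    ultimately show ?thesis using 1 2 unfolding g0_def by linarith
  qed
  have "g0 \<le> 3 * 4 ^ J * e0 * m"
  proof -
    \<comment> \<open>Each layer outwards costs a factor 4: the inner layer is reached with
      probability at least 1/2 and \<open>1 - e0\<close> is at least 1/2. The error
      \<open>3 * e0 * m\<close> reproduces itself because 2 + 3/4 is at most 3.\<close>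
    have layer: "m + g0 / 4 ^ l - 3 * e0 * m \<le> F w" if "l \<le> J" "w \<in> V (s (J - l))" for l w
      using that
    proof (induction l arbitrary: w)
      case 0
      have "0 \<le> e0 * m" using e00 m(2) by simp
      then show ?case using core 0 by fastforce
    next
      case (Suc l)
      interpret S: prob_space "step w" by (rule prob_step)
      define \<gamma> where "\<gamma> = max 0 (g0 / 4 ^ l - 3 * e0 * m)"
      let ?i = "J - Suc l"
      have Si: "Suc ?i = J - l" "?i < J" using Suc.prems by auto
      have low: "(1 - e0) * (m * indicator (V \<rho>) z + \<gamma> * indicator (V (s (Suc ?i))) z) \<le> u z" for z
      proof -
        have "m + \<gamma> \<le> F z" if "z \<in> V (s (Suc ?i))"
        proof -
          have "z \<in> V \<rho>" using that s_le[of "Suc ?i"] by (auto simp: V_def)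
          then have "m \<le> F z" using m(1) F_def by simp
          moreover have "m + g0 / 4 ^ l - 3 * e0 * m \<le> F z" using Suc.IH[of z] Suc.prems that Si by simp
          ultimately show ?thesis unfolding \<gamma>_def by simp
        qed
        then have "(1 - e0) * (m + \<gamma>) \<le> (1 - e0) * F z" if "z \<in> V (s (Suc ?i))"
          using that e0 by (intro mult_left_mono) auto
        moreover have sub: "z \<in> V (s (Suc ?i)) \<Longrightarrow> z \<in> V \<rho>" using s_le[of "Suc ?i"] by (auto simp: V_def)
        ultimately have 1: "(1 - e0) * (m + \<gamma>) \<le> u z" if "z \<in> V (s (Suc ?i))"
          using that uF[of z] unfolding F_def by (meson order_trans)
        show ?thesis
        proof (cases "z \<in> V (s (Suc ?i))")
          case True
          then show ?thesis using 1 sub by simp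
        next
          case False
          then show ?thesis using u_ge[of z] u(1)[of z] by (simp split: split_indicator)
        qed
      qed
      have "(1 - e0) * (m * measure (step w) (V \<rho>) + \<gamma> * measure (step w) (V (s (Suc ?i))))
         = (\<integral>z. (1 - e0) * (m * indicator (V \<rho>) z + \<gamma> * indicator (V (s (Suc ?i))) z) \<partial>step w)"
        by (simp add: S.emeasure_eq_measure)
      also have "\<dots> \<le> F w"
        unfolding F_def by (rule integral_mono[OF _ iu low]) (simp add: S.emeasure_eq_measure)
      finally have 1: "(1 - e0) * (m * measure (step w) (V \<rho>) + \<gamma> * measure (step w) (V (s (Suc ?i)))) \<le> F w" .
      have "1 / 2 \<le> measure (step w) (V (s (Suc ?i)))"
        using stay[OF Suc.prems(2) s_le s_step[OF Si(2)]] t by linarith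
      then have "m * (1 - e0) + \<gamma> * (1 / 2) \<le> m * measure (step w) (V \<rho>) + \<gamma> * measure (step w) (V (s (Suc ?i)))"
        using stayV[OF Suc.prems(2)] m(2) by (intro add_mono mult_left_mono) (auto simp: \<gamma>_def)
      then have 2: "(1 - e0) * (m * (1 - e0) + \<gamma> * (1 / 2)) \<le> F w"
        using e0(2) by (intro order_trans[OF mult_left_mono 1]) auto
      have "(1 - e0) * (\<gamma> * (1 / 2)) \<ge> 1 / 2 * (\<gamma> * (1 / 2))"
        using e0 by (intro mult_right_mono) (auto simp: \<gamma>_def)
      moreover have "m - 2 * e0 * m \<le> (1 - e0) * (m * (1 - e0))"
        using m(2) e00 by (simp add: algebra_simps)
      ultimately have "m - 2 * e0 * m + \<gamma> / 4 \<le> F w" using 2 unfolding distrib_left by linarith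
      moreover have "g0 / 4 ^ Suc l - 3 / 4 * (e0 * m) \<le> \<gamma> / 4" unfolding \<gamma>_def by simp
      moreover have "0 \<le> e0 * m" using e00 m(2) by simp
      ultimately show ?case by linarith
    qed
    \<comment> \<open>At the outermost layer the lower bound holds on all of
      \<open>V \<rho>\<close>, so it cannot exceed the infimum. This turns the gain into an upper
      bound for itself.\<close>
    have "m + g0 / 4 ^ J - 3 * e0 * m \<le> m"
      by (rule m_inf) (use layer[of J] s0 F_def in simp)
    then have "g0 / 4 ^ J \<le> 3 * e0 * m" by simp
    then show ?thesis by (simp add: pos_divide_le_eq mult_ac)
  qed
  then have "b0 * (S - m * measure lborel B) \<le> 3 * (4 ^ J * (e0 * m)) + 2 * (e0 * m)"
    unfolding g0_def by (simp only: mult.assoc diff_le_eq)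
  moreover have "e0 * m \<le> 4 ^ J * (e0 * m)"
  proof -
    have "1 * (e0 * m) \<le> 4 ^ J * (e0 * m)"
      using mult_nonneg_nonneg[OF e00 m(2)] by (intro mult_right_mono) auto
    then show ?thesis by simp
  qed
  ultimately have "b0 * (S - m * measure lborel B) \<le> 5 * (4 ^ J * (e0 * m))" by linarith
  moreover have "0 \<le> 4 ^ J * (e0 * m)" using e00 m(2) by simp
  ultimately have "b0 * (S - m * measure lborel B) \<le> 8 * (4 ^ J * (e0 * m))" by linarith
  then show ?thesis unfolding S_def[symmetric] mult.assoc .
qed

lemma K_upper:
  assumes h: "adm H h" and x: "x \<in> V \<rho>" and e0: "tail ((1 - \<kappa>) * \<rho>) \<le> e0"
    and b: "\<And>z. K h z \<le> b"
  shows "K h x \<le> (\<integral>z. indicator (V \<rho>) z * ext h z \<partial>step x) + e0 * b"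
proof -
  interpret S: prob_space "step x" by (rule prob_step)
  have H0: "0 \<le> H" using h by (simp add: adm_def)
  have [measurable]: "ext h \<in> borel_measurable borel" by (rule ext_borel[OF h])
  have out: "ext h z \<le> max b 0" if "z \<in> - V \<rho>" for z
    using that b[of z] B_sub_V unfolding ext_def by auto
  have int: "integrable (step x) (\<lambda>z. indicator A z * ext h z)" if "A \<in> sets borel" for A
    by (rule integrable_step[where b=H]) (use that ext_bounds[OF h] H0 in \<open>auto split: split_indicator\<close>)
  have "K h x = (\<integral>z. indicator (V \<rho>) z * ext h z + indicator (- V \<rho>) z * ext h z \<partial>step x)"
    unfolding K_step[OF h] by (rule Bochner_Integration.integral_cong) (auto split: split_indicator)
  also have "\<dots> = (\<integral>z. indicator (V \<rho>) z * ext h z \<partial>step x) + (\<integral>z. indicator (- V \<rho>) z * ext h z \<partial>step x)"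
    by (rule Bochner_Integration.integral_add) (auto intro: int)
  also have "(\<integral>z. indicator (- V \<rho>) z * ext h z \<partial>step x) \<le> e0 * b"
  proof -
    have "0 \<le> b" using b[of c] K_nonneg[of h c] by linarith
    then have "(\<integral>z. indicator (- V \<rho>) z * ext h z \<partial>step x) \<le> b * measure (step x) (- V \<rho>)"
      using out by (intro integral_indicator_step_le[where b=H] ext_bounds[OF h]) auto
    also have "\<dots> \<le> b * e0"
      using leave[OF x] e0 \<open>0 \<le> b\<close> by (intro mult_left_mono) auto
    finally show ?thesis by (simp add: mult.commute)
  qed
  finally show ?thesis by simp
qed

text \<open>For an approximate eigenfunction \<open>h\<close> of \<open>K\<close> with eigenvalue \<open>\<lambda>\<close>, either \<open>B\<close> is so large
  that \<open>\<lambda>\<close> is close to 1, or so small that the mass of \<open>h\<close> on \<open>B\<close> is negligible against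
  \<open>inf (K h)\<close> on \<open>V \<rho>\<close>.  In both cases \<open>ext h\<close> and \<open>K h\<close> are close on \<open>V \<rho>\<close>, and coupling applies.\<close>

lemma eigenfunction_ratio:
  fixes s :: "nat \<Rightarrow> real"
  assumes s0: "s 0 = \<rho>" and s_step: "\<And>l. l < J \<Longrightarrow> \<kappa> * s l + t \<le> s (Suc l)"
    and s_dec: "decseq s" and t: "tail t \<le> 1/2"
    and e0: "tail ((1 - \<kappa>) * \<rho>) \<le> e0" "e0 \<le> 1 / 2"
    and b0: "0 < b0" "\<And>x y. x \<in> V (s J) \<Longrightarrow> y \<in> B \<Longrightarrow> b0 \<le> g (y - \<Phi> x)"
    and c1: "0 < c1" "\<And>x y. y \<in> B \<Longrightarrow> g (y - \<Phi> x) \<le> c1 * measure (step x) (V \<rho>)"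
    and \<Lambda>: "0 \<le> \<Lambda>" "\<And>x x' z. x \<in> V \<rho> \<Longrightarrow> x' \<in> V \<rho> \<Longrightarrow> z \<in> V \<rho> \<Longrightarrow> g (z - \<Phi> x) \<le> exp (\<Lambda> * N (x - x')) * g (z - \<Phi> x')"
    and X: "X = 8 * 4 ^ J * e0 / b0" and \<theta>: "0 < \<theta>"
    and \<epsilon>: "0 \<le> \<epsilon>" "\<epsilon> \<le> e0"
    and C1: "(1 + \<epsilon>) ^ Suc T * exp (\<Lambda> * \<kappa> ^ T * (2 * \<rho>)) \<le> 5 / 4"
    and C2: "real (Suc T) * (2 * c1 * (X + \<theta>) + 2 * e0) \<le> 1 / 8"
    and C3: "real (Suc T) * (2 * e0 + X / \<theta> + \<epsilon>) \<le> 1 / 8"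
    and h: "adm H h" "\<And>y. y \<in> B \<Longrightarrow> a \<le> h y" "0 < a" and "B \<noteq> {}"
    and H: "\<And>H'. (\<And>y. y \<in> B \<Longrightarrow> h y \<le> H') \<Longrightarrow> H \<le> H'"
    and lam: "0 < lam" "\<And>y. y \<in> B \<Longrightarrow> lam * h y \<le> K h y" "\<And>y. y \<in> B \<Longrightarrow> K h y \<le> lam * (1 + \<epsilon>) * h y"
    and x: "x \<in> B" "x' \<in> B"
  shows "K h x \<le> 7 / 4 * K h x'"
proof -
  let ?F = "K h" and ?u = "ext h"
  have [measurable]: "?F \<in> borel_measurable borel" "?u \<in> borel_measurable borel" "h \<in> borel_measurable borel"
    using K_borel[OF h(1)] ext_borel[OF h(1)] h(1) by (auto simp: adm_def)
  have e00: "0 \<le> e0" using \<epsilon> by linarith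
  have H0: "0 < H" using h x by (force simp: adm_def)
  have X0: "0 \<le> X" unfolding X using e00 b0(1) by simp
  \<comment> \<open>\<open>H\<close> is the exact supremum of \<open>h\<close> on \<open>B\<close>,
    and \<open>K\<close> does not increase it; hence the eigenvalue is at most 1.\<close>
  have "h y \<le> H / lam" if "y \<in> B" for y
    using lam(2)[OF that] K_le[OF h(1), of y] lam(1) by (simp add: field_simps)
  then have "H \<le> H / lam" by (rule H)
  then have lam1: "lam \<le> 1" using H0 lam(1) by (simp add: field_simps)
  have Fu: "?F z \<le> (1 + \<epsilon>) * ?u z" if "z \<in> V \<rho>" for z
  proof (cases "z \<in> B")
    case True
    have "lam * ((1 + \<epsilon>) * h z) \<le> 1 * ((1 + \<epsilon>) * h z)"
      using lam1 \<epsilon> h True by (intro mult_right_mono) (auto simp: adm_def)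
    then show ?thesis using lam(3)[OF True] True by (simp add: ext_def mult.assoc)
  next
    case False
    then have "z \<notin> M" using that M_V[of \<rho>] by auto
    then have "?u z = ?F z" using False by (simp add: ext_def)
    then show ?thesis using mult_nonneg_nonneg[OF \<epsilon>(1) K_nonneg[of h z]] by (simp add: distrib_right)
  qed
  have int: "integrable (step y) (\<lambda>z. indicator A z * f z)"
    if "A \<in> sets borel" "f \<in> borel_measurable borel" "\<And>z. 0 \<le> f z" "\<And>z. f z \<le> b" for A f and b :: real and y
  proof (rule integrable_step[where b=b])
    have "0 \<le> b" using that(3,4)[of undefined] by linarith
    then show "indicator A z * f z \<le> b" for z using that(4) by (auto split: split_indicator)
  qed (use that in \<open>auto split: split_indicator\<close>)
  have intF: "integrable (step y) (\<lambda>z. indicator (V \<rho>) z * ?F z)" for y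
    by (rule int[where b=H]) (auto simp: K_nonneg K_le[OF h(1)])
  have intu: "integrable (step y) (\<lambda>z. indicator (V \<rho>) z * ?u z)" for y
    by (rule int[where b=H]) (auto simp: ext_bounds[OF h(1)])
  have lower: "(\<integral>z. indicator (V \<rho>) z * ?F z \<partial>step y) \<le> (1 + \<epsilon>) * ?F y" if "y \<in> V \<rho>" for y
  proof -
    have iu: "integrable (step y) (\<lambda>z. (1 + \<epsilon>) * ?u z)"
      using ext_bounds[OF h(1)] by (intro integrable_mult_right integrable_step[where b=H]) auto
    have "(\<integral>z. indicator (V \<rho>) z * ?F z \<partial>step y) \<le> (\<integral>z. (1 + \<epsilon>) * ?u z \<partial>step y)"
      by (rule integral_mono[OF intF iu]) (use Fu ext_bounds(1)[OF h(1)] \<epsilon> in \<open>auto split: split_indicator\<close>)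
    then show ?thesis by (simp add: K_step[OF h(1)])
  qed
  \<comment> \<open>The coupling is used with a family constant in time: one chain step reproduces
    \<open>K h\<close> up to the error \<open>E\<close>, and after \<open>T\<close> steps the
    distance has become harmless.\<close>
  have couple: "?F y \<le> 5 / 4 * ?F y' + real (Suc T) * (E + e0 * m)"
    if "\<And>y. y \<in> V \<rho> \<Longrightarrow> ?F y \<le> (\<integral>z. indicator (V \<rho>) z * ?F z \<partial>step y) + E" "0 \<le> E"
      "\<And>y. y \<in> V \<rho> \<Longrightarrow> ?F y \<le> m" "0 \<le> m" "y \<in> V \<rho>" "y' \<in> V \<rho>" for E m y y'
  proof -
    have "?F y \<le> (1 + \<epsilon>) ^ Suc T * exp (\<Lambda> * \<kappa> ^ T * N (y - y')) * ?F y' + real (Suc T) * (E + e0 * m)"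
      by (rule coupling[where F="\<lambda>_. ?F" and R=\<rho> and b=H, OF _ _ _ _ that(3) that(1) lower \<epsilon>(1) that(2) e0(1) that(4) \<Lambda>(2,1) that(5,6)])
        (auto simp: K_nonneg K_le[OF h(1)])
    also have "(1 + \<epsilon>) ^ Suc T * exp (\<Lambda> * \<kappa> ^ T * N (y - y')) * ?F y' \<le> 5 / 4 * ?F y'"
    proof (intro mult_right_mono K_nonneg)
      have "N (y - y') \<le> 2 * \<rho>"
        using N_diff_triangle[of y y' c] N_minus[of "y' - c"] that(5,6) by (simp add: V_def)
      then have "exp (\<Lambda> * \<kappa> ^ T * N (y - y')) \<le> exp (\<Lambda> * \<kappa> ^ T * (2 * \<rho>))"
        using \<Lambda>(1) \<kappa> by (simp add: mult_left_mono)
      then show "(1 + \<epsilon>) ^ Suc T * exp (\<Lambda> * \<kappa> ^ T * N (y - y')) \<le> 5 / 4"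
        by (rule order_trans[OF mult_left_mono C1]) (use \<epsilon> in simp)
    qed
    finally show ?thesis by simp
  qed
  have BV: "y \<in> V \<rho>" if "y \<in> B" for y using that B_sub_V by blast
  have cV: "c \<in> V \<rho>" using N_0 \<rho> by (simp add: V_def)
  \<comment> \<open>To be applied to \<open>h\<close> itself when \<open>B\<close> is small, and to
    the constant 1, whose image under \<open>K\<close> is the survival probability, when
    \<open>B\<close> is large.\<close>
  have inf_ok: "q' * ((\<integral>y. indicator B y * ext f y \<partial>lborel) - m * measure lborel B) \<le> 8 * 4 ^ J * e0 * m"
    if "q' = b0" "adm G f" "\<And>x. x \<in> V \<rho> \<Longrightarrow> (1 - e0) * K f x \<le> ext f x" "m = (INF x\<in>V \<rho>. K f x)" for q' f G m
  proof -
    have bd: "bdd_below (K f ` V \<rho>)" by (rule bdd_belowI2[where m=0]) (rule K_nonneg)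
    show ?thesis unfolding that(1)
      by (rule inf_bound[OF s0 s_step s_dec t e0 b0, where H=G])
        (use that(3,4) cV in \<open>auto simp only: K_step[OF that(2), symmetric] ext_borel[OF that(2)] ext_bounds[OF that(2)] K_nonneg
          intro!: cINF_lower[OF bd] cINF_greatest\<close>)
  qed
  have ext_B: "(\<integral>y. indicator B y * ext f y \<partial>lborel) = (\<integral>y. indicator B y * f y \<partial>lborel)" for f
    by (rule Bochner_Integration.integral_cong) (auto simp: ext_def split: split_indicator)
  have T1: "z \<le> real (Suc T) * z" if "0 \<le> z" for z using that by (simp add: distrib_right)
  show ?thesis
  proof (cases "measure lborel B \<le> \<theta>")
    case True
    define m where "m = (INF x\<in>V \<rho>. ?F x)"
    define M' where "M' = (SUP x\<in>V \<rho>. ?F x)"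
    define S where "S = (\<integral>y. indicator B y * h y \<partial>lborel)"
    have S0: "0 \<le> S" unfolding S_def by (rule mass_B[OF h(1)])
    have bda: "bdd_above (?F ` V \<rho>)" by (rule bdd_aboveI2[where M=H]) (rule K_le[OF h(1)])
    have bdb: "bdd_below (?F ` V \<rho>)" by (rule bdd_belowI2[where m=0]) (rule K_nonneg)
    have FM: "?F y \<le> M'" if "y \<in> V \<rho>" for y unfolding M'_def by (rule cSUP_upper[OF that bda])
    have M0: "0 \<le> M'" using FM[OF cV] K_nonneg[of h c] by linarith
    have mM: "m \<le> M'" unfolding m_def using cINF_lower[OF bdb cV] FM[OF cV] by linarith
    have m0: "0 \<le> m" unfolding m_def using cV by (intro cINF_greatest) (auto simp: K_nonneg)
    have "(1 - e0) * ?F y \<le> ?u y" if "y \<in> V \<rho>" for y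
    proof -
      have "(1 - e0) * ?F y \<le> (1 - \<epsilon>) * ?F y" using \<epsilon> K_nonneg[of h y] by (intro mult_right_mono) auto
      also have "\<dots> \<le> (1 - \<epsilon>) * ((1 + \<epsilon>) * ?u y)" using Fu[OF that] \<epsilon> e0 by (intro mult_left_mono) auto
      also have "\<dots> = (1 - \<epsilon>\<^sup>2) * ?u y" by (simp add: power2_eq_square algebra_simps)
      also have "\<dots> \<le> 1 * ?u y" by (intro mult_right_mono ext_bounds[OF h(1)]) simp
      finally show ?thesis by simp
    qed
    from inf_ok[OF refl h(1) this m_def]
    have "b0 * (S - m * measure lborel B) \<le> 8 * 4 ^ J * e0 * m" unfolding ext_B S_def .
    then have "S - m * measure lborel B \<le> 8 * 4 ^ J * e0 * m / b0"
      using b0(1) by (simp add: pos_le_divide_eq mult.commute)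
    then have "S \<le> m * X + m * measure lborel B" unfolding X by (simp add: mult_ac)
    also have "\<dots> \<le> m * X + m * \<theta>" using True m0 by (intro add_left_mono mult_left_mono)
    also have "\<dots> \<le> M' * X + M' * \<theta>" using mM X0 \<theta> by (intro add_mono mult_right_mono) auto
    finally have S: "S \<le> M' * (X + \<theta>)" by (simp add: distrib_left)
    \<comment> \<open>The first term is the cost of replacing \<open>ext h\<close> by
      \<open>K h\<close> on \<open>B\<close>; the second is the contribution of leaving
      \<open>V \<rho>\<close>, where \<open>K h\<close> is controlled by the maximum
      principle.\<close>
    define E where "E = c1 * S + e0 * (M' + c1 * S)"
    have E0: "0 \<le> E" unfolding E_def using c1(1) S0 M0 e00 by simp
    have out: "?F z \<le> M' + c1 * S" for z
      unfolding S_def by (rule K_le_sup_V[OF h(1) c1(2) FM M0]) (use c1 in auto)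
    have upper: "?F y \<le> (\<integral>z. indicator (V \<rho>) z * ?F z \<partial>step y) + E" if "y \<in> V \<rho>" for y
    proof -
      have iB: "integrable (step y) (\<lambda>z. indicator B z * h z)" by (rule integral_B_step[OF h(1)])
      have "(\<integral>z. indicator (V \<rho>) z * ?u z \<partial>step y) \<le> (\<integral>z. indicator (V \<rho>) z * ?F z + indicator B z * h z \<partial>step y)"
      proof (rule integral_mono[OF intu Bochner_Integration.integrable_add[OF intF iB]])
        fix z show "indicator (V \<rho>) z * ?u z \<le> indicator (V \<rho>) z * ?F z + indicator B z * h z"
          using K_nonneg[of h z] B_sub_V by (auto simp: ext_def split: split_indicator)
      qed
      also have "\<dots> = (\<integral>z. indicator (V \<rho>) z * ?F z \<partial>step y) + (\<integral>z. indicator B z * h z \<partial>step y)"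
        by (rule Bochner_Integration.integral_add[OF intF iB])
      also have "(\<integral>z. indicator B z * h z \<partial>step y) \<le> c1 * S"
        unfolding S_def
      proof (rule integral_B_step_le[OF h(1)])
        fix w assume "w \<in> B"
        have "g (w - \<Phi> y) \<le> c1 * measure (step y) (V \<rho>)" by (rule c1(2)[OF \<open>w \<in> B\<close>])
        also have "\<dots> \<le> c1" using c1(1) prob_le_1 by (simp add: mult_left_le)
        finally show "g (w - \<Phi> y) \<le> c1" .
      qed
      finally show ?thesis
        using K_upper[OF h(1) that e0(1), of "M' + c1 * S"] out unfolding E_def by simp
    qed
    have "E + e0 * M' \<le> M' * (2 * c1 * (X + \<theta>) + 2 * e0)"
    proof -
      have "e0 * (c1 * S) \<le> 1 * (c1 * S)" using e0 c1(1) S0 by (intro mult_right_mono) auto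
      moreover have "c1 * S \<le> c1 * (M' * (X + \<theta>))" using S c1(1) by (intro mult_left_mono) auto
      ultimately show ?thesis unfolding E_def by (simp add: algebra_simps)
    qed
    then have "real (Suc T) * (E + e0 * M') \<le> M' * (real (Suc T) * (2 * c1 * (X + \<theta>) + 2 * e0))"
      by (subst mult.left_commute) (intro mult_left_mono, auto)
    also have "\<dots> \<le> M' * (1 / 8)" using C2 M0 by (rule mult_left_mono)
    finally have small: "real (Suc T) * (E + e0 * M') \<le> M' / 8" by simp
    have "?F y \<le> 5 / 4 * ?F x' + M' / 8" if "y \<in> V \<rho>" for y
      using couple[OF upper E0 FM M0 that BV[OF x(2)]] small by linarith
    \<comment> \<open>Absorbing \<open>M' / 8\<close> on the left bounds the supremum by 10/7 of the
      value at \<open>x'\<close>, below 7/4.\<close>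
    then have "M' \<le> 5 / 4 * ?F x' + M' / 8" unfolding M'_def using cV by (intro cSUP_least) auto
    then show ?thesis using FM[OF BV[OF x(1)]] K_nonneg[of h x'] by linarith
  next
    case False
    have adm1: "adm 1 (\<lambda>_. 1)" by (simp add: adm_def)
    define m where "m = (INF x\<in>V \<rho>. K (\<lambda>_. 1) x)"
    have bdb: "bdd_below (K (\<lambda>_. 1) ` V \<rho>)" by (rule bdd_belowI2[where m=0]) (rule K_nonneg)
    have m1: "m \<le> 1" unfolding m_def using cINF_lower[OF bdb cV] K_le[OF adm1, of c] by linarith
    have mK: "m \<le> K (\<lambda>_. 1) y" if "y \<in> B" for y unfolding m_def by (rule cINF_lower[OF bdb BV[OF that]])
    have "(1 - e0) * K (\<lambda>_. 1) y \<le> ext (\<lambda>_. 1) y" if "y \<in> V \<rho>" for y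
    proof -
      have "(1 - e0) * K (\<lambda>_. 1) y \<le> 1 * K (\<lambda>_. 1) y" using e00 K_nonneg by (intro mult_right_mono) auto
      also have "\<dots> \<le> ext (\<lambda>_. 1) y"
        using that M_V[of \<rho>] K_le[OF adm1, of y] by (auto simp: ext_def)
      finally show ?thesis .
    qed
    from inf_ok[OF refl adm1 this m_def]
    have "b0 * ((\<integral>y. indicator B y * 1 \<partial>lborel) - m * measure lborel B) \<le> 8 * 4 ^ J * e0 * m" unfolding ext_B .
    then have "b0 * ((1 - m) * measure lborel B) \<le> 8 * 4 ^ J * e0 * m" by (simp add: left_diff_distrib)
    also have "\<dots> \<le> 8 * 4 ^ J * e0 * 1" using m1 e00 by (intro mult_left_mono) auto
    finally have "(1 - m) * measure lborel B \<le> X" unfolding X using b0(1) by (simp add: pos_le_divide_eq mult.commute)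
    moreover have "(1 - m) * \<theta> \<le> (1 - m) * measure lborel B" using False m1 by (intro mult_left_mono) auto
    ultimately have m\<theta>: "1 - m \<le> X / \<theta>" using \<theta> by (simp add: pos_le_divide_eq)
    define hi where "hi = (INF y\<in>B. h y)"
    have bdh: "bdd_below (h ` B)" by (rule bdd_belowI2[where m=a]) (rule h(2))
    have "a \<le> hi" unfolding hi_def using h(2) x by (intro cINF_greatest) auto
    then have hi0: "0 < hi" using h(3) by linarith
    \<comment> \<open>The eigenvalue is bounded below by testing at points where \<open>h\<close> is
      nearly minimal: \<open>K h\<close> is at least \<open>hi\<close> times the survival
      probability there, and at most \<open>lam * (1 + \<epsilon>)\<close> times a value close to
      \<open>hi\<close>.\<close>
    have "hi * m / (lam * (1 + \<epsilon>)) \<le> h y" if "y \<in> B" for y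
    proof -
      have "hi * m \<le> hi * K (\<lambda>_. 1) y" using mK[OF that] hi0 by (intro mult_left_mono) auto
      also have "\<dots> = K (\<lambda>z. hi * 1) y" by (rule K_cmult[OF adm1, symmetric]) (use hi0 in simp)
      also have "\<dots> \<le> K h y"
      proof (rule K_mono[OF _ h(1)])
        show "adm hi (\<lambda>z. hi * 1)" using hi0 by (simp add: adm_def)
        show "hi * 1 \<le> h w" if "w \<in> B" for w unfolding hi_def using cINF_lower[OF bdh that] by simp
      qed
      also have "\<dots> \<le> lam * (1 + \<epsilon>) * h y" by (rule lam(3)[OF that])
      finally show ?thesis using lam(1) \<epsilon> by (simp add: pos_divide_le_eq mult_ac)
    qed
    then have "hi * m / (lam * (1 + \<epsilon>)) \<le> hi" unfolding hi_def using x by (intro cINF_greatest) auto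
    then have "hi * m \<le> hi * (lam * (1 + \<epsilon>))" using lam(1) \<epsilon> by (simp add: pos_divide_le_eq)
    then have "m \<le> lam * (1 + \<epsilon>)" using hi0 by simp
    moreover have "lam * \<epsilon> \<le> \<epsilon>" using mult_right_mono[OF lam1 \<epsilon>(1)] by simp
    ultimately have lam_close: "1 - lam \<le> X / \<theta> + \<epsilon>" using m\<theta> by (simp add: distrib_left)
    define E where "E = (1 - lam) * H + e0 * H"
    have E0: "0 \<le> E" unfolding E_def using lam1 H0 e00 by simp
    have upper: "?F y \<le> (\<integral>z. indicator (V \<rho>) z * ?F z \<partial>step y) + E" if "y \<in> V \<rho>" for y
    proof -
      interpret S: prob_space "step y" by (rule prob_step)
      have "(\<integral>z. indicator (V \<rho>) z * ?u z \<partial>step y) \<le> (\<integral>z. indicator (V \<rho>) z * ?F z + (1 - lam) * H \<partial>step y)"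
      proof (rule integral_mono[OF intu Bochner_Integration.integrable_add[OF intF]])
        fix z
        have "h z - ?F z \<le> (1 - lam) * H" if "z \<in> B"
        proof -
          have "h z - ?F z \<le> (1 - lam) * h z" using lam(2)[OF that] by (simp add: left_diff_distrib)
          also have "\<dots> \<le> (1 - lam) * H" using h(1) that lam1 by (intro mult_left_mono) (auto simp: adm_def)
          finally show ?thesis .
        qed
        moreover have "0 \<le> (1 - lam) * H" using lam1 H0 by simp
        ultimately show "indicator (V \<rho>) z * ?u z \<le> indicator (V \<rho>) z * ?F z + (1 - lam) * H"
          using K_nonneg[of h z] by (auto simp: ext_def split: split_indicator)
      qed simp
      also have "\<dots> = (\<integral>z. indicator (V \<rho>) z * ?F z \<partial>step y) + (1 - lam) * H"
        using intF by (subst Bochner_Integration.integral_add) (auto simp: S.prob_space[simplified])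
      finally show ?thesis
        using K_upper[OF h(1) that e0(1), of H] K_le[OF h(1)] unfolding E_def by simp
    qed
    have "E + e0 * H \<le> H * (2 * e0 + X / \<theta> + \<epsilon>)"
    proof -
      have "(1 - lam) * H \<le> (X / \<theta> + \<epsilon>) * H" using lam_close H0 by (intro mult_right_mono) auto
      then show ?thesis unfolding E_def by (simp add: algebra_simps)
    qed
    then have "real (Suc T) * (E + e0 * H) \<le> H * (real (Suc T) * (2 * e0 + X / \<theta> + \<epsilon>))"
      by (subst mult.left_commute) (intro mult_left_mono, auto)
    also have "\<dots> \<le> H * (1 / 8)" using C3 H0 by (intro mult_left_mono) auto
    finally have small: "real (Suc T) * (E + e0 * H) \<le> H / 8" by simp
    have "h y \<le> (5 / 4 * ?F x' + H / 8) / lam" if "y \<in> B" for y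
    proof -
      have "lam * h y \<le> 5 / 4 * ?F x' + H / 8"
        using couple[OF upper E0 K_le[OF h(1)] _ BV[OF that] BV[OF x(2)]] small lam(2)[OF that] H0 by simp
      then show ?thesis using lam(1) by (simp add: pos_le_divide_eq mult.commute)
    qed
    then have "H \<le> (5 / 4 * ?F x' + H / 8) / lam" by (rule H)
    then have 1: "lam * H \<le> 5 / 4 * ?F x' + H / 8" using lam(1) by (simp add: pos_le_divide_eq mult.commute)
    have "2 * e0 + X / \<theta> + \<epsilon> \<le> 1 / 8"
      by (rule order_trans[OF T1 C3]) (use e00 X0 \<theta> \<epsilon> in simp)
    then have "7 / 8 \<le> lam" using lam_close e00 by linarith
    then have "7 / 8 * H \<le> lam * H" using H0 by (intro mult_right_mono) auto
    \<comment> \<open>Since \<open>lam\<close> is at least 7/8, three quarters of \<open>H\<close>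
      are at most 5/4 of \<open>K h x'\<close>, which gives the ratio 5/3.\<close>
    then show ?thesis using 1 K_le[OF h(1), of x] K_nonneg[of h x'] by linarith
  qed
qed

section \<open>Iterated densities as functions of the starting point and Birkhoff's
  contraction\<close>

definition kr :: "nat \<Rightarrow> 'a \<Rightarrow> 'a \<Rightarrow> real" where
  "kr n x y = enn2real (kp B n x y)"

lemma kr_nonneg: "0 \<le> kr n x y"
  unfolding kr_def by simp

text \<open>Finiteness is essential, because \<open>enn2real\<close> sends infinity to 0.\<close>

lemma kr_Suc:
  assumes fin: "\<And>z. z \<in> B \<Longrightarrow> kp B n z y < \<infinity>"
  shows "kr (Suc n) x y = K (\<lambda>z. kr n z y) x"
proof -
  have "(\<integral>\<^sup>+z. k x z * (indicator B z * kp B n z y) \<partial>lborel) = (\<integral>\<^sup>+z. k x z * (indicator B z * ennreal (kr n z y)) \<partial>lborel)"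
    by (intro nn_integral_cong) (simp add: kr_def ennreal_enn2real[OF fin[simplified]] split: split_indicator)
  then show ?thesis by (simp add: kr_def K_def)
qed

lemma K_add:
  assumes f: "adm Hf f" and h: "adm Hh h"
  shows "K (\<lambda>z. f z + h z) x = K f x + K h x"
proof -
  have [measurable]: "f \<in> borel_measurable borel" "h \<in> borel_measurable borel" using f h by (auto simp: adm_def)
  have adm: "adm (Hf + Hh) (\<lambda>z. f z + h z)" using f h by (auto simp: adm_def intro: add_mono)
  have "ennreal (K (\<lambda>z. f z + h z) x) = (\<integral>\<^sup>+y. k x y * (indicator B y * ennreal (f y)) + k x y * (indicator B y * ennreal (h y)) \<partial>lborel)"
    unfolding ennreal_K[OF adm] using f h
    by (intro nn_integral_cong) (auto simp: adm_def distrib_left split: split_indicator)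
  also have "\<dots> = ennreal (K f x) + ennreal (K h x)"
    unfolding ennreal_K[OF f] ennreal_K[OF h] by (rule nn_integral_add) measurable
  finally have "ennreal (K (\<lambda>z. f z + h z) x) = ennreal (K f x + K h x)"
    using K_nonneg by (simp add: ennreal_plus)
  then show ?thesis using K_nonneg by (metis add_nonneg_nonneg enn2real_ennreal)
qed

lemma nn_mass_B:
  assumes "adm H h"
  shows "(\<integral>\<^sup>+y. indicator B y * ennreal (h y) \<partial>lborel) = ennreal (\<integral>y. indicator B y * h y \<partial>lborel)"
proof -
  have "(\<integral>\<^sup>+y. indicator B y * ennreal (h y) \<partial>lborel) = (\<integral>\<^sup>+y. ennreal (indicator B y * h y) \<partial>lborel)"
    by (intro nn_integral_cong) (auto split: split_indicator)
  also have "\<dots> = ennreal (\<integral>y. indicator B y * h y \<partial>lborel)"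
    by (rule nn_integral_eq_integral[OF mass_B(1)[OF assms]]) (use assms in \<open>auto simp: adm_def split: split_indicator\<close>)
  finally show ?thesis .
qed

lemma K_between:
  assumes h: "adm H h"
  shows "(\<And>y. y \<in> B \<Longrightarrow> k x y \<le> ennreal b) \<Longrightarrow> 0 \<le> b \<Longrightarrow> K h x \<le> b * (\<integral>y. indicator B y * h y \<partial>lborel)"
    and "(\<And>y. y \<in> B \<Longrightarrow> ennreal a \<le> k x y) \<Longrightarrow> 0 \<le> a \<Longrightarrow> a * (\<integral>y. indicator B y * h y \<partial>lborel) \<le> K h x"
proof -
  have [measurable]: "h \<in> borel_measurable borel" using h by (auto simp: adm_def)
  let ?S = "\<integral>y. indicator B y * h y \<partial>lborel"
  have S0: "0 \<le> ?S" by (rule mass_B[OF h])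
  have const: "(\<integral>\<^sup>+y. ennreal b * (indicator B y * ennreal (h y)) \<partial>lborel) = ennreal (b * ?S)" if "0 \<le> b" for b
    using that S0 by (subst nn_integral_cmult) (auto simp: nn_mass_B[OF h] ennreal_mult)
  {
    assume b: "\<And>y. y \<in> B \<Longrightarrow> k x y \<le> ennreal b" "0 \<le> b"
    have "ennreal (K h x) \<le> (\<integral>\<^sup>+y. ennreal b * (indicator B y * ennreal (h y)) \<partial>lborel)"
      unfolding ennreal_K[OF h] by (intro nn_integral_mono) (auto intro!: mult_right_mono b split: split_indicator)
    then show "K h x \<le> b * ?S" using b S0 by (simp add: const)
  next
    assume a: "\<And>y. y \<in> B \<Longrightarrow> ennreal a \<le> k x y" "0 \<le> a"
    have "(\<integral>\<^sup>+y. ennreal a * (indicator B y * ennreal (h y)) \<partial>lborel) \<le> ennreal (K h x)"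
      unfolding ennreal_K[OF h] by (intro nn_integral_mono) (auto intro!: mult_right_mono a split: split_indicator)
    then show "a * ?S \<le> K h x" using a S0 K_nonneg[of h x] by (simp add: const)
  }
qed

text \<open>Birkhoff's contraction of the oscillation of \<open>K f / f\<close>.\<close>

lemma birkhoff_step:
  assumes f: "adm Hf f" and h: "adm Hh h" and pos: "0 < \<alpha>" "\<alpha> \<le> A"
    and low: "\<And>x y. x \<in> B \<Longrightarrow> y \<in> B \<Longrightarrow> ennreal \<alpha> \<le> k x y" and up: "\<And>x y. x \<in> B \<Longrightarrow> y \<in> B \<Longrightarrow> k x y \<le> ennreal A"
    and m: "\<And>y. y \<in> B \<Longrightarrow> m * f y \<le> h y" "\<And>y. y \<in> B \<Longrightarrow> h y \<le> m' * f y" and "0 \<le> m"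
    and Sf: "0 < (\<integral>y. indicator B y * f y \<partial>lborel)"
  obtains r where "m \<le> r" "r \<le> m'" "\<And>x. x \<in> B \<Longrightarrow> (m + \<alpha> / A * (r - m)) * K f x \<le> K h x"
    "\<And>x. x \<in> B \<Longrightarrow> K h x \<le> (m' - \<alpha> / A * (m' - r)) * K f x"
proof
  let ?S = "\<lambda>f. \<integral>y. indicator B y * f y \<partial>lborel"
  \<comment> \<open>The mean of the quotient of \<open>h\<close> by \<open>f\<close> over
    \<open>B\<close>, weighted by \<open>f\<close>. The kernel lies between \<alpha> and
    \<open>A\<close>, so one application of \<open>K\<close> pulls both extremes of the quotient
    towards this mean by at least the fraction \<open>\<alpha> / A\<close>.\<close>
  define r where "r = ?S h / ?S f"
  have A0: "0 < A" using pos by linarith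
  have [measurable]: "f \<in> borel_measurable borel" "h \<in> borel_measurable borel" using f h by (auto simp: adm_def)
  have "m * ?S f \<le> ?S h"
  proof -
    have "(\<integral>y. m * (indicator B y * f y) \<partial>lborel) \<le> ?S h"
      by (rule integral_mono[OF integrable_mult_right mass_B(1)[OF h]]) (use mass_B(1)[OF f] m in \<open>auto split: split_indicator\<close>)
    then show ?thesis by simp
  qed
  then show mr: "m \<le> r" unfolding r_def using Sf by (simp add: pos_le_divide_eq)
  have "?S h \<le> m' * ?S f"
  proof -
    have "?S h \<le> (\<integral>y. m' * (indicator B y * f y) \<partial>lborel)"
      by (rule integral_mono[OF mass_B(1)[OF h] integrable_mult_right]) (use mass_B(1)[OF f] m in \<open>auto split: split_indicator\<close>)
    then show ?thesis by simp
  qed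
  then show rm: "r \<le> m'" unfolding r_def using Sf by (simp add: pos_divide_le_eq)
  fix x assume x: "x \<in> B"
  have Kf: "K f x \<le> A * ?S f" by (rule K_between[OF f]) (use up x A0 in auto)
  have mf: "0 \<le> m * f y" "m * f y \<le> m * Hf" if "y \<in> B" for y
    using f that \<open>0 \<le> m\<close> by (auto simp: adm_def intro: mult_left_mono)
  have mm': "0 \<le> m'" using mr rm \<open>0 \<le> m\<close> by linarith
  have m'f: "0 \<le> m' * f y" "m' * f y \<le> m' * Hf" if "y \<in> B" for y
    using f that mm' by (auto simp: adm_def intro: mult_left_mono)
  have adm_mf: "adm (m * Hf) (\<lambda>y. m * f y)" "adm (m' * Hf) (\<lambda>y. m' * f y)"
    using f mf m'f \<open>0 \<le> m\<close> mm' by (auto simp: adm_def)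
  have adm1: "adm Hh (\<lambda>y. h y - m * f y)"
    using h m(1) mf by (auto simp: adm_def) (metis diff_le_eq add_increasing2)
  have adm2: "adm (m' * Hf) (\<lambda>y. m' * f y - h y)"
    using h m(2) m'f adm_mf(2) by (auto simp: adm_def) (metis diff_le_eq add_increasing2)
  have S1: "?S (\<lambda>y. h y - m * f y) = (r - m) * ?S f"
    using mass_B(1)[OF f] mass_B(1)[OF h] Sf
    by (simp add: right_diff_distrib mult.left_commute[of _ m] r_def left_diff_distrib)
  have S2: "?S (\<lambda>y. m' * f y - h y) = (m' - r) * ?S f"
    using mass_B(1)[OF f] mass_B(1)[OF h] Sf
    by (simp add: right_diff_distrib mult.left_commute[of _ m'] r_def left_diff_distrib)
  have "K h x = K (\<lambda>y. m * f y + (h y - m * f y)) x" by simp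
  also have "\<dots> = m * K f x + K (\<lambda>y. h y - m * f y) x"
    using K_add[OF adm_mf(1) adm1] K_cmult[OF f \<open>0 \<le> m\<close>] by simp
  finally have "K h x = m * K f x + K (\<lambda>y. h y - m * f y) x" .
  moreover have "K (\<lambda>y. h y - m * f y) x \<ge> \<alpha> * ((r - m) * ?S f)"
    unfolding S1[symmetric] by (rule K_between[OF adm1]) (use low x pos in auto)
  ultimately have 1: "m * K f x + \<alpha> * ((r - m) * ?S f) \<le> K h x" by simp
  have "\<alpha> / A * (r - m) * K f x \<le> \<alpha> / A * (r - m) * (A * ?S f)"
    using Kf pos A0 mr by (intro mult_left_mono) auto
  then have "\<alpha> / A * (r - m) * K f x \<le> \<alpha> * ((r - m) * ?S f)" using A0 by simp
  then show "(m + \<alpha> / A * (r - m)) * K f x \<le> K h x" using 1 by (simp add: distrib_right)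
  have "m' * K f x = K (\<lambda>y. h y + (m' * f y - h y)) x"
    using K_cmult[OF f mm', of x] by simp
  also have "\<dots> = K h x + K (\<lambda>y. m' * f y - h y) x" by (rule K_add[OF h adm2])
  finally have "m' * K f x = K h x + K (\<lambda>y. m' * f y - h y) x" .
  moreover have "K (\<lambda>y. m' * f y - h y) x \<ge> \<alpha> * ((m' - r) * ?S f)"
    unfolding S2[symmetric] by (rule K_between[OF adm2]) (use low x pos in auto)
  ultimately have 2: "K h x + \<alpha> * ((m' - r) * ?S f) \<le> m' * K f x" by simp
  have "\<alpha> / A * (m' - r) * K f x \<le> \<alpha> / A * (m' - r) * (A * ?S f)"
    using Kf pos A0 rm by (intro mult_left_mono) auto
  then have "\<alpha> / A * (m' - r) * K f x \<le> \<alpha> * ((m' - r) * ?S f)" using A0 by simp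
  then show "K h x \<le> (m' - \<alpha> / A * (m' - r)) * K f x" using 2 by (simp add: left_diff_distrib)
qed

text \<open>Applied to consecutive densities: the oscillation of their quotient shrinks by
  \<open>\<theta>\<close> at each power, while its lower end stays above \<open>m0 > 0\<close>, so
  the quotient becomes constant up to a factor \<open>1 + \<epsilon>\<close>. The initial bounds
  \<open>m0\<close> and \<open>M0\<close> do not depend on the endpoint, hence neither does
  \<open>n1\<close>.\<close>

lemma birkhoff:
  assumes pos: "0 < \<alpha>" "\<alpha> \<le> A"
    and low: "\<And>x y. x \<in> B \<Longrightarrow> y \<in> B \<Longrightarrow> ennreal \<alpha> \<le> k x y" and up: "\<And>x y. y \<in> B \<Longrightarrow> k x y \<le> ennreal A"
    and kpA: "\<And>n x y. y \<in> B \<Longrightarrow> kp B n x y \<le> ennreal A"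
    and mB: "0 < measure lborel B" and \<epsilon>: "0 < \<epsilon>"
  obtains n1 where "\<And>n y. n \<ge> n1 \<Longrightarrow> y \<in> B \<Longrightarrow> \<exists>lam>0. \<forall>x\<in>B. lam * kr n x y \<le> kr (Suc n) x y \<and>
     kr (Suc n) x y \<le> lam * (1 + \<epsilon>) * kr n x y"
    and "\<And>n y. y \<in> B \<Longrightarrow> \<exists>a>0. \<forall>x\<in>B. a \<le> kr n x y"
    and "\<And>n y. y \<in> B \<Longrightarrow> adm A (\<lambda>x. kr n x y)"
    and "\<And>n x y. y \<in> B \<Longrightarrow> kr (Suc n) x y = K (\<lambda>z. kr n z y) x"
proof -
  have A0: "0 < A" using pos by linarith
  let ?b = "measure lborel B"
  define m0 where "m0 = \<alpha> * \<alpha> * ?b / A"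
  define M0 where "M0 = A * A * ?b / \<alpha>"
  define \<theta> where "\<theta> = 1 - \<alpha> / A"
  have m0: "0 < m0" unfolding m0_def using pos A0 mB by simp
  have \<theta>: "0 \<le> \<theta>" "\<theta> < 1" unfolding \<theta>_def using pos A0 by auto
  have adm: "adm A (\<lambda>x. kr n x y)" if "y \<in> B" for n y
  proof -
    note [measurable] = kp_borel'[OF B_borel]
    have "kr n x y \<le> A" for x
      unfolding kr_def using kpA[OF that, of n x] A0 by (simp add: enn2real_leI)
    then show ?thesis unfolding adm_def kr_def using A0 by (auto intro: kr_nonneg)
  qed
  have Ksuc: "kr (Suc n) x y = K (\<lambda>z. kr n z y) x" if "y \<in> B" for n x y
    by (intro kr_Suc le_less_trans[OF kpA[OF that]]) simp
  have kr0: "\<alpha> \<le> kr 0 x y" "kr 0 x y \<le> A" if "x \<in> B" "y \<in> B" for x y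
  proof -
    have fin: "k x y < \<infinity>" by (rule le_less_trans[OF up[OF that(2)]]) simp
    show "\<alpha> \<le> kr 0 x y" unfolding kr_def using low[OF that] fin pos
      by (metis enn2real_mono enn2real_ennreal kp.simps(1) less_imp_le infinity_ennreal_def)
    show "kr 0 x y \<le> A" unfolding kr_def using up[OF that(2), of x] A0 by (simp add: enn2real_leI)
  qed
  have main: "\<exists>m m'. m0 \<le> m \<and> m' - m \<le> \<theta> ^ n * (M0 - m0) \<and> (\<exists>a>0. \<forall>x\<in>B. a \<le> kr n x y) \<and>
     (\<forall>x\<in>B. m * kr n x y \<le> kr (Suc n) x y \<and> kr (Suc n) x y \<le> m' * kr n x y)" if y: "y \<in> B" for n y
  proof (induction n)
    case 0
    have "\<alpha> * \<alpha> * ?b \<le> kr (Suc 0) x y \<and> kr (Suc 0) x y \<le> A * A * ?b" if x: "x \<in> B" for x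
    proof -
      let ?S = "\<integral>z. indicator B z * kr 0 z y \<partial>lborel"
      have i: "integrable lborel (\<lambda>z. indicator B z * kr 0 z y)" by (rule mass_B(1)[OF adm[OF y]])
      have ic: "integrable lborel (\<lambda>z. indicator B z * a)" for a :: real
        using B_compact emeasure_compact_finite by (intro integrable_mult_left integrable_real_indicator) auto
      have "(\<integral>z. indicator B z * \<alpha> \<partial>lborel) \<le> ?S"
        by (rule integral_mono[OF ic i]) (use kr0 y in \<open>auto split: split_indicator\<close>)
      then have S1: "\<alpha> * ?b \<le> ?S" by (simp add: mult.commute)
      have "?S \<le> (\<integral>z. indicator B z * A \<partial>lborel)"
        by (rule integral_mono[OF i ic]) (use kr0 y in \<open>auto split: split_indicator\<close>)
      then have S2: "?S \<le> A * ?b" by (simp add: mult.commute)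
      have "\<alpha> * ?S \<le> kr (Suc 0) x y" unfolding Ksuc[OF y]
        by (rule K_between(2)[OF adm[OF y]]) (use low x pos in auto)
      moreover have "kr (Suc 0) x y \<le> A * ?S" unfolding Ksuc[OF y]
        by (rule K_between(1)[OF adm[OF y]]) (use up x A0 in auto)
      moreover have "\<alpha> * (\<alpha> * ?b) \<le> \<alpha> * ?S" "A * ?S \<le> A * (A * ?b)"
        using S1 S2 pos A0 by (auto intro!: mult_left_mono)
      ultimately show ?thesis by (simp add: mult.assoc)
    qed
    moreover have "m0 * kr 0 x y \<le> \<alpha> * \<alpha> * ?b" if "x \<in> B" for x
      unfolding m0_def using mult_left_mono[OF kr0(2)[OF that y], of "\<alpha> * \<alpha> * ?b / A"] pos A0 by simp
    moreover have "A * A * ?b \<le> M0 * kr 0 x y" if "x \<in> B" for x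
      unfolding M0_def using mult_left_mono[OF kr0(1)[OF that y], of "A * A * ?b / \<alpha>"] pos A0 by simp
    ultimately have "\<forall>x\<in>B. m0 * kr 0 x y \<le> kr (Suc 0) x y \<and> kr (Suc 0) x y \<le> M0 * kr 0 x y"
      by (meson order_trans)
    then show ?case using kr0(1)[OF _ y] pos(1) by (intro exI[of _ m0] exI[of _ M0]) auto
  next
    case (Suc n)
    then obtain m m' a where IH: "m0 \<le> m" "m' - m \<le> \<theta> ^ n * (M0 - m0)" "0 < a" "\<And>x. x \<in> B \<Longrightarrow> a \<le> kr n x y"
      "\<And>x. x \<in> B \<Longrightarrow> m * kr n x y \<le> kr (Suc n) x y" "\<And>x. x \<in> B \<Longrightarrow> kr (Suc n) x y \<le> m' * kr n x y" by blast
    have ic: "integrable lborel (\<lambda>z. indicator B z * a)"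
      using B_compact emeasure_compact_finite by (intro integrable_mult_left integrable_real_indicator) auto
    have "(\<integral>z. indicator B z * a \<partial>lborel) \<le> (\<integral>z. indicator B z * kr n z y \<partial>lborel)"
      by (rule integral_mono[OF ic mass_B(1)[OF adm[OF y]]]) (use IH(4) in \<open>auto split: split_indicator\<close>)
    moreover have "0 < a * ?b" using IH(3) mB by simp
    ultimately have Sf: "0 < (\<integral>z. indicator B z * kr n z y \<partial>lborel)" by (simp add: mult.commute)
    obtain r where r: "m \<le> r" "r \<le> m'" 
      "\<And>x. x \<in> B \<Longrightarrow> (m + \<alpha> / A * (r - m)) * K (\<lambda>z. kr n z y) x \<le> K (\<lambda>z. kr (Suc n) z y) x"
      "\<And>x. x \<in> B \<Longrightarrow> K (\<lambda>z. kr (Suc n) z y) x \<le> (m' - \<alpha> / A * (m' - r)) * K (\<lambda>z. kr n z y) x"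
      by (rule birkhoff_step[OF adm[OF y, of n] adm[OF y, of "Suc n"] pos low up IH(5,6) _ Sf])
        (use IH(1) m0 in auto)
    let ?m = "m + \<alpha> / A * (r - m)" and ?m' = "m' - \<alpha> / A * (m' - r)"
    have "0 \<le> \<alpha> / A * (r - m)" using pos A0 r(1) by (intro mult_nonneg_nonneg) auto
    then have "m0 \<le> ?m" using IH(1) by linarith
    moreover have "?m' - ?m = \<theta> * (m' - m)" unfolding \<theta>_def using A0 by (simp add: field_simps)
    then have "?m' - ?m \<le> \<theta> ^ Suc n * (M0 - m0)"
      using mult_left_mono[OF IH(2) \<theta>(1)] by (simp add: mult.assoc)
    moreover have "m * a > 0" using IH(1,3) m0 by simp
    moreover have "m * a \<le> kr (Suc n) x y" if "x \<in> B" for x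
      using IH(5)[OF that] mult_left_mono[OF IH(4)[OF that], of m] IH(1) m0 by linarith
    ultimately show ?case
      using r(3,4) unfolding Ksuc[OF y, symmetric]
      by (intro exI[of _ ?m] exI[of _ ?m'] conjI exI[of _ "m * a"]) auto
  qed
  have "(\<lambda>n. \<theta> ^ n * (M0 - m0)) \<longlonglongrightarrow> 0 * (M0 - m0)"
    by (intro tendsto_mult LIMSEQ_power_zero tendsto_const) (use \<theta> in auto)
  then have "eventually (\<lambda>n. \<theta> ^ n * (M0 - m0) < \<epsilon> * m0) sequentially"
    using \<epsilon> m0 by (intro order_tendstoD(2)[where a="\<epsilon> * m0"]) auto
  then obtain n1 where n1: "\<And>n. n \<ge> n1 \<Longrightarrow> \<theta> ^ n * (M0 - m0) < \<epsilon> * m0"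
    unfolding eventually_sequentially by blast
  show ?thesis
  proof
    fix n y assume n: "n \<ge> n1" and y: "y \<in> B"
    obtain m m' where m: "m0 \<le> m" "m' - m \<le> \<theta> ^ n * (M0 - m0)"
      "\<forall>x\<in>B. m * kr n x y \<le> kr (Suc n) x y \<and> kr (Suc n) x y \<le> m' * kr n x y" using main[OF y, of n] by blast
    have "\<epsilon> * m0 \<le> \<epsilon> * m" using m(1) \<epsilon> by simp
    then have "m' \<le> m * (1 + \<epsilon>)" using m(2) n1[OF n] by (simp add: algebra_simps)
    then have "m' * kr n x y \<le> m * (1 + \<epsilon>) * kr n x y" for x by (intro mult_right_mono kr_nonneg)
    then show "\<exists>lam>0. \<forall>x\<in>B. lam * kr n x y \<le> kr (Suc n) x y \<and> kr (Suc n) x y \<le> lam * (1 + \<epsilon>) * kr n x y"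
      using m(1,3) m0 by (intro exI[of _ m]) (meson less_le_trans order_trans)
  next
    fix n y assume "y \<in> B"
    then show "\<exists>a>0. \<forall>x\<in>B. a \<le> kr n x y" using main by blast
  qed (use adm Ksuc in auto)
qed

lemma B_content_pos: "c \<in> interior B \<Longrightarrow> 0 < measure lborel B"
proof -
  assume "c \<in> interior B"
  then obtain e where e: "0 < e" "ball c e \<subseteq> B" unfolding mem_interior by blast
  have "emeasure lborel B < \<infinity>" using B_compact by (rule emeasure_compact_finite)
  then have "measure lborel (ball c e) \<le> measure lborel B"
    using e by (intro measure_mono_fmeasurable) (auto simp: fmeasurable_def)
  then show ?thesis using content_ball_pos[OF e(1), of c] by linarith
qed

lemma bounded_kernel:
  fixes s :: "nat \<Rightarrow> real"
  assumes "s 0 = \<rho>" "\<And>l. l < J \<Longrightarrow> \<kappa> * s l + t \<le> s (Suc l)" "decseq s" "0 \<le> t" "tail t \<le> 1/2"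
    and "0 < c1" and \<beta>: "0 < \<beta>" "\<And>x. x \<in> V (s J) \<Longrightarrow> measure (step x) M \<ge> \<beta>"
    and c1: "\<And>x y. y \<in> B \<Longrightarrow> g (y - \<Phi> x) \<le> c1 * measure (step x) (V \<rho>)"
  shows "y \<in> B \<Longrightarrow> k x y \<le> ennreal (4 ^ Suc J * c1 / \<beta>)"
    and "y \<in> B \<Longrightarrow> kp B n x y \<le> ennreal (4 ^ Suc J * c1 / \<beta>)"
    and "continuous_on (UNIV \<times> B) (\<lambda>(x, y). kr n x y)"
proof -
  obtain W where W: "W \<in> borel_measurable borel" "\<And>x. 0 \<le> W x" "\<And>x. W x \<le> 4 ^ Suc J * c1 / \<beta>"
    "\<And>x. c1 * measure (step x) (V \<rho>) + (\<integral>z. indicator (- M) z * W z \<partial>step x) \<le> W x"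
    by (rule supersolution[OF assms(1-8)]) auto
  show "y \<in> B \<Longrightarrow> k x y \<le> ennreal (4 ^ Suc J * c1 / \<beta>)" by (rule k_le[OF c1 W])
  show "y \<in> B \<Longrightarrow> kp B n x y \<le> ennreal (4 ^ Suc J * c1 / \<beta>)" by (rule kp_le[OF c1 W])
  show "continuous_on (UNIV \<times> B) (\<lambda>(x, y). kr n x y)"
    unfolding kr_def by (rule kp_real_continuous[OF c1 W])
qed

lemma p_le_k: "p x y \<le> k x y"
  by (subst k_first) simp

lemma core_hits_B:
  assumes "x \<in> V r" "\<And>x y. x \<in> V r \<Longrightarrow> y \<in> B \<Longrightarrow> b0 \<le> g (y - \<Phi> x)"
  shows "b0 * measure lborel B \<le> measure (step x) M"
proof -
  interpret S: prob_space "step x" by (rule prob_step)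
  have adm: "adm 1 (\<lambda>_. 1)" by (simp add: adm_def)
  have "b0 * (\<integral>y. indicator B y * 1 \<partial>lborel) \<le> (\<integral>z. indicator B z * 1 \<partial>step x)"
    by (rule integral_B_step_ge[OF adm]) (use assms in auto)
  also have "\<dots> = measure (step x) B" by simp
  also have "\<dots> \<le> measure (step x) M" using B_sub by (intro S.finite_measure_mono) auto
  finally show ?thesis by simp
qed

text \<open>The volume of \<open>B\<close> enters only the upper bound \<open>A\<close> on the
  kernel, hence the rate in Birkhoff's contraction and the index \<open>n1\<close>. None of the
  smallness conditions mentions it, which is what makes the noise threshold uniform in
  \<open>B\<close>.\<close>

theorem middle_regime:
  fixes s :: "nat \<Rightarrow> real"
  assumes s0: "s 0 = \<rho>" and s_step: "\<And>l. l < J \<Longrightarrow> \<kappa> * s l + t \<le> s (Suc l)"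
    and s_dec: "decseq s" and t: "0 \<le> t" "tail t \<le> 1/2"
    and e0: "tail ((1 - \<kappa>) * \<rho>) \<le> e0" "e0 \<le> 1 / 2" "0 < e0"
    and B: "B \<subseteq> V (s J)" "c \<in> interior B"
    and b0: "0 < b0" "\<And>x y. x \<in> V (s J) \<Longrightarrow> y \<in> B \<Longrightarrow> b0 \<le> g (y - \<Phi> x)"
    and c1: "0 < c1" "\<And>x y. y \<in> B \<Longrightarrow> g (y - \<Phi> x) \<le> c1 * measure (step x) (V \<rho>)"
    and \<Lambda>: "0 \<le> \<Lambda>" "\<And>x x' z. x \<in> V \<rho> \<Longrightarrow> x' \<in> V \<rho> \<Longrightarrow> z \<in> V \<rho> \<Longrightarrow> g (z - \<Phi> x) \<le> exp (\<Lambda> * N (x - x')) * g (z - \<Phi> x')"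
    and X: "X = 8 * 4 ^ J * e0 / b0" and \<theta>: "0 < \<theta>"
    and C1: "(1 + e0) ^ Suc T * exp (\<Lambda> * \<kappa> ^ T * (2 * \<rho>)) \<le> 5 / 4"
    and C2: "real (Suc T) * (2 * c1 * (X + \<theta>) + 2 * e0) \<le> 1 / 8"
    and C3: "real (Suc T) * (3 * e0 + X / \<theta>) \<le> 1 / 8"
  shows "\<exists>n1. \<forall>n\<ge>n1. \<forall>x\<in>B. \<forall>x'\<in>B. \<forall>y\<in>B. kr n x y \<le> 7 / 4 * kr n x' y"
    and "\<And>n x y. y \<in> B \<Longrightarrow> kp B n x y < \<infinity>"
    and "\<And>n. continuous_on (UNIV \<times> B) (\<lambda>(x, y). kr n x y)"
proof -
  have mB: "0 < measure lborel B" by (rule B_content_pos[OF B(2)])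
  \<comment> \<open>A step from the core hits \<open>B\<close> with probability at least
    \<open>b0\<close> times its volume, which serves as killing probability in the supersolution.
    The maximum with \<open>b0\<close> only ensures that the lower bound of the kernel is below the
    upper one.\<close>
  define A where "A = max (4 ^ Suc J * c1 / (b0 * measure lborel B)) b0"
  have \<beta>: "0 < b0 * measure lborel B" using b0(1) mB by simp
  have hit: "b0 * measure lborel B \<le> measure (step x) M" if "x \<in> V (s J)" for x
    by (rule core_hits_B[OF that b0(2)])
  have kA: "k x y \<le> ennreal A" if "y \<in> B" for x y
    by (rule order_trans[OF bounded_kernel(1)[where s=s and J=J and t=t and \<beta>="b0 * measure lborel B"]])
      (use s0 s_step s_dec t c1 \<beta> hit that in \<open>auto simp: A_def intro!: ennreal_leI\<close>)
  have kpA: "kp B n x y \<le> ennreal A" if "y \<in> B" for n x y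
    by (rule order_trans[OF bounded_kernel(2)[where s=s and J=J and t=t and \<beta>="b0 * measure lborel B"]])
      (use s0 s_step s_dec t c1 \<beta> hit that in \<open>auto simp: A_def intro!: ennreal_leI\<close>)
  have low: "ennreal b0 \<le> k x y" if "x \<in> B" "y \<in> B" for x y
  proof -
    have "ennreal b0 \<le> p x y" unfolding p_def using b0(2)[of x y] B(1) that by (intro ennreal_leI) auto
    then show ?thesis using p_le_k by (rule order_trans)
  qed
  show "kp B n x y < \<infinity>" if "y \<in> B" for n x y
    by (rule le_less_trans[OF kpA[OF that]]) simp
  show "continuous_on (UNIV \<times> B) (\<lambda>(x, y). kr n x y)" for n
    by (rule bounded_kernel(3)[where s=s and J=J and t=t and \<beta>="b0 * measure lborel B"])
      (use s0 s_step s_dec t c1 \<beta> hit in auto)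
  have bA: "b0 \<le> A" unfolding A_def by simp
  obtain n1 where n1: "\<And>n y. n \<ge> n1 \<Longrightarrow> y \<in> B \<Longrightarrow> \<exists>lam>0. \<forall>x\<in>B. lam * kr n x y \<le> kr (Suc n) x y \<and>
     kr (Suc n) x y \<le> lam * (1 + e0) * kr n x y"
    and lowb: "\<And>n y. y \<in> B \<Longrightarrow> \<exists>a>0. \<forall>x\<in>B. a \<le> kr n x y"
    and adm: "\<And>n y. y \<in> B \<Longrightarrow> adm A (\<lambda>x. kr n x y)"
    and Ks: "\<And>n x y. y \<in> B \<Longrightarrow> kr (Suc n) x y = K (\<lambda>z. kr n z y) x"
    using birkhoff[OF b0(1) bA low kA kpA mB e0(3)] by blast
  have "kr (Suc n) x y \<le> 7 / 4 * kr (Suc n) x' y" if n: "n \<ge> n1" and xy: "x \<in> B" "x' \<in> B" "y \<in> B" for n x x' y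
  proof -
    define h where "h z = kr n z y" for z
    define H where "H = (SUP z\<in>B. h z)"
    obtain lam where lam: "0 < lam" "\<And>z. z \<in> B \<Longrightarrow> lam * h z \<le> K h z" "\<And>z. z \<in> B \<Longrightarrow> K h z \<le> lam * (1 + e0) * h z"
      using n1[OF n xy(3)] unfolding h_def Ks[OF xy(3)] by blast
    obtain a where a: "0 < a" "\<And>z. z \<in> B \<Longrightarrow> a \<le> h z" using lowb[OF xy(3), of n] unfolding h_def by blast
    have admh: "adm A h" using adm[OF xy(3), of n] unfolding h_def .
    have bd: "bdd_above (h ` B)" using admh unfolding adm_def by (intro bdd_aboveI2[where M=A]) auto
    have up: "h z \<le> H" if "z \<in> B" for z unfolding H_def by (rule cSUP_upper[OF that bd])
    have h_adm: "adm H h"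
      using admh up a less_imp_le[OF less_le_trans[OF a(1) order_trans[OF a(2) up]]] xy(1) unfolding adm_def by auto
    have least: "H \<le> H'" if "\<And>z. z \<in> B \<Longrightarrow> h z \<le> H'" for H'
      unfolding H_def using xy(1) that by (intro cSUP_least) auto
    have "K h x \<le> 7 / 4 * K h x'"
      by (rule eigenfunction_ratio[OF s0 s_step s_dec t(2) e0(1,2) b0 c1 \<Lambda> X \<theta> _ order_refl C1 C2 _
          h_adm a(2,1) _ least lam xy(1,2)]) (use e0 C3 xy in auto)
    then show ?thesis unfolding Ks[OF xy(3)] h_def .
  qed
  then show "\<exists>n1. \<forall>n\<ge>n1. \<forall>x\<in>B. \<forall>x'\<in>B. \<forall>y\<in>B. kr n x y \<le> 7 / 4 * kr n x' y"
    by (intro exI[of _ "Suc n1"]) (metis Suc_le_D Suc_le_mono)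
qed

end

section \<open>Flattening in logarithmic time\<close>

text \<open>To be read with \<open>S\<close> a supremum over \<open>B\<close> and \<open>m\<close>
  an infimum over a small ball. The initial ratio \<open>R\<close> is forgotten at rate
  \<open>2 * \<psi>\<close>, where the 2 is the possible loss of \<open>m\<close> over one round;
  what stays is \<open>4 * \<Gamma>\<close>, since
  \<open>2 * \<Gamma> + 8 * \<psi> * \<Gamma>\<close> is at most
  \<open>3 * \<Gamma>\<close>.\<close>

lemma geometric_iteration:
  fixes S m :: "nat \<Rightarrow> real"
  assumes step: "\<And>j. j \<ge> j0 \<Longrightarrow> S (j + L) \<le> 2 * \<Gamma> * m (j + L) + \<psi> * S j"
    and m: "\<And>j. j \<ge> j0 \<Longrightarrow> m j \<le> 2 * m (j + L)" and R: "\<And>j. j \<ge> j0 \<Longrightarrow> S j \<le> R * m j"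
    and "0 \<le> \<psi>" "\<psi> \<le> 1 / 8" "0 \<le> \<Gamma>" "0 \<le> R" and m0: "\<And>j. 0 \<le> m j" and "j \<ge> j0"
  shows "S (j + l * L) \<le> (4 * \<Gamma> + (2 * \<psi>) ^ l * R) * m (j + l * L)"
proof (induction l)
  case 0
  have "0 \<le> 4 * \<Gamma> * m j" using assms by simp
  then show ?case using R[OF \<open>j \<ge> j0\<close>] by (simp add: distrib_right)
next
  case (Suc l)
  let ?i = "j + l * L"
  have i: "?i \<ge> j0" using \<open>j \<ge> j0\<close> by simp
  let ?C = "4 * \<Gamma> + (2 * \<psi>) ^ l * R"
  have C0: "0 \<le> ?C" using assms by simp
  have "S (?i + L) \<le> 2 * \<Gamma> * m (?i + L) + \<psi> * (?C * m ?i)"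
    using step[OF i] mult_left_mono[OF Suc \<open>0 \<le> \<psi>\<close>] by linarith
  also have "\<psi> * (?C * m ?i) \<le> \<psi> * (?C * (2 * m (?i + L)))"
    using assms C0 m[OF i] by (intro mult_left_mono) auto
  finally have "S (?i + L) \<le> (2 * \<Gamma> + 8 * \<psi> * \<Gamma> + (2 * \<psi>) ^ Suc l * R) * m (?i + L)"
    by (simp add: algebra_simps)
  also have "\<dots> \<le> (4 * \<Gamma> + (2 * \<psi>) ^ Suc l * R) * m (?i + L)"
  proof (intro mult_right_mono add_right_mono m0)
    have "8 * \<psi> * \<Gamma> \<le> 1 * \<Gamma>" using assms by (intro mult_right_mono) auto
    then show "2 * \<Gamma> + 8 * \<psi> * \<Gamma> \<le> 4 * \<Gamma>" using \<open>0 \<le> \<Gamma>\<close> by linarith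
  qed
  finally show ?case by (simp add: add.commute add.left_commute)
qed

context contracting_well
begin

lemma K_split:
  assumes h: "adm H h" and A [measurable]: "A \<in> sets borel"
  shows "K h x = (\<integral>z. indicator A z * ext h z \<partial>step x) + (\<integral>z. indicator (- A) z * ext h z \<partial>step x)"
    and "integrable (step x) (\<lambda>z. indicator A z * ext h z)"
    and "0 \<le> (\<integral>z. indicator A z * ext h z \<partial>step x)"
proof -
  have H0: "0 \<le> H" using h by (simp add: adm_def)
  have [measurable]: "ext h \<in> borel_measurable borel" by (rule ext_borel[OF h])
  have int: "integrable (step x) (\<lambda>z. indicator A z * ext h z)" if [measurable]: "A \<in> sets borel" for A
    by (rule integrable_step[where b=H]) (use ext_bounds[OF h] H0 in \<open>auto split: split_indicator\<close>)
  show "integrable (step x) (\<lambda>z. indicator A z * ext h z)" by (rule int) measurable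
  show "0 \<le> (\<integral>z. indicator A z * ext h z \<partial>step x)"
    by (rule integral_nonneg_AE) (use ext_bounds[OF h] in \<open>auto split: split_indicator\<close>)
  have "K h x = (\<integral>z. indicator A z * ext h z + indicator (- A) z * ext h z \<partial>step x)"
    unfolding K_step[OF h] by (rule Bochner_Integration.integral_cong) (auto split: split_indicator)
  also have "\<dots> = (\<integral>z. indicator A z * ext h z \<partial>step x) + (\<integral>z. indicator (- A) z * ext h z \<partial>step x)"
    by (rule Bochner_Integration.integral_add) (auto intro: int)
  finally show "K h x = \<dots>" .
qed

lemma K_le_region:
  assumes h: "adm H h" and r: "x \<in> V r" "r \<le> \<rho>" "\<kappa> * r + t \<le> r'" and e: "tail t \<le> e"
    and a: "\<And>z. z \<in> V r' \<Longrightarrow> ext h z \<le> a" "0 \<le> a" and b: "\<And>z. z \<in> B \<Longrightarrow> h z \<le> b" "0 \<le> b"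
  shows "K h x \<le> a + e * b"
proof -
  interpret S: prob_space "step x" by (rule prob_step)
  have hb: "adm b h" using h b by (auto simp: adm_def)
  have "(\<integral>z. indicator (V r') z * ext h z \<partial>step x) \<le> a * measure (step x) (V r')"
    by (rule integral_indicator_step_le[where b=b]) (use ext_bounds[OF hb] ext_borel[OF hb] a in auto)
  also have "\<dots> \<le> a" using a(2) prob_le_1 by (simp add: mult_left_le)
  finally have 1: "(\<integral>z. indicator (V r') z * ext h z \<partial>step x) \<le> a" .
  have "(\<integral>z. indicator (- V r') z * ext h z \<partial>step x) \<le> b * measure (step x) (- V r')"
    by (rule integral_indicator_step_le[where b=b]) (use ext_bounds[OF hb] ext_borel[OF hb] in auto)
  also have "\<dots> \<le> b * e"
  proof (intro mult_left_mono b(2))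
    have "measure (step x) (- V r') = 1 - measure (step x) (V r')"
      using S.prob_compl[of "V r'"] by (simp add: Compl_eq_Diff_UNIV)
    then show "measure (step x) (- V r') \<le> e" using stay[OF r] e by linarith
  qed
  finally show ?thesis using 1 K_split(1)[OF hb, of "V r'" x] by (simp add: mult.commute)
qed

lemma K_ge_region:
  assumes h: "adm H h" and r: "x \<in> V r" "r \<le> \<rho>" "\<kappa> * r + t \<le> r'" and e: "tail t \<le> e"
    and a: "\<And>z. z \<in> V r' \<Longrightarrow> a \<le> ext h z" "0 \<le> a"
  shows "(1 - e) * a \<le> K h x"
proof -
  interpret S: prob_space "step x" by (rule prob_step)
  have "(1 - e) * a \<le> a * measure (step x) (V r')"
    using stay[OF r] e a(2) by (subst mult.commute) (intro mult_left_mono, auto)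
  also have "\<dots> = (\<integral>z. a * indicator (V r') z \<partial>step x)" by simp
  also have "\<dots> \<le> (\<integral>z. indicator (V r') z * ext h z \<partial>step x)"
    by (rule integral_mono[OF _ K_split(2)[OF h]]) (use a in \<open>auto simp: S.emeasure_eq_measure split: split_indicator\<close>)
  also have "\<dots> \<le> K h x"
    using K_split(1)[OF h, of "V r'" x] K_split(3)[OF h, of "- V r'" x] by simp
  finally show ?thesis .
qed

text \<open>Here \<open>V r0\<close> lies inside \<open>B\<close>, so that as long as the chain stays in \<open>V r0\<close> every step is a
  step of the trace.  The smaller ball \<open>V r\<close> serves as an intermediate target: its size makes the
  factor \<open>\<Gamma>\<close> negligible against the probability \<open>e0\<close> of leaving \<open>V r0\<close>.\<close>

lemma trace_powers_flatten:
  fixes s :: "nat \<Rightarrow> real" and f :: "nat \<Rightarrow> 'a \<Rightarrow> real"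
  assumes s0: "s 0 = \<rho>" and s_step: "\<And>l. l < J \<Longrightarrow> \<kappa> * s l + t \<le> s (Suc l)"
    and s_dec: "decseq s" and t: "t \<le> (1 - \<kappa>) * r" and sJ: "s J \<le> r"
    and r: "0 < r" "r \<le> r0" "r0 \<le> \<rho>" and Vr0: "V r0 \<subseteq> B"
    and e: "tail t \<le> e" and e0: "tail ((1 - \<kappa>) * r0) \<le> e0" "e0 \<le> e"
    and \<Lambda>: "0 \<le> \<Lambda>" "\<And>x x' z. x \<in> V \<rho> \<Longrightarrow> x' \<in> V \<rho> \<Longrightarrow> z \<in> V \<rho> \<Longrightarrow> g (z - \<Phi> x) \<le> exp (\<Lambda> * N (x - x')) * g (z - \<Phi> x')"
    and \<Gamma>: "\<Gamma> = exp (\<Lambda> * (2 * r))" and \<psi>: "\<psi> = real (J + 2) * e" "\<psi> \<le> 1 / 8"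
    and n: "real (Suc n) * e \<le> 1 / 2"
    and ell: "(2 * \<psi>) ^ ell * R \<le> \<Gamma>" "(2 * \<psi>) ^ ell * (5 * \<Gamma>) \<le> 1"
    and \<zeta>: "exp (\<Lambda> * \<kappa> ^ n * (2 * r0)) \<le> 1 + \<zeta>" "20 * real (Suc n) * e0 * \<Gamma> \<le> \<zeta>" "0 < \<zeta>" "\<zeta> \<le> 1 / 4"
    and final: "((1 + 5 * \<zeta>) ^ Suc J + 9 * real J * e) * (1 + 5 * \<zeta>) ^ Suc J \<le> 7 / 4 * (1 - e) ^ (2 * J + 1)"
    and f: "\<And>j. adm A (f j)" "\<And>j x. f (Suc j) x = K (f j) x"
    and R: "\<And>j x x'. x \<in> B \<Longrightarrow> x' \<in> B \<Longrightarrow> f j x \<le> R * f j x'" "0 \<le> R"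
    and j: "j \<ge> 2 * ell * Suc J + Suc n + J" and x: "x \<in> B" "x' \<in> B"
  shows "f j x \<le> 7 / 4 * f j x'"
proof -
  have e00: "0 \<le> e0" using tail_nonneg e0(1) order_trans by blast
  have e': "0 \<le> e" using e00 e0(2) by linarith
  have Je: "real (J + 2) * e \<le> 1 / 8" using \<psi> by simp
  have e2: "e \<le> 1 / 2"
  proof -
    have "1 * e \<le> real (J + 2) * e" using e' by (intro mult_right_mono) auto
    then show ?thesis using Je by linarith
  qed
  have \<Gamma>1: "1 \<le> \<Gamma>" unfolding \<Gamma> using \<Lambda>(1) r by simp
  have ef: "ext (f i) z = (if z \<in> B then f i z else if z \<in> M then 0 else f (Suc i) z)" for i z
    by (simp add: ext_def f(2))
  have VB: "V r \<subseteq> B" "V r0 \<subseteq> V \<rho>" "V r \<subseteq> V r0" using r Vr0 by (auto simp: V_def)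
  have cV: "c \<in> V r" using N_0 r by (simp add: V_def)
  have tail_r: "tail ((1 - \<kappa>) * r) \<le> e" using tail_antimono[OF t] e by linarith
  have s_le: "s l \<le> \<rho>" for l using s0 decseqD[OF s_dec, of 0 l] by simp
  have f_nn: "0 \<le> f i z" if "z \<in> B" for i z using f(1) that by (auto simp: adm_def)
  \<comment> \<open>All comparisons run between the supremum over \<open>B\<close> and the infimum
    over \<open>V r\<close>. The supremum never grows, and the infimum loses at most a factor
    \<open>1 - e\<close> per power because \<open>V r\<close> lies in \<open>B\<close> and is left
    with probability at most \<open>e\<close>.\<close>
  define S where "S i = (SUP z\<in>B. f i z)" for i
  define m where "m i = (INF z\<in>V r. f i z)" for i
  have bda: "bdd_above (f i ` B)" for i using f(1)[of i] unfolding adm_def by (intro bdd_aboveI2[where M=A]) auto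
  have bdb: "bdd_below (f i ` V r)" for i using f_nn VB by (intro bdd_belowI2[where m=0]) auto
  have S: "f i z \<le> S i" if "z \<in> B" for i z unfolding S_def by (rule cSUP_upper[OF that bda])
  have m: "m i \<le> f i z" if "z \<in> V r" for i z unfolding m_def by (rule cINF_lower[OF bdb that])
  have S_least: "S i \<le> b" if "\<And>z. z \<in> B \<Longrightarrow> f i z \<le> b" for i b unfolding S_def using x that by (intro cSUP_least) auto
  have m_great: "b \<le> m i" if "\<And>z. z \<in> V r \<Longrightarrow> b \<le> f i z" for i b unfolding m_def using cV that by (intro cINF_greatest) auto
  have m0: "0 \<le> m i" for i by (rule m_great) (use f_nn VB in auto)
  have S0: "0 \<le> S i" for i using order_trans[OF f_nn[OF x(1)] S[OF x(1)]] .
  have admS: "adm (S i) (f i)" for i using f(1)[of i] S S0 by (auto simp: adm_def)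
  have fS: "f (Suc i) z \<le> S i" for i z unfolding f(2) by (rule K_le[OF admS])
  have S_dec: "S (Suc i) \<le> S i" for i by (rule S_least) (rule fS)
  have S_mono: "i \<le> i' \<Longrightarrow> S i' \<le> S i" for i i' by (induction rule: dec_induct) (auto intro: order_trans[OF S_dec])
  have m_step: "(1 - e) * m i \<le> m (Suc i)" for i
  proof (rule m_great)
    fix z assume "z \<in> V r"
    then show "(1 - e) * m i \<le> f (Suc i) z" unfolding f(2)
      by (rule K_ge_region[OF f(1) _ _ _ tail_r, where r'=r])
        (use r m0 m VB ef in \<open>auto simp: algebra_simps\<close>)
  qed
  have m_steps: "(1 - real l * e) * m i \<le> m (i + l)" for i l
  proof (cases "real l * e \<le> 1")
    case True
    have "(1 - e) ^ l * m i \<le> m (i + l)" for l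
    proof (induction l)
      case (Suc l)
      have "(1 - e) * ((1 - e) ^ l * m i) \<le> (1 - e) * m (i + l)" using Suc e2 by (intro mult_left_mono) auto
      then show ?case using m_step[of "i + l"] by (simp add: mult.assoc)
    qed simp
    moreover have "1 - real l * e \<le> (1 - e) ^ l" using Bernoulli_inequality[of "- e" l] e2 by simp
    ultimately show ?thesis using m0[of i] by (meson mult_right_mono order_trans)
  next
    case False
    then have "(1 - real l * e) * m i \<le> 0" using m0[of i] by (intro mult_nonpos_nonneg) auto
    then show ?thesis using m0[of "i + l"] by linarith
  qed
  have m_double: "m i \<le> 2 * m (i + l)" if "real l * e \<le> 1 / 2" for i l
  proof -
    have "1 / 2 * m i \<le> (1 - real l * e) * m i" using that m0 by (intro mult_right_mono) auto
    then show ?thesis using m_steps[of l i] by linarith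
  qed
  have m_L: "m i \<le> 2 * m (i + l)" if "l \<le> Suc J" for i l
  proof (rule m_double)
    have "real l * e \<le> real (J + 2) * e" using that e' by (intro mult_right_mono) auto
    then show "real l * e \<le> 1 / 2" using Je by linarith
  qed
  \<comment> \<open>A chain step that lands off \<open>M\<close> does not complete a trace step:
    there \<open>ext (f i)\<close> is \<open>f (Suc i)\<close>. Going inwards therefore mixes
    consecutive powers, and the bound on \<open>V r\<close> is required on a whole window of
    times.\<close>
  have upper_layers: "f (j + l) z \<le> a + real l * e * b"
    if "l \<le> J" "\<And>i z. j \<le> i \<Longrightarrow> i \<le> j + l \<Longrightarrow> z \<in> V r \<Longrightarrow> f i z \<le> a" "S j \<le> b" "0 \<le> a" "z \<in> V (s (J - l))" for l j a b z
    using that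
  proof (induction l arbitrary: j z)
    case 0
    then show ?case using sJ by (auto simp: V_def)
  next
    case (Suc l)
    have b0: "0 \<le> b" using S0[of j] Suc.prems(3) by linarith
    have Sb: "S i \<le> b" if "j \<le> i" for i using S_mono[OF that] Suc.prems(3) by linarith
    have "f (Suc (j + l)) z \<le> (a + real l * e * b) + e * b"
      unfolding f(2)
    proof (rule K_le_region[OF f(1) Suc.prems(5) s_le s_step e])
      show "J - Suc l < J" using Suc.prems(1) by simp
      have Sl: "Suc (J - Suc l) = J - l" using Suc.prems(1) by simp
      fix w assume w: "w \<in> V (s (Suc (J - Suc l)))"
      have 1: "f (j + l) w \<le> a + real l * e * b"
        by (rule Suc.IH) (use Suc.prems w Sl in auto)
      have 2: "f (Suc j + l) w \<le> a + real l * e * b"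
        by (rule Suc.IH) (use Suc.prems w Sl Sb in auto)
      show "ext (f (j + l)) w \<le> a + real l * e * b"
        using 1 2 Suc.prems(4) e' b0 unfolding ef by auto
    next
      fix w assume "w \<in> B" then show "f (j + l) w \<le> b" using S[of w "j + l"] Sb[of "j + l"] by simp
    qed (use Suc.prems e' b0 in auto)
    then show ?case by (simp add: algebra_simps)
  qed
  have lower_layers: "(1 - e) ^ l * a \<le> f (j + l) z"
    if "l \<le> J" "\<And>i z. j \<le> i \<Longrightarrow> i \<le> j + l \<Longrightarrow> z \<in> V r \<Longrightarrow> a \<le> f i z" "0 \<le> a" "z \<in> V (s (J - l))" for l j a z
    using that
  proof (induction l arbitrary: j z)
    case 0
    then show ?case using sJ by (auto simp: V_def)
  next
    case (Suc l)
    have "(1 - e) * ((1 - e) ^ l * a) \<le> f (Suc (j + l)) z"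
      unfolding f(2)
    proof (rule K_ge_region[OF f(1) Suc.prems(4) s_le s_step e])
      show "J - Suc l < J" using Suc.prems(1) by simp
      have Sl: "Suc (J - Suc l) = J - l" using Suc.prems(1) by simp
      fix w assume w: "w \<in> V (s (Suc (J - Suc l)))"
      have 1: "(1 - e) ^ l * a \<le> f (j + l) w"
        by (rule Suc.IH) (use Suc.prems w Sl in auto)
      have 2: "(1 - e) ^ l * a \<le> f (Suc j + l) w"
        by (rule Suc.IH) (use Suc.prems w Sl in auto)
      have "w \<in> V \<rho>" using w s_le[of "Suc (J - Suc l)"] by (auto simp: V_def)
      then have "w \<in> B \<or> w \<notin> M" using M_V[of \<rho>] by auto
      then show "(1 - e) ^ l * a \<le> ext (f (j + l)) w" using 1 2 unfolding ef by auto
    qed (use Suc.prems e2 in auto)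
    then show ?case by (simp add: mult.assoc)
  qed
  \<comment> \<open>Inside \<open>V r0\<close> each chain step is a trace step, so the coupling
    applies to successive powers. The family is cut to 0 off \<open>B\<close> because bounds on
    \<open>f\<close> are known on \<open>B\<close> only.\<close>
  have couple: "f (i + Suc l) z \<le> exp (\<Lambda> * \<kappa> ^ l * N (z - z')) * f (i + Suc l) z' + real (Suc l) * (2 * e0 * S i)"
    if "z \<in> V r0" "z' \<in> V r0" for i l z z'
  proof -
    have Sb: "S (i + k) \<le> S i" for k by (rule S_mono) simp
    let ?F = "\<lambda>k z. if z \<in> B then f (i + k) z else 0"
    have [measurable]: "f k \<in> borel_measurable borel" for k using f(1)[of k] by (simp add: adm_def)
    have F_ext: "indicator (V r0) w * ext (f (i + k)) w = indicator (V r0) w * ?F k w" for k w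
      using Vr0 by (auto simp: ef split: split_indicator)
    have "?F (Suc l) z \<le> (1 + 0) ^ Suc l * exp (\<Lambda> * \<kappa> ^ l * N (z - z')) * ?F (Suc l) z' + real (Suc l) * (e0 * S i + e0 * S i)"
    proof (rule coupling[where R=r0 and F="?F" and b="S i"])
      show "?F k w \<le> S i" for k w using S[of w "i + k"] Sb[of k] S0[of i] by auto
      then show "?F k w \<le> S i" for k w .
      fix k w assume w: "w \<in> V r0"
      then have wB: "w \<in> B" "w \<in> V \<rho>" using Vr0 VB by auto
      have "(\<integral>z. indicator (- V r0) z * ext (f (i + k)) z \<partial>step w) \<le> S i * measure (step w) (- V r0)"
      proof (rule integral_indicator_step_le[where b="S (i + k)"])
        show "ext (f (i + k)) z \<le> S i" for z using ext_bounds(2)[OF admS, of "i + k" z] Sb[of k] by linarith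
      qed (use ext_borel[OF admS] ext_bounds[OF admS] in auto)
      also have "\<dots> \<le> S i * e0" using leave[OF w r(3)] e0 S0 by (intro mult_left_mono) auto
      finally have 1: "(\<integral>z. indicator (- V r0) z * ext (f (i + k)) z \<partial>step w) \<le> e0 * S i" by (simp add: mult.commute)
      have 2: "f (i + Suc k) w = (\<integral>z. indicator (V r0) z * ?F k z \<partial>step w) + (\<integral>z. indicator (- V r0) z * ext (f (i + k)) z \<partial>step w)"
        using K_split(1)[OF f(1)[of "i + k"], of "V r0" w] f(2)[of "i + k" w] unfolding F_ext by simp
      show "?F (Suc k) w \<le> (\<integral>z. indicator (V r0) z * ?F k z \<partial>step w) + e0 * S i"
        using 1 2 wB by simp
      show "(\<integral>z. indicator (V r0) z * ?F k z \<partial>step w) \<le> (1 + 0) * ?F (Suc k) w"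
        using 2 wB K_split(3)[OF f(1)[of "i + k"], of "- V r0" w] by simp
    next
      fix x x' z assume "x \<in> V r0" "x' \<in> V r0" "z \<in> V r0"
      then show "g (z - \<Phi> x) \<le> exp (\<Lambda> * N (x - x')) * g (z - \<Phi> x')" using VB by (intro \<Lambda>(2)) auto
    qed (use that r e0 e00 \<Lambda>(1) S0[of i] f_nn in auto)
    moreover have "z \<in> B" "z' \<in> B" using that Vr0 by auto
    moreover have "e0 * S i + e0 * S i = 2 * e0 * S i" by simp
    ultimately show ?thesis by (simp only: if_True add_0_right power_one mult_1)
  qed
  have N2: "N (z - z') \<le> 2 * R'" if "z \<in> V R'" "z' \<in> V R'" for z z' R'
    using N_diff_triangle[of z z' c] N_minus[of "z' - c"] that by (simp add: V_def)
  \<comment> \<open>One round: from anywhere in \<open>B\<close> through the \<open>J\<close> layers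
    into \<open>V r\<close>, and there a comparison with the infimum. The factor \<psi> collects
    \<open>J\<close> failures of a layer step and the term \<open>2 * e0\<close>.\<close>
  have relax: "S (j + Suc J) \<le> 2 * G * m (j + Suc J) + \<psi> * S j"
    if G: "\<And>i z. i \<ge> Suc j \<Longrightarrow> z \<in> V r \<Longrightarrow> f i z \<le> G * m i + 2 * e0 * S (i - 1)" "0 \<le> G" for j G
  proof (rule S_least)
    fix z assume "z \<in> B"
    then have z: "z \<in> V (s (J - J))" using B_sub_V s0 by auto
    have "f (Suc j + J) z \<le> (2 * G * m (j + Suc J) + 2 * e0 * S j) + real J * e * S j"
    proof (rule upper_layers[OF _ _ _ _ z])
      fix i w assume i: "Suc j \<le> i" "i \<le> Suc j + J" and w: "w \<in> V r"
      have "m i \<le> 2 * m (i + (Suc j + J - i))" by (rule m_L) (use i in auto)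
      then have "G * m i \<le> G * (2 * m (j + Suc J))" using G(2) i by (intro mult_left_mono) auto
      moreover have "2 * e0 * S (i - 1) \<le> 2 * e0 * S j" using e00 i by (intro mult_left_mono S_mono) auto
      ultimately show "f i w \<le> 2 * G * m (j + Suc J) + 2 * e0 * S j" using G(1)[OF i(1) w] by simp
    qed (use S_dec[of j] G m0 e00 S0 in auto)
    also have "\<dots> \<le> 2 * G * m (j + Suc J) + \<psi> * S j"
      using mult_right_mono[OF e0(2) S0[of j]] unfolding \<psi>(1) by (simp add: algebra_simps)
    finally show "f (j + Suc J) z \<le> 2 * G * m (j + Suc J) + \<psi> * S j" by simp
  qed
  have \<psi>0: "0 \<le> \<psi>" using \<psi> e' by simp
  have S_R: "S i \<le> R * m i" for i
  proof (rule S_least)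
    fix z assume z: "z \<in> B"
    show "f i z \<le> R * m i"
    proof (cases "R = 0")
      case True then show ?thesis using R(1)[OF z z, of i] by simp
    next
      case False
      have "f i z / R \<le> m i"
        by (rule m_great) (use R(1)[OF z] R(2) False VB in \<open>auto simp: divide_le_eq mult.commute\<close>)
      then show ?thesis using R(2) False by (simp add: divide_le_eq mult.commute)
    qed
  qed
  \<comment> \<open>A single coupled step, where \<Gamma> is the largest ratio of noise densities
    over \<open>V r\<close>. It is huge for small noise, but does not involve the initial ratio
    \<open>R\<close>.\<close>
  have G1: "f i z \<le> \<Gamma> * m i + 2 * e0 * S (i - 1)" if "i \<ge> 1" "z \<in> V r" for i z
  proof -
    have "(f i z - 2 * e0 * S (i - 1)) / \<Gamma> \<le> m i"
    proof (rule m_great)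
      fix w assume w: "w \<in> V r"
      have "f i z \<le> exp (\<Lambda> * N (z - w)) * f i w + 2 * e0 * S (i - 1)"
        using couple[of z w "i - 1" 0] that w VB by auto
      also have "exp (\<Lambda> * N (z - w)) * f i w \<le> \<Gamma> * f i w"
        unfolding \<Gamma> using N2[OF that(2) w] \<Lambda>(1) f_nn w VB by (intro mult_right_mono) (auto intro!: mult_left_mono)
      finally show "(f i z - 2 * e0 * S (i - 1)) / \<Gamma> \<le> f i w" using \<Gamma>1 by (simp add: pos_divide_le_eq mult.commute)
    qed
    then show ?thesis using \<Gamma>1 by (simp add: pos_divide_le_eq mult.commute)
  qed
  have first: "S i \<le> 5 * \<Gamma> * m i" if "i \<ge> ell * Suc J" for i
  proof -
    have "S ((i - ell * Suc J) + ell * Suc J) \<le> (4 * \<Gamma> + (2 * \<psi>) ^ ell * R) * m ((i - ell * Suc J) + ell * Suc J)"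
    proof (rule geometric_iteration[where S=S and m=m and L="Suc J" and \<Gamma>=\<Gamma> and \<psi>=\<psi> and R=R])
      show "S (j + Suc J) \<le> 2 * \<Gamma> * m (j + Suc J) + \<psi> * S j" for j
        by (rule relax) (use G1 \<Gamma>1 in auto)
      show "m j \<le> 2 * m (j + Suc J)" for j by (rule m_L) simp
    qed (use S_R \<psi>0 \<psi>(2) \<Gamma>1 R(2) m0 in auto)
    then have "S i \<le> (4 * \<Gamma> + (2 * \<psi>) ^ ell * R) * m i" using that by simp
    also have "\<dots> \<le> 5 * \<Gamma> * m i" using ell(1) by (intro mult_right_mono m0) simp
    finally show ?thesis .
  qed
  let ?i1 = "ell * Suc J + Suc n"
  \<comment> \<open>With \<open>S\<close> at most \<open>5 * \<Gamma> * m\<close>, hence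
    \<open>10 * \<Gamma>\<close> times the later infimum, \<open>n + 1\<close> coupled steps
    accumulate an error of \<open>20 * (n + 1) * e0 * \<Gamma>\<close> times this infimum. By
    hypothesis that is at most \<zeta> times it, so the long coupling becomes affordable.\<close>
  have flat: "f i z \<le> (1 + 4 * \<zeta>) * f i z'" if i: "i \<ge> ?i1" and z: "z \<in> V r0" "z' \<in> V r0" for i z z'
  proof -
    let ?j = "i - Suc n"
    have ij: "i = ?j + Suc n" "?j \<ge> ell * Suc J" using i by auto
    have "S ?j \<le> 5 * \<Gamma> * m ?j" by (rule first[OF ij(2)])
    also have "\<dots> \<le> 5 * \<Gamma> * (2 * m i)"
      using m_double[OF n, of ?j] ij(1) \<Gamma>1 by (intro mult_left_mono) auto
    finally have Sj: "S ?j \<le> 10 * \<Gamma> * m i" by simp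
    have "real (Suc n) * (2 * e0 * S ?j) \<le> real (Suc n) * (2 * e0 * (10 * \<Gamma> * m i))"
      using Sj e00 by (intro mult_left_mono) auto
    also have "\<dots> = (20 * real (Suc n) * e0 * \<Gamma>) * m i" by simp
    also have "\<dots> \<le> \<zeta> * m i" using \<zeta>(2) by (intro mult_right_mono m0)
    finally have err: "real (Suc n) * (2 * e0 * S ?j) \<le> \<zeta> * m i" .
    have gen: "f i w \<le> (1 + \<zeta>) * f i z' + \<zeta> * m i" if w: "w \<in> V r0" for w
    proof -
      have "f i w \<le> exp (\<Lambda> * \<kappa> ^ n * N (w - z')) * f i z' + real (Suc n) * (2 * e0 * S ?j)"
        using couple[OF w z(2), of ?j n] ij(1) by simp
      also have "exp (\<Lambda> * \<kappa> ^ n * N (w - z')) * f i z' \<le> (1 + \<zeta>) * f i z'"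
      proof (rule mult_right_mono)
        have "exp (\<Lambda> * \<kappa> ^ n * N (w - z')) \<le> exp (\<Lambda> * \<kappa> ^ n * (2 * r0))"
          using N2[OF w z(2)] \<Lambda>(1) \<kappa> by (simp add: mult_left_mono)
        then show "exp (\<Lambda> * \<kappa> ^ n * N (w - z')) \<le> 1 + \<zeta>" using \<zeta>(1) by linarith
      qed (use f_nn z Vr0 in auto)
      finally show ?thesis using err by linarith
    qed
    have "m i \<le> f i c" by (rule m[OF cV])
    then have "(1 - \<zeta>) * m i \<le> (1 + \<zeta>) * f i z'" using gen[of c] cV VB by (auto simp: left_diff_distrib)
    then have "\<zeta> * ((1 - \<zeta>) * m i) \<le> \<zeta> * ((1 + \<zeta>) * f i z')" using \<zeta> by (intro mult_left_mono) auto
    moreover have "(1 - \<zeta>) * f i z \<le> (1 - \<zeta>) * ((1 + \<zeta>) * f i z' + \<zeta> * m i)"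
      using gen[OF z(1)] \<zeta> by (intro mult_left_mono) auto
    ultimately have "(1 - \<zeta>) * f i z \<le> (1 + \<zeta>) * f i z'" by (simp add: algebra_simps)
    also have "\<dots> \<le> (1 - \<zeta>) * ((1 + 4 * \<zeta>) * f i z')"
    proof -
      have "\<zeta> * \<zeta> \<le> \<zeta> * (1 / 4)" using \<zeta> by (intro mult_left_mono) auto
      moreover have "(1 - \<zeta>) * (1 + 4 * \<zeta>) = 1 + 3 * \<zeta> - 4 * (\<zeta> * \<zeta>)" by (simp add: algebra_simps)
      ultimately have "1 + \<zeta> \<le> (1 - \<zeta>) * (1 + 4 * \<zeta>)" using \<zeta>(3) by linarith
      then show ?thesis using f_nn[of z' i] z Vr0 by (subst mult.assoc[symmetric]) (auto intro!: mult_right_mono)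
    qed
    finally show ?thesis using \<zeta> by simp
  qed
  have e0\<Gamma>: "5 * e0 * \<Gamma> \<le> \<zeta>"
  proof -
    have "5 * (e0 * \<Gamma>) \<le> (20 * real (Suc n)) * (e0 * \<Gamma>)" using e00 \<Gamma>1 by (intro mult_right_mono) auto
    then show ?thesis using \<zeta>(2) by (simp only: mult.assoc)
  qed
  have next_up: "f (Suc i) z \<le> (1 + 5 * \<zeta>) * f i z'" if i: "i \<ge> ?i1" and z: "z \<in> V r" "z' \<in> V r" for i z z'
  proof -
    have "f (Suc i) z \<le> (1 + 4 * \<zeta>) * f i z' + e0 * S i"
      unfolding f(2)
    proof (rule K_le_region[OF f(1) _ r(3) _ e0(1)])
      show "z \<in> V r0" using z VB by auto
      show "\<kappa> * r0 + (1 - \<kappa>) * r0 \<le> r0" by (simp add: algebra_simps)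
      fix w assume w: "w \<in> V r0"
      then have "ext (f i) w = f i w" using Vr0 by (auto simp: ef)
      then show "ext (f i) w \<le> (1 + 4 * \<zeta>) * f i z'" using flat[OF i w, of z'] z VB by auto
    next
      show "0 \<le> (1 + 4 * \<zeta>) * f i z'" using \<zeta> f_nn z VB by auto
    qed (use S S0 in auto)
    also have "e0 * S i \<le> e0 * (5 * \<Gamma> * m i)" using first[of i] i e00 by (intro mult_left_mono) auto
    also have "\<dots> = (5 * e0 * \<Gamma>) * m i" by simp
    also have "\<dots> \<le> \<zeta> * f i z'" using e0\<Gamma> \<zeta> m[OF z(2), of i] m0 by (intro mult_mono) auto
    finally show ?thesis by (simp add: algebra_simps)
  qed
  have next_low: "(1 - e) * f i z' \<le> (1 + 5 * \<zeta>) * f (Suc i) z" if i: "i \<ge> ?i1" and z: "z \<in> V r" "z' \<in> V r" for i z z'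
  proof -
    have "f i z' / (1 + 5 * \<zeta>) \<le> m i"
    proof (rule m_great)
      fix w assume w: "w \<in> V r"
      have "f i z' \<le> (1 + 4 * \<zeta>) * f i w" by (rule flat[OF i]) (use w z VB in auto)
      also have "\<dots> \<le> (1 + 5 * \<zeta>) * f i w" using \<zeta> f_nn w VB by (intro mult_right_mono) auto
      finally show "f i z' / (1 + 5 * \<zeta>) \<le> f i w" using \<zeta> by (simp add: pos_divide_le_eq mult.commute)
    qed
    then have "(1 - e) * (f i z' / (1 + 5 * \<zeta>)) \<le> (1 - e) * m i" using e2 by (intro mult_left_mono) auto
    also have "\<dots> \<le> f (Suc i) z" using m_step[of i] m[OF z(1), of "Suc i"] by linarith
    finally show ?thesis using \<zeta> by (simp add: pos_divide_le_eq mult.commute)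
  qed
  \<comment> \<open>The rounds are run once more, now with 2 in place of \<Gamma>, since values on
    \<open>V r\<close> already agree up to \<open>1 + 4 * \<zeta>\<close>. They start from the ratio
    \<open>5 * \<Gamma>\<close> and end at 8 + 1.\<close>
  have second: "S i \<le> 9 * m i" if "i \<ge> ?i1 + ell * Suc J" for i
  proof -
    have "S ((i - ell * Suc J) + ell * Suc J) \<le> (4 * 2 + (2 * \<psi>) ^ ell * (5 * \<Gamma>)) * m ((i - ell * Suc J) + ell * Suc J)"
    proof (rule geometric_iteration[where S=S and m=m and L="Suc J" and \<Gamma>=2 and \<psi>=\<psi> and R="5 * \<Gamma>" and ?j0.0="?i1"])
      show "m j \<le> 2 * m (j + Suc J)" for j by (rule m_L) simp
      show "S j \<le> 5 * \<Gamma> * m j" if "j \<ge> ?i1" for j by (rule first) (use that in simp)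
      fix j assume "j \<ge> ?i1"
      show "S (j + Suc J) \<le> 2 * 2 * m (j + Suc J) + \<psi> * S j"
      proof (rule relax)
      fix i z assume "i \<ge> Suc j" and z: "z \<in> V r"
      with \<open>j \<ge> ?i1\<close> have i: "i \<ge> ?i1" by simp
      have "f i z / 2 \<le> m i"
      proof (rule m_great)
        fix w assume w: "w \<in> V r"
        have "f i z \<le> (1 + 4 * \<zeta>) * f i w" by (rule flat[OF i]) (use w z VB in auto)
        also have "\<dots> \<le> 2 * f i w" using \<zeta> f_nn w VB by (intro mult_right_mono) auto
        finally show "f i z / 2 \<le> f i w" by simp
      qed
      then show "f i z \<le> 2 * m i + 2 * e0 * S (i - 1)" using mult_nonneg_nonneg[OF e00 S0[of "i - 1"]] by simp
      qed simp
    qed (use \<psi>0 \<psi>(2) \<Gamma>1 m0 that in auto)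
    then have "S i \<le> (8 + (2 * \<psi>) ^ ell * (5 * \<Gamma>)) * m i" using that by simp
    also have "\<dots> \<le> 9 * m i" using ell(2) by (intro mult_right_mono m0) simp
    finally show ?thesis .
  qed
  \<comment> \<open>The last \<open>J\<close> powers carry the flatness from \<open>V r\<close>
    through the layers to all of \<open>B\<close>. As this mixes the powers from \<open>j'\<close>
    to \<open>j\<close>, all of them are first compared with the single number
    \<open>F\<close>.\<close>
  define j' where "j' = j - J"
  have j': "j = j' + J" "j' \<ge> ?i1" "j' \<ge> ?i1 + ell * Suc J" unfolding j'_def using j by (auto simp: mult_2 distrib_right)
  define F where "F = f j' c"
  have F0: "0 \<le> F" unfolding F_def using f_nn cV VB by auto
  have up: "f (j' + l) z \<le> (1 + 5 * \<zeta>) ^ Suc l * F" if "z \<in> V r" for l z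
    using that
  proof (induction l arbitrary: z)
    case 0
    have "f j' z \<le> (1 + 4 * \<zeta>) * F" unfolding F_def by (rule flat[OF j'(2)]) (use 0 cV VB in auto)
    also have "\<dots> \<le> (1 + 5 * \<zeta>) * F" using \<zeta> F0 by (intro mult_right_mono) auto
    finally show ?case by simp
  next
    case (Suc l)
    have "f (Suc (j' + l)) z \<le> (1 + 5 * \<zeta>) * f (j' + l) c" by (rule next_up) (use j' Suc cV in auto)
    also have "\<dots> \<le> (1 + 5 * \<zeta>) * ((1 + 5 * \<zeta>) ^ Suc l * F)" using \<zeta> by (intro mult_left_mono Suc.IH cV) auto
    finally show ?case by simp
  qed
  have low: "(1 - e) ^ Suc l * F \<le> (1 + 5 * \<zeta>) ^ Suc l * f (j' + l) z" if "z \<in> V r" for l z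
    using that
  proof (induction l arbitrary: z)
    case 0
    have "F \<le> (1 + 4 * \<zeta>) * f j' z" unfolding F_def by (rule flat[OF j'(2)]) (use 0 cV VB in auto)
    also have "\<dots> \<le> (1 + 5 * \<zeta>) * f j' z" using \<zeta> f_nn 0 VB by (intro mult_right_mono) auto
    finally show ?case using mult_right_mono[of "1 - e" 1 F] e' F0 by simp
  next
    case (Suc l)
    have "(1 - e) ^ Suc (Suc l) * F \<le> (1 - e) * ((1 + 5 * \<zeta>) ^ Suc l * f (j' + l) c)"
      using mult_left_mono[OF Suc.IH[OF cV], of "1 - e"] e2 by (simp add: mult.assoc)
    also have "\<dots> = (1 + 5 * \<zeta>) ^ Suc l * ((1 - e) * f (j' + l) c)" by simp
    also have "\<dots> \<le> (1 + 5 * \<zeta>) ^ Suc l * ((1 + 5 * \<zeta>) * f (Suc (j' + l)) z)"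
      by (intro mult_left_mono next_low) (use j' Suc cV \<zeta> in auto)
    finally show ?case by (simp add: mult.assoc mult.left_commute)
  qed
  let ?P = "(1 + 5 * \<zeta>) ^ Suc J"
  have P1: "1 \<le> 1 + 5 * \<zeta>" using \<zeta> by simp
  have P0: "0 < ?P" using \<zeta> by simp
  have zB: "z \<in> V (s (J - J))" if "z \<in> B" for z using that B_sub_V s0 by auto
  have U: "f j x \<le> (?P + 9 * real J * e) * F"
  proof -
    have "f (j' + J) x \<le> ?P * F + real J * e * (9 * F)"
    proof (rule upper_layers[OF _ _ _ _ zB[OF x(1)]])
      fix i z assume i: "j' \<le> i" "i \<le> j' + J" and z: "z \<in> V r"
      have "f i z \<le> (1 + 5 * \<zeta>) ^ Suc (i - j') * F" using up[OF z, of "i - j'"] i by simp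
      also have "\<dots> \<le> ?P * F" using i F0 by (intro mult_right_mono power_increasing P1) auto
      finally show "f i z \<le> ?P * F" .
    next
      show "S j' \<le> 9 * F" using second[OF j'(3)] m[OF cV, of j'] unfolding F_def by linarith
    qed (use P0 F0 in auto)
    then show ?thesis using j'(1) by (simp add: algebra_simps)
  qed
  have Lo: "(1 - e) ^ J * ((1 - e) ^ Suc J * F / ?P) \<le> f j x'"
  proof -
    have "(1 - e) ^ J * ((1 - e) ^ Suc J * F / ?P) \<le> f (j' + J) x'"
    proof (rule lower_layers[OF _ _ _ zB[OF x(2)]])
      fix i z assume i: "j' \<le> i" "i \<le> j' + J" and z: "z \<in> V r"
      have "(1 - e) ^ Suc J * F \<le> (1 - e) ^ Suc (i - j') * F"
        using i e' e2 F0 by (intro mult_right_mono power_decreasing) auto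
      also have "\<dots> \<le> (1 + 5 * \<zeta>) ^ Suc (i - j') * f i z" using low[OF z, of "i - j'"] i by simp
      also have "\<dots> \<le> ?P * f i z" using i f_nn z VB by (intro mult_right_mono power_increasing P1) auto
      finally show "(1 - e) ^ Suc J * F / ?P \<le> f i z" using P0 by (simp add: pos_divide_le_eq mult.commute)
    qed (use P0 F0 e2 in auto)
    then show ?thesis using j'(1) by simp
  qed
  have "?P * f j x \<le> ?P * ((?P + 9 * real J * e) * F)" using U P0 by (intro mult_left_mono) auto
  also have "\<dots> = ((?P + 9 * real J * e) * ?P) * F" by (simp only: mult_ac)
  also have "\<dots> \<le> (7 / 4 * (1 - e) ^ (2 * J + 1)) * F" by (rule mult_right_mono[OF final F0])
  also have "\<dots> = 7 / 4 * ?P * ((1 - e) ^ J * ((1 - e) ^ Suc J * F / ?P))"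
  proof -
    have eq: "(1 - e) ^ (2 * J + 1) = (1 - e) ^ J * (1 - e) ^ Suc J"
      by (simp only: power_add[symmetric]) (simp add: mult_2)
    have "P * (a * (b * F / P)) = (a * b) * F" if "0 < P" for P a b :: real using that by simp
    from this[OF P0, of "(1 - e) ^ J" "(1 - e) ^ Suc J"]
    show ?thesis unfolding eq by (simp only: mult.assoc)
  qed
  also have "\<dots> \<le> 7 / 4 * ?P * f j x'" using Lo P0 by (intro mult_left_mono) auto
  finally have "?P * f j x \<le> ?P * (7 / 4 * f j x')" by (simp only: mult_ac)
  then show ?thesis using P0 by (simp only: mult_le_cancel_left_pos)
qed

end

section \<open>Adapted norms at linearly stable fixed points\<close>

text \<open>The vector \<open>p(C) v\<close>, with the polynomial evaluated at the matrix by
  Horner's scheme.\<close>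

definition papply :: "complex^'n^'n \<Rightarrow> complex poly \<Rightarrow> complex^'n \<Rightarrow> complex^'n" where
  "papply C p v = fold_coeffs (\<lambda>a w. a *s v + C *v w) p 0"

lemma papply_0 [simp]: "papply C 0 v = 0"
  by (simp add: papply_def)

lemma papply_pCons [simp]: "papply C (pCons a p) v = a *s v + C *v papply C p v"
  by (cases "a = 0 \<and> p = 0") (auto simp: papply_def)

lemma papply_add: "papply C (p + q) v = papply C p v + papply C q v"
  by (induction p q rule: poly_induct2)
    (auto simp: vector_sadd_rdistrib matrix_vector_right_distrib)

lemma papply_smult: "papply C (smult a p) v = a *s papply C p v"
  by (induction p) (auto simp: vector_smult_assoc vector_add_ldistrib vector_scalar_commute)

lemma papply_commute: "papply C p (C *v v) = C *v papply C p v"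
  by (induction p) (auto simp: matrix_vector_right_distrib vector_scalar_commute)

lemma papply_linear: "papply C p (v + w) = papply C p v + papply C p w"
  "papply C p (a *s v) = a *s papply C p v"
  by (induction p) (auto simp: vector_add_ldistrib vector_smult_assoc mult.commute
      matrix_vector_right_distrib vector_scalar_commute)

lemma papply_diff_scaled: "papply C p (v - a *s w) = papply C p v - a *s papply C p w"
proof -
  have "v - a *s w = v + (- a) *s w" by (simp add: vec_eq_iff)
  then have "papply C p (v - a *s w) = papply C p v + (- a) *s papply C p w"
    by (simp only: papply_linear)
  then show ?thesis by (simp add: vec_eq_iff)
qed

lemma papply_root: "papply C ([:- \<mu>, 1:] * q) v = papply C q (C *v v - \<mu> *s v)"
proof -
  have "[:- \<mu>, 1:] * q = smult (- \<mu>) q + pCons 0 q" by simp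
  then have "papply C ([:- \<mu>, 1:] * q) v = (- \<mu>) *s papply C q v + C *v papply C q v"
    by (simp only: papply_add papply_smult papply_pCons) simp
  then show ?thesis
    by (simp add: papply_diff_scaled papply_commute vec_eq_iff)
qed

lemma papply_eigenvector: "C *v v = \<mu> *s v \<Longrightarrow> papply C p v = poly p \<mu> *s v"
  by (induction p) (auto simp: vector_scalar_commute vector_smult_assoc vector_sadd_rdistrib mult.commute)

lemma papply_monom: "papply C (monom a i) v = a *s (((*v) C) ^^ i) v"
  by (induction i) (auto simp: monom_0 monom_Suc vector_scalar_commute)

lemma papply_sum: "papply C (\<Sum>i\<in>I. p i) v = (\<Sum>i\<in>I. papply C (p i) v)"
  by (induction I rule: infinite_finite_induct) (auto simp: papply_add)

lemma sequence_dependent: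
  fixes x :: "nat \<Rightarrow> 'v::euclidean_space"
  obtains c :: "nat \<Rightarrow> real" and i where "i \<le> DIM('v)" "c i \<noteq> 0" "(\<Sum>j\<le>DIM('v). c j *\<^sub>R x j) = 0"
proof (cases "inj_on x {..DIM('v)}")
  case True
  have "card (x ` {..DIM('v)}) = Suc DIM('v)" using card_image[OF True] by simp
  then have "dependent (x ` {..DIM('v)})" using independent_bound[of "x ` {..DIM('v)}"] by force
  then obtain u w where u: "w \<in> x ` {..DIM('v)}" "u w \<noteq> 0" "(\<Sum>v\<in>x ` {..DIM('v)}. u v *\<^sub>R v) = 0"
    using dependent_finite[of "x ` {..DIM('v)}"] by auto
  then obtain i where "i \<le> DIM('v)" "w = x i" by auto
  then show ?thesis using u that[of i "u \<circ> x"] by (simp add: sum.reindex[OF True])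
next
  case False
  then obtain i j where ij: "i \<le> DIM('v)" "j \<le> DIM('v)" "x i = x j" "i \<noteq> j" unfolding inj_on_def by auto
  let ?c = "\<lambda>l. if l = i then 1 else if l = j then -1 else 0 :: real"
  have "(\<Sum>l\<le>DIM('v). ?c l *\<^sub>R x l) = (\<Sum>l\<in>{i, j}. ?c l *\<^sub>R x l)"
    using ij by (intro sum.mono_neutral_right) auto
  also have "\<dots> = 0" using ij by simp
  finally show ?thesis using ij that[of i ?c] by simp
qed

text \<open>One more power of \<open>C\<close> than the real dimension of the matrix space is
  linearly dependent, and a dependence relation is a polynomial killing \<open>C\<close>. Its degree
  is irrelevant for what follows.\<close>

lemma annihilating_poly:
  fixes C :: "complex^'n^'n"
  obtains p where "p \<noteq> 0" "\<And>v. papply C p v = 0"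
proof -
  let ?x = "\<lambda>i. (((**) C) ^^ i) (mat 1)"
  obtain c :: "nat \<Rightarrow> real" and i where c: "i \<le> DIM(complex^'n^'n)" "c i \<noteq> 0"
    "(\<Sum>j\<le>DIM(complex^'n^'n). c j *\<^sub>R ?x j) = 0"
    using sequence_dependent[of ?x] by blast
  define d where "d = DIM(complex^'n^'n)"
  define p where "p = (\<Sum>j\<le>d. monom (complex_of_real (c j)) j)"
  have "coeff p i = complex_of_real (c i)"
    unfolding p_def coeff_sum coeff_monom using c(1) by (simp add: d_def)
  then have "p \<noteq> 0" using c(2) by auto
  moreover have "papply C p v = 0" for v
  proof -
    have x: "?x j *v v = (((*v) C) ^^ j) v" for j
      by (induction j) (auto simp: matrix_vector_mul_assoc[symmetric])
    have "papply C p v = (\<Sum>j\<le>d. complex_of_real (c j) *s (?x j *v v))"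
      unfolding p_def papply_sum papply_monom x ..
    also have "\<dots> = (\<Sum>j\<le>d. (c j *\<^sub>R ?x j)) *v v"
    proof -
      have "complex_of_real a *s (X *v v) = (a *\<^sub>R X) *v v" for a and X :: "complex^'n^'n"
        by (simp add: vec_eq_iff matrix_vector_mult_def scaleR_conv_of_real[where 'a=complex] sum_distrib_left mult.assoc)
      moreover have "(\<Sum>j\<in>I. X j *v v) = (\<Sum>j\<in>I. X j) *v v" for X :: "nat \<Rightarrow> complex^'n^'n" and I
        by (induction I rule: infinite_finite_induct) (auto simp: matrix_vector_mult_add_rdistrib)
      ultimately show ?thesis by simp
    qed
    also have "\<dots> = 0" using c(3) by (simp add: d_def)
    finally show ?thesis .
  qed
  ultimately show ?thesis using that by blast
qed

text \<open>Any rate strictly above \<open>r\<close> and at least \<theta> works; the midpoint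
  between their maximum and 1 also covers the resonant case of equal rates.\<close>

lemma geometric_recursion_bound:
  fixes a :: "nat \<Rightarrow> real"
  assumes "\<And>n. a (Suc n) \<le> r * a n + K * \<theta> ^ n" "0 \<le> r" "r < 1" "0 \<le> \<theta>" "\<theta> < 1"
  shows "\<exists>K' \<theta>'. 0 \<le> \<theta>' \<and> \<theta>' < 1 \<and> (\<forall>n. a n \<le> K' * \<theta>' ^ n)"
proof -
  define \<eta> where "\<eta> = (1 + max r \<theta>) / 2"
  have \<eta>: "r < \<eta>" "\<theta> \<le> \<eta>" "\<eta> < 1" "0 < \<eta>" unfolding \<eta>_def using assms by auto
  define K' where "K' = max (a 0) (\<bar>K\<bar> / (\<eta> - r))"
  have "\<bar>K\<bar> / (\<eta> - r) \<le> K'" unfolding K'_def by simp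
  then have K': "\<bar>K\<bar> \<le> K' * (\<eta> - r)" using \<eta> by (simp add: pos_divide_le_eq)
  have "a n \<le> K' * \<eta> ^ n" for n
  proof (induction n)
    case (Suc n)
    have "K * \<theta> ^ n \<le> \<bar>K\<bar> * \<eta> ^ n"
      using \<eta> assms by (intro mult_mono power_mono) auto
    also have "\<dots> \<le> K' * (\<eta> - r) * \<eta> ^ n" using K' \<eta> by (intro mult_right_mono) auto
    finally have "a (Suc n) \<le> r * (K' * \<eta> ^ n) + K' * (\<eta> - r) * \<eta> ^ n"
      using assms(1)[of n] mult_left_mono[OF Suc assms(2)] by linarith
    then show ?case by (simp add: algebra_simps)
  qed (simp add: K'_def)
  then show ?thesis using \<eta> by (intro exI[of _ K'] exI[of _ \<eta>]) auto
qed

text \<open>Induction on the degree of an annihilating polynomial, by splitting off a root \<mu>. If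
  \<mu> has modulus below 1, the orbit of \<open>C v - \<mu> v\<close> decays by induction and that
  of \<open>v\<close> follows by a scalar recursion. Otherwise \<mu> is no eigenvalue, so the
  quotient polynomial already annihilates \<open>v\<close>.\<close>

lemma orbit_decay:
  fixes C :: "complex^'n^'n"
  assumes spec: "\<And>\<mu> v. v \<noteq> 0 \<Longrightarrow> C *v v = \<mu> *s v \<Longrightarrow> norm \<mu> < 1"
    and "p \<noteq> 0" "papply C p v = 0"
  shows "\<exists>K \<theta>. 0 \<le> \<theta> \<and> \<theta> < 1 \<and> (\<forall>n. norm ((((*v) C) ^^ n) v) \<le> K * \<theta> ^ n)"
  using assms(2,3)
proof (induction "degree p" arbitrary: p v)
  case 0
  then obtain a where "p = [:a:]" "a \<noteq> 0" by (metis degree_eq_zeroE pCons_0_0)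
  then have "v = 0" using 0 by simp
  moreover have "(((*v) C) ^^ n) 0 = 0" for n by (induction n) auto
  ultimately show ?case by (intro exI[of _ 0]) auto
next
  case (Suc d)
  then have "\<not> constant (poly p)" by (simp add: constant_degree)
  then obtain \<mu> where "poly p \<mu> = 0" using fundamental_theorem_of_algebra by blast
  then obtain q where q: "p = [:- \<mu>, 1:] * q" by (metis dvdE poly_eq_0_iff_dvd)
  have q0: "q \<noteq> 0" using q Suc.prems by auto
  have "degree p = degree [:- \<mu>, 1:] + degree q" unfolding q using q0 by (intro degree_mult_eq) auto
  then have dq: "d = degree q" using Suc.hyps(2) by simp
  let ?w = "C *v v - \<mu> *s v"
  have qw: "papply C q ?w = 0" using Suc.prems(2) unfolding q papply_root .
  show ?case
  proof (cases "norm \<mu> < 1")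
    case True
    obtain K \<theta> where K: "0 \<le> \<theta>" "\<theta> < 1" "\<And>n. norm ((((*v) C) ^^ n) ?w) \<le> K * \<theta> ^ n"
      using Suc.hyps(1)[OF dq q0 qw] by blast
    have it: "(((*v) C) ^^ n) (C *v v - \<mu> *s v) = (((*v) C) ^^ Suc n) v - \<mu> *s (((*v) C) ^^ n) v" for n
    proof (induction n)
      case (Suc n)
      then show ?case by (simp add: matrix_vector_mult_diff_distrib vector_scalar_commute)
    qed simp
    have "norm ((((*v) C) ^^ Suc n) v) \<le> norm \<mu> * norm ((((*v) C) ^^ n) v) + K * \<theta> ^ n" for n
    proof -
      have "norm (\<mu> *s u) = norm \<mu> * norm u" for u :: "complex^'n"
        by (simp add: norm_vec_def norm_mult L2_set_right_distrib)
      then show ?thesis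
        using K(3)[of n] norm_triangle_ineq[of "\<mu> *s (((*v) C) ^^ n) v" "(((*v) C) ^^ n) ?w"] unfolding it
        by simp
    qed
    then show ?thesis using geometric_recursion_bound[of "\<lambda>n. norm ((((*v) C) ^^ n) v)" "norm \<mu>" K \<theta>] True K by simp
  next
    case False
    have "papply C q ?w = C *v papply C q v - \<mu> *s papply C q v"
      by (simp add: papply_diff_scaled papply_commute)
    then have "C *v papply C q v = \<mu> *s papply C q v" using qw by simp
    then have "papply C q v = 0" using spec False by blast
    then show ?thesis using Suc.hyps(1)[OF dq q0] by blast
  qed
qed

text \<open>\<open>Max\<close> bounds its set only if the set is finite. Eigenvalues are roots of an
  annihilating polynomial, so there are finitely many.\<close>

lemma spectral_radius_bound:
  fixes A :: "real^'n^'n"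
  assumes "spectral_radius A < 1" "v \<noteq> 0" "map_matrix complex_of_real A *v v = \<mu> *s v"
  shows "norm \<mu> < 1"
proof -
  obtain p where p: "p \<noteq> 0" "\<And>v. papply (map_matrix complex_of_real A) p v = 0"
    using annihilating_poly by blast
  have "complex_spectrum A \<subseteq> {z. poly p z = 0}"
  proof
    fix \<nu> assume "\<nu> \<in> complex_spectrum A"
    then obtain w where "w \<noteq> 0" "map_matrix complex_of_real A *v w = \<nu> *s w"
      unfolding complex_spectrum_def by blast
    then show "\<nu> \<in> {z. poly p z = 0}" using papply_eigenvector[of _ w \<nu> p] p(2)[of w] by simp
  qed
  then have "finite (complex_spectrum A)" using poly_roots_finite[OF p(1)] finite_subset by blast
  moreover have "\<mu> \<in> complex_spectrum A" unfolding complex_spectrum_def using assms by blast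
  ultimately have "norm \<mu> \<le> spectral_radius A" unfolding spectral_radius_def by (intro Max_ge) auto
  then show ?thesis using assms(1) by simp
qed

lemma powers_tend_to_0:
  fixes A :: "real^'n^'n"
  assumes "spectral_radius A < 1"
  shows "(\<lambda>n. norm ((((*v) A) ^^ n) v)) \<longlonglongrightarrow> 0"
proof -
  let ?C = "map_matrix complex_of_real A"
  let ?c = "\<lambda>v :: real^'n. (\<chi> i. complex_of_real (v $ i))"
  have c: "?C *v ?c v = ?c (A *v v)" for v
    by (simp add: vec_eq_iff matrix_vector_mult_def)
  have cn: "(((*v) ?C) ^^ n) (?c v) = ?c ((((*v) A) ^^ n) v)" for n
    by (induction n) (simp_all add: c)
  have nc: "norm (?c v) = norm v" for v by (simp add: norm_vec_def)
  obtain p where "p \<noteq> 0" "\<And>v. papply ?C p v = 0"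
    using annihilating_poly by blast
  then obtain K \<theta> where K: "0 \<le> \<theta>" "\<theta> < 1" "\<And>n. norm ((((*v) ?C) ^^ n) (?c v)) \<le> K * \<theta> ^ n"
    using orbit_decay[of ?C p "?c v"] spectral_radius_bound[OF assms] by blast
  show ?thesis
  proof (rule tendsto_sandwich[of "\<lambda>_. 0" _ _ "\<lambda>n. K * \<theta> ^ n"])
    show "(\<lambda>n. K * \<theta> ^ n) \<longlonglongrightarrow> 0"
      using tendsto_mult[OF tendsto_const LIMSEQ_power_zero[of \<theta>], of K] K by simp
    show "\<forall>\<^sub>F n in sequentially. norm ((((*v) A) ^^ n) v) \<le> K * \<theta> ^ n"
      using K(3) unfolding cn nc by simp
  qed auto
qed

lemma linear_funpow: "linear ((((*v) A) ^^ n) :: real^'n \<Rightarrow> real^'n)"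
proof (induction n)
  case 0 show ?case by (simp add: linear_id[unfolded id_def])
next
  case (Suc n)
  then show ?case using linear_compose[OF Suc matrix_vector_mul_linear[of A]] by (simp add: comp_def)
qed

theorem adapted_norm:
  fixes A :: "real^'n^'n"
  assumes "spectral_radius A < 1"
  obtains N :: "real^'n \<Rightarrow> real" and \<kappa> c where "0 < \<kappa>" "\<kappa> < 1" "\<And>v w. N (v + w) \<le> N v + N w" "N 0 = 0"
    "\<And>v. N (- v) = N v" "\<And>v. norm v \<le> N v" "\<And>v. N v \<le> c * norm v" "\<And>v. N (A *v v) \<le> \<kappa> * N v"
proof -
  let ?A = "\<lambda>n. ((*v) A) ^^ n"
  have lin: "linear (?A n)" for n by (rule linear_funpow)
  have bound: "norm (?A n v) \<le> (\<Sum>b\<in>Basis. norm (?A n b)) * norm v" for n v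
  proof -
    have "?A n v = ?A n (\<Sum>b\<in>Basis. (v \<bullet> b) *\<^sub>R b)" by (simp add: euclidean_representation)
    also have "\<dots> = (\<Sum>b\<in>Basis. (v \<bullet> b) *\<^sub>R ?A n b)" by (simp add: linear_sum[OF lin] linear_scale[OF lin])
    also have "norm \<dots> \<le> (\<Sum>b\<in>Basis. norm ((v \<bullet> b) *\<^sub>R ?A n b))" by (rule norm_sum)
    also have "\<dots> \<le> (\<Sum>b\<in>Basis. norm v * norm (?A n b))"
      by (intro sum_mono) (auto intro!: mult_right_mono Basis_le_norm)
    finally show ?thesis by (simp add: sum_distrib_left mult.commute)
  qed
  have "(\<lambda>n. \<Sum>b\<in>Basis. norm (?A n b)) \<longlonglongrightarrow> (\<Sum>b\<in>(Basis :: (real^'n) set). 0)"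
    by (intro tendsto_sum powers_tend_to_0 assms)
  then have "\<forall>\<^sub>F n in sequentially. (\<Sum>b\<in>Basis. norm (?A n b)) < 1 / 2"
    by (intro order_tendstoD(2)) auto
  then obtain p0 where p0: "\<And>n. n \<ge> p0 \<Longrightarrow> (\<Sum>b\<in>Basis. norm (?A n b)) < 1 / 2"
    unfolding eventually_sequentially by blast
  define p where "p = Suc p0"
  define \<kappa> where "\<kappa> = root p (1 / 2)"
  have p: "0 < p" unfolding p_def by simp
  have \<kappa>: "0 < \<kappa>" "\<kappa> < 1" "\<kappa> ^ p = 1 / 2" unfolding \<kappa>_def using p by auto
  have Ap: "norm (?A p v) \<le> \<kappa> ^ p * norm v" for v
  proof -
    have "p \<ge> p0" unfolding p_def by simp
    from mult_right_mono[OF less_imp_le[OF p0[OF this]] norm_ge_zero[of v]]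
    show ?thesis unfolding \<kappa>(3) using bound[of p v] by linarith
  qed
  \<comment> \<open>With \<open>\<kappa> ^ p = 1 / 2\<close> and the \<open>p\<close>-th power of
    \<open>A\<close> at most halving the norm, \<open>N (A *v v)\<close> equals \<kappa> times
    \<open>N v - norm v\<close> plus the term of index \<open>p\<close>, and the latter is at most
    \<open>norm v\<close>.\<close>
  define N where "N v = (\<Sum>k<p. norm (?A k v) / \<kappa> ^ k)" for v
  define c where "c = (\<Sum>k<p. (\<Sum>b\<in>Basis. norm (?A k b)) / \<kappa> ^ k)"
  show ?thesis
  proof
    show "0 < \<kappa>" "\<kappa> < 1" by (fact \<kappa>)+
    show "N (v + w) \<le> N v + N w" for v w
      unfolding N_def sum.distrib[symmetric] linear_add[OF lin] add_divide_distrib[symmetric] using \<kappa>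
      by (intro sum_mono divide_right_mono norm_triangle_ineq) auto
    show "N 0 = 0" unfolding N_def by (simp add: linear_0[OF lin])
    show "N (- v) = N v" for v unfolding N_def by (simp add: linear_neg[OF lin])
    show "norm v \<le> N v" for v
      unfolding N_def using member_le_sum[of 0 "{..<p}" "\<lambda>k. norm (?A k v) / \<kappa> ^ k"] p \<kappa> by simp
    show "N v \<le> c * norm v" for v
      unfolding N_def c_def sum_distrib_right
    proof (rule sum_mono)
      fix k
      show "norm (?A k v) / \<kappa> ^ k \<le> (\<Sum>b\<in>Basis. norm (?A k b)) / \<kappa> ^ k * norm v"
        using divide_right_mono[OF bound[of k v], of "\<kappa> ^ k"] \<kappa>(1) by (simp add: mult.commute)
    qed
    fix v
    have "N (A *v v) = (\<Sum>k<p. norm (?A (Suc k) v) / \<kappa> ^ k)"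
      unfolding N_def by (simp add: funpow_swap1)
    also have "\<dots> = \<kappa> * (\<Sum>k<p. norm (?A (Suc k) v) / \<kappa> ^ Suc k)"
      using \<kappa> by (simp add: sum_distrib_left)
    also have "(\<Sum>k<p. norm (?A (Suc k) v) / \<kappa> ^ Suc k) \<le> N v"
    proof -
      have "norm v + (\<Sum>k<p. norm (?A (Suc k) v) / \<kappa> ^ Suc k) = (\<Sum>k<Suc p. norm (?A k v) / \<kappa> ^ k)"
        by (subst sum.lessThan_Suc_shift) simp
      also have "\<dots> = N v + norm (?A p v) / \<kappa> ^ p" unfolding N_def by simp
      also have "norm (?A p v) / \<kappa> ^ p \<le> norm v" using Ap[of v] unfolding \<kappa>(3) by simp
      finally show ?thesis by simp
    qed
    finally show "N (A *v v) \<le> \<kappa> * N v" using \<kappa> by simp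
  qed
qed

theorem local_contraction:
  fixes \<Phi> :: "real^'n \<Rightarrow> real^'n"
  assumes C2: "C2_map \<Phi>" and stable: "lin_stable_fixed_point \<Phi> z"
  obtains N :: "real^'n \<Rightarrow> real" and \<kappa> c \<rho> where "0 < \<kappa>" "\<kappa> < 1" "0 < \<rho>" "\<And>v w. N (v + w) \<le> N v + N w" "N 0 = 0"
    "\<And>v. N (- v) = N v" "\<And>v. norm v \<le> N v" "\<And>v. N v \<le> c * norm v" "0 < c"
    "\<And>x x'. N (x - z) \<le> \<rho> \<Longrightarrow> N (x' - z) \<le> \<rho> \<Longrightarrow> N (\<Phi> x - \<Phi> x') \<le> \<kappa> * N (x - x')"
proof -
  obtain D :: "real^'n \<Rightarrow> ((real^'n) \<Rightarrow>\<^sub>L (real^'n))" and D2 where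
    D: "\<And>x. (\<Phi> has_derivative blinfun_apply (D x)) (at x)"
    and D2: "\<And>x. (D has_derivative blinfun_apply (D2 x)) (at x)"
    using C2 unfolding C2_map_def by blast
  define A where "A = jacobian \<Phi> (at z)"
  have A: "blinfun_apply (D z) = (*v) A"
  proof (rule has_derivative_unique[OF D])
    have "\<Phi> differentiable (at z)" using D unfolding differentiable_def by blast
    then show "(\<Phi> has_derivative (*v) A) (at z)" unfolding A_def jacobian_works .
  qed
  have "spectral_radius A < 1" using stable unfolding lin_stable_fixed_point_def A_def by simp
  then obtain N :: "real^'n \<Rightarrow> real" and \<kappa> c' where N: "0 < \<kappa>" "\<kappa> < 1" "\<And>v w. N (v + w) \<le> N v + N w" "N 0 = 0"
    "\<And>v. N (- v) = N v" "\<And>v. norm v \<le> N v" "\<And>v. N v \<le> c' * norm v" "\<And>v. N (A *v v) \<le> \<kappa> * N v"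
    by (rule adapted_norm) blast
  define c where "c = max c' 1"
  have c: "0 < c" "N v \<le> c * norm v" for v
    unfolding c_def using N(7)[of v] mult_right_mono[of c' "max c' 1" "norm v"] by auto
  \<comment> \<open>How far the derivative may deviate from its value at \<open>z\<close>: after
    conversion between the two norms, which costs \<open>c\<close>, the nonlinear remainder adds
    half of the gap \<open>1 - \<kappa>\<close>, leaving the rate
    \<open>(1 + \<kappa>) / 2\<close>.\<close>
  define \<eta> where "\<eta> = (1 - \<kappa>) / (2 * c)"
  have \<eta>: "0 < \<eta>" unfolding \<eta>_def using N c by simp
  have "isCont D z" using has_derivative_continuous[OF D2[of z]] by simp
  then obtain \<rho>' where \<rho>': "0 < \<rho>'" "\<And>x. dist x z < \<rho>' \<Longrightarrow> dist (D x) (D z) < \<eta>"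
    unfolding continuous_at_eps_delta using \<eta> by blast
  define \<rho> where "\<rho> = \<rho>' / 2"
  have "N (\<Phi> x - \<Phi> x') \<le> (1 + \<kappa>) / 2 * N (x - x')" if x: "N (x - z) \<le> \<rho>" "N (x' - z) \<le> \<rho>" for x x'
  proof -
    have in_ball: "x \<in> ball z \<rho>'" "x' \<in> ball z \<rho>'"
      using x N(6)[of "x - z"] N(6)[of "x' - z"] \<rho>'(1) unfolding \<rho>_def by (auto simp: dist_norm norm_minus_commute)
    have "norm ((\<Phi> x - A *v x) - (\<Phi> x' - A *v x')) \<le> \<eta> * norm (x - x')"
    proof (rule differentiable_bound[OF convex_ball _ _ in_ball])
      fix w assume w: "w \<in> ball z \<rho>'"
      show "((\<lambda>w. \<Phi> w - A *v w) has_derivative (\<lambda>h. blinfun_apply (D w) h - blinfun_apply (D z) h)) (at w within ball z \<rho>')"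
        unfolding A[symmetric]
        by (intro has_derivative_diff has_derivative_at_withinI[OF D] bounded_linear_imp_has_derivative blinfun.bounded_linear_right)
      have "onorm (\<lambda>h. blinfun_apply (D w - D z) h) \<le> \<eta>"
        using \<rho>'(2)[of w] w unfolding norm_blinfun.rep_eq[symmetric] by (simp add: dist_norm norm_minus_commute)
      then show "onorm (\<lambda>h. blinfun_apply (D w) h - blinfun_apply (D z) h) \<le> \<eta>"
        by (simp add: blinfun.diff_left)
    qed
    then have "c * norm ((\<Phi> x - A *v x) - (\<Phi> x' - A *v x')) \<le> c * (\<eta> * norm (x - x'))" using c by simp
    also have "\<dots> = (1 - \<kappa>) / 2 * norm (x - x')" unfolding \<eta>_def using c(1) by simp
    also have "\<dots> \<le> (1 - \<kappa>) / 2 * N (x - x')" using N by (intro mult_left_mono) auto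
    finally have 1: "N ((\<Phi> x - A *v x) - (\<Phi> x' - A *v x')) \<le> (1 - \<kappa>) / 2 * N (x - x')"
      using c(2) order_trans by blast
    have "\<Phi> x - \<Phi> x' = A *v (x - x') + ((\<Phi> x - A *v x) - (\<Phi> x' - A *v x'))"
      by (simp add: matrix_vector_mult_diff_distrib)
    then have "N (\<Phi> x - \<Phi> x') \<le> N (A *v (x - x')) + N ((\<Phi> x - A *v x) - (\<Phi> x' - A *v x'))"
      using N(3) by metis
    then have "N (\<Phi> x - \<Phi> x') \<le> \<kappa> * N (x - x') + (1 - \<kappa>) / 2 * N (x - x')"
      using N(8)[of "x - x'"] 1 by linarith
    then show ?thesis by (simp add: field_simps)
  qed
  then show ?thesis using that[of "(1 + \<kappa>) / 2" \<rho> N c] N c \<rho>'(1) unfolding \<rho>_def by auto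
qed

section \<open>Gaussian noise\<close>

lemma nn_integral_scale:
  fixes f :: "'a::euclidean_space \<Rightarrow> ennreal"
  assumes [measurable]: "f \<in> borel_measurable borel" and "\<sigma> \<noteq> 0"
  shows "(\<integral>\<^sup>+z. f z \<partial>lborel) = ennreal (\<bar>\<sigma>\<bar> ^ DIM('a)) * (\<integral>\<^sup>+v. f (t + \<sigma> *\<^sub>R v) \<partial>lborel)"
proof -
  have "(\<integral>\<^sup>+z. f z \<partial>lborel) = (\<integral>\<^sup>+z. f z \<partial>density (distr lborel borel (\<lambda>v. t + \<sigma> *\<^sub>R v)) (\<lambda>_. ennreal (\<bar>\<sigma>\<bar> ^ DIM('a))))"
    using lborel_affine[OF \<open>\<sigma> \<noteq> 0\<close>, of t] by simp
  also have "\<dots> = (\<integral>\<^sup>+z. ennreal (\<bar>\<sigma>\<bar> ^ DIM('a)) * f z \<partial>distr lborel borel (\<lambda>v. t + \<sigma> *\<^sub>R v))"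
    by (rule nn_integral_density) auto
  also have "\<dots> = (\<integral>\<^sup>+v. ennreal (\<bar>\<sigma>\<bar> ^ DIM('a)) * f (t + \<sigma> *\<^sub>R v) \<partial>lborel)"
    by (rule nn_integral_distr) auto
  finally show ?thesis by (simp add: nn_integral_cmult)
qed

text \<open>\<open>S\<close> is the inverse of the covariance. The normalisation \<open>Z\<close> is
  pinned down by \<open>mass\<close>, which is later read off from the fact that the noise has this
  law, so no Gaussian integral has to be evaluated.\<close>

locale gaussian =
  fixes S :: "'a::euclidean_space \<Rightarrow> 'a" and Z :: real
  assumes S_linear: "linear S" and S_sym: "v \<bullet> S w = w \<bullet> S v"
    and S_pos: "v \<noteq> 0 \<Longrightarrow> 0 < v \<bullet> S v"
    and mass: "(\<integral>\<^sup>+v. ennreal (Z * exp (- (v \<bullet> S v) / 2)) \<partial>lborel) = 1"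
begin

definition \<gamma> :: "'a \<Rightarrow> real" where "\<gamma> v = Z * exp (- (v \<bullet> S v) / 2)"

definition noise :: "real \<Rightarrow> 'a \<Rightarrow> real" where "noise \<sigma> v = \<gamma> (v /\<^sub>R \<sigma>) / \<sigma> ^ DIM('a)"

lemma Z_pos: "0 < Z"
proof (rule ccontr)
  assume "\<not> 0 < Z"
  then have "ennreal (Z * exp (- (v \<bullet> S v) / 2)) = 0" for v
    by (simp add: mult_le_0_iff ennreal_neg)
  then show False using mass by simp
qed

lemma S_cont [continuous_intros]: "continuous_on A S"
  using S_linear linear_continuous_on linear_conv_bounded_linear by blast

lemma S_borel [measurable]: "S \<in> borel_measurable borel"
  by (rule borel_measurable_continuous_onI) (rule S_cont)

lemma quadratic_bounds:
  obtains a b where "0 < a" "0 < b" "\<And>v. a * (norm v)\<^sup>2 \<le> v \<bullet> S v" "\<And>v w. \<bar>v \<bullet> S w\<bar> \<le> b * norm v * norm w"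
proof -
  have "bounded_linear S" using S_linear linear_conv_bounded_linear by blast
  then obtain K where K: "0 < K" "\<And>w. norm (S w) \<le> norm w * K" using bounded_linear.pos_bounded by blast
  have up: "\<bar>v \<bullet> S w\<bar> \<le> K * norm v * norm w" for v w
  proof -
    have "\<bar>v \<bullet> S w\<bar> \<le> norm v * norm (S w)" by (rule Cauchy_Schwarz_ineq2)
    also have "\<dots> \<le> norm v * (norm w * K)" using K by (intro mult_left_mono) auto
    finally show ?thesis by (simp add: mult_ac)
  qed
  obtain e :: 'a where e: "e \<in> Basis" using nonempty_Basis by blast
  have ne: "sphere (0 :: 'a) 1 \<noteq> {}" using e by (auto intro!: exI[of _ e])
  have "continuous_on (sphere (0 :: 'a) 1) (\<lambda>v. v \<bullet> S v)" by (intro continuous_intros)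
  then obtain v0 :: 'a where v0: "v0 \<in> sphere 0 1" "\<And>v. v \<in> sphere 0 1 \<Longrightarrow> v0 \<bullet> S v0 \<le> v \<bullet> S v"
    using continuous_attains_inf[OF compact_sphere ne] by blast
  have "v0 \<bullet> S v0 * (norm v)\<^sup>2 \<le> v \<bullet> S v" for v
  proof (cases "v = 0")
    case False
    let ?u = "v /\<^sub>R norm v"
    have "v0 \<bullet> S v0 \<le> ?u \<bullet> S ?u" by (rule v0) (use False in simp)
    also have "?u \<bullet> S ?u = (v \<bullet> S v) / (norm v)\<^sup>2"
      by (simp add: linear_scale[OF S_linear] power2_eq_square divide_inverse)
    finally show ?thesis using False by (simp add: pos_le_divide_eq)
  qed simp
  moreover have "0 < v0 \<bullet> S v0" using v0(1) by (intro S_pos) auto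
  ultimately show ?thesis using that[OF _ K(1) _ up] by blast
qed

lemma \<gamma>_borel [measurable]: "\<gamma> \<in> borel_measurable borel"
proof -
  have "continuous_on UNIV \<gamma>" unfolding \<gamma>_def by (intro continuous_intros) auto
  then show ?thesis by (rule borel_measurable_continuous_onI)
qed

lemma \<gamma>_pos: "0 < \<gamma> v"
  unfolding \<gamma>_def using Z_pos by simp

lemma \<gamma>_mass: "(\<integral>\<^sup>+v. ennreal (\<gamma> v) \<partial>lborel) = 1"
  unfolding \<gamma>_def by (rule mass)

lemma noise_eq: "\<sigma> > 0 \<Longrightarrow> noise \<sigma> v = Z * exp (- (v \<bullet> S v) / (2 * \<sigma>\<^sup>2)) / \<sigma> ^ DIM('a)"
  unfolding noise_def \<gamma>_def by (simp add: linear_scale[OF S_linear] power2_eq_square field_simps)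

lemma noise_pos: "\<sigma> > 0 \<Longrightarrow> 0 < noise \<sigma> v"
  unfolding noise_def using \<gamma>_pos by simp

lemma noise_cont: "continuous_on A (noise \<sigma>)"
  unfolding noise_def \<gamma>_def by (cases "\<sigma> = 0") (auto intro!: continuous_intros continuous_on_compose2[OF S_cont[of UNIV]])

lemma noise_borel [measurable]: "noise \<sigma> \<in> borel_measurable borel"
  using noise_cont by (rule borel_measurable_continuous_onI)

lemma nn_integral_noise:
  fixes f :: "'a \<Rightarrow> ennreal"
  assumes [measurable]: "f \<in> borel_measurable borel" and \<sigma>: "\<sigma> > 0"
  shows "(\<integral>\<^sup>+z. ennreal (noise \<sigma> z) * f z \<partial>lborel) = (\<integral>\<^sup>+v. ennreal (\<gamma> v) * f (\<sigma> *\<^sub>R v) \<partial>lborel)"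
proof -
  have "(\<integral>\<^sup>+z. ennreal (noise \<sigma> z) * f z \<partial>lborel) =
    ennreal (\<sigma> ^ DIM('a)) * (\<integral>\<^sup>+v. ennreal (noise \<sigma> (\<sigma> *\<^sub>R v)) * f (\<sigma> *\<^sub>R v) \<partial>lborel)"
    using nn_integral_scale[of "\<lambda>z. ennreal (noise \<sigma> z) * f z" \<sigma> 0] \<sigma> by simp
  also have "\<dots> = (\<integral>\<^sup>+v. ennreal (\<sigma> ^ DIM('a)) * (ennreal (noise \<sigma> (\<sigma> *\<^sub>R v)) * f (\<sigma> *\<^sub>R v)) \<partial>lborel)"
    by (simp add: nn_integral_cmult)
  also have "\<dots> = (\<integral>\<^sup>+v. ennreal (\<gamma> v) * f (\<sigma> *\<^sub>R v) \<partial>lborel)"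
  proof (rule nn_integral_cong)
    fix v
    have "ennreal (\<sigma> ^ DIM('a)) * ennreal (noise \<sigma> (\<sigma> *\<^sub>R v)) = ennreal (\<gamma> v)"
      using \<sigma> \<gamma>_pos[of v] unfolding noise_def by (subst ennreal_mult[symmetric]) auto
    then show "ennreal (\<sigma> ^ DIM('a)) * (ennreal (noise \<sigma> (\<sigma> *\<^sub>R v)) * f (\<sigma> *\<^sub>R v)) = ennreal (\<gamma> v) * f (\<sigma> *\<^sub>R v)"
      by (simp add: mult.assoc[symmetric])
  qed
  finally show ?thesis .
qed

lemma noise_mass: "\<sigma> > 0 \<Longrightarrow> (\<integral>\<^sup>+v. ennreal (noise \<sigma> v) \<partial>lborel) = 1"
  using nn_integral_noise[of "\<lambda>_. 1" \<sigma>] \<gamma>_mass by simp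

lemma scaled_law:
  assumes \<sigma>: "\<sigma> > 0"
  shows "distr (density lborel (\<lambda>v. ennreal (\<gamma> v))) borel (\<lambda>v. \<sigma> *\<^sub>R v) = density lborel (\<lambda>v. ennreal (noise \<sigma> v))"
proof (rule measure_eqI)
  fix A assume "A \<in> sets (distr (density lborel (\<lambda>v. ennreal (\<gamma> v))) borel (\<lambda>v. \<sigma> *\<^sub>R v))"
  then have [measurable]: "A \<in> sets borel" by simp
  have "emeasure (distr (density lborel (\<lambda>v. ennreal (\<gamma> v))) borel (\<lambda>v. \<sigma> *\<^sub>R v)) A = (\<integral>\<^sup>+v. ennreal (\<gamma> v) * indicator A (\<sigma> *\<^sub>R v) \<partial>lborel)"
    by (simp add: emeasure_distr emeasure_density vimage_def indicator_def)
  also have "\<dots> = (\<integral>\<^sup>+z. ennreal (noise \<sigma> z) * indicator A z \<partial>lborel)"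
    using nn_integral_noise[of "indicator A" \<sigma>] \<sigma> by simp
  finally show "emeasure (distr (density lborel (\<lambda>v. ennreal (\<gamma> v))) borel (\<lambda>v. \<sigma> *\<^sub>R v)) A =
    emeasure (density lborel (\<lambda>v. ennreal (noise \<sigma> v))) A"
    by (simp add: emeasure_density)
qed simp

text \<open>Half of the exponent is given away: the density is dominated by the density with
  \<sigma> enlarged by \<open>sqrt 2\<close>, times a constant and the remaining exponential. The
  enlarged density has mass one, which bounds the probability in every dimension.\<close>

lemma noise_tail:
  assumes \<sigma>: "\<sigma> > 0" and a: "\<And>v. a * (norm v)\<^sup>2 \<le> v \<bullet> S v" "0 < a" and A: "A \<in> sets borel"
    and r: "\<And>v. v \<in> A \<Longrightarrow> r \<le> norm v" "0 \<le> r"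
  shows "measure (density lborel (\<lambda>v. ennreal (noise \<sigma> v))) A \<le> sqrt 2 ^ DIM('a) * exp (- (a * r\<^sup>2 / (4 * \<sigma>\<^sup>2)))"
proof -
  let ?C = "sqrt 2 ^ DIM('a) * exp (- (a * r\<^sup>2 / (4 * \<sigma>\<^sup>2)))"
  have le: "noise \<sigma> v \<le> ?C * noise (sqrt 2 * \<sigma>) v" if "v \<in> A" for v
  proof -
    have "r\<^sup>2 \<le> (norm v)\<^sup>2" using r(1)[OF that] r(2) by (intro power_mono) auto
    then have "a * r\<^sup>2 \<le> v \<bullet> S v" using a(1)[of v] mult_left_mono[of "r\<^sup>2" "(norm v)\<^sup>2" a] a(2) by linarith
    then have "exp (- (v \<bullet> S v) / (4 * \<sigma>\<^sup>2)) \<le> exp (- (a * r\<^sup>2 / (4 * \<sigma>\<^sup>2)))"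
      using \<sigma> by (simp add: divide_right_mono)
    then have "exp (- (v \<bullet> S v) / (4 * \<sigma>\<^sup>2)) * (Z * exp (- (v \<bullet> S v) / (4 * \<sigma>\<^sup>2)) / \<sigma> ^ DIM('a)) \<le>
      exp (- (a * r\<^sup>2 / (4 * \<sigma>\<^sup>2))) * (Z * exp (- (v \<bullet> S v) / (4 * \<sigma>\<^sup>2)) / \<sigma> ^ DIM('a))"
      using \<sigma> Z_pos by (intro mult_right_mono) auto
    moreover have "noise \<sigma> v = exp (- (v \<bullet> S v) / (4 * \<sigma>\<^sup>2)) * (Z * exp (- (v \<bullet> S v) / (4 * \<sigma>\<^sup>2)) / \<sigma> ^ DIM('a))"
    proof -
      have "exp (- (v \<bullet> S v) / (2 * \<sigma>\<^sup>2)) = exp (- (v \<bullet> S v) / (4 * \<sigma>\<^sup>2)) * exp (- (v \<bullet> S v) / (4 * \<sigma>\<^sup>2))"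
        unfolding exp_add[symmetric] by (simp add: field_simps)
      then show ?thesis unfolding noise_eq[OF \<sigma>] by simp
    qed
    moreover have "noise (sqrt 2 * \<sigma>) v = Z * exp (- (v \<bullet> S v) / (4 * \<sigma>\<^sup>2)) / (sqrt 2 ^ DIM('a) * \<sigma> ^ DIM('a))"
      using \<sigma> by (subst noise_eq) (auto simp: power_mult_distrib)
    ultimately show ?thesis by (simp add: field_simps)
  qed
  have "emeasure (density lborel (\<lambda>v. ennreal (noise \<sigma> v))) A = (\<integral>\<^sup>+v. ennreal (noise \<sigma> v) * indicator A v \<partial>lborel)"
    using A by (simp add: emeasure_density)
  also have "\<dots> \<le> (\<integral>\<^sup>+v. ennreal ?C * ennreal (noise (sqrt 2 * \<sigma>) v) \<partial>lborel)"
  proof (rule nn_integral_mono)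
    fix v
    show "ennreal (noise \<sigma> v) * indicator A v \<le> ennreal ?C * ennreal (noise (sqrt 2 * \<sigma>) v)"
    proof (cases "v \<in> A")
      case True
      have "0 \<le> noise (sqrt 2 * \<sigma>) v" using noise_pos[of "sqrt 2 * \<sigma>" v] \<sigma> by simp
      then have "ennreal ?C * ennreal (noise (sqrt 2 * \<sigma>) v) = ennreal (?C * noise (sqrt 2 * \<sigma>) v)"
        by (intro ennreal_mult[symmetric]) auto
      then show ?thesis using le[OF True] True by (simp add: ennreal_leI)
    qed simp
  qed
  also have "\<dots> = ennreal ?C"
    using \<sigma> by (subst nn_integral_cmult) (auto simp: noise_mass)
  finally show ?thesis by (simp add: measure_def enn2real_leI)
qed

lemma noise_lower:
  assumes \<sigma>: "\<sigma> > 0" and b: "\<And>v w. \<bar>v \<bullet> S w\<bar> \<le> b * norm v * norm w" "0 < b" and s: "norm w \<le> s"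
  shows "Z / \<sigma> ^ DIM('a) * exp (- (b * s\<^sup>2 / (2 * \<sigma>\<^sup>2))) \<le> noise \<sigma> w"
proof -
  have "w \<bullet> S w \<le> b * (norm w * norm w)" using b(1)[of w w] by (simp add: mult.assoc)
  also have "\<dots> \<le> b * (s * s)" using s b(2) order_trans[OF norm_ge_zero s] by (intro mult_left_mono mult_mono) auto
  finally have "exp (- (b * s\<^sup>2 / (2 * \<sigma>\<^sup>2))) \<le> exp (- (w \<bullet> S w) / (2 * \<sigma>\<^sup>2))"
    using \<sigma> by (simp add: power2_eq_square divide_right_mono)
  then have "Z / \<sigma> ^ DIM('a) * exp (- (b * s\<^sup>2 / (2 * \<sigma>\<^sup>2))) \<le> Z / \<sigma> ^ DIM('a) * exp (- (w \<bullet> S w) / (2 * \<sigma>\<^sup>2))"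
    using \<sigma> Z_pos by (intro mult_left_mono) auto
  then show ?thesis unfolding noise_eq[OF \<sigma>] by simp
qed

text \<open>By symmetry of \<open>S\<close> the difference of the two quadratic forms is the product
  of \<open>w' - w\<close> with \<open>S (w' + w)\<close>. On a ball the logarithm of the density is
  therefore Lipschitz with a constant of order \<open>1 / \<sigma>\<^sup>2\<close>.\<close>

lemma noise_ratio:
  assumes \<sigma>: "\<sigma> > 0" and b: "\<And>v w. \<bar>v \<bullet> S w\<bar> \<le> b * norm v * norm w" "0 < b"
    and w: "norm w \<le> r" "norm w' \<le> r" "norm (w - w') \<le> s"
  shows "noise \<sigma> w \<le> exp (b * r / \<sigma>\<^sup>2 * s) * noise \<sigma> w'"
proof -
  have "w' \<bullet> S w' - w \<bullet> S w = (w' - w) \<bullet> S (w' + w)"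
    using S_sym[of w' w] by (simp add: linear_add[OF S_linear] inner_diff_left inner_add_right)
  also have "\<dots> \<le> b * norm (w' - w) * norm (w' + w)" using b(1)[of "w' - w" "w' + w"] by linarith
  also have "\<dots> \<le> b * s * (2 * r)"
    using w b(2) norm_triangle_ineq[of w' w] by (intro mult_mono) (auto simp: norm_minus_commute intro: mult_nonneg_nonneg order_trans[OF norm_ge_zero])
  finally have "- (w \<bullet> S w) \<le> b * s * (2 * r) - w' \<bullet> S w'" by simp
  then have "- (w \<bullet> S w) / (2 * \<sigma>\<^sup>2) \<le> (b * s * (2 * r) - w' \<bullet> S w') / (2 * \<sigma>\<^sup>2)"
    using \<sigma> by (intro divide_right_mono) auto
  also have "\<dots> = b * r / \<sigma>\<^sup>2 * s + - (w' \<bullet> S w') / (2 * \<sigma>\<^sup>2)" using \<sigma> by (simp add: field_simps)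
  finally have "exp (- (w \<bullet> S w) / (2 * \<sigma>\<^sup>2)) \<le> exp (b * r / \<sigma>\<^sup>2 * s) * exp (- (w' \<bullet> S w') / (2 * \<sigma>\<^sup>2))"
    unfolding exp_add[symmetric] by simp
  then have "Z / \<sigma> ^ DIM('a) * exp (- (w \<bullet> S w) / (2 * \<sigma>\<^sup>2)) \<le> Z / \<sigma> ^ DIM('a) * (exp (b * r / \<sigma>\<^sup>2 * s) * exp (- (w' \<bullet> S w') / (2 * \<sigma>\<^sup>2)))"
    using \<sigma> Z_pos by (intro mult_left_mono) auto
  then show ?thesis unfolding noise_eq[OF \<sigma>] by (simp add: mult_ac)
qed

text \<open>Integrability is borrowed from the noise itself, with \<sigma> so large that its
  quadratic form is at most that of the given exponential.\<close>

lemma exp_le_integrable: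
  assumes "0 < c"
  shows "(\<integral>\<^sup>+z. ennreal (exp (- (c * (norm z)\<^sup>2))) \<partial>(lborel :: 'a measure)) < \<infinity>"
proof -
  obtain a b where b: "0 < b" "\<And>v w. \<bar>v \<bullet> S w\<bar> \<le> b * norm v * norm w" by (rule quadratic_bounds) blast
  define \<sigma> where "\<sigma> = sqrt (b / (2 * c))"
  have \<sigma>: "0 < \<sigma>" "\<sigma>\<^sup>2 = b / (2 * c)" unfolding \<sigma>_def using b assms by auto
  have le: "exp (- (c * (norm z)\<^sup>2)) \<le> (\<sigma> ^ DIM('a) / Z) * noise \<sigma> z" for z
  proof -
    have "z \<bullet> S z \<le> b * (norm z)\<^sup>2" using b(2)[of z z] by (simp add: power2_eq_square mult.assoc)
    then have "(z \<bullet> S z) / (2 * \<sigma>\<^sup>2) \<le> c * (norm z)\<^sup>2" unfolding \<sigma>(2) using b(1) assms by (simp add: field_simps)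
    then have "exp (- (c * (norm z)\<^sup>2)) \<le> exp (- (z \<bullet> S z) / (2 * \<sigma>\<^sup>2))" by simp
    then show ?thesis unfolding noise_eq[OF \<sigma>(1)] using \<sigma>(1) Z_pos by simp
  qed
  have "(\<integral>\<^sup>+z. ennreal (exp (- (c * (norm z)\<^sup>2))) \<partial>(lborel :: 'a measure)) \<le> (\<integral>\<^sup>+z. ennreal (\<sigma> ^ DIM('a) / Z) * ennreal (noise \<sigma> z) \<partial>lborel)"
    using le \<sigma>(1) Z_pos noise_pos[OF \<sigma>(1)]
    by (intro nn_integral_mono) (subst ennreal_mult[symmetric], auto intro!: ennreal_leI simp: less_imp_le)
  also have "\<dots> = ennreal (\<sigma> ^ DIM('a) / Z)"
    by (subst nn_integral_cmult) (auto simp: noise_mass[OF \<sigma>(1)])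
  finally show ?thesis by (rule le_less_trans) simp
qed

text \<open>From \<open>norm z \<le> norm (z - u) + norm u\<close> half of the squared norm of
  \<open>z\<close> is at most that of \<open>z - u\<close> plus that of \<open>u\<close>, so shifts
  by bounded vectors share one Gaussian envelope of larger variance.\<close>

lemma noise_dominated:
  assumes \<sigma>: "\<sigma> > 0"
  shows "\<exists>G\<in>borel_measurable borel. (\<integral>\<^sup>+z. G z \<partial>lborel) < \<infinity> \<and>
      (\<forall>u z. norm u \<le> r \<longrightarrow> ennreal (noise \<sigma> (z - u)) \<le> G z)"
proof -
  obtain a b where a: "0 < a" "\<And>v. a * (norm v)\<^sup>2 \<le> v \<bullet> S v" by (rule quadratic_bounds) blast
  define c where "c = a / (4 * \<sigma>\<^sup>2)"
  define C where "C = Z / \<sigma> ^ DIM('a) * exp (a * r\<^sup>2 / (2 * \<sigma>\<^sup>2))"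
  have c: "0 < c" unfolding c_def using a \<sigma> by simp
  have C: "0 \<le> C" unfolding C_def using Z_pos \<sigma> by simp
  let ?G = "\<lambda>z::'a. ennreal C * ennreal (exp (- (c * (norm z)\<^sup>2)))"
  have "(\<integral>\<^sup>+z. ?G z \<partial>lborel) < \<infinity>"
    using exp_le_integrable[OF c] by (simp add: nn_integral_cmult ennreal_mult_less_top)
  moreover have "ennreal (noise \<sigma> (z - u)) \<le> ?G z" if u: "norm u \<le> r" for u z
  proof -
    have "norm z \<le> norm (z - u) + norm u" using norm_triangle_ineq[of "z - u" u] by simp
    then have "(norm z)\<^sup>2 \<le> (norm (z - u) + norm u)\<^sup>2" by (intro power_mono) auto
    also have "\<dots> \<le> 2 * (norm (z - u))\<^sup>2 + 2 * (norm u)\<^sup>2"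
      using zero_le_power2[of "norm (z - u) - norm u"] by (simp add: power2_eq_square algebra_simps)
    also have "\<dots> \<le> 2 * (norm (z - u))\<^sup>2 + 2 * r\<^sup>2" using u power_mono[OF u norm_ge_zero, of 2] by simp
    finally have "a * ((norm z)\<^sup>2 / 2 - r\<^sup>2) \<le> a * (norm (z - u))\<^sup>2" using a(1) by (intro mult_left_mono) auto
    then have "a * ((norm z)\<^sup>2 / 2 - r\<^sup>2) \<le> (z - u) \<bullet> S (z - u)" using a(2)[of "z - u"] by linarith
    then have "- ((z - u) \<bullet> S (z - u)) / (2 * \<sigma>\<^sup>2) \<le> - (a * ((norm z)\<^sup>2 / 2 - r\<^sup>2)) / (2 * \<sigma>\<^sup>2)"
      using \<sigma> by (intro divide_right_mono) auto
    also have "\<dots> = a * r\<^sup>2 / (2 * \<sigma>\<^sup>2) + - (c * (norm z)\<^sup>2)" unfolding c_def using \<sigma> by (simp add: field_simps)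
    finally have "exp (- ((z - u) \<bullet> S (z - u)) / (2 * \<sigma>\<^sup>2)) \<le> exp (a * r\<^sup>2 / (2 * \<sigma>\<^sup>2)) * exp (- (c * (norm z)\<^sup>2))"
      unfolding exp_add[symmetric] by simp
    then have "Z / \<sigma> ^ DIM('a) * exp (- ((z - u) \<bullet> S (z - u)) / (2 * \<sigma>\<^sup>2)) \<le> Z / \<sigma> ^ DIM('a) * (exp (a * r\<^sup>2 / (2 * \<sigma>\<^sup>2)) * exp (- (c * (norm z)\<^sup>2)))"
      using \<sigma> Z_pos by (intro mult_left_mono) auto
    then have "noise \<sigma> (z - u) \<le> C * exp (- (c * (norm z)\<^sup>2))" unfolding noise_eq[OF \<sigma>] C_def by (simp add: mult_ac)
    then have "ennreal (noise \<sigma> (z - u)) \<le> ennreal (C * exp (- (c * (norm z)\<^sup>2)))" by (rule ennreal_leI)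
    also have "\<dots> = ?G z" using C by (simp add: ennreal_mult)
    finally show ?thesis .
  qed
  ultimately show ?thesis by (intro bexI[of _ ?G]) auto
qed

text \<open>The constant does not depend on \<open>m\<close>: averaging over \<open>v\<close> and \<open>-v\<close> removes the linear term
  in the exponent, since \<open>e\<^sup>t + e\<^sup>-\<^sup>t \<ge> 2\<close>.\<close>

lemma noise_le_ball_mass:
  assumes \<sigma>: "\<sigma> > 0" and b: "\<And>v w. \<bar>v \<bullet> S w\<bar> \<le> b * norm v * norm w" "0 < b"
    and A: "A \<in> sets borel" "cball y \<sigma> \<subseteq> A"
  shows "ennreal (noise \<sigma> (y - m) * (\<sigma> ^ DIM('a) * exp (- b / 2) * measure lborel (cball (0::'a) 1)))
    \<le> (\<integral>\<^sup>+z. ennreal (noise \<sigma> (z - m)) * indicator A z \<partial>lborel)"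
proof -
  define u where "u = (y - m) /\<^sub>R \<sigma>"
  let ?D = "cball (0::'a) 1"
  let ?l = "\<lambda>v. u \<bullet> S v"
  have [measurable]: "?D \<in> sets borel" "A \<in> sets borel" using A(1) by simp_all
  have reflect: "(\<integral>\<^sup>+v. ennreal (exp (- ?l v)) * indicator ?D v \<partial>lborel) = (\<integral>\<^sup>+v. ennreal (exp (?l v)) * indicator ?D v \<partial>lborel)"
    using nn_integral_scale[of "\<lambda>v. ennreal (exp (- ?l v)) * indicator ?D v" "-1" 0]
    by (simp add: linear_neg[OF S_linear] indicator_def)
  have "2 * emeasure lborel ?D = (\<integral>\<^sup>+v. 2 * indicator ?D v \<partial>lborel)"
    by (rule nn_integral_cmult_indicator[symmetric]) simp
  also have "\<dots> \<le> (\<integral>\<^sup>+v. ennreal (exp (- ?l v)) * indicator ?D v + ennreal (exp (?l v)) * indicator ?D v \<partial>lborel)"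
  proof (rule nn_integral_mono)
    fix v
    have "2 \<le> exp (- ?l v) + exp (?l v)" using exp_ge_add_one_self[of "- ?l v"] exp_ge_add_one_self[of "?l v"] by linarith
    then have "ennreal 2 \<le> ennreal (exp (- ?l v) + exp (?l v))" by (rule ennreal_leI)
    then show "2 * indicator ?D v \<le> ennreal (exp (- ?l v)) * indicator ?D v + ennreal (exp (?l v)) * indicator ?D v"
      by (simp add: ennreal_plus split: split_indicator)
  qed
  also have "\<dots> = 2 * (\<integral>\<^sup>+v. ennreal (exp (- ?l v)) * indicator ?D v \<partial>lborel)"
    by (subst nn_integral_add) (auto simp: reflect[symmetric] mult_2)
  finally have 1: "emeasure lborel ?D \<le> (\<integral>\<^sup>+v. ennreal (exp (- ?l v)) * indicator ?D v \<partial>lborel)"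
    by (subst (asm) ennreal_mult_le_mult_iff) auto
  have nu: "noise \<sigma> (y - m) = \<gamma> u / \<sigma> ^ DIM('a)" unfolding noise_def u_def ..
  have "ennreal (noise \<sigma> (y - m) * (\<sigma> ^ DIM('a) * exp (- b / 2) * measure lborel ?D)) = ennreal (\<gamma> u * exp (- b / 2)) * emeasure lborel ?D"
  proof -
    have "emeasure lborel ?D < \<infinity>" by (rule emeasure_compact_finite) simp
    then have "emeasure lborel ?D = ennreal (measure lborel ?D)" by (simp add: emeasure_eq_ennreal_measure)
    moreover have "ennreal (noise \<sigma> (y - m) * (\<sigma> ^ DIM('a) * exp (- b / 2) * measure lborel ?D)) =
        ennreal (\<gamma> u * exp (- b / 2) * measure lborel ?D)"
      unfolding nu using \<sigma> by (simp add: mult.assoc)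
    moreover have "\<dots> = ennreal (\<gamma> u * exp (- b / 2)) * ennreal (measure lborel ?D)"
      by (rule ennreal_mult) (use \<gamma>_pos[of u] in \<open>auto simp: less_imp_le\<close>)
    ultimately show ?thesis by simp
  qed
  also have "\<dots> \<le> ennreal (\<gamma> u * exp (- b / 2)) * (\<integral>\<^sup>+v. ennreal (exp (- ?l v)) * indicator ?D v \<partial>lborel)"
    by (rule mult_left_mono[OF 1]) simp
  also have "\<dots> = (\<integral>\<^sup>+v. ennreal (\<gamma> u * exp (- b / 2)) * (ennreal (exp (- ?l v)) * indicator ?D v) \<partial>lborel)"
    by (rule nn_integral_cmult[symmetric]) measurable
  also have "\<dots> \<le> (\<integral>\<^sup>+v. ennreal (\<gamma> (u + v)) * indicator ?D v \<partial>lborel)"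
  proof (rule nn_integral_mono)
    fix v
    show "ennreal (\<gamma> u * exp (- b / 2)) * (ennreal (exp (- ?l v)) * indicator ?D v) \<le> ennreal (\<gamma> (u + v)) * indicator ?D v"
    proof (cases "v \<in> ?D")
      case True
      have "b * norm v * norm v \<le> b * 1 * 1" using True b(2) by (intro mult_mono) auto
      then have "v \<bullet> S v \<le> b" using b(1)[of v v] by linarith
      then have "- (u \<bullet> S u) / 2 - b / 2 - ?l v \<le> - ((u + v) \<bullet> S (u + v)) / 2"
        using S_sym[of u v] by (simp add: linear_add[OF S_linear] inner_add_left inner_add_right field_simps)
      then have "exp (- (u \<bullet> S u) / 2) * exp (- b / 2) * exp (- ?l v) \<le> exp (- ((u + v) \<bullet> S (u + v)) / 2)"
        unfolding exp_add[symmetric] by simp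
      then have "Z * (exp (- (u \<bullet> S u) / 2) * exp (- b / 2) * exp (- ?l v)) \<le> Z * exp (- ((u + v) \<bullet> S (u + v)) / 2)"
        using Z_pos by (intro mult_left_mono) auto
      then have "\<gamma> u * exp (- b / 2) * exp (- ?l v) \<le> \<gamma> (u + v)" unfolding \<gamma>_def by (simp add: mult_ac)
      moreover have "ennreal (\<gamma> u * exp (- b / 2)) * ennreal (exp (- ?l v)) = ennreal (\<gamma> u * exp (- b / 2) * exp (- ?l v))"
        using \<gamma>_pos[of u] by (intro ennreal_mult[symmetric]) (auto simp: less_imp_le)
      ultimately show ?thesis using True by (simp add: ennreal_leI)
    qed simp
  qed
  also have "\<dots> = (\<integral>\<^sup>+v. ennreal (\<sigma> ^ DIM('a)) * (ennreal (noise \<sigma> (y + \<sigma> *\<^sub>R v - m)) * indicator ?D v) \<partial>lborel)"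
  proof (rule nn_integral_cong)
    fix v
    have "(y + \<sigma> *\<^sub>R v - m) /\<^sub>R \<sigma> = u + v" unfolding u_def using \<sigma> by (simp add: algebra_simps)
    then have "ennreal (\<sigma> ^ DIM('a)) * ennreal (noise \<sigma> (y + \<sigma> *\<^sub>R v - m)) = ennreal (\<gamma> (u + v))"
      using \<sigma> \<gamma>_pos[of "u + v"] unfolding noise_def by (subst ennreal_mult[symmetric]) (auto simp: less_imp_le)
    then show "ennreal (\<gamma> (u + v)) * indicator ?D v = ennreal (\<sigma> ^ DIM('a)) * (ennreal (noise \<sigma> (y + \<sigma> *\<^sub>R v - m)) * indicator ?D v)"
      by (simp add: mult.assoc[symmetric])
  qed
  also have "\<dots> \<le> (\<integral>\<^sup>+v. ennreal (\<sigma> ^ DIM('a)) * (ennreal (noise \<sigma> (y + \<sigma> *\<^sub>R v - m)) * indicator A (y + \<sigma> *\<^sub>R v)) \<partial>lborel)"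
  proof (intro nn_integral_mono mult_left_mono)
    fix v
    have "y + \<sigma> *\<^sub>R v \<in> A" if "v \<in> ?D"
      using A(2) that \<sigma> by (intro subsetD[OF A(2)]) (simp add: dist_norm mult_left_le)
    then show "indicator ?D v \<le> (indicator A (y + \<sigma> *\<^sub>R v) :: ennreal)" by (auto split: split_indicator)
  qed auto
  also have "\<dots> = ennreal (\<sigma> ^ DIM('a)) * (\<integral>\<^sup>+v. ennreal (noise \<sigma> (y + \<sigma> *\<^sub>R v - m)) * indicator A (y + \<sigma> *\<^sub>R v) \<partial>lborel)"
    by (intro nn_integral_cmult) measurable
  also have "\<dots> = (\<integral>\<^sup>+z. ennreal (noise \<sigma> (z - m)) * indicator A z \<partial>lborel)"
    using nn_integral_scale[of "\<lambda>z. ennreal (noise \<sigma> (z - m)) * indicator A z" \<sigma> y] \<sigma> A(1) by simp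
  finally show ?thesis .
qed

text \<open>The constant \<open>L\<close> of the assumption is fixed here as 7/4. By the indexing of
  \<open>kp\<close>, this concerns the power \<open>n + 1\<close>. Since \<open>enn2real\<close>
  maps infinity to 0, finiteness of the densities is established separately.\<close>

definition flat :: "('a \<Rightarrow> 'a) \<Rightarrow> real \<Rightarrow> 'a set \<Rightarrow> 'a set \<Rightarrow> nat \<Rightarrow> bool" where
  "flat \<Phi> \<sigma> M B n \<longleftrightarrow> (\<forall>x\<in>B. \<forall>x'\<in>B. \<forall>y\<in>B.
     enn2real (trace_chain.kp \<Phi> (noise \<sigma>) M B n x y) \<le> 7 / 4 * enn2real (trace_chain.kp \<Phi> (noise \<sigma>) M B n x' y))"

end

section \<open>Quantities that vanish as the noise tends to zero\<close>

lemma power_exp_decay: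
  assumes "0 < c"
  shows "((\<lambda>y::real. y ^ m * exp (- (c * y))) \<longlongrightarrow> 0) at_top"
proof -
  have "((\<lambda>y. (c * y) ^ m / exp (c * y)) \<longlongrightarrow> 0) at_top"
    by (rule filterlim_compose[OF tendsto_power_div_exp_0 filterlim_tendsto_pos_mult_at_top[OF tendsto_const assms filterlim_ident]])
  then have "((\<lambda>y. inverse (c ^ m) * ((c * y) ^ m / exp (c * y))) \<longlongrightarrow> inverse (c ^ m) * 0) at_top"
    by (intro tendsto_mult tendsto_const)
  moreover have "inverse (c ^ m) * ((c * y) ^ m / exp (c * y)) = y ^ m * exp (- (c * y))" for y
    using assms by (simp add: power_mult_distrib exp_minus field_simps)
  ultimately show ?thesis by simp
qed

lemma small_near_0:
  fixes f :: "real \<Rightarrow> real"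
  assumes "(f \<longlongrightarrow> 0) at_top" "0 < \<epsilon>"
  shows "\<forall>\<^sub>F \<sigma> in at_right 0. f (1 / \<sigma>) < \<epsilon>"
proof -
  have "\<forall>\<^sub>F y in at_top. f y < \<epsilon>" using order_tendstoD(2)[OF assms] .
  then have "\<forall>\<^sub>F \<sigma> in at_right 0. f (inverse \<sigma>) < \<epsilon>"
    by (rule filterlim_inverse_at_top_right[unfolded filterlim_iff, rule_format])
  then show ?thesis by (simp add: divide_inverse)
qed

lemma power_exp_small:
  assumes "0 < c" "0 < \<epsilon>"
  shows "\<forall>\<^sub>F \<sigma> in at_right 0. K * (1 / \<sigma>) ^ m * exp (- (c / \<sigma>)) \<le> (\<epsilon> :: real)"
proof -
  have "((\<lambda>y. K * (y ^ m * exp (- (c * y)))) \<longlongrightarrow> K * 0) at_top"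
    by (intro tendsto_mult tendsto_const power_exp_decay assms)
  from small_near_0[of "\<lambda>y. K * (y ^ m * exp (- (c * y)))", simplified, OF this[simplified] assms(2)]
  show ?thesis by eventually_elim (simp add: mult.assoc)
qed

lemma power_gauss_small:
  assumes "0 < c" "0 < \<epsilon>" "0 \<le> K"
  shows "\<forall>\<^sub>F \<sigma> in at_right 0. K * (1 / \<sigma>) ^ m * exp (- (c / \<sigma>\<^sup>2)) \<le> (\<epsilon> :: real)"
proof -
  have "\<forall>\<^sub>F \<sigma> in at_right 0. 0 < \<sigma> \<and> \<sigma> < (1 :: real)"
    unfolding eventually_at_right_field by (intro exI[of _ 1]) auto
  then show ?thesis using power_exp_small[OF assms(1,2), of K m]
  proof eventually_elim
    case (elim \<sigma>)
    have "\<sigma>\<^sup>2 \<le> \<sigma>" using elim by (simp add: power2_eq_square mult_left_le_one_le)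
    then have "c / \<sigma> \<le> c / \<sigma>\<^sup>2" using elim assms by (intro divide_left_mono) auto
    then have "K * (1 / \<sigma>) ^ m * exp (- (c / \<sigma>\<^sup>2)) \<le> K * (1 / \<sigma>) ^ m * exp (- (c / \<sigma>))"
      using elim assms by (intro mult_left_mono) auto
    then show ?case using elim by linarith
  qed
qed

lemma exp_le_quadratic: "0 \<le> x \<Longrightarrow> x \<le> 1 \<Longrightarrow> exp x \<le> 1 + x + x\<^sup>2" for x :: real
  by (rule exp_bound)

lemma one_plus_power_le: "0 \<le> x \<Longrightarrow> (1 + x) ^ n \<le> exp (real n * x)" for x :: real
proof -
  assume "0 \<le> x"
  then have "(1 + x) ^ n \<le> exp x ^ n" using exp_ge_add_one_self[of x] by (intro power_mono) auto
  then show ?thesis by (simp add: exp_of_nat_mult)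
qed

text \<open>Nested radii \<open>s l\<close> decreasing from \<open>\<rho>\<close> to the core of size \<open>\<delta>\<close>; a step from one layer
  reaches the next unless the noise exceeds \<open>(1 - \<kappa>) * \<delta> / 2\<close>.\<close>

lemma layers:
  assumes "0 < \<kappa>" "\<kappa> < 1" "0 < \<delta>" "\<delta> \<le> (\<rho> :: real)"
  obtains s :: "nat \<Rightarrow> real" and J where "s 0 = \<rho>" "\<And>l. \<kappa> * s l + (1 - \<kappa>) * \<delta> / 2 \<le> s (Suc l)"
    "decseq s" "s J \<le> \<delta>" "\<And>l. \<delta> / 2 \<le> s l"
proof -
  define s where "s l = \<delta> / 2 + \<kappa> ^ l * (\<rho> - \<delta> / 2)" for l
  have "(\<lambda>l. \<kappa> ^ l * (\<rho> - \<delta> / 2)) \<longlonglongrightarrow> 0 * (\<rho> - \<delta> / 2)"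
    by (intro tendsto_mult LIMSEQ_power_zero tendsto_const) (use assms in auto)
  then have "\<forall>\<^sub>F l in sequentially. \<kappa> ^ l * (\<rho> - \<delta> / 2) < \<delta> / 2"
    using assms by (intro order_tendstoD(2)[where a="\<delta> / 2" and y="0 * (\<rho> - \<delta> / 2)"]) auto
  then obtain J where "\<kappa> ^ J * (\<rho> - \<delta> / 2) < \<delta> / 2" unfolding eventually_sequentially by blast
  then have "s J \<le> \<delta>" unfolding s_def by simp
  moreover have "decseq s"
  proof (rule decseq_SucI)
    fix l
    have "\<kappa> ^ Suc l \<le> \<kappa> ^ l" using assms by (simp add: mult_left_le_one_le)
    then show "s (Suc l) \<le> s l" unfolding s_def using assms by (intro add_left_mono mult_right_mono) auto
  qed
  moreover have "\<kappa> * s l + (1 - \<kappa>) * \<delta> / 2 = s (Suc l)" for l unfolding s_def by (simp add: field_simps)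
  moreover have "\<delta> / 2 \<le> s l" for l unfolding s_def using assms by simp
  moreover have "s 0 = \<rho>" unfolding s_def by simp
  ultimately show ?thesis using that[of s J] by (metis order_refl)
qed

section \<open>Choice of constants for Gaussian noise near a stable fixed point\<close>

locale gaussian_well = gaussian S Z
  for S :: "'a::euclidean_space \<Rightarrow> 'a" and Z +
  fixes \<Phi> :: "'a \<Rightarrow> 'a" and N :: "'a \<Rightarrow> real" and c :: 'a and \<kappa> \<rho> cN :: real
  assumes cont_map: "continuous_on UNIV \<Phi>"
    and N_triangle: "N (v + w) \<le> N v + N w"
    and N_0: "N 0 = 0"
    and N_minus: "N (- v) = N v"
    and norm_le_N: "norm v \<le> N v"
    and N_le_norm: "N v \<le> cN * norm v" and cN: "0 < cN"
    and \<kappa>: "0 < \<kappa>" "\<kappa> < 1"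
    and \<rho>: "0 < \<rho>"
    and fixed: "\<Phi> c = c"
    and contraction: "N (x - c) \<le> \<rho> \<Longrightarrow> N (x' - c) \<le> \<rho> \<Longrightarrow> N (\<Phi> x - \<Phi> x') \<le> \<kappa> * N (x - x')"
begin

text \<open>The same sets as \<open>V\<close>, but available before \<sigma>, \<open>M\<close> and
  \<open>B\<close> are fixed.\<close>

definition ball_N :: "real \<Rightarrow> 'a set" where "ball_N r = {z. N (z - c) \<le> r}"

lemma N_cont: "continuous_on UNIV N"
proof (rule continuous_on_subset[OF _ subset_UNIV], unfold continuous_on_iff, intro ballI allI impI)
  fix x :: 'a and e :: real assume e: "0 < e"
  have "\<bar>N y - N x\<bar> \<le> cN * dist y x" for y
  proof -
    have "N y \<le> N (y - x) + N x" "N x \<le> N (x - y) + N y"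
      using N_triangle[of "y - x" x] N_triangle[of "x - y" y] by auto
    moreover have "N (x - y) = N (y - x)" using N_minus[of "y - x"] by simp
    ultimately show ?thesis using N_le_norm[of "y - x"] by (simp add: dist_norm)
  qed
  then show "\<exists>d>0. \<forall>x'\<in>UNIV. dist x' x < d \<longrightarrow> dist (N x') (N x) < e"
    using e cN
    by (intro exI[of _ "e / cN"]) (auto simp: dist_real_def pos_less_divide_eq mult.commute intro: le_less_trans)
qed

lemma well:
  assumes \<sigma>: "0 < \<sigma>" and M: "closed M" and B: "closed B" "B = {z \<in> M. N (z - c) \<le> \<rho>}"
  shows "contracting_well \<Phi> (noise \<sigma>) M N c \<kappa> \<rho> B"
proof
  show "\<exists>G\<in>borel_measurable borel. (\<integral>\<^sup>+ z. G z \<partial>lborel) < \<infinity> \<and> (\<forall>u z. norm u \<le> r \<longrightarrow> ennreal (noise \<sigma> (z - u)) \<le> G z)" for r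
    by (rule noise_dominated[OF \<sigma>])
qed (use \<sigma> M B cont_map noise_cont noise_pos noise_mass N_triangle N_0 N_minus norm_le_N N_cont \<kappa> \<rho> fixed contraction in auto)

lemma tail_le:
  assumes \<sigma>: "0 < \<sigma>" and W: "contracting_well \<Phi> (noise \<sigma>) M N c \<kappa> \<rho> B"
    and a: "\<And>v. a * (norm v)\<^sup>2 \<le> v \<bullet> S v" "0 < a" and t: "0 \<le> t"
  shows "contracting_well.tail (noise \<sigma>) N t \<le> sqrt 2 ^ DIM('a) * exp (- (a / (4 * cN\<^sup>2) * t\<^sup>2 / \<sigma>\<^sup>2))"
proof -
  interpret W: contracting_well \<Phi> "noise \<sigma>" M N c \<kappa> \<rho> B by (rule W)
  have "W.tail t \<le> sqrt 2 ^ DIM('a) * exp (- (a * (t / cN)\<^sup>2 / (4 * \<sigma>\<^sup>2)))"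
    unfolding W.tail_def
  proof (rule noise_tail[OF \<sigma> a])
    show "{v. t < N v} \<in> sets borel" by measurable
    show "t / cN \<le> norm v" if "v \<in> {v. t < N v}" for v
      using that N_le_norm[of v] cN by (simp add: pos_divide_le_eq mult.commute)
  qed (use t cN in auto)
  also have "a * (t / cN)\<^sup>2 / (4 * \<sigma>\<^sup>2) = a / (4 * cN\<^sup>2) * t\<^sup>2 / \<sigma>\<^sup>2" by (simp add: power_divide)
  finally show ?thesis .
qed

text \<open>Since the map contracts \<open>N\<close> and \<open>N\<close> dominates the norm, a
  bound in the Euclidean distance of the means turns into one in \<open>N (x - x')\<close>; the
  vectors involved have norm at most \<open>2 * \<rho>\<close>.\<close>

lemma ratio:
  assumes \<sigma>: "0 < \<sigma>" and b: "\<And>v w. \<bar>v \<bullet> S w\<bar> \<le> b * norm v * norm w" "0 < b"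
    and x: "x \<in> ball_N \<rho>" "x' \<in> ball_N \<rho>" "z \<in> ball_N \<rho>"
  shows "noise \<sigma> (z - \<Phi> x) \<le> exp (2 * b * \<rho> / \<sigma>\<^sup>2 * N (x - x')) * noise \<sigma> (z - \<Phi> x')"
proof -
  have nb: "norm (z - \<Phi> y) \<le> 2 * \<rho>" if "y \<in> ball_N \<rho>" for y
  proof -
    have "N (\<Phi> y - c) \<le> \<kappa> * N (y - c)" using contraction[of y c] that fixed N_0 \<rho> by (simp add: ball_N_def)
    also have "\<dots> \<le> 1 * \<rho>" using that \<kappa> \<rho> order_trans[OF norm_ge_zero norm_le_N] by (intro mult_mono) (auto simp: ball_N_def)
    finally have "N (c - \<Phi> y) \<le> \<rho>" using N_minus[of "\<Phi> y - c"] by simp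
    then show ?thesis using N_triangle[of "z - c" "c - \<Phi> y"] x(3) norm_le_N[of "z - \<Phi> y"] by (simp add: ball_N_def)
  qed
  have "norm ((z - \<Phi> x) - (z - \<Phi> x')) \<le> N (x - x')"
  proof -
    have "norm ((z - \<Phi> x) - (z - \<Phi> x')) = norm (\<Phi> x - \<Phi> x')" by (simp add: norm_minus_commute)
    also have "\<dots> \<le> \<kappa> * N (x - x')" using norm_le_N contraction[of x x'] x by (force simp: ball_N_def intro: order_trans)
    also have "\<dots> \<le> 1 * N (x - x')" using \<kappa> order_trans[OF norm_ge_zero norm_le_N] by (intro mult_right_mono) auto
    finally show ?thesis by simp
  qed
  from noise_ratio[OF \<sigma> b nb[OF x(1)] nb[OF x(2)] this]
  show ?thesis by (simp add: mult.left_commute mult.commute)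
qed

lemma lower_core:
  assumes \<sigma>: "0 < \<sigma>" and b: "\<And>v w. \<bar>v \<bullet> S w\<bar> \<le> b * norm v * norm w" "0 < b"
    and x: "x \<in> ball_N \<delta>" "y \<in> ball_N \<delta>" and \<delta>: "\<delta> \<le> \<rho>"
  shows "Z / \<sigma> ^ DIM('a) * exp (- (2 * b * \<delta>\<^sup>2 / \<sigma>\<^sup>2)) \<le> noise \<sigma> (y - \<Phi> x)"
proof -
  have "N (\<Phi> x - c) \<le> \<kappa> * N (x - c)" using contraction[of x c] x \<delta> fixed N_0 \<rho> by (simp add: ball_N_def)
  also have "\<dots> \<le> 1 * \<delta>" using x \<kappa> order_trans[OF norm_ge_zero norm_le_N] by (intro mult_mono) (auto simp: ball_N_def)
  finally have "N (c - \<Phi> x) \<le> \<delta>" using N_minus[of "\<Phi> x - c"] by simp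
  then have "norm (y - \<Phi> x) \<le> 2 * \<delta>"
    using N_triangle[of "y - c" "c - \<Phi> x"] x(2) norm_le_N[of "y - \<Phi> x"] by (simp add: ball_N_def)
  from noise_lower[OF \<sigma> b this]
  show ?thesis by (simp add: power_mult_distrib mult.assoc)
qed

text \<open>This supplies the constant \<open>c1\<close>. A ball of radius \<sigma> around
  \<open>y\<close> fits into \<open>V \<rho>\<close>, so the density at \<open>y\<close> is bounded
  by the mass of that ball with a constant that is a mere power of \<open>1 / \<sigma>\<close>,
  uniformly in \<open>x\<close> however far away.\<close>

lemma step_into_ball:
  assumes \<sigma>: "0 < \<sigma>" and W: "contracting_well \<Phi> (noise \<sigma>) M N c \<kappa> \<rho> B"
    and b: "\<And>v w. \<bar>v \<bullet> S w\<bar> \<le> b * norm v * norm w" "0 < b"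
    and y: "y \<in> ball_N \<delta>" "cN * \<sigma> + \<delta> \<le> \<rho>"
  shows "noise \<sigma> (y - \<Phi> x) \<le> exp (b / 2) / measure lborel (cball (0::'a) 1) / \<sigma> ^ DIM('a) *
    measure (noisy_map.step \<Phi> (noise \<sigma>) x) (contracting_well.V N c \<rho>)"
proof -
  interpret W: contracting_well \<Phi> "noise \<sigma>" M N c \<kappa> \<rho> B by (rule W)
  interpret P: prob_space "W.step x" by (rule W.prob_step)
  let ?\<omega> = "measure lborel (cball (0::'a) 1)"
  have \<omega>: "0 < ?\<omega>" by (rule content_cball_pos) simp
  have sub: "cball y \<sigma> \<subseteq> W.V \<rho>"
  proof
    fix z assume "z \<in> cball y \<sigma>"
    then have "N (z - y) \<le> cN * \<sigma>"
      using cN by (intro order_trans[OF N_le_norm] mult_left_mono) (auto simp: dist_norm norm_minus_commute)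
    then show "z \<in> W.V \<rho>" using N_triangle[of "z - y" "y - c"] y by (simp add: W.V_def ball_N_def)
  qed
  have "ennreal (noise \<sigma> (y - \<Phi> x) * (\<sigma> ^ DIM('a) * exp (- b / 2) * ?\<omega>))
    \<le> (\<integral>\<^sup>+z. ennreal (noise \<sigma> (z - \<Phi> x)) * indicator (W.V \<rho>) z \<partial>lborel)"
    by (rule noise_le_ball_mass[OF \<sigma> b W.V_borel sub])
  also have "\<dots> = emeasure (W.step x) (W.V \<rho>)"
    by (simp add: W.step_def W.p_def emeasure_density)
  also have "\<dots> = ennreal (measure (W.step x) (W.V \<rho>))" by (rule P.emeasure_eq_measure)
  finally have "noise \<sigma> (y - \<Phi> x) * (\<sigma> ^ DIM('a) * exp (- b / 2) * ?\<omega>) \<le> measure (W.step x) (W.V \<rho>)"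
    by simp
  then show ?thesis using \<sigma> \<omega> by (simp add: field_simps exp_minus)
qed

text \<open>Everything that depends on \<open>B\<close> is hidden in \<open>n1\<close>: the radius
  and the noise threshold are chosen from \<kappa>, \<rho> and the noise alone.\<close>

lemma flat_all_noise:
  obtains \<delta> \<sigma>0 where "0 < \<delta>" "\<delta> \<le> \<rho> / 2" "0 < \<sigma>0"
    "\<And>\<sigma> M B. 0 < \<sigma> \<Longrightarrow> \<sigma> < \<sigma>0 \<Longrightarrow> closed M \<Longrightarrow> closed B \<Longrightarrow> B = {z \<in> M. N (z - c) \<le> \<rho>} \<Longrightarrow>
      c \<in> interior B \<Longrightarrow> B \<subseteq> ball_N (\<delta> / 2) \<Longrightarrow>
      (\<exists>n1. \<forall>n\<ge>n1. flat \<Phi> \<sigma> M B n) \<and> (\<forall>n x. \<forall>y\<in>B. trace_chain.kp \<Phi> (noise \<sigma>) M B n x y < \<infinity>) \<and>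
      (\<forall>n. continuous_on (UNIV \<times> B) (\<lambda>(x, y). enn2real (trace_chain.kp \<Phi> (noise \<sigma>) M B n x y)))"
proof -
  obtain a b where ab: "0 < a" "0 < b" "\<And>v. a * (norm v)\<^sup>2 \<le> v \<bullet> S v" "\<And>v w. \<bar>v \<bullet> S w\<bar> \<le> b * norm v * norm w"
    by (rule quadratic_bounds) blast
  let ?D = "DIM('a)"
  define \<omega> where "\<omega> = measure lborel (cball (0::'a) 1)"
  have \<omega>: "0 < \<omega>" unfolding \<omega>_def by (rule content_cball_pos) simp
  define C2 :: real where "C2 = sqrt 2 ^ ?D"
  define C1 where "C1 = exp (b / 2) / \<omega>"
  define \<alpha> where "\<alpha> = a / (4 * cN\<^sup>2)"
  define c0 where "c0 = \<alpha> * ((1 - \<kappa>) * \<rho>)\<^sup>2"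
  \<comment> \<open>The square root makes \<open>2 * b * \<delta>\<^sup>2\<close> at most
    \<open>c0 / 2\<close>. Leaving \<open>V \<rho>\<close> is then exponentially rarer than the
    lower bound for the density across the core, and \<open>X\<close> decays like
    \<open>exp (- c0 / (2 * \<sigma>\<^sup>2))\<close>.\<close>
  define \<delta> where "\<delta> = min (\<rho> / 2) (sqrt (c0 / (4 * b)))"
  have C2: "0 < C2" and C1: "0 < C1" and \<alpha>: "0 < \<alpha>" unfolding C2_def C1_def \<alpha>_def using \<omega> ab cN by auto
  have c0: "0 < c0" unfolding c0_def using \<alpha> \<kappa> \<rho> by simp
  have \<delta>: "0 < \<delta>" "\<delta> \<le> \<rho> / 2" unfolding \<delta>_def using \<rho> c0 ab by auto
  have \<delta>2: "2 * b * \<delta>\<^sup>2 \<le> c0 / 2"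
  proof -
    have "\<delta>\<^sup>2 \<le> (sqrt (c0 / (4 * b)))\<^sup>2" using \<delta>(1) unfolding \<delta>_def by (intro power_mono) auto
    also have "\<dots> = c0 / (4 * b)" using c0 ab by simp
    finally show ?thesis using ab(2) by (simp add: field_simps)
  qed
  obtain s :: "nat \<Rightarrow> real" and J where s: "s 0 = \<rho>" "\<And>l. \<kappa> * s l + (1 - \<kappa>) * \<delta> / 2 \<le> s (Suc l)"
    "decseq s" "s J \<le> \<delta>" "\<And>l. \<delta> / 2 \<le> s l"
    using layers[OF \<kappa> \<delta>(1), of \<rho>] \<delta>(2) \<rho> by auto
  define t where "t = (1 - \<kappa>) * \<delta> / 2"
  have t: "0 < t" unfolding t_def using \<kappa> \<delta> by simp
  define KX where "KX = 8 * 4 ^ J * C2 / Z"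
  have KX: "0 < KX" unfolding KX_def using C2 Z_pos by simp
  define lk where "lk = - ln \<kappa>"
  have lk: "0 < lk" unfolding lk_def using \<kappa> by simp
  define K3 where "K3 = 6 * C1 * (KX + sqrt KX)"
  have K3: "0 < K3" unfolding K3_def using C1 KX by (simp add: add_pos_pos)
  have ev: "\<forall>\<^sub>F \<sigma> in at_right 0. 0 < \<sigma> \<and> \<sigma> < min 1 (\<rho> / (2 * cN))"
    unfolding eventually_at_right_field using \<rho> cN by (intro exI[of _ "min 1 (\<rho> / (2 * cN))"]) auto
  have "\<forall>\<^sub>F \<sigma> in at_right 0. (0 < \<sigma> \<and> \<sigma> < min 1 (\<rho> / (2 * cN))) \<and>
     9 * C2 * (1 / \<sigma>) ^ 1 * exp (- (c0 / \<sigma>\<^sup>2)) \<le> 1 / 16 \<and>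
     4 * b * \<rho>\<^sup>2 * (1 / \<sigma>) ^ 2 * exp (- (lk / \<sigma>)) \<le> 1 / 16 \<and>
     K3 * (1 / \<sigma>) ^ Suc ?D * exp (- (c0 / 4 / \<sigma>\<^sup>2)) \<le> 1 / 16 \<and>
     3 * sqrt KX * (1 / \<sigma>) ^ 1 * exp (- (c0 / 4 / \<sigma>\<^sup>2)) \<le> 1 / 16 \<and>
     C2 * (1 / \<sigma>) ^ 0 * exp (- (\<alpha> * t\<^sup>2 / \<sigma>\<^sup>2)) \<le> 1 / 2"
    by (intro eventually_conj ev power_gauss_small power_exp_small) (use c0 lk \<alpha> t C2 K3 KX in auto)
  then obtain \<sigma>0 where \<sigma>0: "0 < \<sigma>0" and small: "\<And>\<sigma>. 0 < \<sigma> \<Longrightarrow> \<sigma> < \<sigma>0 \<Longrightarrow> \<sigma> < min 1 (\<rho> / (2 * cN)) \<and>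
     9 * C2 * (1 / \<sigma>) ^ 1 * exp (- (c0 / \<sigma>\<^sup>2)) \<le> 1 / 16 \<and>
     4 * b * \<rho>\<^sup>2 * (1 / \<sigma>) ^ 2 * exp (- (lk / \<sigma>)) \<le> 1 / 16 \<and>
     K3 * (1 / \<sigma>) ^ Suc ?D * exp (- (c0 / 4 / \<sigma>\<^sup>2)) \<le> 1 / 16 \<and>
     3 * sqrt KX * (1 / \<sigma>) ^ 1 * exp (- (c0 / 4 / \<sigma>\<^sup>2)) \<le> 1 / 16 \<and>
     C2 * (1 / \<sigma>) ^ 0 * exp (- (\<alpha> * t\<^sup>2 / \<sigma>\<^sup>2)) \<le> 1 / 2"
    unfolding eventually_at_right_field by auto
  show ?thesis
  proof (rule that[OF \<delta> \<sigma>0])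
    fix \<sigma> M B
    assume \<sigma>: "0 < \<sigma>" "\<sigma> < \<sigma>0" and M: "closed M" and B: "closed B" "B = {z \<in> M. N (z - c) \<le> \<rho>}"
      and cB: "c \<in> interior B" and B\<delta>: "B \<subseteq> ball_N (\<delta> / 2)"
    have sm: "\<sigma> < 1" "cN * \<sigma> + \<delta> \<le> \<rho>" "9 * C2 * (1 / \<sigma>) * exp (- (c0 / \<sigma>\<^sup>2)) \<le> 1 / 16"
      "4 * b * \<rho>\<^sup>2 * (1 / \<sigma>) ^ 2 * exp (- (lk / \<sigma>)) \<le> 1 / 16"
      "K3 * (1 / \<sigma>) ^ Suc ?D * exp (- (c0 / 4 / \<sigma>\<^sup>2)) \<le> 1 / 16"
      "3 * sqrt KX * (1 / \<sigma>) * exp (- (c0 / 4 / \<sigma>\<^sup>2)) \<le> 1 / 16"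
      "C2 * exp (- (\<alpha> * t\<^sup>2 / \<sigma>\<^sup>2)) \<le> 1 / 2"
      using small[OF \<sigma>] cN \<delta>(2) by (auto simp: pos_less_divide_eq mult_ac)
    have W: "contracting_well \<Phi> (noise \<sigma>) M N c \<kappa> \<rho> B" by (rule well[OF \<sigma>(1) M B])
    interpret W: contracting_well \<Phi> "noise \<sigma>" M N c \<kappa> \<rho> B by (rule W)
    have V: "W.V r = ball_N r" for r unfolding W.V_def ball_N_def ..
    define e0 where "e0 = C2 * exp (- (c0 / \<sigma>\<^sup>2))"
    define b0 where "b0 = Z / \<sigma> ^ ?D * exp (- (2 * b * \<delta>\<^sup>2 / \<sigma>\<^sup>2))"
    define c1 where "c1 = C1 / \<sigma> ^ ?D"
    define X where "X = 8 * 4 ^ J * e0 / b0"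
    define E where "E = exp (- (c0 / 4 / \<sigma>\<^sup>2))"
    \<comment> \<open>The volume threshold of the dichotomy is a geometric mean: \<open>X\<close> is
      at most the square of \<theta>, so both \<theta> and \<open>X / \<theta>\<close> are
      exponentially small, and each side of the dichotomy is served.\<close>
    define \<theta> where "\<theta> = sqrt KX * E"
    \<comment> \<open>The coupling time must be long enough for \<open>\<kappa> ^ T\<close> to beat
      the Lipschitz constant of order \<open>1 / \<sigma>\<^sup>2\<close>, yet so short that
      \<open>T\<close> times the escape probability stays small. The order
      \<open>1 / \<sigma>\<close> meets both.\<close>
    define T where "T = nat \<lceil>1 / \<sigma>\<rceil>"
    have is1: "1 \<le> 1 / \<sigma>" using \<sigma> sm(1) by simp
    have e0p: "0 < e0" unfolding e0_def using C2 by simp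
    have b0p: "0 < b0" unfolding b0_def using Z_pos \<sigma> by simp
    have c1p: "0 < c1" unfolding c1_def using C1 \<sigma> by simp
    have \<theta>p: "0 < \<theta>" unfolding \<theta>_def E_def using KX by simp
    have Tl: "1 / \<sigma> \<le> real T" unfolding T_def using \<sigma> by (simp add: le_of_int_ceiling of_nat_nat)
    have Tu: "real (Suc T) \<le> 3 * (1 / \<sigma>)"
    proof -
      have "real T \<le> 1 / \<sigma> + 1" unfolding T_def using \<sigma> by (simp add: of_nat_nat)
      then show ?thesis using is1 by simp
    qed
    have Te0: "real (Suc T) * e0 \<le> 1 / 48"
    proof -
      have "real (Suc T) * e0 \<le> 3 * (1 / \<sigma>) * e0" using Tu e0p by (intro mult_right_mono) auto
      also have "\<dots> = (9 * C2 * (1 / \<sigma>) * exp (- (c0 / \<sigma>\<^sup>2))) / 3" unfolding e0_def by simp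
      also have "\<dots> \<le> (1 / 16) / 3" by (rule divide_right_mono[OF sm(3)]) simp
      finally show ?thesis by simp
    qed
    have e0h: "e0 \<le> 1 / 2"
    proof -
      have "1 * e0 \<le> real (Suc T) * e0" using e0p by (intro mult_right_mono) auto
      then show ?thesis using Te0 by linarith
    qed
    have XE: "X \<le> KX * E * E"
    proof -
      have "X = KX * \<sigma> ^ ?D * (exp (- (c0 / \<sigma>\<^sup>2)) / exp (- (2 * b * \<delta>\<^sup>2 / \<sigma>\<^sup>2)))"
        unfolding X_def e0_def b0_def KX_def using Z_pos \<sigma> by (simp add: field_simps)
      also have "exp (- (c0 / \<sigma>\<^sup>2)) / exp (- (2 * b * \<delta>\<^sup>2 / \<sigma>\<^sup>2)) = exp (- ((c0 - 2 * b * \<delta>\<^sup>2) / \<sigma>\<^sup>2))"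
        unfolding exp_diff[symmetric] by (simp add: diff_divide_distrib)
      also have "KX * \<sigma> ^ ?D * exp (- ((c0 - 2 * b * \<delta>\<^sup>2) / \<sigma>\<^sup>2)) \<le> KX * 1 * exp (- (c0 / 2 / \<sigma>\<^sup>2))"
      proof (intro mult_mono mult_nonneg_nonneg)
        show "\<sigma> ^ ?D \<le> 1" using \<sigma> sm(1) by (simp add: power_le_one)
        have "c0 / 2 / \<sigma>\<^sup>2 \<le> (c0 - 2 * b * \<delta>\<^sup>2) / \<sigma>\<^sup>2" using \<delta>2 \<sigma> by (intro divide_right_mono) auto
        then show "exp (- ((c0 - 2 * b * \<delta>\<^sup>2) / \<sigma>\<^sup>2)) \<le> exp (- (c0 / 2 / \<sigma>\<^sup>2))" by simp
      qed (use KX \<sigma> in auto)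
      also have "exp (- (c0 / 2 / \<sigma>\<^sup>2)) = E * E" unfolding E_def exp_add[symmetric] by (simp add: field_simps)
      finally show ?thesis by (simp add: mult.assoc)
    qed
    have E: "0 < E" "E \<le> 1" unfolding E_def using c0 by auto
    have X\<theta>: "X / \<theta> \<le> sqrt KX * E"
    proof -
      have "KX * E * E = (sqrt KX * E) * \<theta>" unfolding \<theta>_def using KX by simp
      then have "X \<le> (sqrt KX * E) * \<theta>" using XE by (rule ord_le_eq_trans[rotated])
      then show ?thesis unfolding pos_divide_le_eq[OF \<theta>p] .
    qed
    have Xplus: "X + \<theta> \<le> (KX + sqrt KX) * E"
    proof -
      have "KX * E * E \<le> KX * E * 1" using E KX by (intro mult_left_mono) auto
      then show ?thesis using XE unfolding \<theta>_def by (simp add: distrib_right)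
    qed
    have C1c: "(1 + e0) ^ Suc T * exp (2 * b * \<rho> / \<sigma>\<^sup>2 * \<kappa> ^ T * (2 * \<rho>)) \<le> 5 / 4"
    proof -
      have "\<kappa> ^ T = exp (- (lk * real T))" unfolding lk_def using \<kappa> by (simp add: exp_of_nat2_mult)
      also have "\<dots> \<le> exp (- (lk / \<sigma>))" using mult_left_mono[OF Tl, of lk] lk by simp
      finally have "2 * b * \<rho> / \<sigma>\<^sup>2 * (2 * \<rho>) * \<kappa> ^ T \<le> 2 * b * \<rho> / \<sigma>\<^sup>2 * (2 * \<rho>) * exp (- (lk / \<sigma>))"
        using ab \<rho> by (intro mult_left_mono) auto
      also have "\<dots> = 4 * b * \<rho>\<^sup>2 * (1 / \<sigma>) ^ 2 * exp (- (lk / \<sigma>))"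
        using \<sigma> by (simp add: power2_eq_square field_simps)
      finally have 1: "2 * b * \<rho> / \<sigma>\<^sup>2 * \<kappa> ^ T * (2 * \<rho>) \<le> 1 / 16" using sm(4) by (simp only: mult_ac)
      have "(1 + e0) ^ Suc T \<le> exp (real (Suc T) * e0)" by (rule one_plus_power_le) (use e0p in simp)
      also have "\<dots> \<le> exp (1 / 16)" using Te0 by simp
      finally have "(1 + e0) ^ Suc T * exp (2 * b * \<rho> / \<sigma>\<^sup>2 * \<kappa> ^ T * (2 * \<rho>)) \<le> exp (1 / 16) * exp (1 / 16)"
        using 1 e0p by (intro mult_mono) auto
      also have "\<dots> = exp (1 / 8)" by (simp flip: exp_add)
      also have "\<dots> \<le> 1 + 1 / 8 + (1 / 8)\<^sup>2" by (rule exp_le_quadratic) auto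
      finally show ?thesis by (simp add: power2_eq_square)
    qed
    have C2c: "real (Suc T) * (2 * c1 * (X + \<theta>) + 2 * e0) \<le> 1 / 8"
    proof -
      have "real (Suc T) * (2 * c1 * (X + \<theta>)) \<le> 3 * (1 / \<sigma>) * (2 * c1 * ((KX + sqrt KX) * E))"
        using Tu Xplus c1p \<theta>p KX E \<sigma> XE by (intro mult_mono mult_left_mono) (auto simp: X_def e0_def b0_def Z_pos less_imp_le C2)
      also have "\<dots> = K3 * (1 / \<sigma>) ^ Suc ?D * E"
        unfolding K3_def c1_def by (simp add: power_one_over divide_inverse power_inverse mult_ac)
      finally show ?thesis using sm(5) Te0 unfolding E_def by (simp add: distrib_left)
    qed
    have C3c: "real (Suc T) * (3 * e0 + X / \<theta>) \<le> 1 / 8"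
    proof -
      have "real (Suc T) * (X / \<theta>) \<le> real (Suc T) * (sqrt KX * E)" using X\<theta> by (intro mult_left_mono) auto
      also have "\<dots> \<le> 3 * (1 / \<sigma>) * (sqrt KX * E)" using Tu KX E by (intro mult_right_mono) auto
      also have "\<dots> \<le> 1 / 16" using sm(6) unfolding E_def by (simp add: mult_ac)
      finally have "real (Suc T) * (X / \<theta>) \<le> 1 / 16" .
      moreover have "real (Suc T) * (3 * e0 + X / \<theta>) = 3 * (real (Suc T) * e0) + real (Suc T) * (X / \<theta>)"
        by (simp only: distrib_left mult.left_commute)
      ultimately show ?thesis using Te0 by linarith
    qed
    have s\<delta>: "s J \<le> \<delta>" by (rule s(4))
    have BsJ: "B \<subseteq> W.V (s J)" using B\<delta> s(5)[of J] unfolding V ball_N_def by auto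
    have b0c: "b0 \<le> noise \<sigma> (y - \<Phi> x)" if "x \<in> W.V (s J)" "y \<in> B" for x y
      unfolding b0_def
      by (rule lower_core[OF \<sigma>(1) ab(4,2)]) (use that B\<delta> s\<delta> \<delta> \<rho> in \<open>auto simp: V ball_N_def\<close>)
    have c1c: "noise \<sigma> (y - \<Phi> x) \<le> c1 * measure (W.step x) (W.V \<rho>)" if "y \<in> B" for x y
      unfolding c1_def C1_def \<omega>_def
      by (rule step_into_ball[OF \<sigma>(1) W ab(4,2) _ sm(2)]) (use that B\<delta> \<delta> in \<open>auto simp: ball_N_def\<close>)
    have tail_t: "W.tail t \<le> 1 / 2"
      using tail_le[OF \<sigma>(1) W ab(3,1), of t] t sm(7) unfolding C2_def \<alpha>_def by simp
    have tail_e0: "W.tail ((1 - \<kappa>) * \<rho>) \<le> e0"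
      using tail_le[OF \<sigma>(1) W ab(3,1), of "(1 - \<kappa>) * \<rho>"] \<kappa> \<rho> unfolding e0_def C2_def c0_def \<alpha>_def by simp
    have \<Lambda>0: "0 \<le> 2 * b * \<rho> / \<sigma>\<^sup>2" using ab \<rho> by simp
    have \<Lambda>: "noise \<sigma> (z - \<Phi> x) \<le> exp (2 * b * \<rho> / \<sigma>\<^sup>2 * N (x - x')) * noise \<sigma> (z - \<Phi> x')"
      if "x \<in> W.V \<rho>" "x' \<in> W.V \<rho>" "z \<in> W.V \<rho>" for x x' z
      by (rule ratio[OF \<sigma>(1) ab(4,2)]) (use that in \<open>auto simp: V\<close>)
    have ss: "\<kappa> * s l + t \<le> s (Suc l)" for l using s(2)[of l] unfolding t_def .
    note mid = W.middle_regime[OF s(1) ss s(3) less_imp_le[OF t] tail_t tail_e0 e0h e0p BsJ cB b0p b0c c1p c1c \<Lambda>0 \<Lambda> X_def \<theta>p C1c C2c C3c]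
    show "(\<exists>n1. \<forall>n\<ge>n1. flat \<Phi> \<sigma> M B n) \<and> (\<forall>n x. \<forall>y\<in>B. W.kp B n x y < \<infinity>) \<and>
      (\<forall>n. continuous_on (UNIV \<times> B) (\<lambda>(x, y). enn2real (W.kp B n x y)))"
      using mid unfolding flat_def W.kr_def by blast
  qed
qed

lemma flat_small_noise:
  assumes M: "closed M" and B: "closed B" "B = {z \<in> M. N (z - c) \<le> \<rho>}"
    and cB: "c \<in> interior B" and B\<delta>: "B \<subseteq> ball_N \<delta>" "0 < \<delta>" "\<delta> \<le> \<rho> / 2"
  obtains C \<sigma>1 where "0 < C" "0 < \<sigma>1" "\<And>\<sigma> n. 0 < \<sigma> \<Longrightarrow> \<sigma> < \<sigma>1 \<Longrightarrow> C * ln (1 / \<sigma>) \<le> real n \<Longrightarrow> flat \<Phi> \<sigma> M B n"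
proof -
  obtain a b where ab: "0 < a" "0 < b" "\<And>v. a * (norm v)\<^sup>2 \<le> v \<bullet> S v" "\<And>v w. \<bar>v \<bullet> S w\<bar> \<le> b * norm v * norm w"
    by (rule quadratic_bounds) blast
  let ?D = "DIM('a)"
  define \<omega> where "\<omega> = measure lborel (cball (0::'a) 1)"
  have \<omega>: "0 < \<omega>" unfolding \<omega>_def by (rule content_cball_pos) simp
  define C2 :: real where "C2 = sqrt 2 ^ ?D"
  define C1 where "C1 = exp (b / 2) / \<omega>"
  define \<alpha> where "\<alpha> = a / (4 * cN\<^sup>2)"
  have C2: "0 < C2" and C1: "0 < C1" and \<alpha>: "0 < \<alpha>" unfolding C2_def C1_def \<alpha>_def using \<omega> ab cN by auto
  obtain r' where r': "0 < r'" "ball c r' \<subseteq> B" using cB unfolding mem_interior by blast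
  define r0 where "r0 = min (r' / 2) \<rho>"
  have r0: "0 < r0" "r0 \<le> \<rho>" unfolding r0_def using r' \<rho> by auto
  have r0B: "ball_N r0 \<subseteq> B"
  proof
    fix z assume "z \<in> ball_N r0"
    then have "norm (z - c) \<le> r' / 2" using norm_le_N[of "z - c"] unfolding ball_N_def r0_def by simp
    then have "z \<in> ball c r'" using r'(1) by (simp add: dist_norm norm_minus_commute)
    then show "z \<in> B" using r'(2) by blast
  qed
  define c3 where "c3 = \<alpha> * ((1 - \<kappa>) * r0)\<^sup>2"
  have c3: "0 < c3" unfolding c3_def using \<alpha> \<kappa> r0 by simp
  \<comment> \<open>This radius keeps the density ratio \<Gamma> over \<open>V r\<close> below
    \<open>exp (c3 / (2 * \<sigma>\<^sup>2))\<close>, the square root of the inverse order of the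
    escape probability \<open>e0\<close> from \<open>V r0\<close>.\<close>
  define r where "r = min r0 (c3 / (8 * b * \<rho>))"
  have r: "0 < r" "r \<le> r0" unfolding r_def using r0 c3 ab \<rho> by auto
  have rc3: "4 * b * \<rho> * r \<le> c3 / 2"
  proof -
    have "r \<le> c3 / (8 * b * \<rho>)" unfolding r_def by simp
    then show ?thesis using ab \<rho> by (simp add: field_simps)
  qed
  have r\<rho>: "r \<le> \<rho>" using r r0 by linarith
  obtain s :: "nat \<Rightarrow> real" and J where s: "s 0 = \<rho>" "\<And>l. \<kappa> * s l + (1 - \<kappa>) * r / 2 \<le> s (Suc l)"
    "decseq s" "s J \<le> r"
    by (rule layers[OF \<kappa> r(1) r\<rho>]) (rule that)
  define t where "t = (1 - \<kappa>) * r / 2"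
  have t: "0 < t" "t \<le> (1 - \<kappa>) * r" unfolding t_def using \<kappa> r by auto
  define c4 where "c4 = \<alpha> * t\<^sup>2"
  have c4: "0 < c4" unfolding c4_def using \<alpha> t by simp
  have c43: "c4 \<le> c3"
  proof -
    have "t \<le> (1 - \<kappa>) * r0" using t(2) mult_left_mono[OF r(2), of "1 - \<kappa>"] \<kappa> by linarith
    then show ?thesis unfolding c4_def c3_def using t \<alpha> by (intro mult_left_mono power_mono) auto
  qed
  define k where "k = 2 * b * \<delta>\<^sup>2"
  have k0: "0 \<le> k" unfolding k_def using ab by simp
  define CR where "CR = max 1 (2 * 4 ^ Suc J * C1 / Z)"
  have CR: "1 \<le> CR" "2 * 4 ^ Suc J * C1 / Z \<le> CR" unfolding CR_def by auto
  \<comment> \<open>Each round gains an exponent \<open>c4\<close>. The rounds must absorb the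
    exponent \<open>k\<close> of the initial ratio and the exponent \<open>c3 / 2\<close> of
    \<Gamma>; the extra 1 beats the constants. Their number does not depend on the noise.\<close>
  obtain ell :: nat where "(k + c3 / 2 + 1) / c4 \<le> real ell" using real_arch_simple by blast
  then have ell: "k + c3 / 2 + 1 \<le> real ell * c4" using c4 by (simp add: pos_divide_le_eq)
  define KE where "KE = (2 * real (J + 2) * C2) ^ ell"
  have KE: "0 < KE" unfolding KE_def using C2 by simp
  define lk where "lk = - ln \<kappa>"
  have lk: "0 < lk" unfolding lk_def using \<kappa> by simp
  \<comment> \<open>With \<open>n\<close> at least \<open>C' * ln (1 / \<sigma>)\<close>, the factor
    \<open>\<kappa> ^ n\<close> is at most the third power of \<sigma>, one power more than needed
    against the Lipschitz constant.\<close>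
  define C' where "C' = 3 / lk"
  have C': "0 < C'" unfolding C'_def using lk by simp
  \<comment> \<open>So small that the factors \<open>1 + 5 * \<zeta>\<close> lost over
    \<open>J + 1\<close> powers multiply to at most \<open>exp (1 / 8)\<close>.\<close>
  define \<zeta> where "\<zeta> = 1 / (40 * real (Suc J))"
  have \<zeta>: "0 < \<zeta>" "\<zeta> \<le> 1 / 4" unfolding \<zeta>_def by (auto simp: field_simps)
  \<comment> \<open>The part of the required power that does not grow, with 1 for rounding. It is
    eventually below one further \<open>ln (1 / \<sigma>)\<close>, whence the constant
    \<open>C' + 1\<close>.\<close>
  define L where "L = real (2 * ell * Suc J + Suc 0 + J) + 1"
  have "filterlim (\<lambda>\<sigma>. ln (1 / \<sigma>)) at_top (at_right (0::real))"
    using filterlim_compose[OF ln_at_top filterlim_inverse_at_top_right] by (simp add: divide_inverse)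
  then have evL: "\<forall>\<^sub>F \<sigma> in at_right (0::real). L \<le> ln (1 / \<sigma>)" by (rule filterlim_at_top[THEN iffD1, rule_format])
  define \<sigma>c where "\<sigma>c = min 1 (min (\<rho> / (2 * cN)) (\<zeta> / (8 * b * \<rho> * r0)))"
  have \<sigma>c: "0 < \<sigma>c" unfolding \<sigma>c_def using \<rho> cN \<zeta> ab r0 by auto
  have ev: "\<forall>\<^sub>F \<sigma> in at_right 0. 0 < \<sigma> \<and> \<sigma> < \<sigma>c"
    unfolding eventually_at_right_field using \<sigma>c by (intro exI[of _ \<sigma>c]) auto
  have "\<forall>\<^sub>F \<sigma> in at_right 0. (0 < \<sigma> \<and> \<sigma> < \<sigma>c) \<and> L \<le> ln (1 / \<sigma>) \<and>
     real (20 * (J + 2)) * C2 * (1 / \<sigma>) ^ 0 * exp (- (c4 / \<sigma>\<^sup>2)) \<le> 1 / 10 \<and>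
     (C' + 2) * C2 * (1 / \<sigma>) ^ 1 * exp (- (c4 / \<sigma>\<^sup>2)) \<le> 1 / 2 \<and>
     20 * (C' + 2) * C2 * (1 / \<sigma>) ^ 1 * exp (- (c3 / 2 / \<sigma>\<^sup>2)) \<le> \<zeta> \<and>
     KE * CR * (1 / \<sigma>) ^ 0 * exp (- (1 / \<sigma>\<^sup>2)) \<le> 1 \<and>
     5 * KE * (1 / \<sigma>) ^ 0 * exp (- (1 / \<sigma>\<^sup>2)) \<le> 1"
    by (intro eventually_conj ev evL power_gauss_small) (use c4 c3 C2 C' KE CR \<zeta> in auto)
  then obtain \<sigma>1 where \<sigma>1: "0 < \<sigma>1" and small: "\<And>\<sigma>. 0 < \<sigma> \<Longrightarrow> \<sigma> < \<sigma>1 \<Longrightarrow> \<sigma> < \<sigma>c \<and> L \<le> ln (1 / \<sigma>) \<and>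
     real (20 * (J + 2)) * C2 * (1 / \<sigma>) ^ 0 * exp (- (c4 / \<sigma>\<^sup>2)) \<le> 1 / 10 \<and>
     (C' + 2) * C2 * (1 / \<sigma>) ^ 1 * exp (- (c4 / \<sigma>\<^sup>2)) \<le> 1 / 2 \<and>
     20 * (C' + 2) * C2 * (1 / \<sigma>) ^ 1 * exp (- (c3 / 2 / \<sigma>\<^sup>2)) \<le> \<zeta> \<and>
     KE * CR * (1 / \<sigma>) ^ 0 * exp (- (1 / \<sigma>\<^sup>2)) \<le> 1 \<and>
     5 * KE * (1 / \<sigma>) ^ 0 * exp (- (1 / \<sigma>\<^sup>2)) \<le> 1"
    unfolding eventually_at_right_field by auto
  show ?thesis
  proof (rule that[OF _ \<sigma>1])
    show "0 < C' + 1" using C' by simp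
    fix \<sigma> :: real and j :: nat assume \<sigma>: "0 < \<sigma>" "\<sigma> < \<sigma>1" and j: "(C' + 1) * ln (1 / \<sigma>) \<le> real j"
    have sm: "\<sigma> < \<sigma>c" "L \<le> ln (1 / \<sigma>)" "real (20 * (J + 2)) * (C2 * exp (- (c4 / \<sigma>\<^sup>2))) \<le> 1 / 10"
      "(C' + 2) * (1 / \<sigma>) * (C2 * exp (- (c4 / \<sigma>\<^sup>2))) \<le> 1 / 2"
      "20 * ((C' + 2) * (1 / \<sigma>)) * (C2 * exp (- (c3 / 2 / \<sigma>\<^sup>2))) \<le> \<zeta>"
      "KE * CR * exp (- (1 / \<sigma>\<^sup>2)) \<le> 1" "5 * KE * exp (- (1 / \<sigma>\<^sup>2)) \<le> 1"
      using small[OF \<sigma>] by (auto simp: mult_ac)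
    have \<sigma>s: "\<sigma> < 1" "cN * \<sigma> + \<delta> \<le> \<rho>" "8 * b * \<rho> * r0 * \<sigma> \<le> \<zeta>"
      using sm(1) cN B\<delta>(3) ab \<rho> r0 unfolding \<sigma>c_def by (auto simp: pos_less_divide_eq mult_ac less_imp_le)
    have W: "contracting_well \<Phi> (noise \<sigma>) M N c \<kappa> \<rho> B" by (rule well[OF \<sigma>(1) M B])
    interpret W: contracting_well \<Phi> "noise \<sigma>" M N c \<kappa> \<rho> B by (rule W)
    have V: "W.V r = ball_N r" for r unfolding W.V_def ball_N_def ..
    define e where "e = C2 * exp (- (c4 / \<sigma>\<^sup>2))"
    define e0 where "e0 = C2 * exp (- (c3 / \<sigma>\<^sup>2))"
    define b0 where "b0 = Z / \<sigma> ^ ?D * exp (- (k / \<sigma>\<^sup>2))"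
    define c1 where "c1 = C1 / \<sigma> ^ ?D"
    define \<Lambda> where "\<Lambda> = 2 * b * \<rho> / \<sigma>\<^sup>2"
    define \<Gamma> where "\<Gamma> = exp (\<Lambda> * (2 * r))"
    define n where "n = nat \<lceil>C' * ln (1 / \<sigma>)\<rceil>"
    define A where "A = max (4 ^ Suc J * c1 / (1 / 2)) b0"
    \<comment> \<open>The initial ratio: an upper bound of the kernel that is a power of
      \<open>1 / \<sigma>\<close>, over a lower bound with exponent \<open>k\<close>. Every power of
      the kernel inherits it.\<close>
    define R where "R = CR * exp (k / \<sigma>\<^sup>2)"
    define \<psi> where "\<psi> = real (J + 2) * e"
    have ep: "0 < e" "0 < e0" unfolding e_def e0_def using C2 by auto
    have e0e: "e0 \<le> e"
      unfolding e_def e0_def using C2 c43 by (auto intro!: mult_left_mono divide_right_mono)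
    have Je: "real (20 * (J + 2)) * e \<le> 1 / 10" using sm(3) unfolding e_def .
    have Je': "real m * e \<le> 1 / 10" if "m \<le> 20 * (J + 2)" for m
    proof -
      have "real m * e \<le> real (20 * (J + 2)) * e" using that ep by (intro mult_right_mono) (auto simp del: of_nat_mult)
      then show ?thesis using Je by linarith
    qed
    have b0p: "0 < b0" unfolding b0_def using Z_pos \<sigma> by simp
    have c1p: "0 < c1" unfolding c1_def using C1 \<sigma> by simp
    have ln0: "0 < ln (1 / \<sigma>)" using \<sigma> \<sigma>s(1) by simp
    have nl: "C' * ln (1 / \<sigma>) \<le> real n" unfolding n_def using C' ln0 by (simp add: of_nat_nat le_of_int_ceiling)
    have nu: "real n \<le> C' * ln (1 / \<sigma>) + 1" unfolding n_def using C' ln0 by (simp add: of_nat_nat)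
    have nu': "real (Suc n) \<le> (C' + 2) * (1 / \<sigma>)"
    proof -
      have "ln (1 / \<sigma>) \<le> 1 / \<sigma>" using ln_le_minus_one[of "1 / \<sigma>"] \<sigma> by simp
      then have "C' * ln (1 / \<sigma>) \<le> C' * (1 / \<sigma>)" using C' by (intro mult_left_mono) auto
      moreover have "1 \<le> 1 / \<sigma>" using \<sigma> \<sigma>s by simp
      moreover have "(C' + 2) * (1 / \<sigma>) = C' * (1 / \<sigma>) + 2 * (1 / \<sigma>)" by (rule distrib_right)
      ultimately show ?thesis using nu by linarith
    qed
    have ne: "real (Suc n) * e \<le> 1 / 2"
      using mult_right_mono[OF nu', of e] ep sm(4) unfolding e_def by linarith
    have \<Gamma>_eq: "\<Gamma> = exp (4 * b * \<rho> * r / \<sigma>\<^sup>2)" unfolding \<Gamma>_def \<Lambda>_def by (simp add: mult_ac)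
    have \<Gamma>1: "1 \<le> \<Gamma>" unfolding \<Gamma>_eq using ab \<rho> r by simp
    have \<Gamma>3: "\<Gamma> \<le> exp (c3 / 2 / \<sigma>\<^sup>2)" unfolding \<Gamma>_eq using divide_right_mono[OF rc3, of "\<sigma>\<^sup>2"] by simp
    have \<Lambda>0: "0 \<le> \<Lambda>" unfolding \<Lambda>_def using ab \<rho> by simp
    have \<psi>e: "(2 * \<psi>) ^ ell = KE * exp (- (real ell * c4 / \<sigma>\<^sup>2))"
    proof -
      have "(exp (- (c4 / \<sigma>\<^sup>2))) ^ ell = exp (real ell * (- (c4 / \<sigma>\<^sup>2)))" by (rule exp_of_nat_mult[symmetric])
      moreover have "2 * \<psi> = (2 * real (J + 2) * C2) * exp (- (c4 / \<sigma>\<^sup>2))" unfolding \<psi>_def e_def by simp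
      ultimately show ?thesis unfolding KE_def by (simp only: power_mult_distrib) simp
    qed
    have ell1: "(2 * \<psi>) ^ ell * R \<le> \<Gamma>"
    proof -
      have "(2 * \<psi>) ^ ell * R = KE * CR * exp (- ((real ell * c4 - k) / \<sigma>\<^sup>2))"
        unfolding \<psi>e R_def by (simp add: exp_add[symmetric] diff_divide_distrib)
      also have "\<dots> \<le> KE * CR * exp (- (1 / \<sigma>\<^sup>2))"
      proof (rule mult_left_mono)
        have "1 / \<sigma>\<^sup>2 \<le> (real ell * c4 - k) / \<sigma>\<^sup>2" using ell c3 by (intro divide_right_mono) auto
        then show "exp (- ((real ell * c4 - k) / \<sigma>\<^sup>2)) \<le> exp (- (1 / \<sigma>\<^sup>2))" by simp
      qed (use KE CR in simp)
      also have "\<dots> \<le> \<Gamma>" using sm(6) \<Gamma>1 by linarith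
      finally show ?thesis .
    qed
    have ell2: "(2 * \<psi>) ^ ell * (5 * \<Gamma>) \<le> 1"
    proof -
      have "(2 * \<psi>) ^ ell * (5 * \<Gamma>) \<le> (2 * \<psi>) ^ ell * (5 * exp (c3 / 2 / \<sigma>\<^sup>2))"
        using \<Gamma>3 ep unfolding \<psi>_def by (intro mult_left_mono) auto
      also have "\<dots> = 5 * KE * exp (- ((real ell * c4 - c3 / 2) / \<sigma>\<^sup>2))"
        unfolding \<psi>e by (simp add: exp_add[symmetric] diff_divide_distrib)
      also have "\<dots> \<le> 5 * KE * exp (- (1 / \<sigma>\<^sup>2))"
      proof (rule mult_left_mono)
        have "1 / \<sigma>\<^sup>2 \<le> (real ell * c4 - c3 / 2) / \<sigma>\<^sup>2" using ell k0 by (intro divide_right_mono) auto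
        then show "exp (- ((real ell * c4 - c3 / 2) / \<sigma>\<^sup>2)) \<le> exp (- (1 / \<sigma>\<^sup>2))" by simp
      qed (use KE in simp)
      also have "\<dots> \<le> 1" by (rule sm(7))
      finally show ?thesis .
    qed
    have \<zeta>1: "exp (\<Lambda> * \<kappa> ^ n * (2 * r0)) \<le> 1 + \<zeta>"
    proof -
      have "\<kappa> ^ n = exp (- (lk * real n))" unfolding lk_def using \<kappa> by (simp add: exp_of_nat2_mult)
      also have "\<dots> \<le> exp (- (3 * ln (1 / \<sigma>)))"
        using mult_left_mono[OF nl, of lk] lk unfolding C'_def by simp
      also have "\<dots> = exp (real 3 * ln \<sigma>)" using \<sigma> by (simp add: ln_div)
      also have "\<dots> = exp (ln \<sigma>) ^ 3" by (rule exp_of_nat_mult)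
      also have "\<dots> = \<sigma> ^ 3" using \<sigma> by simp
      finally have "\<Lambda> * (2 * r0) * \<kappa> ^ n \<le> \<Lambda> * (2 * r0) * \<sigma> ^ 3" using \<Lambda>0 r0 by (intro mult_left_mono) auto
      also have "\<dots> = 4 * b * \<rho> * r0 * \<sigma>" unfolding \<Lambda>_def using \<sigma> by (simp add: power2_eq_square power3_eq_cube)
      finally have le: "\<Lambda> * \<kappa> ^ n * (2 * r0) \<le> \<zeta> / 2" using \<sigma>s(3) by (simp add: mult_ac)
      have "exp (\<Lambda> * \<kappa> ^ n * (2 * r0)) \<le> exp (\<zeta> / 2)" using le by simp
      also have "\<dots> \<le> 1 + \<zeta> / 2 + (\<zeta> / 2)\<^sup>2" by (rule exp_le_quadratic) (use \<zeta> in auto)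
      also have "(\<zeta> / 2)\<^sup>2 \<le> \<zeta> / 2 * 1" unfolding power2_eq_square using \<zeta> by (intro mult_left_mono) auto
      finally show ?thesis by simp
    qed
    have \<zeta>2: "20 * real (Suc n) * e0 * \<Gamma> \<le> \<zeta>"
    proof -
      have "e0 * \<Gamma> \<le> e0 * exp (c3 / 2 / \<sigma>\<^sup>2)" using \<Gamma>3 ep by (intro mult_left_mono) auto
      also have "\<dots> = C2 * exp (- (c3 / 2 / \<sigma>\<^sup>2))" unfolding e0_def by (simp add: exp_add[symmetric] field_simps)
      finally have le: "e0 * \<Gamma> \<le> C2 * exp (- (c3 / 2 / \<sigma>\<^sup>2))" .
      have "20 * real (Suc n) * (e0 * \<Gamma>) \<le> 20 * ((C' + 2) * (1 / \<sigma>)) * (C2 * exp (- (c3 / 2 / \<sigma>\<^sup>2)))"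
      proof (rule mult_mono[OF _ le])
        show "20 * real (Suc n) \<le> 20 * ((C' + 2) * (1 / \<sigma>))" by (rule mult_left_mono[OF nu']) simp
        show "0 \<le> 20 * ((C' + 2) * (1 / \<sigma>))" using C' \<sigma> by simp
        show "0 \<le> e0 * \<Gamma>" using ep \<Gamma>1 by simp
      qed
      then show ?thesis using sm(5) unfolding mult.assoc by (rule order_trans)
    qed
    have final: "((1 + 5 * \<zeta>) ^ Suc J + 9 * real J * e) * (1 + 5 * \<zeta>) ^ Suc J \<le> 7 / 4 * (1 - e) ^ (2 * J + 1)"
    proof -
      let ?P = "(1 + 5 * \<zeta>) ^ Suc J"
      have "?P \<le> exp (real (Suc J) * (5 * \<zeta>))" by (rule one_plus_power_le) (use \<zeta> in simp)
      also have "real (Suc J) * (5 * \<zeta>) = 1 / 8" unfolding \<zeta>_def by (simp add: field_simps)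
      also have "exp (1 / 8 :: real) \<le> 1 + 1 / 8 + (1 / 8)\<^sup>2" by (rule exp_le_quadratic) auto
      also have "\<dots> \<le> 115 / 100" by (simp add: power2_eq_square)
      finally have P: "?P \<le> 115 / 100" .
      have "9 * real J * e \<le> 1 / 10" using Je'[of "9 * J"] by simp
      then have "(?P + 9 * real J * e) * ?P \<le> (115 / 100 + 1 / 10) * (115 / 100)"
        using P \<zeta> ep by (intro mult_mono) auto
      also have "\<dots> \<le> 7 / 4 * (1 - 1 / 10)" by simp
      also have "\<dots> \<le> 7 / 4 * (1 - real (2 * J + 1) * e)"
        by (intro mult_left_mono diff_left_mono Je') auto
      also have "\<dots> \<le> 7 / 4 * (1 - e) ^ (2 * J + 1)"
        using Bernoulli_inequality[of "- e" "2 * J + 1"] Je'[of 1] by simp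
      finally show ?thesis .
    qed
    have \<psi>8: "\<psi> \<le> 1 / 8" unfolding \<psi>_def using Je'[of "J + 2"] by simp
    have tail_t: "W.tail t \<le> e"
      using tail_le[OF \<sigma>(1) W ab(3,1), of t] t unfolding e_def C2_def c4_def \<alpha>_def by simp
    have tail_e0: "W.tail ((1 - \<kappa>) * r0) \<le> e0"
      using tail_le[OF \<sigma>(1) W ab(3,1), of "(1 - \<kappa>) * r0"] \<kappa> r0 unfolding e0_def C2_def c3_def \<alpha>_def by simp
    have ss: "\<kappa> * s l + t \<le> s (Suc l)" for l using s(2)[of l] unfolding t_def .
    have b0c: "b0 \<le> noise \<sigma> (y - \<Phi> x)" if "x \<in> B" "y \<in> B" for x y
      unfolding b0_def k_def
      by (rule lower_core[OF \<sigma>(1) ab(4,2)]) (use that B\<delta> \<rho> in auto)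
    have c1c: "noise \<sigma> (y - \<Phi> x) \<le> c1 * measure (W.step x) (W.V \<rho>)" if "y \<in> B" for x y
      unfolding c1_def C1_def \<omega>_def
      by (rule step_into_ball[OF \<sigma>(1) W ab(4,2) _ \<sigma>s(2)]) (use that B\<delta> in auto)
    have \<Lambda>c: "noise \<sigma> (z - \<Phi> x) \<le> exp (\<Lambda> * N (x - x')) * noise \<sigma> (z - \<Phi> x')"
      if "x \<in> W.V \<rho>" "x' \<in> W.V \<rho>" "z \<in> W.V \<rho>" for x x' z
      unfolding \<Lambda>_def by (rule ratio[OF \<sigma>(1) ab(4,2)]) (use that in \<open>auto simp: V\<close>)
    have eh: "e \<le> 1 / 10" using Je'[of 1] by simp
    \<comment> \<open>For fixed \<open>B\<close> the core lies in a ball inside \<open>M\<close>, so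
      the trace returns at once with probability at least 1/2. This replaces the volume of
      \<open>B\<close> in the upper bound on the kernel.\<close>
    have hit: "1 / 2 \<le> measure (W.step x) M" if "x \<in> W.V (s J)" for x
    proof -
      interpret P: prob_space "W.step x" by (rule W.prob_step)
      have "x \<in> W.V r" using that s(4) by (auto simp: V ball_N_def)
      then have "1 - W.tail ((1 - \<kappa>) * r) \<le> measure (W.step x) (W.V r)"
        using r r0 by (intro W.stay_same) auto
      moreover have "W.tail ((1 - \<kappa>) * r) \<le> e" using W.tail_antimono[OF t(2)] tail_t by linarith
      moreover have "W.V r \<subseteq> M" using r0B W.B_sub r(2) by (force simp: V ball_N_def)
      then have "measure (W.step x) (W.V r) \<le> measure (W.step x) M" by (intro P.finite_measure_mono) auto
      ultimately show ?thesis using eh by linarith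
    qed
    have half: "W.tail t \<le> 1 / 2" using tail_t eh by linarith
    have kA: "W.k x y \<le> ennreal A" if "y \<in> B" for x y
      by (rule order_trans[OF W.bounded_kernel(1)[where s=s and J=J and t=t and \<beta>="1/2", OF s(1) ss s(3) less_imp_le[OF t(1)] half c1p _ hit c1c that]])
        (auto simp: A_def intro!: ennreal_leI)
    have kpA: "W.kp B n x y \<le> ennreal A" if "y \<in> B" for n x y
      by (rule order_trans[OF W.bounded_kernel(2)[where s=s and J=J and t=t and \<beta>="1/2", OF s(1) ss s(3) less_imp_le[OF t(1)] half c1p _ hit c1c that]])
        (auto simp: A_def intro!: ennreal_leI)
    have low: "ennreal b0 \<le> W.k x y" if "x \<in> B" "y \<in> B" for x y
    proof -
      have "ennreal b0 \<le> W.p x y" unfolding W.p_def using b0c[OF that] by (rule ennreal_leI)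
      then show ?thesis using W.p_le_k by (rule order_trans)
    qed
    have bA: "b0 \<le> A" unfolding A_def by simp
    have A0: "0 < A" using bA b0p by linarith
    have both: "(\<forall>n. \<forall>y\<in>B. W.adm A (\<lambda>x. W.kr n x y)) \<and> (\<forall>n x. \<forall>y\<in>B. W.kr (Suc n) x y = W.K (\<lambda>z. W.kr n z y) x)"
    proof (rule W.birkhoff[OF b0p bA low kA kpA W.B_content_pos[OF cB] zero_less_one])
      assume 1: "\<And>n y. y \<in> B \<Longrightarrow> W.adm A (\<lambda>x. W.kr n x y)"
        and 2: "\<And>n x y. y \<in> B \<Longrightarrow> W.kr (Suc n) x y = W.K (\<lambda>z. W.kr n z y) x"
      show ?thesis by (intro conjI allI ballI 1 2)
    qed
    have adm: "W.adm A (\<lambda>x. W.kr n x y)" and Ks: "W.kr (Suc n) x y = W.K (\<lambda>z. W.kr n z y) x"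
      if "y \<in> B" for n x y
      using both that by (simp_all only: Ball_def)
    have R1: "1 \<le> R"
      unfolding R_def using mult_mono[OF CR(1), of 1 "exp (k / \<sigma>\<^sup>2)"] CR(1) k0 by simp
    have bR: "A \<le> R * b0"
    proof -
      have "exp (k / \<sigma>\<^sup>2) * exp (- (k / \<sigma>\<^sup>2)) = 1" by (simp add: exp_add[symmetric])
      then have "R * b0 = CR * (Z / \<sigma> ^ ?D)" unfolding R_def b0_def by (simp add: mult_ac)
      also have "\<dots> \<ge> 2 * 4 ^ Suc J * C1 / Z * (Z / \<sigma> ^ ?D)"
        using CR(2) Z_pos \<sigma> by (intro mult_right_mono) auto
      also have "2 * 4 ^ Suc J * C1 / Z * (Z / \<sigma> ^ ?D) = 4 ^ Suc J * c1 / (1 / 2)"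
        unfolding c1_def using Z_pos by simp
      finally have "4 ^ Suc J * c1 / (1 / 2) \<le> R * b0" by simp
      moreover have "b0 \<le> R * b0" using R1 b0p by simp
      ultimately show ?thesis unfolding A_def by simp
    qed
    have Rf: "W.kr i x y \<le> R * W.kr i x' y" if "x \<in> B" "x' \<in> B" "y \<in> B" for i x x' y
    proof (cases i)
      case 0
      have fin: "W.k x' y < \<infinity>" by (rule le_less_trans[OF kA[OF that(3)]]) simp
      have "W.kr 0 x y \<le> A" unfolding W.kr_def using kA[OF that(3), of x] A0 by (simp add: enn2real_leI)
      also have "\<dots> \<le> R * b0" by (rule bR)
      also have "b0 \<le> W.kr 0 x' y" unfolding W.kr_def using low[OF that(2,3)] fin b0p
        by (metis enn2real_mono enn2real_ennreal W.kp.simps(1) less_imp_le infinity_ennreal_def)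
      finally show ?thesis using 0 R1 by (simp add: mult_left_mono)
    next
      case (Suc i')
      let ?h = "\<lambda>z. W.kr i' z y"
      let ?S = "\<integral>z. indicator B z * ?h z \<partial>lborel"
      have S0: "0 \<le> ?S" by (rule W.mass_B[OF adm[OF that(3)]])
      have "W.kr i x y \<le> A * ?S" unfolding Suc Ks[OF that(3)]
        by (rule W.K_between(1)[OF adm[OF that(3)]]) (use kA A0 in auto)
      also have "\<dots> \<le> R * b0 * ?S" using bR S0 by (intro mult_right_mono)
      also have "\<dots> \<le> R * W.kr i x' y"
      proof -
        have "b0 * ?S \<le> W.kr i x' y" unfolding Suc Ks[OF that(3)]
          by (rule W.K_between(2)[OF adm[OF that(3)]]) (use low that b0p in auto)
        then show ?thesis using R1 by (simp add: mult.assoc mult_left_mono)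
      qed
      finally show ?thesis .
    qed
    have jj: "2 * ell * Suc J + Suc n + J \<le> j"
    proof -
      have "real (2 * ell * Suc J + Suc n + J) = (L - 1) + real n" unfolding L_def by simp
      also have "\<dots> \<le> ln (1 / \<sigma>) + C' * ln (1 / \<sigma>)" using sm(2) nu by linarith
      also have "\<dots> \<le> real j" using j by (simp add: distrib_right)
      finally show ?thesis by linarith
    qed
    show "flat \<Phi> \<sigma> M B j"
      unfolding flat_def W.kr_def[symmetric]
    proof (intro ballI)
      fix x x' y assume xy: "x \<in> B" "x' \<in> B" "y \<in> B"
      show "W.kr j x y \<le> 7 / 4 * W.kr j x' y"
      proof (rule W.trace_powers_flatten[where f="\<lambda>i x. W.kr i x y", OF s(1) ss s(3) t(2) s(4) r(1,2) r0(2) _ tail_t tail_e0 e0e \<Lambda>0 \<Lambda>c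
            \<Gamma>_def \<psi>_def \<psi>8 ne ell1 ell2 \<zeta>1 \<zeta>2 \<zeta> final adm[OF xy(3)] Ks[OF xy(3)] Rf[OF _ _ xy(3)] _ jj xy(1,2)])
      qed (use r0B R1 V in auto)
    qed
  qed
qed

end

section \<open>From local flatness to the uniform positivity assumption\<close>

lemma pos_def_inverse:
  fixes \<Sigma> :: "real^'n^'n"
  assumes "pos_def_symmetric \<Sigma>"
  shows "v \<bullet> (matrix_inv \<Sigma> *v w) = w \<bullet> (matrix_inv \<Sigma> *v v)"
    and "v \<noteq> 0 \<Longrightarrow> 0 < v \<bullet> (matrix_inv \<Sigma> *v v)"
proof -
  have sym: "transpose \<Sigma> = \<Sigma>" and pos: "\<And>v. v \<noteq> 0 \<Longrightarrow> 0 < v \<bullet> (\<Sigma> *v v)"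
    using assms by (auto simp: pos_def_symmetric_def)
  have "\<forall>v. \<Sigma> *v v = 0 \<longrightarrow> v = 0" using pos by force
  then have inv: "invertible \<Sigma>" unfolding matrix_left_invertible_ker[symmetric] invertible_left_inverse .
  have right: "\<Sigma> *v (matrix_inv \<Sigma> *v v) = v" for v
  proof -
    have "\<exists>A'. \<Sigma> ** A' = mat 1 \<and> A' ** \<Sigma> = mat 1" using inv unfolding invertible_def .
    from someI_ex[OF this] have "\<Sigma> ** matrix_inv \<Sigma> = mat 1" unfolding matrix_inv_def by blast
    then show ?thesis by (simp add: matrix_vector_mul_assoc)
  qed
  have \<Sigma>: "v \<bullet> (\<Sigma> *v w) = (\<Sigma> *v v) \<bullet> w" for v w
    using dot_lmul_matrix[of v \<Sigma> w] transpose_matrix_vector[of \<Sigma> v] sym by simp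
  show "v \<bullet> (matrix_inv \<Sigma> *v w) = w \<bullet> (matrix_inv \<Sigma> *v v)"
    using \<Sigma>[of "matrix_inv \<Sigma> *v v" "matrix_inv \<Sigma> *v w"] by (simp add: right inner_commute)
  assume "v \<noteq> 0"
  then have "matrix_inv \<Sigma> *v v \<noteq> 0" using right[of v] by auto
  from pos[OF this] show "0 < v \<bullet> (matrix_inv \<Sigma> *v v)" by (simp add: right inner_commute)
qed

lemma C2_map_continuous: "C2_map \<Phi> \<Longrightarrow> continuous_on UNIV \<Phi>"
  unfolding C2_map_def by (auto intro!: continuous_at_imp_continuous_on intro: has_derivative_continuous)

text \<open>The order of the quantifiers is the content: radius and threshold precede
  \<open>M\<close> and \<open>B\<close>, while the constants of the logarithmic regime may depend on
  them. The norm, rate and neighbourhood no longer appear; \<open>D\<close> alone expresses that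
  other pieces of \<open>M\<close> are far away.\<close>

lemma flat_near_stable_point:
  fixes S :: "real^'n \<Rightarrow> real^'n"
  assumes G: "gaussian S Z" and C2: "C2_map \<Phi>" and stable: "lin_stable_fixed_point \<Phi> z" and D: "0 < D"
  shows "\<exists>\<delta>>0. \<exists>\<sigma>0>0. \<forall>M B. closed M \<longrightarrow> closed B \<longrightarrow> B \<subseteq> M \<longrightarrow> z \<in> interior B \<longrightarrow> B \<subseteq> cball z \<delta> \<longrightarrow>
     (\<forall>w\<in>M. dist w z < D \<longrightarrow> w \<in> B) \<longrightarrow>
     (\<forall>\<sigma>. 0 < \<sigma> \<longrightarrow> \<sigma> < \<sigma>0 \<longrightarrow> (\<exists>n1. \<forall>n\<ge>n1. gaussian.flat S Z \<Phi> \<sigma> M B n) \<and>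
        (\<forall>n x. \<forall>y\<in>B. trace_chain.kp \<Phi> (gaussian.noise S Z \<sigma>) M B n x y < \<infinity>) \<and>
        (\<forall>n. continuous_on (UNIV \<times> B) (\<lambda>(x, y). enn2real (trace_chain.kp \<Phi> (gaussian.noise S Z \<sigma>) M B n x y)))) \<and>
     (\<exists>C>0. \<exists>\<sigma>1>0. \<forall>\<sigma> n. 0 < \<sigma> \<longrightarrow> \<sigma> < \<sigma>1 \<longrightarrow> C * ln (1 / \<sigma>) \<le> real n \<longrightarrow> gaussian.flat S Z \<Phi> \<sigma> M B n)"
proof -
  obtain N :: "real^'n \<Rightarrow> real" and \<kappa> cN \<rho>' where N: "0 < \<kappa>" "\<kappa> < 1" "0 < \<rho>'" "\<And>v w. N (v + w) \<le> N v + N w" "N 0 = 0"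
    "\<And>v. N (- v) = N v" "\<And>v. norm v \<le> N v" "\<And>v. N v \<le> cN * norm v" "0 < cN"
    "\<And>x x'. N (x - z) \<le> \<rho>' \<Longrightarrow> N (x' - z) \<le> \<rho>' \<Longrightarrow> N (\<Phi> x - \<Phi> x') \<le> \<kappa> * N (x - x')"
  proof (rule local_contraction[OF C2 stable], goal_cases)
    case (1 N \<kappa> c \<rho>)
    from 1(2-) show ?thesis by (rule that[where N=N and \<kappa>=\<kappa> and cN=c and \<rho>'=\<rho>])
  qed
  \<comment> \<open>Below \<open>D\<close>, so that every point of \<open>M\<close> in the
    neighbourhood belongs to \<open>B\<close>.\<close>
  define \<rho> where "\<rho> = min \<rho>' (D / 2)"
  have \<rho>z: "0 < \<rho>" "\<rho> \<le> \<rho>'" "\<rho> < D" unfolding \<rho>_def using N D by auto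
  have fix_z: "\<Phi> z = z" using stable by (simp add: lin_stable_fixed_point_def)
  interpret gaussian S Z by (rule G)
  interpret gaussian_well S Z \<Phi> N z \<kappa> \<rho> cN
    by unfold_locales (use N \<rho>z fix_z C2_map_continuous[OF C2] in auto)
  obtain \<delta> \<sigma>0 where \<delta>: "0 < \<delta>" "\<delta> \<le> \<rho> / 2" "0 < \<sigma>0"
    and all: "\<And>\<sigma> M B. 0 < \<sigma> \<Longrightarrow> \<sigma> < \<sigma>0 \<Longrightarrow> closed M \<Longrightarrow> closed B \<Longrightarrow> B = {w \<in> M. N (w - z) \<le> \<rho>} \<Longrightarrow>
      z \<in> interior B \<Longrightarrow> B \<subseteq> ball_N (\<delta> / 2) \<Longrightarrow>
      (\<exists>n1. \<forall>n\<ge>n1. flat \<Phi> \<sigma> M B n) \<and> (\<forall>n x. \<forall>y\<in>B. trace_chain.kp \<Phi> (noise \<sigma>) M B n x y < \<infinity>) \<and>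
      (\<forall>n. continuous_on (UNIV \<times> B) (\<lambda>(x, y). enn2real (trace_chain.kp \<Phi> (noise \<sigma>) M B n x y)))"
  proof (rule flat_all_noise, goal_cases)
    case (1 \<delta> \<sigma>0)
    from 1(2-) show ?thesis by (rule that[of \<delta> \<sigma>0])
  qed
  have core: "\<forall>M B. closed M \<longrightarrow> closed B \<longrightarrow> B \<subseteq> M \<longrightarrow> z \<in> interior B \<longrightarrow> B \<subseteq> cball z (\<delta> / (2 * cN)) \<longrightarrow>
     (\<forall>w\<in>M. dist w z < D \<longrightarrow> w \<in> B) \<longrightarrow>
     (\<forall>\<sigma>. 0 < \<sigma> \<longrightarrow> \<sigma> < \<sigma>0 \<longrightarrow> (\<exists>n1. \<forall>n\<ge>n1. flat \<Phi> \<sigma> M B n) \<and>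
        (\<forall>n x. \<forall>y\<in>B. trace_chain.kp \<Phi> (noise \<sigma>) M B n x y < \<infinity>) \<and>
        (\<forall>n. continuous_on (UNIV \<times> B) (\<lambda>(x, y). enn2real (trace_chain.kp \<Phi> (noise \<sigma>) M B n x y)))) \<and>
     (\<exists>C>0. \<exists>\<sigma>1>0. \<forall>\<sigma> n. 0 < \<sigma> \<longrightarrow> \<sigma> < \<sigma>1 \<longrightarrow> C * ln (1 / \<sigma>) \<le> real n \<longrightarrow> flat \<Phi> \<sigma> M B n)"
  proof (intro allI impI conjI)
    fix M B assume M: "closed M" and B: "closed B" "B \<subseteq> M" "z \<in> interior B" "B \<subseteq> cball z (\<delta> / (2 * cN))"
      and far: "\<forall>w\<in>M. dist w z < D \<longrightarrow> w \<in> B"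
    have B\<delta>: "B \<subseteq> ball_N (\<delta> / 2)"
    proof
      fix w assume "w \<in> B"
      then have "norm (w - z) \<le> \<delta> / (2 * cN)" using B(4) by (auto simp: dist_norm norm_minus_commute)
      then have "cN * norm (w - z) \<le> cN * (\<delta> / (2 * cN))" using N by (intro mult_left_mono) auto
      then show "w \<in> ball_N (\<delta> / 2)" using N(8)[of "w - z"] N(9) by (simp add: ball_N_def)
    qed
    have Beq: "B = {w \<in> M. N (w - z) \<le> \<rho>}"
    proof (intro set_eqI iffI)
      fix w assume "w \<in> B"
      then show "w \<in> {w \<in> M. N (w - z) \<le> \<rho>}" using B(2) B\<delta> \<delta> by (force simp: ball_N_def)
    next
      fix w assume w: "w \<in> {w \<in> M. N (w - z) \<le> \<rho>}"
      then have "norm (w - z) \<le> \<rho>" using N(7)[of "w - z"] by auto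
      then have "dist w z < D" unfolding dist_norm using \<rho>z(3) by linarith
      then show "w \<in> B" using far w by blast
    qed
    show "\<exists>n1. \<forall>n\<ge>n1. flat \<Phi> \<sigma> M B n" if "0 < \<sigma>" "\<sigma> < \<sigma>0" for \<sigma>
      by (rule conjunct1[OF all[OF that M B(1) Beq B(3) B\<delta>]])
    show "\<forall>y\<in>B. trace_chain.kp \<Phi> (noise \<sigma>) M B n x y < \<infinity>" if "0 < \<sigma>" "\<sigma> < \<sigma>0" for \<sigma> n x
      by (rule conjunct1[OF conjunct2[OF all[OF that M B(1) Beq B(3) B\<delta>]], THEN spec, THEN spec])
    show "continuous_on (UNIV \<times> B) (\<lambda>(x, y). enn2real (trace_chain.kp \<Phi> (noise \<sigma>) M B n x y))" if "0 < \<sigma>" "\<sigma> < \<sigma>0" for \<sigma> n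
      by (rule conjunct2[OF conjunct2[OF all[OF that M B(1) Beq B(3) B\<delta>]], THEN spec])
    have B\<delta>': "B \<subseteq> ball_N \<delta>" using B\<delta> \<delta> by (force simp: ball_N_def)
    obtain C \<sigma>1 where "0 < C" "0 < \<sigma>1" "\<And>\<sigma> n. 0 < \<sigma> \<Longrightarrow> \<sigma> < \<sigma>1 \<Longrightarrow> C * ln (1 / \<sigma>) \<le> real n \<Longrightarrow> flat \<Phi> \<sigma> M B n"
    proof (rule flat_small_noise[OF M B(1) Beq B(3) B\<delta>' \<delta>(1,2)], goal_cases)
      case (1 C \<sigma>1)
      from 1(2-) show ?thesis by (rule that[of C \<sigma>1])
    qed
    then show "\<exists>C>0. \<exists>\<sigma>1>0. \<forall>\<sigma> n. 0 < \<sigma> \<longrightarrow> \<sigma> < \<sigma>1 \<longrightarrow> C * ln (1 / \<sigma>) \<le> real n \<longrightarrow> flat \<Phi> \<sigma> M B n"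
      by blast
  qed
  have "0 < \<delta> / (2 * cN)" using \<delta> N by simp
  show ?thesis
    by (rule exI, rule conjI[OF \<open>0 < \<delta> / (2 * cN)\<close>], rule exI, rule conjI[OF \<delta>(3) core])
qed

lemma scaled_noise_law:
  assumes P: "prob_space P" and iid: "iid_sequence P \<xi>"
    and dens: "distributed P lborel (\<xi> 1) (\<lambda>x. ennreal (f x))"
    and G: "gaussian S Z" and f: "\<And>x. f x = gaussian.\<gamma> S Z x" and \<sigma>: "0 < \<sigma>" and n: "n \<ge> 1"
  shows "distr P borel (\<lambda>\<omega>. \<sigma> *\<^sub>R \<xi> n \<omega>) = density lborel (\<lambda>v. ennreal (gaussian.noise S Z \<sigma> v))"
proof -
  interpret P: prob_space P by (rule P)
  interpret gaussian S Z by (rule G)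
  have "\<xi> n \<in> borel_measurable P"
    using iid n unfolding iid_sequence_def P.indep_vars_def2 by auto
  then have "distr P borel (\<lambda>\<omega>. \<sigma> *\<^sub>R \<xi> n \<omega>) = distr (distr P borel (\<xi> n)) borel (\<lambda>v. \<sigma> *\<^sub>R v)"
    by (subst distr_distr) (auto simp: comp_def)
  also have "distr P borel (\<xi> n) = distr P borel (\<xi> 1)" using iid n unfolding iid_sequence_def by blast
  also have "\<dots> = distr P lborel (\<xi> 1)" by (rule distr_cong) auto
  also have "\<dots> = density lborel (\<lambda>v. ennreal (\<gamma> v))" using dens f unfolding distributed_def by simp
  also have "distr \<dots> borel (\<lambda>v. \<sigma> *\<^sub>R v) = density lborel (\<lambda>v. ennreal (noise \<sigma> v))" by (rule scaled_law[OF \<sigma>])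
  finally show ?thesis .
qed

theorem proposition4p1:
  fixes \<Phi> :: "real^'n \<Rightarrow> real^'n" and R\<^sub>0 \<epsilon>\<^sub>0 :: real
    and N :: nat and xs :: "nat \<Rightarrow> real^'n"
    and P :: "'w measure" and \<xi> :: "nat \<Rightarrow> 'w \<Rightarrow> real^'n" and \<Sigma> :: "real^'n^'n"
  assumes "map_assumptions \<Phi> R\<^sub>0 \<epsilon>\<^sub>0 N xs"
    and "prob_space P"
    and "iid_sequence P \<xi>"
    and "pos_def_symmetric \<Sigma>"
    and "distributed P lborel (\<xi> 1) (\<lambda>x. ennreal (centred_normal_density \<Sigma> x))"
  shows "\<exists>\<delta>\<^sub>0>0. \<exists>\<sigma>\<^sub>0>0. \<forall>B :: nat \<Rightarrow> (real^'n) set.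
           (\<forall>j\<in>{1..N}. trapping_neighbourhood \<Phi> (xs j) \<delta>\<^sub>0 (B j)) \<longrightarrow>
           (\<exists>n\<^sub>0 :: real \<Rightarrow> nat.
              uniform_positivity P \<xi> \<Phi> N B \<sigma>\<^sub>0 n\<^sub>0 \<and>
              (\<lambda>\<sigma>. real (n\<^sub>0 \<sigma>)) \<in> \<Theta>[at_right 0](\<lambda>\<sigma>. ln (1 / \<sigma>)))"
proof -
  interpret P: prob_space P by (rule assms)
  define S where "S = (\<lambda>v. matrix_inv \<Sigma> *v v)"
  define Z where "Z = 1 / sqrt ((2 * pi) ^ CARD('n) * det \<Sigma>)"
  have dens: "centred_normal_density \<Sigma> x = Z * exp (- (x \<bullet> S x) / 2)" for x
    unfolding centred_normal_density_def Z_def S_def by simp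
  note map = assms(1)[unfolded map_assumptions_def]
  have C2: "C2_map \<Phi>" by (rule conjunct1[OF map])
  have inj: "inj_on xs {1..N}"
    using map by (elim conjE)
  have im: "xs ` {1..N} = {z. {z} \<in> limit_sets \<Phi> (ball 0 R\<^sub>0) \<and> lin_stable_fixed_point \<Phi> z}"
    using map by (elim conjE)
  have stable: "lin_stable_fixed_point \<Phi> (xs i)" if "i \<in> {1..N}" for i
    using imageI[OF that, of xs] unfolding im by simp
  have G: "gaussian S Z"
  proof (rule gaussian.intro)
    show "linear S" unfolding S_def by (rule matrix_vector_mul_linear)
    show "v \<bullet> S w = w \<bullet> S v" for v w unfolding S_def by (rule pos_def_inverse(1)[OF assms(4)])
    show "0 < v \<bullet> S v" if "v \<noteq> 0" for v using that unfolding S_def by (rule pos_def_inverse(2)[OF assms(4)])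
    have "emeasure (distr P lborel (\<xi> 1)) UNIV = 1"
    proof -
      have "\<xi> 1 \<in> measurable P lborel" using assms(5) unfolding distributed_def by blast
      then show ?thesis using P.emeasure_space_1 by (subst emeasure_distr) auto
    qed
    then have "emeasure (density lborel (\<lambda>x. ennreal (centred_normal_density \<Sigma> x))) UNIV = 1"
      using assms(5) unfolding distributed_def by simp
    moreover have "(\<lambda>x. ennreal (centred_normal_density \<Sigma> x)) \<in> borel_measurable lborel"
      using assms(5) unfolding distributed_def by blast
    ultimately show "(\<integral>\<^sup>+v. ennreal (Z * exp (- (v \<bullet> S v) / 2)) \<partial>lborel) = 1"
      by (simp add: emeasure_density dens)
  qed
  interpret gaussian S Z by (rule G)
  have cd_\<gamma>: "centred_normal_density \<Sigma> x = \<gamma> x" for x unfolding dens \<gamma>_def ..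
  define E where "E = insert 1 {dist (xs i) (xs j) | i j. i \<in> {1..N} \<and> j \<in> {1..N} \<and> i \<noteq> j}"
  \<comment> \<open>Half the least distance between stable points; the inserted 1 keeps
    \<open>E\<close> nonempty when there is at most one. Sets of diameter at most \<open>D\<close>
    around their points then cannot reach within \<open>D\<close> of another stable point.\<close>
  define D where "D = Min E / 2"
  have "E \<subseteq> insert 1 ((\<lambda>(i, j). dist (xs i) (xs j)) ` ({1..N} \<times> {1..N}))" unfolding E_def by auto
  then have E: "finite E" "E \<noteq> {}" by (rule finite_subset) (auto simp: E_def)
  have "0 < e" if "e \<in> E" for e
    using that inj_on_eq_iff[OF inj] unfolding E_def by fastforce
  then have "0 < Min E" using Min_in[OF E] by blast
  then have D: "0 < D" unfolding D_def by simp
  have sep: "2 * D \<le> dist (xs i) (xs j)" if "i \<in> {1..N}" "j \<in> {1..N}" "i \<noteq> j" for i j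
  proof -
    have "dist (xs i) (xs j) \<in> E" unfolding E_def using that by blast
    from Min_le[OF E(1) this] show ?thesis unfolding D_def by simp
  qed
  define Q where "Q i d s \<longleftrightarrow> (\<forall>M B. closed M \<longrightarrow> closed B \<longrightarrow> B \<subseteq> M \<longrightarrow> xs i \<in> interior B \<longrightarrow> B \<subseteq> cball (xs i) d \<longrightarrow>
     (\<forall>w\<in>M. dist w (xs i) < D \<longrightarrow> w \<in> B) \<longrightarrow>
     (\<forall>\<sigma>. 0 < \<sigma> \<longrightarrow> \<sigma> < s \<longrightarrow> (\<exists>n1. \<forall>n\<ge>n1. gaussian.flat S Z \<Phi> \<sigma> M B n) \<and>
        (\<forall>n x. \<forall>y\<in>B. trace_chain.kp \<Phi> (noise \<sigma>) M B n x y < \<infinity>) \<and>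
        (\<forall>n. continuous_on (UNIV \<times> B) (\<lambda>(x, y). enn2real (trace_chain.kp \<Phi> (noise \<sigma>) M B n x y)))) \<and>
     (\<exists>C>0. \<exists>\<sigma>1>0. \<forall>\<sigma> n. 0 < \<sigma> \<longrightarrow> \<sigma> < \<sigma>1 \<longrightarrow> C * ln (1 / \<sigma>) \<le> real n \<longrightarrow> gaussian.flat S Z \<Phi> \<sigma> M B n))" for i d s
  have "\<exists>d>0. \<exists>s>0. Q i d s" if "i \<in> {1..N}" for i
    unfolding Q_def by (rule flat_near_stable_point[OF G C2 stable[OF that] D])
  then obtain \<delta> \<sigma>0 where \<delta>: "\<And>i. i \<in> {1..N} \<Longrightarrow> 0 < \<delta> i" "\<And>i. i \<in> {1..N} \<Longrightarrow> 0 < \<sigma>0 i"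
    and loc: "\<And>i. i \<in> {1..N} \<Longrightarrow> Q i (\<delta> i) (\<sigma>0 i)" by metis
  define \<delta>\<^sub>0 where "\<delta>\<^sub>0 = Min (insert D (\<delta> ` {1..N}))"
  define \<sigma>\<^sub>0 where "\<sigma>\<^sub>0 = Min (insert 1 (\<sigma>0 ` {1..N}))"
  have \<delta>\<^sub>0: "0 < \<delta>\<^sub>0" "\<delta>\<^sub>0 \<le> D" "\<And>i. i \<in> {1..N} \<Longrightarrow> \<delta>\<^sub>0 \<le> \<delta> i"
    unfolding \<delta>\<^sub>0_def using D \<delta>(1) by (subst Min_gr_iff; force) (intro Min_le; simp)+
  have \<sigma>\<^sub>0: "0 < \<sigma>\<^sub>0" "\<And>i. i \<in> {1..N} \<Longrightarrow> \<sigma>\<^sub>0 \<le> \<sigma>0 i"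
    unfolding \<sigma>\<^sub>0_def using \<delta>(2) by (subst Min_gr_iff; force) (intro Min_le; simp)
  have main: "\<forall>B :: nat \<Rightarrow> (real^'n) set. (\<forall>j\<in>{1..N}. trapping_neighbourhood \<Phi> (xs j) \<delta>\<^sub>0 (B j)) \<longrightarrow>
     (\<exists>n\<^sub>0 :: real \<Rightarrow> nat. uniform_positivity P \<xi> \<Phi> N B \<sigma>\<^sub>0 n\<^sub>0 \<and>
        (\<lambda>\<sigma>. real (n\<^sub>0 \<sigma>)) \<in> \<Theta>[at_right 0](\<lambda>\<sigma>. ln (1 / \<sigma>)))"
  proof (intro allI impI)
    fix B :: "nat \<Rightarrow> (real^'n) set"
    assume trap: "\<forall>j\<in>{1..N}. trapping_neighbourhood \<Phi> (xs j) \<delta>\<^sub>0 (B j)"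
    define M where "M = (\<Union>j\<in>{1..N}. B j)"
    have Bc: "closed (B j)" "xs j \<in> interior (B j)" if "j \<in> {1..N}" for j
      using trap that by (auto simp: trapping_neighbourhood_def)
    have Bd: "dist w (xs j) \<le> \<delta>\<^sub>0" if "j \<in> {1..N}" "w \<in> B j" for j w
    proof -
      have "bounded (B j)" "diameter (B j) \<le> \<delta>\<^sub>0"
        using trap that by (auto simp: trapping_neighbourhood_def)
      moreover have "xs j \<in> B j" using Bc(2)[OF that(1)] interior_subset by blast
      ultimately show ?thesis using diameter_bounded_bound[of "B j" w "xs j"] that by simp
    qed
    have Mc: "closed M" unfolding M_def using Bc by (intro closed_UN) auto
    have far: "w \<in> B i" if i: "i \<in> {1..N}" and w: "w \<in> M" "dist w (xs i) < D" for i w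
    proof -
      obtain j where j: "j \<in> {1..N}" "w \<in> B j" using w unfolding M_def by blast
      have "i = j"
      proof (rule ccontr)
        assume "i \<noteq> j"
        then have "2 * D \<le> dist (xs i) w + dist w (xs j)"
          using sep[OF i j(1)] dist_triangle[of "xs i" "xs j" w] by linarith
        then show False using Bd[OF j] \<delta>\<^sub>0(2) w(2) by (simp add: dist_commute)
      qed
      then show ?thesis using j by simp
    qed
    let ?flat = "gaussian.flat S Z \<Phi>"
    let ?kp = "\<lambda>\<sigma>. trace_chain.kp \<Phi> (noise \<sigma>) M"
    have L: "(\<forall>\<sigma>. 0 < \<sigma> \<longrightarrow> \<sigma> < \<sigma>0 i \<longrightarrow> (\<exists>n1. \<forall>n\<ge>n1. ?flat \<sigma> M (B i) n) \<and>
        (\<forall>n x. \<forall>y\<in>B i. ?kp \<sigma> (B i) n x y < \<infinity>) \<and>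
        (\<forall>n. continuous_on (UNIV \<times> B i) (\<lambda>(x, y). enn2real (?kp \<sigma> (B i) n x y)))) \<and>
     (\<exists>C>0. \<exists>\<sigma>1>0. \<forall>\<sigma> n. 0 < \<sigma> \<longrightarrow> \<sigma> < \<sigma>1 \<longrightarrow> C * ln (1 / \<sigma>) \<le> real n \<longrightarrow> ?flat \<sigma> M (B i) n)"
      if i: "i \<in> {1..N}" for i
    proof -
      have 1: "B i \<subseteq> M" unfolding M_def using i by blast
      have 2: "B i \<subseteq> cball (xs i) (\<delta> i)" using order_trans[OF Bd[OF i] \<delta>\<^sub>0(3)[OF i]]
        by (auto simp: dist_commute)
      have 3: "\<forall>w\<in>M. dist w (xs i) < D \<longrightarrow> w \<in> B i" using far[OF i] by blast
      show ?thesis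
        using loc[OF i, unfolded Q_def, THEN spec, THEN spec, THEN mp, OF Mc, THEN mp, OF Bc(1)[OF i], THEN mp, OF 1,
          THEN mp, OF Bc(2)[OF i], THEN mp, OF 2, THEN mp, OF 3] .
    qed
    have Lpos: "\<exists>n1. \<forall>n\<ge>n1. ?flat \<sigma> M (B i) n" "\<forall>n x. \<forall>y\<in>B i. ?kp \<sigma> (B i) n x y < \<infinity>"
      "\<forall>n. continuous_on (UNIV \<times> B i) (\<lambda>(x, y). enn2real (?kp \<sigma> (B i) n x y))"
      if i: "i \<in> {1..N}" and \<sigma>: "0 < \<sigma>" "\<sigma> < \<sigma>\<^sub>0" for i \<sigma>
    proof -
      have "\<sigma> < \<sigma>0 i" using \<sigma>(2) \<sigma>\<^sub>0(2)[OF i] by simp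
      note l = conjunct1[OF L[OF i], THEN spec, THEN mp, OF \<sigma>(1), THEN mp, OF this]
      show "\<exists>n1. \<forall>n\<ge>n1. ?flat \<sigma> M (B i) n" by (rule conjunct1[OF l])
      show "\<forall>n x. \<forall>y\<in>B i. ?kp \<sigma> (B i) n x y < \<infinity>" by (rule conjunct1[OF conjunct2[OF l]])
      show "\<forall>n. continuous_on (UNIV \<times> B i) (\<lambda>(x, y). enn2real (?kp \<sigma> (B i) n x y))"
        by (rule conjunct2[OF conjunct2[OF l]])
    qed
    define R where "R i C s \<longleftrightarrow> (\<forall>\<sigma> n. 0 < \<sigma> \<longrightarrow> \<sigma> < s \<longrightarrow> C * ln (1 / \<sigma>) \<le> real n \<longrightarrow> ?flat \<sigma> M (B i) n)" for i C s
    have "\<exists>C>0. \<exists>s>0. R i C s" if "i \<in> {1..N}" for i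
      unfolding R_def by (rule conjunct2[OF L[OF that]])
    then obtain C \<sigma>1 where C12: "\<And>i. i \<in> {1..N} \<Longrightarrow> 0 < C i" "\<And>i. i \<in> {1..N} \<Longrightarrow> 0 < \<sigma>1 i"
      "\<And>i. i \<in> {1..N} \<Longrightarrow> R i (C i) (\<sigma>1 i)" by metis
    have C: "\<And>i. i \<in> {1..N} \<Longrightarrow> 0 < C i" "\<And>i. i \<in> {1..N} \<Longrightarrow> 0 < \<sigma>1 i"
      "\<And>i \<sigma> n. i \<in> {1..N} \<Longrightarrow> 0 < \<sigma> \<Longrightarrow> \<sigma> < \<sigma>1 i \<Longrightarrow> C i * ln (1 / \<sigma>) \<le> real n \<Longrightarrow> ?flat \<sigma> M (B i) n"
      using C12(1,2) C12(3)[unfolded R_def] by blast+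
    \<comment> \<open>The inserted 1 covers the case without stable points and also gives the lower
      logarithmic bound with constant 1.\<close>
    define Cm where "Cm = Max (insert 1 (C ` {1..N}))"
    define \<sigma>m where "\<sigma>m = Min (insert 1 (\<sigma>1 ` {1..N}))"
    have Cm: "1 \<le> Cm" "\<And>i. i \<in> {1..N} \<Longrightarrow> C i \<le> Cm" unfolding Cm_def by (intro Max_ge; simp)+
    have \<sigma>m: "0 < \<sigma>m" "\<sigma>m \<le> 1" "\<And>i. i \<in> {1..N} \<Longrightarrow> \<sigma>m \<le> \<sigma>1 i"
      unfolding \<sigma>m_def using C(2) by (subst Min_gr_iff; force) (intro Min_le; simp)+
    define jlog where "jlog \<sigma> = nat \<lceil>Cm * ln (1 / \<sigma>)\<rceil>" for \<sigma>
    have jlog: "Cm * ln (1 / \<sigma>) \<le> real (jlog \<sigma>)" "real (jlog \<sigma>) \<le> Cm * ln (1 / \<sigma>) + 1" if "0 < \<sigma>" "\<sigma> < 1" for \<sigma>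
      unfolding jlog_def using that Cm(1) by (auto simp: of_nat_nat le_of_int_ceiling)
    have "\<exists>j. 0 < \<sigma> \<and> \<sigma> < \<sigma>\<^sub>0 \<longrightarrow> (\<forall>i\<in>{1..N}. ?flat \<sigma> M (B i) j)" for \<sigma>
    proof (cases "0 < \<sigma> \<and> \<sigma> < \<sigma>\<^sub>0")
      case True
      have "\<exists>n1. \<forall>n\<ge>n1. ?flat \<sigma> M (B i) n" if "i \<in> {1..N}" for i
        using Lpos(1)[OF that] True by blast
      then obtain n1 where n1: "\<And>i n. i \<in> {1..N} \<Longrightarrow> n \<ge> n1 i \<Longrightarrow> ?flat \<sigma> M (B i) n" by metis
      \<comment> \<open>Flatness persists beyond \<open>n1 i\<close>, so the sum is a common index
        for all the sets.\<close>
      have "n1 i \<le> (\<Sum>i\<in>{1..N}. n1 i)" if "i \<in> {1..N}" for i using that by (intro member_le_sum) auto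
      then show ?thesis using n1 by blast
    qed auto
    then obtain j' where j': "\<And>\<sigma>. 0 < \<sigma> \<Longrightarrow> \<sigma> < \<sigma>\<^sub>0 \<Longrightarrow> \<forall>i\<in>{1..N}. ?flat \<sigma> M (B i) (j' \<sigma>)" by metis
    \<comment> \<open>The bound \<open>\<sigma>m\<close> depends on the sets \<open>B i\<close>, the
      threshold \<open>\<sigma>\<^sub>0\<close> must not. Between them only the existence of a
      suitable power is known, which does not affect the order as the noise tends to zero.\<close>
    define j where "j \<sigma> = (if 0 < \<sigma> \<and> \<sigma> < \<sigma>m then jlog \<sigma> else j' \<sigma>)" for \<sigma>
    have flat: "?flat \<sigma> M (B i) (j \<sigma>)" if "0 < \<sigma>" "\<sigma> < \<sigma>\<^sub>0" "i \<in> {1..N}" for \<sigma> i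
    proof (cases "\<sigma> < \<sigma>m")
      case True
      have "C i * ln (1 / \<sigma>) \<le> Cm * ln (1 / \<sigma>)"
        using Cm(2)[OF that(3)] True that \<sigma>m(2) by (intro mult_right_mono) auto
      also have "\<dots> \<le> real (j \<sigma>)" using jlog(1)[of \<sigma>] that True \<sigma>m(2) unfolding j_def by simp
      finally show ?thesis using C(3)[OF that(3,1)] True \<sigma>m(3)[OF that(3)] by simp
    next
      case False
      then show ?thesis using j'[OF that(1,2)] that(3) unfolding j_def by auto
    qed
    have ev: "\<forall>\<^sub>F \<sigma> in at_right 0. 0 < \<sigma> \<and> \<sigma> < \<sigma>m"
      unfolding eventually_at_right_field using \<sigma>m(1) by (intro exI[of _ \<sigma>m]) auto
    have j_small: "j \<sigma> = jlog \<sigma>" if "0 < \<sigma>" "\<sigma> < \<sigma>m" for \<sigma> using that unfolding j_def by simp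
    show "\<exists>n\<^sub>0. uniform_positivity P \<xi> \<Phi> N B \<sigma>\<^sub>0 n\<^sub>0 \<and> (\<lambda>\<sigma>. real (n\<^sub>0 \<sigma>)) \<in> \<Theta>[at_right 0](\<lambda>\<sigma>. ln (1 / \<sigma>))"
    \<comment> \<open>The successor undoes the shift in \<open>kp\<close>, whose index
      \<open>j\<close> belongs to the power \<open>j + 1\<close>.\<close>
    proof (intro exI[of _ "\<lambda>\<sigma>. Suc (j \<sigma>)"] conjI)
      have "filterlim (\<lambda>\<sigma>. ln (1 / \<sigma>)) at_top (at_right (0::real))"
        using filterlim_compose[OF ln_at_top filterlim_inverse_at_top_right] by (simp add: divide_inverse)
      then have evL: "\<forall>\<^sub>F \<sigma> in at_right (0::real). 1 \<le> ln (1 / \<sigma>)" by (rule filterlim_at_top[THEN iffD1, rule_format])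
      show "(\<lambda>\<sigma>. real (Suc (j \<sigma>))) \<in> \<Theta>[at_right 0](\<lambda>\<sigma>. ln (1 / \<sigma>))"
      proof (rule bigthetaI)
        show "(\<lambda>\<sigma>. real (Suc (j \<sigma>))) \<in> O[at_right 0](\<lambda>\<sigma>. ln (1 / \<sigma>))"
        proof (rule bigoI[where c="Cm + 2"])
          show "\<forall>\<^sub>F \<sigma> in at_right 0. norm (real (Suc (j \<sigma>))) \<le> (Cm + 2) * norm (ln (1 / \<sigma>))"
            using ev evL
          proof eventually_elim
            case (elim \<sigma>)
            then have "real (Suc (j \<sigma>)) \<le> Cm * ln (1 / \<sigma>) + 2" using jlog(2)[of \<sigma>] \<sigma>m(2) j_small[of \<sigma>] by simp
            also have "\<dots> \<le> (Cm + 2) * ln (1 / \<sigma>)" using elim by (simp only: distrib_right)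
            finally show ?case using elim by simp
          qed
        qed
        show "(\<lambda>\<sigma>. real (Suc (j \<sigma>))) \<in> \<Omega>[at_right 0](\<lambda>\<sigma>. ln (1 / \<sigma>))"
        proof (rule landau_omega.bigI[where c=1])
          show "\<forall>\<^sub>F \<sigma> in at_right 0. norm (real (Suc (j \<sigma>))) \<ge> 1 * norm (ln (1 / \<sigma>))"
            using ev evL
          proof eventually_elim
            case (elim \<sigma>)
            have "1 * ln (1 / \<sigma>) \<le> Cm * ln (1 / \<sigma>)" by (rule mult_right_mono) (use Cm(1) elim in linarith)+
            also have "\<dots> \<le> real (Suc (j \<sigma>))" using jlog(1)[of \<sigma>] \<sigma>m(2) j_small[of \<sigma>] elim by simp
            finally show ?case using elim by simp
          qed
        qed simp
      qed
      show "uniform_positivity P \<xi> \<Phi> N B \<sigma>\<^sub>0 (\<lambda>\<sigma>. Suc (j \<sigma>))"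
        unfolding uniform_positivity_def M_def[symmetric]
      proof (rule conjI, rule exI[of _ "7 / 4"], intro conjI allI impI ballI)
        fix \<sigma> i assume \<sigma>: "0 < \<sigma> \<and> \<sigma> < \<sigma>\<^sub>0" and i: "i \<in> {1..N}"
        interpret T: trace_chain \<Phi> "noise \<sigma>" M
          by unfold_locales (use \<sigma> C2_map_continuous[OF C2] noise_cont noise_pos noise_mass Mc in auto)
        let ?k = "\<lambda>x y. enn2real (T.kp (B i) (j \<sigma>) x y)"
        have fin: "T.kp (B i) n x y < \<infinity>" if "y \<in> B i" for n x y
          using Lpos(2)[OF i] \<sigma> that by blast
        have cont: "continuous_on (UNIV \<times> B i) (\<lambda>(x, y). enn2real (T.kp (B i) n x y))" for n
          using Lpos(3)[OF i] \<sigma> by blast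
        have Bi: "B i \<in> sets borel" "B i \<subseteq> M" using Bc(1)[OF i] i unfolding M_def by auto
        have indep: "prob_space.indep_vars P (\<lambda>_. borel) \<xi> {1..}" using assms(3) unfolding iid_sequence_def by blast
        have law: "distr P borel (\<lambda>\<omega>. \<sigma> *\<^sub>R \<xi> n \<omega>) = density lborel (\<lambda>v. ennreal (noise \<sigma> v))" if "n \<ge> 1" for n
          by (rule scaled_noise_law[OF assms(2,3,5) G cd_\<gamma> _ that]) (use \<sigma> in simp)
        have trace: "trace_kernel P (chain \<Phi> \<sigma> \<xi>) M x = density lborel (\<lambda>y. T.k x y * indicator M y)" for x
          unfolding trace_kernel_def Let_def by (rule T.trace_kernel_density[OF assms(2) indep law])
        have flat': "?k x y \<le> 7 / 4 * ?k x' y" if "x \<in> B i" "x' \<in> B i" "y \<in> B i" for x x' y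
          using flat[of \<sigma> i] \<sigma> i that unfolding flat_def by blast
        show "\<exists>k. continuous_density_on (B i)
               (kernel_power (killed_kernel (trace_kernel P (chain \<Phi> \<sigma> \<xi>) M) (B i)) (Suc (j \<sigma>))) k \<and>
             (\<forall>y\<in>B i. (SUP x\<in>B i. k x y) \<le> 7 / 4 * (INF x\<in>B i. k x y))"
        proof (intro exI[of _ ?k] conjI ballI)
          show "continuous_density_on (B i)
             (kernel_power (killed_kernel (trace_kernel P (chain \<Phi> \<sigma> \<xi>) M) (B i)) (Suc (j \<sigma>))) ?k"
            unfolding continuous_density_on_def
          proof (intro conjI ballI)
            show "continuous_on (B i \<times> B i) (\<lambda>(x, y). ?k x y)"
              by (rule continuous_on_subset[OF cont]) auto
            fix x assume "x \<in> B i"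
            show "kernel_power (killed_kernel (trace_kernel P (chain \<Phi> \<sigma> \<xi>) M) (B i)) (Suc (j \<sigma>)) x
               = density lborel (\<lambda>y. ennreal (indicator (B i) y * ?k x y))"
              unfolding T.kernel_power_density[OF Bi trace]
            proof (intro arg_cong[where f="density lborel"] ext)
              fix y
              show "indicator (B i) y * T.kp (B i) (j \<sigma>) x y = ennreal (indicator (B i) y * ?k x y)"
                using fin[of y "j \<sigma>" x] by (auto split: split_indicator)
            qed
          qed simp
          fix y assume y: "y \<in> B i"
          have ne: "B i \<noteq> {}" using y by blast
          have "(SUP x\<in>B i. ?k x y) \<le> 7 / 4 * ?k x' y" if "x' \<in> B i" for x'
            by (rule cSUP_least[OF ne]) (rule flat'[OF _ that y])
          then have "(SUP x\<in>B i. ?k x y) / (7 / 4) \<le> (INF x\<in>B i. ?k x y)"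
            by (intro cINF_greatest[OF ne]) (simp add: field_simps)
          then show "(SUP x\<in>B i. ?k x y) \<le> 7 / 4 * (INF x\<in>B i. ?k x y)" by simp
        qed
      next
        show "\<forall>\<eta>>0. \<exists>\<sigma>\<^sub>1>0. \<forall>\<sigma>. 0 < \<sigma> \<and> \<sigma> \<le> \<sigma>\<^sub>1 \<longrightarrow> real (Suc (j \<sigma>)) \<le> exp (\<eta> / \<sigma>\<^sup>2)"
        proof (intro allI impI)
          fix \<eta> :: real assume \<eta>: "0 < \<eta>"
          have "\<forall>\<^sub>F \<sigma> in at_right 0. (0 < \<sigma> \<and> \<sigma> < \<sigma>m) \<and> (Cm + 2) * (1 / \<sigma>) ^ 1 * exp (- (\<eta> / \<sigma>\<^sup>2)) \<le> 1"
            by (intro eventually_conj ev power_gauss_small) (use \<eta> Cm in auto)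
          then obtain \<sigma>2 where \<sigma>2: "0 < \<sigma>2" "\<And>\<sigma>. 0 < \<sigma> \<Longrightarrow> \<sigma> < \<sigma>2 \<Longrightarrow> \<sigma> < \<sigma>m \<and> (Cm + 2) * (1 / \<sigma>) ^ 1 * exp (- (\<eta> / \<sigma>\<^sup>2)) \<le> 1"
            unfolding eventually_at_right_field by auto
          have "real (Suc (j \<sigma>)) \<le> exp (\<eta> / \<sigma>\<^sup>2)" if "0 < \<sigma>" "\<sigma> < \<sigma>2" for \<sigma>
          proof -
            have \<sigma>: "\<sigma> < \<sigma>m" "(Cm + 2) * (1 / \<sigma>) * exp (- (\<eta> / \<sigma>\<^sup>2)) \<le> 1" using \<sigma>2(2)[OF that] by auto
            have "ln (1 / \<sigma>) \<le> 1 / \<sigma>" using ln_le_minus_one[of "1 / \<sigma>"] that by simp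
            then have "Cm * ln (1 / \<sigma>) \<le> Cm * (1 / \<sigma>)" using Cm(1) by (intro mult_left_mono) auto
            moreover have "1 \<le> 1 / \<sigma>" using that \<sigma> \<sigma>m(2) by simp
            moreover have "(Cm + 2) * (1 / \<sigma>) = Cm * (1 / \<sigma>) + 2 * (1 / \<sigma>)" by (rule distrib_right)
            moreover have "real (Suc (j \<sigma>)) \<le> Cm * ln (1 / \<sigma>) + 2"
              using jlog(2)[of \<sigma>] that \<sigma> \<sigma>m(2) j_small[of \<sigma>] by simp
            ultimately have "real (Suc (j \<sigma>)) \<le> (Cm + 2) * (1 / \<sigma>)" by linarith
            also have "\<dots> \<le> exp (\<eta> / \<sigma>\<^sup>2)"
              using mult_right_mono[OF \<sigma>(2), of "exp (\<eta> / \<sigma>\<^sup>2)"] by (simp add: mult.assoc flip: exp_add)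
            finally show ?thesis .
          qed
          then show "\<exists>\<sigma>\<^sub>1>0. \<forall>\<sigma>. 0 < \<sigma> \<and> \<sigma> \<le> \<sigma>\<^sub>1 \<longrightarrow> real (Suc (j \<sigma>)) \<le> exp (\<eta> / \<sigma>\<^sup>2)"
            using \<sigma>2(1) by (intro exI[of _ "\<sigma>2 / 2"]) auto
        qed
      qed auto
    qed
  qed
  show ?thesis
    by (rule exI[of _ \<delta>\<^sub>0], rule conjI[OF \<delta>\<^sub>0(1)], rule exI[of _ \<sigma>\<^sub>0], rule conjI[OF \<sigma>\<^sub>0(1) main])
qed

end
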